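(* Let $a>0$ and let $\Omega=(-a,a)^2\subset\mathbb{R}^2$. Let $f\in C_0^2(\Omega)$ (extended by zero to $\mathbb{R}^2$), and for $y\in\partial\Omega$, $r\ge0$, let $$m(y,r)=\frac{1}{2\pi}\int_{S^1}f(y+r\omega)\,d\omega$$ be its circular means with centers on $\partial\Omega$. Then $f$ can be reconstructed from $m$ by the following formula: for every $x\in\Omega$, $$f(x)=\frac1\pi\,\operatorname{div}_x\sum_{j=1}^{4}\int\limits_{\Phi_j}n_j\left[\mathrm{PV}\int\limits_0^{2\sqrt2\,a}\frac{m_j^{\mathrm{repl}}(y,r)}{r^2-|x-y|^2}\,r\,dr\right]dl(y),$$ or, equivalently, by either of the formulae $$f(x)=\frac1\pi\sum_{j=1}^{4}\int\limits_{\Phi_j}\frac{n_j\cdot(x-y)}{|x-y|}\left.\left(\frac{\partial}{\partial s}\,\mathrm{PV}\int\limits_0^{2\sqrt2\,a}\frac{r\,m_j^{\mathrm{repl}}(y,r)}{r^2-s^2}\,dr\right)\right|_{s=|x-y|}dl(y),$$ $$f(x)=\frac1\pi\sum_{j=1}^{4}\int\limits_{\Phi_j}n_j\cdot\nabla_x\left[\left.\left(\mathrm{PV}\int\limits_0^{2\sqrt2\,a}\frac{r\,m_j^{\mathrm{repl}}(y,r)}{r^2-s^2}\,dr\right)\right|_{s=|x-y|}\right]dl(y),$$ where the families of lines $\Phi_j$, the normals $n_j$ and the replicated means $m_j^{\mathrm{repl}}$ are as defined in the context.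
   Context: $C_0^2(\Omega)$ denotes the twice continuously differentiable functions with compact support in $\Omega$. $S^1$ is the unit circle in $\mathbb{R}^2$, $dl(y)$ is the standard arc length, and $\mathrm{PV}$ indicates that the integral is understood in the (Cauchy) principal value sense. An integral over a family of lines is the integral over the union of the lines in the family. Sides, normals and families of lines: the four sides of the square $\Omega$ are $S_1,\dots,S_4$. Each side lies on a line $\{x_i=\sigma a\}$ for some $i\in\{1,2\}$ and $\sigma\in\{+1,-1\}$. If $S_j$ is the side lying on $\{x_i=\sigma a\}$, then $n_j=\sigma e_i$ is the exterior unit normal to $S_j$ ($e_i$ being the $i$-th standard basis vector), and $\Phi_j$ is the family of all the parallel lines $\{x_i=\sigma a+4ka\}$, $k\in\mathbb{Z}$. All the lines in $\Phi_j$ are equipped with the same normal $n_j$. Replication operator: $E^{1D}$ extends a function $h$ defined on $(-a,a)$ to a function $h^{\mathrm{repl}}=E^{1D}h$ on $\mathbb{R}$ by odd reflections: if $\xi\ne(2m+1)a$ for all $m\in\mathbb{Z}$, let $n(\xi)$ be the unique integer with $|\xi-2n(\xi)a|<a$ and set $$h^{\mathrm{repl}}(\xi)=(-1)^{n(\xi)}h\bigl((-1)^{n(\xi)}(\xi-2n(\xi)a)\bigr);$$ also $h^{\mathrm{repl}}((2m+1)a)=0$ for all $m\in\mathbb{Z}$. Replicated means: for each $r$, $m_j^{\mathrm{repl}}(\cdot,r)=E^{1D}\bigl(m(\cdot,r)|_{S_j}\bigr)$, where $m(\cdot,r)|_{S_j}$ is regarded as a function on $(-a,a)$ of the coordinate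 other than $x_i$. For $y$ on any line of $\Phi_j$, $m_j^{\mathrm{repl}}(y,r)$ denotes the value of $m_j^{\mathrm{repl}}(\cdot,r)$ at the coordinate of $y$ other than $y_i$ (so the same replicated means are placed on every line of $\Phi_j$). *)

theory Defs
  imports "HOL-Analysis.Analysis"
begin

definition square :: "real \<Rightarrow> (real^2) set" where
  "square a = {x. \<forall>i. - a < x $ i \<and> x $ i < a}"

definition C2_on :: "(real^2) set \<Rightarrow> (real^2 \<Rightarrow> real) \<Rightarrow> bool" where
  "C2_on U f \<longleftrightarrow>
     (\<exists>(f' :: real^2 \<Rightarrow> (real^2) \<Rightarrow>\<^sub>L real)
       (f'' :: real^2 \<Rightarrow> (real^2) \<Rightarrow>\<^sub>L ((real^2) \<Rightarrow>\<^sub>L real)).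
        (\<forall>x\<in>U. (f has_derivative blinfun_apply (f' x)) (at x)) \<and>
        (\<forall>x\<in>U. (f' has_derivative blinfun_apply (f'' x)) (at x)) \<and>
        continuous_on U f'')"

(* f is total on the plane, so the support condition also says that f is extended by zero
   outside U. *)
definition C2_0 :: "(real^2) set \<Rightarrow> (real^2 \<Rightarrow> real) \<Rightarrow> bool" where
  "C2_0 U f \<longleftrightarrow>
     C2_on U f \<and> compact (closure {x. f x \<noteq> 0}) \<and> closure {x. f x \<noteq> 0} \<subseteq> U"

definition circ_mean :: "(real^2 \<Rightarrow> real) \<Rightarrow> real^2 \<Rightarrow> real \<Rightarrow> real" where
  "circ_mean f y r =
     1 / (2 * pi) * (LINT \<theta>:{0..2*pi}|lborel. f (y + r *\<^sub>R vector [cos \<theta>, sin \<theta>]))"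

(* A side of the square is a pair (i, \<sigma>): it lies on the line x_i = \<sigma> a. *)
type_synonym side = "2 \<times> real"

definition sides :: "side set" where
  "sides = UNIV \<times> {1, -1}"

definition normal :: "side \<Rightarrow> real^2" where
  "normal j = snd j *\<^sub>R axis (fst j) 1"

definition other :: "2 \<Rightarrow> 2" where
  "other i = (if i = 1 then 2 else 1)"

(* t \<mapsto> line_point i c t is the arc length parametrisation of the line x_i = c by the
   remaining coordinate. *)
definition line_point :: "2 \<Rightarrow> real \<Rightarrow> real \<Rightarrow> real^2" where
  "line_point i c t = (\<chi> l. if l = i then c else t)"

definition line_offset :: "real \<Rightarrow> side \<Rightarrow> int \<Rightarrow> real" where
  "line_offset a j k = snd j * a + 4 * of_int k * a"

definition line_family :: "real \<Rightarrow> side \<Rightarrow> (real^2) set" where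
  "line_family a j = {y. \<exists>k. y $ fst j = line_offset a j k}"

(* The integral over the union of the lines is the sum over the lines of the integrals along
   the individual lines. This order matters: for the potentials occurring in the divergence
   formula the integral over one line decays rapidly in k because of cancellation, but the
   integrand is in general not absolutely integrable over the union of all lines. *)
definition family_integrable ::
  "real \<Rightarrow> side \<Rightarrow> (real^2 \<Rightarrow> 'b::{banach, second_countable_topology}) \<Rightarrow> bool" where
  "family_integrable a j g \<longleftrightarrow>
     (\<forall>k. integrable lborel (\<lambda>t. g (line_point (fst j) (line_offset a j k) t))) \<and>
     (\<lambda>k. LINT t|lborel. g (line_point (fst j) (line_offset a j k) t)) summable_on UNIV"

definition family_integral ::
  "real \<Rightarrow> side \<Rightarrow> (real^2 \<Rightarrow> 'b::{banach, second_countable_topology}) \<Rightarrow> 'b" where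
  "family_integral a j g =
     (\<Sum>\<^sub>\<infinity>k\<in>UNIV. LINT t|lborel. g (line_point (fst j) (line_offset a j k) t))"

definition replicate_1D :: "real \<Rightarrow> (real \<Rightarrow> real) \<Rightarrow> real \<Rightarrow> real" where
  "replicate_1D a h \<xi> =
     (if \<exists>m::int. \<xi> = (2 * of_int m + 1) * a then 0
      else let n = (THE n::int. \<bar>\<xi> - 2 * of_int n * a\<bar> < a)
           in (-1) powi n * h ((-1) powi n * (\<xi> - 2 * of_int n * a)))"

definition repl_mean :: "real \<Rightarrow> (real^2 \<Rightarrow> real) \<Rightarrow> side \<Rightarrow> real^2 \<Rightarrow> real \<Rightarrow> real" where
  "repl_mean a f j y r =
     replicate_1D a (\<lambda>u. circ_mean f (line_point (fst j) (snd j * a) u) r) (y $ other (fst j))"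

(* Cauchy principal value of the integral of g over [l, u] with the singularity at c, which may
   also lie outside [l, u]. *)
definition pv_exists :: "real \<Rightarrow> real \<Rightarrow> real \<Rightarrow> (real \<Rightarrow> real) \<Rightarrow> bool" where
  "pv_exists l u c g \<longleftrightarrow>
     (\<forall>\<epsilon>>0. set_integrable lborel ({l..u} - {c - \<epsilon><..<c + \<epsilon>}) g) \<and>
     (\<exists>L. ((\<lambda>\<epsilon>. LINT r:({l..u} - {c - \<epsilon><..<c + \<epsilon>})|lborel. g r) \<longlongrightarrow> L) (at_right 0))"

definition pv_integral :: "real \<Rightarrow> real \<Rightarrow> real \<Rightarrow> (real \<Rightarrow> real) \<Rightarrow> real" where
  "pv_integral l u c g =
     Lim (at_right 0) (\<lambda>\<epsilon>. LINT r:({l..u} - {c - \<epsilon><..<c + \<epsilon>})|lborel. g r)"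

definition pv_integrand ::
  "real \<Rightarrow> (real^2 \<Rightarrow> real) \<Rightarrow> side \<Rightarrow> real^2 \<Rightarrow> real \<Rightarrow> real \<Rightarrow> real" where
  "pv_integrand a f j y s r = r * repl_mean a f j y r / (r\<^sup>2 - s\<^sup>2)"

definition pv_potential ::
  "real \<Rightarrow> (real^2 \<Rightarrow> real) \<Rightarrow> side \<Rightarrow> real^2 \<Rightarrow> real \<Rightarrow> real" where
  "pv_potential a f j y s = pv_integral 0 (2 * sqrt 2 * a) s (pv_integrand a f j y s)"

definition has_partial_deriv :: "2 \<Rightarrow> (real^2 \<Rightarrow> real) \<Rightarrow> real^2 \<Rightarrow> bool" where
  "has_partial_deriv i g x \<longleftrightarrow> (\<lambda>t. g (x + t *\<^sub>R axis i 1)) field_differentiable (at 0)"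

definition partial_deriv :: "2 \<Rightarrow> (real^2 \<Rightarrow> real) \<Rightarrow> real^2 \<Rightarrow> real" where
  "partial_deriv i g x = deriv (\<lambda>t. g (x + t *\<^sub>R axis i 1)) 0"

definition gradient :: "(real^2 \<Rightarrow> real) \<Rightarrow> real^2 \<Rightarrow> real^2" where
  "gradient g x = (\<chi> i. partial_deriv i g x)"

definition divergence :: "(real^2 \<Rightarrow> real^2) \<Rightarrow> real^2 \<Rightarrow> real" where
  "divergence V x = (\<Sum>i\<in>UNIV. partial_deriv i (\<lambda>z. V z $ i) x)"

definition div_integrand ::
  "real \<Rightarrow> (real^2 \<Rightarrow> real) \<Rightarrow> side \<Rightarrow> real^2 \<Rightarrow> real^2 \<Rightarrow> real^2" where
  "div_integrand a f j x y = pv_potential a f j y (norm (x - y)) *\<^sub>R normal j"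

definition radial_integrand ::
  "real \<Rightarrow> (real^2 \<Rightarrow> real) \<Rightarrow> side \<Rightarrow> real^2 \<Rightarrow> real^2 \<Rightarrow> real" where
  "radial_integrand a f j x y =
     (normal j \<bullet> (x - y)) / norm (x - y) * deriv (pv_potential a f j y) (norm (x - y))"

definition grad_integrand ::
  "real \<Rightarrow> (real^2 \<Rightarrow> real) \<Rightarrow> side \<Rightarrow> real^2 \<Rightarrow> real^2 \<Rightarrow> real" where
  "grad_integrand a f j x y =
     normal j \<bullet> gradient (\<lambda>z. pv_potential a f j y (norm (z - y))) x"

definition div_field :: "real \<Rightarrow> (real^2 \<Rightarrow> real) \<Rightarrow> real^2 \<Rightarrow> real^2" where
  "div_field a f x = (\<Sum>j\<in>sides. family_integral a j (div_integrand a f j x))"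

(* Limits, derivatives, integrals and sums are total functions in HOL; the following predicates
   say that those occurring in the reconstruction formulas really exist at x. *)
definition pv_well_defined :: "real \<Rightarrow> (real^2 \<Rightarrow> real) \<Rightarrow> bool" where
  "pv_well_defined a f \<longleftrightarrow>
     (\<forall>j\<in>sides. \<forall>y\<in>line_family a j. \<forall>s>0.
        pv_exists 0 (2 * sqrt 2 * a) s (pv_integrand a f j y s))"

definition div_formula_well_defined :: "real \<Rightarrow> (real^2 \<Rightarrow> real) \<Rightarrow> real^2 \<Rightarrow> bool" where
  "div_formula_well_defined a f x \<longleftrightarrow>
     (\<forall>j\<in>sides. family_integrable a j (div_integrand a f j x)) \<and>
     (\<forall>i. has_partial_deriv i (\<lambda>z. div_field a f z $ i) x)"

definition radial_formula_well_defined :: "real \<Rightarrow> (real^2 \<Rightarrow> real) \<Rightarrow> real^2 \<Rightarrow> bool" where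
  "radial_formula_well_defined a f x \<longleftrightarrow>
     (\<forall>j\<in>sides. family_integrable a j (radial_integrand a f j x) \<and>
        (\<forall>y\<in>line_family a j.
           pv_potential a f j y field_differentiable (at (norm (x - y)))))"

definition grad_formula_well_defined :: "real \<Rightarrow> (real^2 \<Rightarrow> real) \<Rightarrow> real^2 \<Rightarrow> bool" where
  "grad_formula_well_defined a f x \<longleftrightarrow>
     (\<forall>j\<in>sides. family_integrable a j (grad_integrand a f j x) \<and>
        (\<forall>y\<in>line_family a j. \<forall>i.
           has_partial_deriv i (\<lambda>z. pv_potential a f j y (norm (z - y))) x))"

end

theory Submission
  imports Defs
begin

text \<open>
  Multiplied by \<open>r\<close>, the mean over a circle is a planar integral of \<open>f\<close>, so the contribution of a side
  with centres \<open>y\<close> is the integral of \<open>f z\<close> against a kernel \<open>h (dist z y ^ 2 - dist x y ^ 2)\<close> with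
  \<open>h v = 1 / v\<close>, regularised as \<open>h v = v / (v\<^sup>2 + e\<^sup>2)\<close>. The argument of \<open>h\<close> is affine in the position of
  \<open>y\<close> on the side, hence the derivative of the kernel integrates along the side to a difference of its
  values at the two corners. By oddness of the replication, an integral over a whole line is an
  alternating sum of integrals over the side, taken for the images of \<open>x\<close> in the tiles of the line.
  After summation by parts the values at a common corner, coming from the two adjacent sides, combine to
  \<open>(h (p + q) - h p) / q + (h (p + q) - h q) / p\<close>. Up to the product \<open>- h p * h q\<close> this is an
  approximate identity of mass \<open>pi\<^sup>2\<close>, and inside the square only the four corners nearest to \<open>x\<close>
  reproduce \<open>f x\<close>. The sums over the images of the product terms telescope, and together with the
  boundary terms of the truncated lattice they are \<open>O(1 / K)\<close> for \<open>K\<close> lines on either side.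
\<close>

section \<open>Principal values and their regularisation\<close>

text \<open>The value \<open>f x\<close> emerges only in the limit of vanishing \<open>e\<close>.
  This limit is taken at a fixed truncation \<open>K\<close>, and what survives it besides
  \<open>f x\<close> is bounded uniformly in \<open>e\<close>, so that \<open>K\<close> can grow at
  the end.

  The obstacle at fixed \<open>K\<close> is the product of the two image sums. The available
  pointwise bound on a factor grows like \<open>1 / e\<close>; smallness appears only after
  integration against a Lipschitz function. It is extracted one coordinate at a time, and the
  function left after one integration must again be Lipschitz. The bound on mixed second differences
  of \<open>f\<close>, which follows from its Lipschitz gradient, provides this.

  The three formulas reduce to one: the derivative in \<open>s\<close> of the potential of
  \<open>r * m\<close> is \<open>s\<close> times the potential of the radial derivative of
  \<open>m\<close>, and this \<open>s\<close> cancels the norm in the chain rule. The differentiated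
  integrand decays like the inverse fourth power of the distance and converges absolutely. The
  potential itself decays like the inverse square, and its line integrals are summable because the
  alternating signs cancel the leading term.\<close>

definition hker :: "real \<Rightarrow> real \<Rightarrow> real" where
  "hker e v = v / (v\<^sup>2 + e\<^sup>2)"

definition hker' :: "real \<Rightarrow> real \<Rightarrow> real" where
  "hker' e v = (e\<^sup>2 - v\<^sup>2) / (v\<^sup>2 + e\<^sup>2)\<^sup>2"

lemma sq_pos [simp]: "e > 0 \<Longrightarrow> (v::real)\<^sup>2 + e\<^sup>2 > 0"
  by (simp add: add_nonneg_pos)

lemma sq_nz [simp]: "e > 0 \<Longrightarrow> (v::real)\<^sup>2 + e\<^sup>2 \<noteq> 0"
  using sq_pos[of e v] by linarith

lemma hker_deriv [derivative_intros]:
  assumes "e > 0" "(g has_real_derivative g') (at x within S)"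
  shows "((\<lambda>x. hker e (g x)) has_real_derivative (hker' e (g x) * g')) (at x within S)"
proof -
  have "((\<lambda>v. v / (v\<^sup>2 + e\<^sup>2)) has_real_derivative hker' e (g x)) (at (g x))"
    unfolding hker'_def using sq_nz[OF assms(1), of "g x"]
    by (auto intro!: derivative_eq_intros simp: power2_eq_square algebra_simps)
  from DERIV_chain2[OF this assms(2)] show ?thesis unfolding hker_def by simp
qed

lemma hker_measurable [measurable]: "hker e \<in> borel_measurable borel"
  unfolding hker_def by measurable

lemma hker'_measurable [measurable]: "hker' e \<in> borel_measurable borel"
  unfolding hker'_def by measurable

lemma continuous_on_hker [continuous_intros]:
  assumes "e > 0" "continuous_on S g"
  shows "continuous_on S (\<lambda>x. hker e (g x))"
  unfolding hker_def by (intro continuous_intros assms) (use assms in auto)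

lemma continuous_on_hker' [continuous_intros]:
  assumes "e > 0" "continuous_on S g"
  shows "continuous_on S (\<lambda>x. hker' e (g x))"
  unfolding hker'_def by (intro continuous_intros assms) (use assms in auto)

text \<open>Multiplication by \<open>v\<close> removes the pole and leaves a Lorentzian of height 1
  and width \<open>e\<close>, the measure of the error made by using \<open>hker e v\<close> for
  \<open>1 / v\<close>.\<close>

lemma hker_minus_inverse:
  assumes "e > 0" "v \<noteq> 0"
  shows "v * (hker e v - 1 / v) = - (e\<^sup>2 / (v\<^sup>2 + e\<^sup>2))"
proof -
  have "v * (hker e v - 1 / v) = v\<^sup>2 / (v\<^sup>2 + e\<^sup>2) - 1"
    using assms by (simp add: hker_def right_diff_distrib power2_eq_square)
  also have "\<dots> = - (e\<^sup>2 / (v\<^sup>2 + e\<^sup>2))"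
  proof -
    have "v\<^sup>2 + e\<^sup>2 \<noteq> 0" using sq_nz[of e v] assms by blast
    hence "v\<^sup>2 / (v\<^sup>2 + e\<^sup>2) + e\<^sup>2 / (v\<^sup>2 + e\<^sup>2) = 1"
      by (simp add: add_divide_distrib[symmetric])
    thus ?thesis by linarith
  qed
  finally show ?thesis .
qed

lemma abs_mult_hker_le: "e > 0 \<Longrightarrow> \<bar>v * hker e v\<bar> \<le> 1"
  using sq_pos[of e v] by (simp add: hker_def abs_mult power2_eq_square[symmetric])

lemma abs_hker_le: "e > 0 \<Longrightarrow> v \<noteq> 0 \<Longrightarrow> \<bar>hker e v\<bar> \<le> 1 / \<bar>v\<bar>"
  using abs_mult_hker_le[of e v] by (simp add: abs_mult field_simps)

lemma abs_hker_le': "e > 0 \<Longrightarrow> \<bar>hker e v\<bar> \<le> 1 / e"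
proof -
  assume e: "e > 0"
  have "0 \<le> (\<bar>v\<bar> - e)\<^sup>2" by simp
  hence "e * \<bar>v\<bar> * 2 \<le> v\<^sup>2 + e\<^sup>2" by (simp add: power2_eq_square algebra_simps)
  moreover have "0 \<le> e * \<bar>v\<bar>" using e by simp
  ultimately have "e * \<bar>v\<bar> \<le> v\<^sup>2 + e\<^sup>2" by linarith
  thus ?thesis using e sq_pos[OF e, of v] by (simp add: hker_def field_simps)
qed

lemma abs_sq_diff:
  fixes r s :: real
  assumes "0 \<le> r" "0 \<le> s"
  shows "\<bar>r\<^sup>2 - s\<^sup>2\<bar> = \<bar>r - s\<bar> * (r + s)"
proof -
  have "r\<^sup>2 - s\<^sup>2 = (r - s) * (r + s)" by (simp add: power2_eq_square algebra_simps)
  thus ?thesis using assms by (simp add: abs_mult)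
qed

lemma integrable_bounded_Icc:
  fixes g :: "real \<Rightarrow> real"
  assumes [measurable]: "g \<in> borel_measurable borel"
    and "\<And>r. \<lbrakk>l \<le> r; r \<le> u\<rbrakk> \<Longrightarrow> \<bar>g r\<bar> \<le> C" "\<And>r. r < l \<or> u < r \<Longrightarrow> g r = 0"
  shows "integrable lborel g"
proof (rule integrableI_bounded_set[where A="{l..u}" and B=C])
  show "AE x in lborel. x \<notin> {l..u} \<longrightarrow> g x = 0" using assms(3) by (auto intro!: AE_I2)
  show "emeasure lborel {l..u} < \<infinity>" by (cases "l \<le> u") auto
qed (use assms(2) in auto)

lemma integral_bounded_Icc:
  fixes g :: "real \<Rightarrow> real"
  assumes [measurable]: "g \<in> borel_measurable borel"
    and b: "\<And>r. \<lbrakk>l \<le> r; r \<le> u\<rbrakk> \<Longrightarrow> \<bar>g r\<bar> \<le> C" "\<And>r. r < l \<or> u < r \<Longrightarrow> g r = 0"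
    and "l \<le> u"
  shows "\<bar>LINT r|lborel. g r\<bar> \<le> C * (u - l)"
proof -
  have "integrable lborel g" by (rule integrable_bounded_Icc[OF assms(1-3)])
  hence "\<bar>LINT r|lborel. g r\<bar> \<le> (LINT r|lborel. \<bar>g r\<bar>)"
    using integral_norm_bound[of lborel g] by simp
  also have "\<dots> \<le> (LINT r|lborel. C * indicator {l..u} r)"
  proof (rule integral_mono)
    show "integrable lborel (\<lambda>r. \<bar>g r\<bar>)" using \<open>integrable lborel g\<close> by simp
    show "integrable lborel (\<lambda>r. C * indicator {l..u} r)" using \<open>l \<le> u\<close> by simp
    show "\<bar>g r\<bar> \<le> C * indicator {l..u} r" for r using b by (cases "r \<in> {l..u}") auto
  qed
  also have "\<dots> = C * (u - l)" using \<open>l \<le> u\<close> by simp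
  finally show ?thesis .
qed

text \<open>The radial functions whose principal values are formed. The Lipschitz condition concerns
  the half line; negative radii are cut off by \<open>pv_sub\<close> and by the set integral in
  \<open>pv_reg\<close>.\<close>

definition lip_supp :: "real \<Rightarrow> real \<Rightarrow> (real \<Rightarrow> real) \<Rightarrow> bool" where
  "lip_supp L R \<phi> \<longleftrightarrow> 0 \<le> L \<and> 0 < R \<and> \<phi> \<in> borel_measurable borel \<and>
     (\<forall>r\<ge>0. \<forall>s\<ge>0. \<bar>\<phi> r - \<phi> s\<bar> \<le> L * \<bar>r - s\<bar>) \<and> (\<forall>r\<ge>R. \<phi> r = 0)"

text \<open>The principal value of \<open>r / (r\<^sup>2 - s\<^sup>2)\<close> over \<open>[0, sqrt 2 * s]\<close> is \<open>0\<close>, so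
  subtracting \<open>\<phi> s * r / s\<close> there turns a principal value into an absolutely convergent integral.\<close>

definition pv_sub :: "(real \<Rightarrow> real) \<Rightarrow> real \<Rightarrow> real \<Rightarrow> real" where
  "pv_sub \<phi> s r = (if 0 \<le> r then \<phi> r - (if r \<le> sqrt 2 * s then \<phi> s * r / s else 0) else 0)"

definition pv :: "(real \<Rightarrow> real) \<Rightarrow> real \<Rightarrow> real" where
  "pv \<phi> s = (LINT r|lborel. pv_sub \<phi> s r / (r\<^sup>2 - s\<^sup>2))"

definition pv_reg :: "real \<Rightarrow> (real \<Rightarrow> real) \<Rightarrow> real \<Rightarrow> real" where
  "pv_reg e \<phi> s = (LINT r:{0..}|lborel. \<phi> r * hker e (r\<^sup>2 - s\<^sup>2))"

lemma lip_supp_bound: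
  assumes "lip_supp L R \<phi>" "0 \<le> r" shows "\<bar>\<phi> r\<bar> \<le> L * R"
proof (cases "r \<ge> R")
  case True thus ?thesis using assms by (auto simp: lip_supp_def)
next
  case False
  have "\<bar>\<phi> r - \<phi> R\<bar> \<le> L * \<bar>r - R\<bar>" "\<phi> R = 0"
    using assms less_imp_le[of 0 R] unfolding lip_supp_def by blast+
  moreover have "L * \<bar>r - R\<bar> \<le> L * R" using assms False by (intro mult_left_mono) (auto simp: lip_supp_def)
  ultimately show ?thesis by simp
qed

text \<open>Either the pole lies beyond the support and the subtracted multiple is zero, or
  \<open>s < R\<close> and the subtraction stops before \<open>2 * R\<close>, since
  \<open>sqrt 2 < 2\<close>.\<close>

lemma pv_sub_zero:
  assumes "lip_supp L R \<phi>" "s > 0" "r < 0 \<or> 2 * R < r"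
  shows "pv_sub \<phi> s r = 0"
proof -
  have s2: "sqrt 2 < (2::real)" using real_sqrt_less_iff[of 2 4] by simp
  show ?thesis
  proof (cases "s \<ge> R")
    case True thus ?thesis using assms by (auto simp: pv_sub_def lip_supp_def)
  next
    case False
    have "sqrt 2 * s \<le> 2 * R" using False assms s2 by (intro mult_mono) (auto simp: lip_supp_def)
    thus ?thesis using assms by (auto simp: pv_sub_def lip_supp_def)
  qed
qed

text \<open>Up to \<open>sqrt 2 * s\<close> both \<open>pv_sub\<close> and
  \<open>r\<^sup>2 - s\<^sup>2\<close> vanish linearly at \<open>r = s\<close>, so the quotient is
  bounded. Beyond this point nothing is subtracted, but \<open>r\<^sup>2 - s\<^sup>2\<close> is at
  least \<open>s\<^sup>2\<close>.\<close>

lemma pv_sub_le: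
  assumes lip: "lip_supp L R \<phi>" and s: "s > 0"
  shows "\<bar>pv_sub \<phi> s r\<bar> \<le> L * (s + R) / s\<^sup>2 * \<bar>r\<^sup>2 - s\<^sup>2\<bar>"
proof -
  have L: "0 \<le> L" "0 < R" using lip by (auto simp: lip_supp_def)
  consider "r < 0" | "0 \<le> r" "r \<le> sqrt 2 * s" | "0 \<le> r" "r > sqrt 2 * s" by linarith
  thus ?thesis
  proof cases
    case 1 thus ?thesis using L s by (simp add: pv_sub_def)
  next
    case 2
    have "\<bar>pv_sub \<phi> s r\<bar> = \<bar>(\<phi> r - \<phi> s) + \<phi> s / s * (s - r)\<bar>"
      using 2 s by (simp add: pv_sub_def field_simps)
    also have "\<dots> \<le> \<bar>\<phi> r - \<phi> s\<bar> + \<bar>\<phi> s / s * (s - r)\<bar>" by (rule abs_triangle_ineq)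
    also have "\<bar>\<phi> r - \<phi> s\<bar> \<le> L * \<bar>r - s\<bar>" using lip 2 s by (auto simp: lip_supp_def)
    also have "\<bar>\<phi> s / s * (s - r)\<bar> \<le> (L * R / s) * \<bar>r - s\<bar>"
      using lip_supp_bound[OF lip, of s] s
      by (auto simp: abs_mult abs_minus_commute intro!: mult_right_mono divide_right_mono)
    also have "L * \<bar>r - s\<bar> + L * R / s * \<bar>r - s\<bar> = L * (s + R) / s\<^sup>2 * (\<bar>r - s\<bar> * s)"
      using s by (simp add: field_simps power2_eq_square)
    also have "\<dots> \<le> L * (s + R) / s\<^sup>2 * (\<bar>r - s\<bar> * (r + s))"
      using L s 2 by (intro mult_left_mono) auto
    also have "\<bar>r - s\<bar> * (r + s) = \<bar>r\<^sup>2 - s\<^sup>2\<bar>"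
      using abs_sq_diff[of r s] 2 s by simp
    finally show ?thesis by simp
  next
    case 3
    have "(sqrt 2 * s)\<^sup>2 \<le> r\<^sup>2" by (rule power_mono) (use 3 s in auto)
    hence r: "s\<^sup>2 \<le> \<bar>r\<^sup>2 - s\<^sup>2\<bar>" by (simp add: power_mult_distrib)
    have "\<bar>pv_sub \<phi> s r\<bar> \<le> L * (s + R)"
      using lip_supp_bound[OF lip, of r] 3 L s by (simp add: pv_sub_def ring_distribs add_increasing)
    also have "\<dots> = L * (s + R) / s\<^sup>2 * s\<^sup>2" using s by simp
    also have "\<dots> \<le> L * (s + R) / s\<^sup>2 * \<bar>r\<^sup>2 - s\<^sup>2\<bar>" using r L s by (intro mult_left_mono) auto
    finally show ?thesis .
  qed
qed

lemma pv_sub_measurable [measurable]: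
  assumes [measurable]: "\<phi> \<in> borel_measurable borel"
  shows "pv_sub \<phi> s \<in> borel_measurable borel"
  unfolding pv_sub_def by measurable

lemma pv_quot_le:
  assumes lip: "lip_supp L R \<phi>" and s: "s > 0"
  shows "\<bar>pv_sub \<phi> s r / (r\<^sup>2 - s\<^sup>2)\<bar> \<le> L * (s + R) / s\<^sup>2"
proof (cases "r\<^sup>2 = s\<^sup>2")
  case True thus ?thesis using lip s by (simp add: lip_supp_def)
next
  case False
  thus ?thesis using pv_sub_le[OF assms, of r] by (simp add: field_simps)
qed

lemma pv_integrable:
  assumes lip: "lip_supp L R \<phi>" and s: "s > 0"
  shows "integrable lborel (\<lambda>r. pv_sub \<phi> s r / (r\<^sup>2 - s\<^sup>2))"
proof -
  have [measurable]: "\<phi> \<in> borel_measurable borel" using lip by (simp add: lip_supp_def)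
  show ?thesis
    by (rule integrable_bounded_Icc[where l=0 and u="2*R" and C="L * (s + R) / s\<^sup>2"])
       (use pv_quot_le[OF lip s] pv_sub_zero[OF lip s] in auto)
qed

lemma pv_bound:
  assumes lip: "lip_supp L R \<phi>" and s: "s > 0"
  shows "\<bar>pv \<phi> s\<bar> \<le> L * (s + R) / s\<^sup>2 * (2 * R)"
proof -
  have [measurable]: "\<phi> \<in> borel_measurable borel" and "0 < R" using lip by (simp_all add: lip_supp_def)
  thus ?thesis unfolding pv_def
    using integral_bounded_Icc[of "\<lambda>r. pv_sub \<phi> s r / (r\<^sup>2 - s\<^sup>2)" 0 "2*R" "L * (s + R) / s\<^sup>2"]
    pv_quot_le[OF lip s] pv_sub_zero[OF lip s] by auto
qed

text \<open>The antiderivative depends on \<open>(r\<^sup>2 - s\<^sup>2)\<^sup>2\<close>, which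
  equals \<open>s ^ 4\<close> at both ends. This is where the upper limit \<open>sqrt 2 * s\<close>
  comes from: the subtraction in \<open>pv_sub\<close> is invisible to the regularised integral for
  every \<open>e\<close>.\<close>

lemma integral_r_hker:
  assumes e: "e > 0" and s: "s > 0"
  shows "integrable lborel (\<lambda>r. indicator {0..sqrt 2 * s} r *\<^sub>R (r * hker e (r\<^sup>2 - s\<^sup>2)))" (is ?A)
    and "(LINT r|lborel. indicator {0..sqrt 2 * s} r *\<^sub>R (r * hker e (r\<^sup>2 - s\<^sup>2))) = 0" (is ?B)
proof -
  define G where "G r = ln ((r\<^sup>2 - s\<^sup>2)\<^sup>2 + e\<^sup>2) / 4" for r :: real
  have *: "(LINT r|lborel. indicator {0..sqrt 2 * s} r *\<^sub>R (r * hker e (r\<^sup>2 - s\<^sup>2))) = G (sqrt 2 * s) - G 0"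
  proof (rule integral_FTC_atLeastAtMost)
    fix r
    show "(G has_vector_derivative r * hker e (r\<^sup>2 - s\<^sup>2)) (at r within {0..sqrt 2 * s})"
      unfolding has_real_derivative_iff_has_vector_derivative[symmetric] G_def hker_def
      using e sq_pos[OF e, of "r\<^sup>2 - s\<^sup>2"] sq_nz[OF e, of "r\<^sup>2 - s\<^sup>2"]
      by (auto intro!: derivative_eq_intros simp: field_simps)
  qed (use s e in \<open>auto intro!: continuous_intros\<close>)
  have "G (sqrt 2 * s) = G 0" by (simp add: G_def power_mult_distrib)
  with * show ?B by simp
  have "continuous_on {0..sqrt 2 * s} (\<lambda>r. r * hker e (r\<^sup>2 - s\<^sup>2))"
    using e by (auto intro!: continuous_intros)
  from borel_integrable_atLeastAtMost'[OF this] show ?A by (simp add: set_integrable_def)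
qed

lemma lip_supp_hker_integrable:
  assumes lip: "lip_supp L R \<phi>" and e: "e > 0" and [measurable]: "g \<in> borel_measurable borel"
  shows "set_integrable lborel {0..} (\<lambda>r. \<phi> r * hker e (g r))"
proof -
  have [measurable]: "\<phi> \<in> borel_measurable borel" and R: "0 < R" "0 \<le> L"
    using lip by (simp_all add: lip_supp_def)
  show ?thesis unfolding set_integrable_def
  proof (rule integrable_bounded_Icc[where l=0 and u=R and C="L * R * (1 / e)"])
    fix r :: real assume r: "0 \<le> r" "r \<le> R"
    have "\<bar>\<phi> r\<bar> * \<bar>hker e (g r)\<bar> \<le> L * R * (1 / e)"
      by (rule mult_mono) (use lip_supp_bound[OF lip, of r] abs_hker_le'[OF e] R r in auto)
    thus "\<bar>indicator {0..} r *\<^sub>R (\<phi> r * hker e (g r))\<bar> \<le> L * R * (1 / e)"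
      using r by (simp add: abs_mult)
  qed (use lip in \<open>auto simp: lip_supp_def indicator_def\<close>)
qed

text \<open>With the subtraction inserted on this side too, \<open>pv_reg\<close> and
  \<open>pv\<close> share the numerator and differ in the kernel alone.\<close>

lemma pv_reg_eq:
  assumes lip: "lip_supp L R \<phi>" and s: "s > 0" and e: "e > 0"
  shows "pv_reg e \<phi> s = (LINT r|lborel. pv_sub \<phi> s r * hker e (r\<^sup>2 - s\<^sup>2))"
    and "integrable lborel (\<lambda>r. pv_sub \<phi> s r * hker e (r\<^sup>2 - s\<^sup>2))"
proof -
  have eq: "(\<lambda>r. pv_sub \<phi> s r * hker e (r\<^sup>2 - s\<^sup>2)) =
     (\<lambda>r. indicator {0..} r *\<^sub>R (\<phi> r * hker e (r\<^sup>2 - s\<^sup>2))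
          - \<phi> s / s * (indicator {0..sqrt 2 * s} r *\<^sub>R (r * hker e (r\<^sup>2 - s\<^sup>2))))"
    by (auto simp: pv_sub_def indicator_def algebra_simps fun_eq_iff)
  have i: "integrable lborel (\<lambda>r. indicator {0..} r *\<^sub>R (\<phi> r * hker e (r\<^sup>2 - s\<^sup>2)))"
    using lip_supp_hker_integrable[OF lip e, of "\<lambda>r. r\<^sup>2 - s\<^sup>2"] by (simp add: set_integrable_def)
  show "integrable lborel (\<lambda>r. pv_sub \<phi> s r * hker e (r\<^sup>2 - s\<^sup>2))"
    unfolding eq using i integral_r_hker(1)[OF e s]
    by (intro Bochner_Integration.integrable_diff integrable_mult_right) auto
  show "pv_reg e \<phi> s = (LINT r|lborel. pv_sub \<phi> s r * hker e (r\<^sup>2 - s\<^sup>2))"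
    unfolding eq pv_reg_def set_lebesgue_integral_def using i integral_r_hker[OF e s]
    by (subst Bochner_Integration.integral_diff) (auto intro!: integrable_mult_right)
qed

lemma integral_lorentz_le:
  assumes e: "e > 0" and s: "s > 0" and "0 \<le> T"
  shows "(LINT r|lborel. indicator {0..T} r *\<^sub>R (e\<^sup>2 / (s\<^sup>2 * (r - s)\<^sup>2 + e\<^sup>2))) \<le> pi * e / s"
proof -
  define G where "G r = e / s * arctan (s * (r - s) / e)" for r
  have "(LINT r|lborel. indicator {0..T} r *\<^sub>R (e\<^sup>2 / (s\<^sup>2 * (r - s)\<^sup>2 + e\<^sup>2))) = G T - G 0"
  proof (rule integral_FTC_atLeastAtMost)
    fix r
    have p: "1 + (s * (r - s) / e)\<^sup>2 \<noteq> 0" using sum_power2_gt_zero_iff[of 1 "s * (r - s) / e"] by simp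
    have "((\<lambda>r. s * (r - s) / e) has_real_derivative s / e) (at r within {0..T})"
      using e by (auto intro!: derivative_eq_intros)
    from DERIV_cmult[OF DERIV_chain2[OF DERIV_arctan this], of "e / s"]
    have "(G has_real_derivative (e / s * ((s / e) / (1 + (s * (r - s) / e)\<^sup>2)))) (at r within {0..T})"
      unfolding G_def by (simp add: field_simps)
    moreover have "e / s * ((s / e) / (1 + (s * (r - s) / e)\<^sup>2)) = e\<^sup>2 / (s\<^sup>2 * (r - s)\<^sup>2 + e\<^sup>2)"
    proof -
      have "1 + (s * (r - s) / e)\<^sup>2 = (s\<^sup>2 * (r - s)\<^sup>2 + e\<^sup>2) / e\<^sup>2"
        using e by (simp add: power_divide power_mult_distrib add_divide_distrib)
      thus ?thesis using e s p by simp
    qed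
    ultimately show "(G has_vector_derivative e\<^sup>2 / (s\<^sup>2 * (r - s)\<^sup>2 + e\<^sup>2)) (at r within {0..T})"
      by (simp add: has_real_derivative_iff_has_vector_derivative)
  next
    have "s\<^sup>2 * (r - s)\<^sup>2 + e\<^sup>2 \<noteq> 0" for r
      using sq_nz[OF e, of "s * (r - s)"] by (simp add: power_mult_distrib)
    thus "continuous_on {0..T} (\<lambda>r. e\<^sup>2 / (s\<^sup>2 * (r - s)\<^sup>2 + e\<^sup>2))"
      by (auto intro!: continuous_intros)
  qed fact
  also have "G T - G 0 \<le> e / s * (pi / 2) - e / s * (- (pi / 2))"
    unfolding G_def by (intro diff_mono mult_left_mono)
      (use e s arctan_bounded[of "s * (T - s) / e"] arctan_bounded[of "s * (0 - s) / e"] in auto)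
  also have "\<dots> = pi * e / s" by (simp add: field_simps)
  finally show ?thesis .
qed

text \<open>The numerator \<open>pv_sub\<close> is at most a multiple of the modulus of
  \<open>r\<^sup>2 - s\<^sup>2\<close>, and this factor turns the difference of the kernels into a
  Lorentzian of mass of order \<open>e\<close>. The explicit linear rate serves twice later: it
  makes derivatives in \<open>s\<close> converge locally uniformly, and it yields one power of
  \<open>e\<close> per coordinate for the product terms.\<close>

lemma pv_reg_rate:
  assumes lip: "lip_supp L R \<phi>" and s: "s > 0" and e: "e > 0"
  shows "\<bar>pv_reg e \<phi> s - pv \<phi> s\<bar> \<le> L * (s + R) / s\<^sup>2 * (pi * e / s)"
proof -
  have [measurable]: "\<phi> \<in> borel_measurable borel" and R: "0 < R" "0 \<le> L"
    using lip by (simp_all add: lip_supp_def)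
  define C where "C = L * (s + R) / s\<^sup>2"
  have C: "C \<ge> 0" using R s by (simp add: C_def)
  have "pv_reg e \<phi> s - pv \<phi> s =
      (LINT r|lborel. pv_sub \<phi> s r * hker e (r\<^sup>2 - s\<^sup>2) - pv_sub \<phi> s r / (r\<^sup>2 - s\<^sup>2))"
    unfolding pv_def pv_reg_eq(1)[OF assms]
    by (rule Bochner_Integration.integral_diff[symmetric]) (fact pv_reg_eq(2)[OF assms] pv_integrable[OF lip s])+
  hence "\<bar>pv_reg e \<phi> s - pv \<phi> s\<bar> \<le>
      (LINT r|lborel. \<bar>pv_sub \<phi> s r * hker e (r\<^sup>2 - s\<^sup>2) - pv_sub \<phi> s r / (r\<^sup>2 - s\<^sup>2)\<bar>)"
    using integral_norm_bound[of lborel "\<lambda>r. pv_sub \<phi> s r * hker e (r\<^sup>2 - s\<^sup>2) - pv_sub \<phi> s r / (r\<^sup>2 - s\<^sup>2)"]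
    by simp
  also have "\<dots> \<le> (LINT r|lborel. C * (indicator {0..2*R} r *\<^sub>R (e\<^sup>2 / (s\<^sup>2 * (r - s)\<^sup>2 + e\<^sup>2))))"
  proof (rule integral_mono)
    show "integrable lborel (\<lambda>r. \<bar>pv_sub \<phi> s r * hker e (r\<^sup>2 - s\<^sup>2) - pv_sub \<phi> s r / (r\<^sup>2 - s\<^sup>2)\<bar>)"
      using pv_reg_eq(2)[OF assms] pv_integrable[OF lip s] by auto
    have n: "s\<^sup>2 * (r - s)\<^sup>2 + e\<^sup>2 \<noteq> 0" for r
      using sq_nz[OF e, of "s * (r - s)"] by (simp add: power_mult_distrib)
    have "integrable lborel (\<lambda>r. indicator {0..2*R} r *\<^sub>R (e\<^sup>2 / (s\<^sup>2 * (r - s)\<^sup>2 + e\<^sup>2)))"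
      by (rule integrable_bounded_Icc[where l=0 and u="2*R" and C=1])
         (use e in \<open>auto simp: divide_le_eq add_nonneg_pos\<close>)
    thus "integrable lborel (\<lambda>r. C * (indicator {0..2*R} r *\<^sub>R (e\<^sup>2 / (s\<^sup>2 * (r - s)\<^sup>2 + e\<^sup>2))))"
      by (rule integrable_mult_right)
    fix r :: real
    show "\<bar>pv_sub \<phi> s r * hker e (r\<^sup>2 - s\<^sup>2) - pv_sub \<phi> s r / (r\<^sup>2 - s\<^sup>2)\<bar>
        \<le> C * (indicator {0..2*R} r *\<^sub>R (e\<^sup>2 / (s\<^sup>2 * (r - s)\<^sup>2 + e\<^sup>2)))"
    proof (cases "r \<in> {0..2*R} \<and> r\<^sup>2 \<noteq> s\<^sup>2")
      case False
      hence "pv_sub \<phi> s r = 0" using pv_sub_zero[OF lip s, of r] pv_sub_le[OF lip s, of r] by auto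
      thus ?thesis using C by (auto intro!: mult_nonneg_nonneg)
    next
      case True
      define v where "v = r\<^sup>2 - s\<^sup>2"
      have v: "v \<noteq> 0" using True by (simp add: v_def)
      have "\<bar>pv_sub \<phi> s r * hker e v - pv_sub \<phi> s r / v\<bar> = \<bar>pv_sub \<phi> s r\<bar> * \<bar>hker e v - 1 / v\<bar>"
        by (simp add: abs_mult[symmetric] algebra_simps)
      also have "\<dots> \<le> (C * \<bar>v\<bar>) * \<bar>hker e v - 1 / v\<bar>"
        using pv_sub_le[OF lip s, of r] by (intro mult_right_mono) (auto simp: C_def v_def)
      also have "\<dots> = C * (e\<^sup>2 / (v\<^sup>2 + e\<^sup>2))"
      proof -
        have "\<bar>v\<bar> * \<bar>hker e v - 1 / v\<bar> = e\<^sup>2 / (v\<^sup>2 + e\<^sup>2)"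
          using arg_cong[OF hker_minus_inverse[OF e v], of abs] sq_pos[OF e, of v]
          by (simp add: abs_mult)
        thus ?thesis by (simp only: mult.assoc)
      qed
      \<comment> \<open>As \<open>v = (r + s) * (r - s)\<close> with \<open>r\<close> nonnegative,
        the Lorentzian in \<open>v\<close> is dominated by one in \<open>r\<close> with an
        elementary integral.\<close>
      also have "\<dots> \<le> C * (e\<^sup>2 / (s\<^sup>2 * (r - s)\<^sup>2 + e\<^sup>2))"
      proof (intro mult_left_mono divide_left_mono C)
        have "v = (r + s) * (r - s)" by (simp add: v_def power2_eq_square algebra_simps)
        moreover have "s\<^sup>2 \<le> (r + s)\<^sup>2" using True s by (intro power_mono) auto
        ultimately show "s\<^sup>2 * (r - s)\<^sup>2 + e\<^sup>2 \<le> v\<^sup>2 + e\<^sup>2"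
          by (simp add: power_mult_distrib mult_right_mono)
        show "0 < (v\<^sup>2 + e\<^sup>2) * (s\<^sup>2 * (r - s)\<^sup>2 + e\<^sup>2)"
          by (intro mult_pos_pos sq_pos e add_nonneg_pos) (use e in auto)
      qed simp
      finally show ?thesis using True by (simp add: v_def)
    qed
  qed
  also have "\<dots> \<le> C * (pi * e / s)"
    unfolding integral_mult_right_zero using integral_lorentz_le[OF e s, of "2*R"] R C
    by (intro mult_left_mono) auto
  finally show ?thesis by (simp add: C_def)
qed

section \<open>Principal values as limits of symmetric cuts, and their decay for distant
  poles\<close>

lemma integral_diff_add_cmult:
  fixes f g h :: "'a \<Rightarrow> real"
  assumes "integrable M f" "integrable M h" "integrable M g"
  shows "(LINT x|M. f x - h x + c * g x) = (LINT x|M. f x) - (LINT x|M. h x) + c * (LINT x|M. g x)"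
  using assms by simp

text \<open>The logarithmic antiderivative takes the arguments \<open>d * (2 * s - d)\<close> and
  \<open>d * (2 * s + d)\<close> at the two sides of the gap. The divergent factor \<open>d\<close>
  cancels, as do the contributions of the ends \<open>0\<close> and \<open>sqrt 2 * s\<close>, and a
  quotient tending to 1 remains.\<close>

lemma r_quot_cut:
  assumes s: "s > 0" and d: "0 < d" "d < s / 4"
  defines "g \<equiv> (\<lambda>r. indicator ({0..sqrt 2 * s} - {s - d<..<s + d}) r *\<^sub>R (r / (r\<^sup>2 - s\<^sup>2)))"
  shows "integrable lborel g" and "(LINT r|lborel. g r) = ln ((2 * s - d) / (2 * s + d)) / 2"
proof -
  define g1 where "g1 = (\<lambda>r. indicator {0..s - d} r *\<^sub>R (r / (r\<^sup>2 - s\<^sup>2)))"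
  define g2 where "g2 = (\<lambda>r. indicator {s + d..sqrt 2 * s} r *\<^sub>R (r / (r\<^sup>2 - s\<^sup>2)))"
  \<comment> \<open>The restriction \<open>d < s / 4\<close> thus keeps the gap inside the range of
    integration.\<close>
  have "5 / 4 < sqrt (2::real)" by (rule real_less_rsqrt) (simp add: power2_eq_square)
  hence s2: "s + d < sqrt 2 * s" using d s mult_strict_right_mono[of "5/4" "sqrt 2" s] by linarith
  have g: "g = (\<lambda>r. g1 r + g2 r)"
    using s2 d s by (auto simp: g_def g1_def g2_def indicator_def fun_eq_iff)
  have D1: "s\<^sup>2 - r\<^sup>2 > 0" if "0 \<le> r" "r \<le> s - d" for r
    using that d power_strict_mono[of r s 2] by auto
  have D2: "r\<^sup>2 - s\<^sup>2 > 0" if "s + d \<le> r" for r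
    using that d s power_strict_mono[of s r 2] by auto
  have c1: "continuous_on {0..s-d} (\<lambda>r. r / (r\<^sup>2 - s\<^sup>2))"
  proof (intro continuous_intros ballI)
    fix r assume "r \<in> {0..s-d}" thus "r\<^sup>2 - s\<^sup>2 \<noteq> 0" using D1[of r] by auto
  qed
  have c2: "continuous_on {s+d..sqrt 2 * s} (\<lambda>r. r / (r\<^sup>2 - s\<^sup>2))"
  proof (intro continuous_intros ballI)
    fix r assume "r \<in> {s+d..sqrt 2 * s}" thus "r\<^sup>2 - s\<^sup>2 \<noteq> 0" using D2[of r] by auto
  qed
  have i: "integrable lborel g1" "integrable lborel g2"
    using borel_integrable_atLeastAtMost'[OF c1] borel_integrable_atLeastAtMost'[OF c2]
    by (auto simp: set_integrable_def g1_def g2_def)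
  thus "integrable lborel g" unfolding g by (rule Bochner_Integration.integrable_add)
  have "(LINT r|lborel. g1 r) = ln (s\<^sup>2 - (s - d)\<^sup>2) / 2 - ln (s\<^sup>2 - 0\<^sup>2) / 2"
    unfolding g1_def
  proof (rule integral_FTC_atLeastAtMost)
    fix r assume r: "0 \<le> r" "r \<le> s - d"
    show "((\<lambda>r. ln (s\<^sup>2 - r\<^sup>2) / 2) has_vector_derivative r / (r\<^sup>2 - s\<^sup>2)) (at r within {0..s - d})"
      unfolding has_real_derivative_iff_has_vector_derivative[symmetric]
      using D1[OF r] by (auto intro!: derivative_eq_intros simp: field_simps)
  qed (use d s c1 in auto)
  moreover have "(LINT r|lborel. g2 r) = ln ((sqrt 2 * s)\<^sup>2 - s\<^sup>2) / 2 - ln ((s + d)\<^sup>2 - s\<^sup>2) / 2"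
    unfolding g2_def
  proof (rule integral_FTC_atLeastAtMost)
    fix r assume r: "s + d \<le> r" "r \<le> sqrt 2 * s"
    show "((\<lambda>r. ln (r\<^sup>2 - s\<^sup>2) / 2) has_vector_derivative r / (r\<^sup>2 - s\<^sup>2)) (at r within {s + d..sqrt 2 * s})"
      unfolding has_real_derivative_iff_has_vector_derivative[symmetric]
      using D2[OF r(1)] by (auto intro!: derivative_eq_intros simp: field_simps)
  qed (use s2 c2 in auto)
  moreover have "(LINT r|lborel. g r) = (LINT r|lborel. g1 r) + (LINT r|lborel. g2 r)"
    unfolding g using i by (rule Bochner_Integration.integral_add)
  moreover have "s\<^sup>2 - (s - d)\<^sup>2 = d * (2 * s - d)" "(s + d)\<^sup>2 - s\<^sup>2 = d * (2 * s + d)"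
    by (auto simp: power2_eq_square algebra_simps)
  ultimately show "(LINT r|lborel. g r) = ln ((2 * s - d) / (2 * s + d)) / 2"
    using d s by (simp add: power_mult_distrib ln_mult ln_div) (simp add: field_simps)
qed

lemma pv_cut_integrable:
  assumes lip: "lip_supp L R \<phi>" and s: "s > 0" and d: "d > 0"
  shows "set_integrable lborel ({0..T} - {s - d<..<s + d}) (\<lambda>r. \<phi> r / (r\<^sup>2 - s\<^sup>2))"
proof -
  have [measurable]: "\<phi> \<in> borel_measurable borel" and R: "0 < R" "0 \<le> L"
    using lip by (simp_all add: lip_supp_def)
  show ?thesis unfolding set_integrable_def
  proof (rule integrable_bounded_Icc[where l=0 and u=T and C="L * R / (d * s)"])
    fix r :: real assume r: "0 \<le> r" "r \<le> T"
    show "\<bar>indicator ({0..T} - {s - d<..<s + d}) r *\<^sub>R (\<phi> r / (r\<^sup>2 - s\<^sup>2))\<bar> \<le> L * R / (d * s)"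
    proof (cases "r \<in> {s - d<..<s + d}")
      case False
      have "\<bar>r\<^sup>2 - s\<^sup>2\<bar> = \<bar>r - s\<bar> * (r + s)"
        using abs_sq_diff[of r s] r s by simp
      also have "\<dots> \<ge> d * s" using False r s d by (intro mult_mono) auto
      finally have "d * s \<le> \<bar>r\<^sup>2 - s\<^sup>2\<bar>" .
      hence "\<bar>\<phi> r / (r\<^sup>2 - s\<^sup>2)\<bar> \<le> L * R / (d * s)"
        unfolding abs_divide using lip_supp_bound[OF lip r(1)] d s R
        by (intro frac_le) auto
      thus ?thesis using False r by simp
    qed (use R d s in auto)
  qed auto
qed

text \<open>The cut integral differs from the absolutely convergent one by an integral of a bounded
  function over the gap and by the cut integral of the subtracted multiple of \<open>r\<close>, the
  logarithm of \<open>r_quot_cut\<close>. Both vanish with the gap, so \<open>pv\<close> is the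
  Cauchy principal value.\<close>

lemma pv_cut_tendsto:
  assumes lip: "lip_supp L R \<phi>" and s: "s > 0" and T: "R \<le> T"
  shows "((\<lambda>d. LINT r:({0..T} - {s - d<..<s + d})|lborel. \<phi> r / (r\<^sup>2 - s\<^sup>2)) \<longlongrightarrow> pv \<phi> s) (at_right 0)"
proof -
  have [measurable]: "\<phi> \<in> borel_measurable borel" and R: "0 < R" "0 \<le> L"
    using lip by (simp_all add: lip_supp_def)
  define C where "C = L * (s + R) / s\<^sup>2"
  have C: "C \<ge> 0" using R s by (simp add: C_def)
  define E where "E d = 2 * C * d + \<bar>\<phi> s / s * (ln ((2 * s - d) / (2 * s + d)) / 2)\<bar>" for d
  have "((\<lambda>d. ln ((2 * s - d) / (2 * s + d))) \<longlongrightarrow> ln ((2 * s - 0) / (2 * s + 0))) (at_right 0)"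
    by (intro tendsto_intros) (use s in auto)
  hence "(E \<longlongrightarrow> 2 * C * 0 + \<bar>\<phi> s / s * (0 / 2)\<bar>) (at_right 0)"
    unfolding E_def by (intro tendsto_intros) (use s in auto)
  hence E0: "(E \<longlongrightarrow> 0) (at_right 0)" by simp
  let ?I = "\<lambda>d. LINT r:({0..T} - {s - d<..<s + d})|lborel. \<phi> r / (r\<^sup>2 - s\<^sup>2)"
  have bound: "\<bar>?I d - pv \<phi> s\<bar> \<le> E d" if d: "0 < d" "d < s / 4" for d
  proof -
    let ?q = "\<lambda>r. pv_sub \<phi> s r / (r\<^sup>2 - s\<^sup>2)"
    let ?g = "\<lambda>r. indicator ({0..sqrt 2 * s} - {s - d<..<s + d}) r *\<^sub>R (r / (r\<^sup>2 - s\<^sup>2))"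
    let ?h = "\<lambda>r. indicator {s - d<..<s + d} r * ?q r"
    have h: "integrable lborel ?h"
      by (rule integrable_bounded_Icc[where l="s-d" and u="s+d" and C=C])
         (use pv_quot_le[OF lip s] C in \<open>auto simp: C_def indicator_def\<close>)
    have "\<phi> r = 0" if "r > T" for r using that T lip by (auto simp: lip_supp_def)
    hence "(\<lambda>r. indicator ({0..T} - {s - d<..<s + d}) r *\<^sub>R (\<phi> r / (r\<^sup>2 - s\<^sup>2))) =
        (\<lambda>r. ?q r - ?h r + \<phi> s / s * ?g r)"
      by (auto simp: fun_eq_iff indicator_def pv_sub_def diff_divide_distrib)
    hence "?I d = (LINT r|lborel. ?q r - ?h r + \<phi> s / s * ?g r)"
      by (simp add: set_lebesgue_integral_def)
    also have "\<dots> = (LINT r|lborel. ?q r) - (LINT r|lborel. ?h r) + \<phi> s / s * (LINT r|lborel. ?g r)"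
      by (rule integral_diff_add_cmult) (fact pv_integrable[OF lip s] h r_quot_cut(1)[OF s d])+
    finally have "?I d - pv \<phi> s = - (LINT r|lborel. ?h r) + \<phi> s / s * (ln ((2 * s - d) / (2 * s + d)) / 2)"
      unfolding r_quot_cut(2)[OF s d] pv_def by simp
    moreover have "\<bar>LINT r|lborel. ?h r\<bar> \<le> C * ((s + d) - (s - d))"
      by (rule integral_bounded_Icc)
         (use pv_quot_le[OF lip s] C d in \<open>auto simp: C_def indicator_def\<close>)
    ultimately show ?thesis unfolding E_def by (simp add: abs_if split: if_splits)
  qed
  have "((\<lambda>d. ?I d - pv \<phi> s) \<longlongrightarrow> 0) (at_right 0)"
  proof (rule tendsto_rabs_zero_cancel, rule tendsto_sandwich[OF _ _ tendsto_const E0])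
    show "\<forall>\<^sub>F d in at_right 0. \<bar>?I d - pv \<phi> s\<bar> \<le> E d"
      using eventually_at_right_real[of 0 "s/4"] s by (auto elim!: eventually_mono intro!: bound)
  qed auto
  thus ?thesis using Lim_null by blast
qed

lemma lip_supp_integrable:
  assumes lip: "lip_supp L R \<phi>"
  shows "set_integrable lborel {0..} \<phi>"
proof -
  have [measurable]: "\<phi> \<in> borel_measurable borel" and R: "0 < R" "0 \<le> L"
    using lip by (simp_all add: lip_supp_def)
  show ?thesis unfolding set_integrable_def
    by (rule integrable_bounded_Icc[where l=0 and u=R and C="L * R"])
       (use lip lip_supp_bound[OF lip] in \<open>auto simp: lip_supp_def indicator_def\<close>)
qed

text \<open>For \<open>s \<ge> 2 * R\<close> the kernel is \<open>- 1 / s\<^sup>2\<close> up to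
  \<open>O(R\<^sup>2 / s ^ 4)\<close>, so the leading term carries the integral of
  \<open>\<phi>\<close>. For smaller \<open>s\<close> the two summands are bounded separately by 6
  and 1 times \<open>L * R\<^sup>2 / s\<^sup>2\<close>, and
  \<open>s\<^sup>2 \<le> 4 * R\<^sup>2\<close> raises the power; hence the constant 28.\<close>

lemma pv_decay:
  assumes lip: "lip_supp L R \<phi>" and s: "s > 0"
  shows "\<bar>pv \<phi> s + (LINT r:{0..}|lborel. \<phi> r) / s\<^sup>2\<bar> \<le> 28 * L * R^4 / s^4"
proof -
  have [measurable]: "\<phi> \<in> borel_measurable borel" and R: "0 < R" "0 \<le> L"
    and z: "\<And>r. R \<le> r \<Longrightarrow> \<phi> r = 0"
    using lip by (simp_all add: lip_supp_def)
  let ?f = "\<lambda>r. indicator {0..} r *\<^sub>R \<phi> r"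
  show ?thesis
  proof (cases "s \<ge> 2 * R")
    case True
    let ?q = "\<lambda>r. pv_sub \<phi> s r / (r\<^sup>2 - s\<^sup>2)"
    have "\<phi> s = 0" using True R z by auto
    hence q: "?q = (\<lambda>r. ?f r / (r\<^sup>2 - s\<^sup>2))" by (auto simp: pv_sub_def fun_eq_iff)
    have "pv \<phi> s + (LINT r:{0..}|lborel. \<phi> r) / s\<^sup>2 = (LINT r|lborel. ?q r + ?f r / s\<^sup>2)"
      unfolding pv_def set_lebesgue_integral_def
      using pv_integrable[OF lip s] lip_supp_integrable[OF lip]
      by (subst Bochner_Integration.integral_add) (auto simp: set_integrable_def)
    also have "\<bar>\<dots>\<bar> \<le> (4 / 3 * L * R^3 / s^4) * (R - 0)"
    proof (rule integral_bounded_Icc)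
      fix r assume r: "0 \<le> r" "r \<le> R"
      have "r\<^sup>2 \<le> (s / 2)\<^sup>2" using r True by (intro power_mono) auto
      hence r2: "3 / 4 * s\<^sup>2 \<le> s\<^sup>2 - r\<^sup>2" by (simp add: power_divide)
      hence n: "s\<^sup>2 - r\<^sup>2 > 0" using zero_less_power[OF s, of 2] by linarith
      have "?q r + ?f r / s\<^sup>2 = \<phi> r / (r\<^sup>2 - s\<^sup>2) + \<phi> r / s\<^sup>2"
        using fun_cong[OF q, of r] r by simp
      also have "\<dots> = - (\<phi> r * r\<^sup>2 / ((s\<^sup>2 - r\<^sup>2) * s\<^sup>2))"
        using n s r by (simp add: divide_simps) (auto simp: algebra_simps)
      finally have "\<bar>?q r + ?f r / s\<^sup>2\<bar> = \<bar>\<phi> r\<bar> * r\<^sup>2 / ((s\<^sup>2 - r\<^sup>2) * s\<^sup>2)"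
        using n s by (simp add: abs_mult)
      also have "\<dots> \<le> (L * R) * R\<^sup>2 / ((3 / 4 * s\<^sup>2) * s\<^sup>2)"
        using lip_supp_bound[OF lip r(1)] r R s r2 True
        by (intro frac_le mult_mono power_mono) auto
      also have "\<dots> = 4 / 3 * L * R^3 / s^4" by (simp add: eval_nat_numeral)
      finally show "\<bar>?q r + ?f r / s\<^sup>2\<bar> \<le> 4 / 3 * L * R^3 / s^4" .
    qed (use R z in \<open>auto simp: pv_sub_def indicator_def \<open>\<phi> s = 0\<close>\<close>)
    also have "\<dots> = (4/3) * (L * R^4 / s^4)" by (simp add: eval_nat_numeral)
    also have "\<dots> \<le> 28 * (L * R^4 / s^4)" using R s by (intro mult_right_mono) auto
    finally show ?thesis by simp
  next
    case False
    have "\<bar>LINT r|lborel. ?f r\<bar> \<le> L * R * (R - 0)"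
      by (rule integral_bounded_Icc)
         (use R z lip_supp_bound[OF lip] in \<open>auto simp: indicator_def\<close>)
    hence 1: "\<bar>(LINT r:{0..}|lborel. \<phi> r) / s\<^sup>2\<bar> \<le> L * R\<^sup>2 / s\<^sup>2"
      unfolding set_lebesgue_integral_def using s by (simp add: divide_right_mono power2_eq_square)
    have "\<bar>pv \<phi> s\<bar> \<le> L * (s + R) / s\<^sup>2 * (2 * R)" by (rule pv_bound[OF lip s])
    also have "\<dots> \<le> L * (3 * R) / s\<^sup>2 * (2 * R)"
      using False R s by (intro mult_right_mono divide_right_mono mult_left_mono) auto
    finally have "\<bar>pv \<phi> s + (LINT r:{0..}|lborel. \<phi> r) / s\<^sup>2\<bar> \<le> L * (3 * R) / s\<^sup>2 * (2 * R) + L * R\<^sup>2 / s\<^sup>2"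
      using 1 by linarith
    also have "\<dots> = 7 * L * R\<^sup>2 * s\<^sup>2 / s^4" using s by (simp add: field_simps eval_nat_numeral)
    also have "\<dots> \<le> 7 * L * R\<^sup>2 * (2 * R)\<^sup>2 / s^4"
      using False R s by (intro divide_right_mono mult_left_mono power_mono) auto
    also have "\<dots> = 28 * L * R^4 / s^4" by (simp add: eval_nat_numeral)
    finally show ?thesis .
  qed
qed

lemma pv_reg_tendsto:
  assumes lip: "lip_supp L R \<phi>" and s: "s > 0" and e: "\<And>n. e n > 0" and e0: "e \<longlonglongrightarrow> 0"
  shows "(\<lambda>n. pv_reg (e n) \<phi> s) \<longlonglongrightarrow> pv \<phi> s"
proof -
  have "(\<lambda>n. L * (s + R) / s\<^sup>2 * (pi * e n / s)) \<longlonglongrightarrow> L * (s + R) / s\<^sup>2 * (pi * 0 / s)"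
    using s by (intro tendsto_intros e0) auto
  hence "(\<lambda>n. pv_reg (e n) \<phi> s - pv \<phi> s) \<longlonglongrightarrow> 0"
    by (intro Lim_null_comparison[where f="\<lambda>n. pv_reg (e n) \<phi> s - pv \<phi> s"] always_eventually)
       (use pv_reg_rate[OF lip s e] in auto)
  thus ?thesis using Lim_null by blast
qed

section \<open>Differentiation of a principal value with respect to its pole\<close>

lemma pv_reg_HK:
  assumes lip: "lip_supp L R \<phi>" and e: "e > 0" and c: "continuous_on {0..R} \<phi>"
  shows "pv_reg e \<phi> s = integral {0..R} (\<lambda>r. \<phi> r * hker e (r\<^sup>2 - s\<^sup>2))"
proof -
  have R: "0 < R" "\<And>r. R \<le> r \<Longrightarrow> \<phi> r = 0" using lip by (auto simp: lip_supp_def)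
  have c': "continuous_on {0..R} (\<lambda>r. \<phi> r * hker e (r\<^sup>2 - s\<^sup>2))"
    using e c by (auto intro!: continuous_intros)
  have "pv_reg e \<phi> s = (LINT r:{0..R}|lborel. \<phi> r * hker e (r\<^sup>2 - s\<^sup>2))"
    unfolding pv_reg_def set_lebesgue_integral_def
    by (rule Bochner_Integration.integral_cong) (use R in \<open>auto simp: indicator_def\<close>)
  also have "\<dots> = integral {0..R} (\<lambda>r. \<phi> r * hker e (r\<^sup>2 - s\<^sup>2))"
    using borel_integrable_atLeastAtMost'[OF c'] by (rule set_borel_integral_eq_integral)
  finally show ?thesis .
qed

text \<open>Models the circular mean about a fixed boundary point as a function \<open>M\<close> of
  the radius. \<open>M 0 = 0\<close> reflects that \<open>f\<close> vanishes at the centre, and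
  \<open>R\<close> will be the diameter of the square.\<close>

locale radial_profile =
  fixes L R :: real and M M' :: "real \<Rightarrow> real"
  assumes L: "0 \<le> L" and R: "0 < R"
    and deriv: "\<And>r. (M has_real_derivative M' r) (at r)"
    and lip: "\<And>r s. \<bar>M' r - M' s\<bar> \<le> L * \<bar>r - s\<bar>"
    and M_0: "M 0 = 0" and M_R: "\<And>r. R \<le> r \<Longrightarrow> M r = 0" and M'_R: "\<And>r. R \<le> r \<Longrightarrow> M' r = 0"
begin

lemma cont_M': "continuous_on UNIV M'"
proof -
  have "L-lipschitz_on UNIV M'" using lip L by (auto simp: lipschitz_on_def dist_real_def)
  thus ?thesis by (rule lipschitz_on_continuous_on)
qed

lemma cont_M: "continuous_on UNIV M"
  using deriv DERIV_isCont continuous_at_imp_continuous_on by blast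

lemma measurable_M [measurable]: "M \<in> borel_measurable borel" "M' \<in> borel_measurable borel"
  using cont_M cont_M' by (auto intro: borel_measurable_continuous_onI)

lemma lip_supp_M': "lip_supp L R M'"
  using L R lip M'_R by (auto simp: lip_supp_def)

lemma abs_M'_le: "0 \<le> r \<Longrightarrow> \<bar>M' r\<bar> \<le> L * R"
  using lip_supp_bound[OF lip_supp_M'] .

lemma abs_M_le: assumes "0 \<le> r" shows "\<bar>M r\<bar> \<le> L * R * R"
proof (cases "r \<ge> R")
  case True thus ?thesis using M_R L R by simp
next
  case False
  have "norm (M r - M 0) \<le> (L * R) * norm (r - 0)"
    by (rule field_differentiable_bound[of "{0..r}" M M'])
       (use assms abs_M'_le has_field_derivative_at_within[OF deriv] in \<open>auto intro!: convex_real_interval\<close>)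
  also have "\<dots> \<le> (L * R) * R" using assms False L R by (intro mult_left_mono) auto
  finally show ?thesis using M_0 by simp
qed

lemma lip_supp_rM: "lip_supp (2 * L * R\<^sup>2) R (\<lambda>r. r * M r)"
proof -
  have "\<bar>r * M r - s * M s\<bar> \<le> (2 * L * R\<^sup>2) * \<bar>r - s\<bar>" if "0 \<le> r" "0 \<le> s" for r s
  proof -
    have "norm (r * M r - s * M s) \<le> (2 * L * R\<^sup>2) * norm (r - s)"
    proof (rule field_differentiable_bound[of "{0..}" "\<lambda>r. r * M r" "\<lambda>r. M r + r * M' r"])
      fix r :: real assume r: "r \<in> {0..}"
      show "((\<lambda>r. r * M r) has_field_derivative (M r + r * M' r)) (at r within {0..})"
        using has_field_derivative_at_within[OF DERIV_mult[OF DERIV_ident deriv[of r]]]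
        by (simp add: add.commute mult.commute)
      have "\<bar>r * M' r\<bar> \<le> R * (L * R)"
      proof (cases "r \<ge> R")
        case True thus ?thesis using M'_R L R by simp
      next
        case False thus ?thesis using abs_M'_le[of r] r L R unfolding abs_mult by (intro mult_mono) auto
      qed
      moreover have "\<bar>M r\<bar> \<le> L * R * R" using abs_M_le r by simp
      ultimately show "norm (M r + r * M' r) \<le> 2 * L * R\<^sup>2"
        by (simp add: power2_eq_square mult_ac)
    qed (use that in \<open>auto intro!: convex_real_interval\<close>)
    thus ?thesis by simp
  qed
  thus ?thesis using L R M_R by (auto simp: lip_supp_def)
qed

text \<open>Integration by parts, with boundary terms killed by \<open>M 0 = 0\<close> and
  \<open>M R = 0\<close>. The right-hand side contains \<open>r * M r\<close>, the radial density of
  a planar integral, and it is also what differentiating the kernel in \<open>s\<close>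
  produces.\<close>

lemma pv_reg_parts:
  assumes e: "e > 0"
  shows "pv_reg e M' s = - 2 * integral {0..R} (\<lambda>r. r * M r * hker' e (r\<^sup>2 - s\<^sup>2))"
proof -
  let ?f = "\<lambda>r. M' r * hker e (r\<^sup>2 - s\<^sup>2)" and ?g = "\<lambda>r. r * M r * hker' e (r\<^sup>2 - s\<^sup>2)"
  have c: "continuous_on {0..R} ?f" "continuous_on {0..R} ?g"
    using e continuous_on_subset[OF cont_M'] continuous_on_subset[OF cont_M]
    by (auto intro!: continuous_intros)
  have "((\<lambda>r. ?f r + 2 * ?g r) has_integral (M R * hker e (R\<^sup>2 - s\<^sup>2) - M 0 * hker e (0\<^sup>2 - s\<^sup>2))) {0..R}"
  proof (rule fundamental_theorem_of_calculus)
    fix r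
    have "((\<lambda>r. M r * hker e (r\<^sup>2 - s\<^sup>2)) has_real_derivative (?f r + 2 * ?g r)) (at r within {0..R})"
    proof -
      have "((\<lambda>r. hker e (r\<^sup>2 - s\<^sup>2)) has_real_derivative hker' e (r\<^sup>2 - s\<^sup>2) * (2 * r)) (at r)"
        by (rule hker_deriv[OF e]) (auto intro!: derivative_eq_intros)
      from has_field_derivative_at_within[OF DERIV_mult[OF deriv[of r] this]] show ?thesis
        by (simp add: algebra_simps)
    qed
    thus "((\<lambda>r. M r * hker e (r\<^sup>2 - s\<^sup>2)) has_vector_derivative (?f r + 2 * ?g r)) (at r within {0..R})"
      by (simp add: has_real_derivative_iff_has_vector_derivative)
  qed (use R in auto)
  hence "integral {0..R} (\<lambda>r. ?f r + 2 * ?g r) = 0" using M_0 M_R by (simp add: integral_unique)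
  moreover have "integral {0..R} (\<lambda>r. ?f r + 2 * ?g r) = integral {0..R} ?f + 2 * integral {0..R} ?g"
    using c by (subst Henstock_Kurzweil_Integration.integral_add)
      (auto intro!: integrable_continuous_interval continuous_intros)
  ultimately show ?thesis
    using pv_reg_HK[OF lip_supp_M' e, of s] continuous_on_subset[OF cont_M'] by auto
qed

text \<open>The kernel depends on \<open>r\<^sup>2 - s\<^sup>2\<close>, so its derivative in
  \<open>s\<close> is \<open>- 2 * s\<close> times \<open>hker'\<close>, and
  \<open>pv_reg_parts\<close> exchanges this for \<open>M'\<close>.\<close>

lemma pv_reg_rM_deriv:
  assumes e: "e > 0"
  shows "((\<lambda>s. pv_reg e (\<lambda>r. r * M r) s) has_real_derivative (s * pv_reg e M' s)) (at s)"
proof -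
  have c: "continuous_on {0..R} (\<lambda>r. r * M r)"
    using continuous_on_subset[OF cont_M] by (auto intro!: continuous_intros)
  have "((\<lambda>s. integral (cbox 0 R) (\<lambda>r. r * M r * hker e (r\<^sup>2 - s\<^sup>2))) has_field_derivative
      integral (cbox 0 R) (\<lambda>r. - 2 * s * (r * M r * hker' e (r\<^sup>2 - s\<^sup>2)))) (at s within UNIV)"
  proof (rule leibniz_rule_field_derivative)
    fix s r :: real
    show "((\<lambda>s. r * M r * hker e (r\<^sup>2 - s\<^sup>2)) has_field_derivative - 2 * s * (r * M r * hker' e (r\<^sup>2 - s\<^sup>2))) (at s within UNIV)"
    proof -
      have "((\<lambda>s. hker e (r\<^sup>2 - s\<^sup>2)) has_real_derivative hker' e (r\<^sup>2 - s\<^sup>2) * (- 2 * s)) (at s)"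
        by (rule hker_deriv[OF e]) (auto intro!: derivative_eq_intros)
      from DERIV_cmult[OF this, of "r * M r"] show ?thesis by (simp add: mult_ac)
    qed
    show "(\<lambda>r. r * M r * hker e (r\<^sup>2 - s\<^sup>2)) integrable_on cbox 0 R"
      using c e by (auto intro!: integrable_continuous_interval continuous_intros)
    have "continuous_on (UNIV \<times> cbox 0 R) (\<lambda>x. M (snd x))"
      by (rule continuous_on_compose2[OF cont_M]) (auto intro!: continuous_intros)
    thus "continuous_on (UNIV \<times> cbox 0 R) (\<lambda>(s, r). - 2 * s * (r * M r * hker' e (r\<^sup>2 - s\<^sup>2)))"
      unfolding split_beta by (intro continuous_intros e)
  qed auto
  moreover have "integral (cbox 0 R) (\<lambda>r. - 2 * s * (r * M r * hker' e (r\<^sup>2 - s\<^sup>2))) = s * pv_reg e M' s"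
    unfolding pv_reg_parts[OF e] integral_mult_right by simp
  ultimately show ?thesis
    using pv_reg_HK[OF lip_supp_rM e c] by simp
qed

text \<open>The regularised identity survives the limit because by \<open>pv_reg_rate\<close> the
  derivatives converge uniformly on the neighbourhood \<open>S\<close> of \<open>s\<close>.\<close>

lemma pv_rM_deriv:
  assumes s: "s > 0"
  shows "(pv (\<lambda>r. r * M r) has_real_derivative (s * pv M' s)) (at s)"
proof -
  define S where "S = {s / 2<..<2 * s}"
  have sS: "s \<in> S" using s by (simp add: S_def)
  \<comment> \<open>The rate for \<open>t * pv_reg (e n) M' t\<close>, with \<open>t\<close>
    replaced by the upper end \<open>2 * s\<close> of \<open>S\<close> in numerators and by the
    lower end \<open>s / 2\<close> in denominators.\<close>
  define C where "C = 2 * s * (L * (2 * s + R) / (s / 2)\<^sup>2 * (pi / (s / 2)))"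
  have C: "C \<ge> 0" unfolding C_def using s L R by (intro mult_nonneg_nonneg divide_nonneg_nonneg) auto
  define e where "e n = 1 / real (Suc n)" for n
  have e: "e n > 0" for n by (simp add: e_def)
  have e0: "e \<longlonglongrightarrow> 0" unfolding e_def using LIMSEQ_inverse_real_of_nat by (simp add: inverse_eq_divide)
  have rate: "\<bar>t * pv_reg (e n) M' t - t * pv M' t\<bar> \<le> C * e n" if "t \<in> S" for t n
  proof -
    have t: "s / 2 < t" "t < 2 * s" "t > 0" using that s by (auto simp: S_def)
    have "\<bar>pv_reg (e n) M' t - pv M' t\<bar> \<le> L * (t + R) / t\<^sup>2 * (pi * e n / t)"
      by (rule pv_reg_rate[OF lip_supp_M' t(3) e])
    also have "\<dots> \<le> L * (2 * s + R) / (s / 2)\<^sup>2 * (pi * e n / (s / 2))"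
      using t s L R e[of n] by (intro mult_mono frac_le power_mono) auto
    finally have "\<bar>t\<bar> * \<bar>pv_reg (e n) M' t - pv M' t\<bar> \<le> (2 * s) * (L * (2 * s + R) / (s / 2)\<^sup>2 * (pi * e n / (s / 2)))"
      using t by (intro mult_mono) auto
    also have "\<dots> = C * e n" by (simp add: C_def)
    finally show ?thesis by (simp add: abs_mult[symmetric] right_diff_distrib)
  qed
  have "\<exists>g. \<forall>x\<in>S. (\<lambda>n. pv_reg (e n) (\<lambda>r. r * M r) x) \<longlonglongrightarrow> g x \<and> (g has_derivative (\<lambda>h. (x * pv M' x) * h)) (at x within S)"
  proof (rule has_derivative_sequence[where f' = "\<lambda>n x h. (x * pv_reg (e n) M' x) * h" and ?x0.0 = s])
    fix n x
    show "(pv_reg (e n) (\<lambda>r. r * M r) has_derivative (\<lambda>h. (x * pv_reg (e n) M' x) * h)) (at x within S)"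
      using has_field_derivative_at_within[OF pv_reg_rM_deriv[OF e[of n], of x]]
      by (simp add: has_field_derivative_def)
  next
    fix d :: real assume d: "d > 0"
    have "(\<lambda>n. C * e n) \<longlonglongrightarrow> C * 0" by (intro tendsto_intros e0)
    hence "\<forall>\<^sub>F n in sequentially. C * e n < d" using d by (intro order_tendstoD) auto
    thus "\<forall>\<^sub>F n in sequentially. \<forall>x\<in>S. \<forall>h. norm ((x * pv_reg (e n) M' x) * h - (x * pv M' x) * h) \<le> d * norm h"
    proof eventually_elim
      case (elim n)
      show ?case
      proof (intro ballI allI)
        fix x h assume "x \<in> S"
        hence "\<bar>x * pv_reg (e n) M' x - x * pv M' x\<bar> \<le> d" using rate[of x n] elim by simp
        hence "\<bar>x * pv_reg (e n) M' x - x * pv M' x\<bar> * \<bar>h\<bar> \<le> d * \<bar>h\<bar>" by (intro mult_right_mono) auto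
        thus "norm ((x * pv_reg (e n) M' x) * h - (x * pv M' x) * h) \<le> d * norm h"
          by (simp add: abs_mult[symmetric] left_diff_distrib)
      qed
    qed
  next
    show "(\<lambda>n. pv_reg (e n) (\<lambda>r. r * M r) s) \<longlonglongrightarrow> pv (\<lambda>r. r * M r) s"
      by (rule pv_reg_tendsto[OF lip_supp_rM s e e0])
  qed (use sS in \<open>auto simp: S_def\<close>)
  then obtain g where g: "\<And>x. x \<in> S \<Longrightarrow> (\<lambda>n. pv_reg (e n) (\<lambda>r. r * M r) x) \<longlonglongrightarrow> g x"
    "\<And>x. x \<in> S \<Longrightarrow> (g has_derivative (\<lambda>h. (x * pv M' x) * h)) (at x within S)" by blast
  have eq: "g x = pv (\<lambda>r. r * M r) x" if "x \<in> S" for x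
  proof -
    have "x > 0" using that s by (auto simp: S_def)
    from LIMSEQ_unique[OF g(1)[OF that] pv_reg_tendsto[OF lip_supp_rM this e e0]] show ?thesis .
  qed
  have "(g has_real_derivative (s * pv M' s)) (at s within S)"
    using g(2)[OF sS] by (simp add: has_field_derivative_def)
  hence "(g has_real_derivative (s * pv M' s)) (at s)"
    using sS at_within_open[of s S] by (simp add: S_def)
  thus ?thesis
    by (rule has_field_derivative_transform_within_open[where S=S]) (use sS eq in \<open>auto simp: S_def\<close>)
qed

end

section \<open>The corner kernel\<close>

text \<open>As \<open>e\<close> tends to \<open>0\<close>, the kernel \<open>hker e v\<close> becomes \<open>1 / v\<close>, for which
  \<open>(h (p + q) - h p) / q + (h (p + q) - h q) / p + h p * h q\<close> vanishes pointwise. For \<open>e > 0\<close> this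
  expression is \<open>theta e p q\<close>, which concentrates at the origin with total mass \<open>pi\<^sup>2\<close>.\<close>

definition theta :: "real \<Rightarrow> real \<Rightarrow> real \<Rightarrow> real" where
  "theta e p q = e\<^sup>2 * (2 * e\<^sup>2 - p * q) / ((p\<^sup>2 + e\<^sup>2) * (q\<^sup>2 + e\<^sup>2) * ((p + q)\<^sup>2 + e\<^sup>2))"

text \<open>After multiplication by \<open>p * q\<close> the left side is a combination of
  \<open>v * hker e v = 1 - e\<^sup>2 / (v\<^sup>2 + e\<^sup>2)\<close> for \<open>v\<close> equal
  to \<open>p\<close>, \<open>q\<close> and \<open>p + q\<close>. Its constant part is that of the
  product on the right, and the Lorentzian remainders combine to \<open>theta\<close>.\<close>

lemma hker_corner_identity:
  assumes e: "e > 0" and "p \<noteq> 0" "q \<noteq> 0"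
  shows "(hker e (p + q) - hker e p) / q + (hker e (p + q) - hker e q) / p
         = theta e p q - hker e p * hker e q"
proof -
  have h: "v * hker e v = 1 - e\<^sup>2 / (v\<^sup>2 + e\<^sup>2)" for v
    using sq_nz[OF e, of v] by (simp add: hker_def diff_divide_eq_iff power2_eq_square)
  define A B D where "A = p\<^sup>2 + e\<^sup>2" and "B = q\<^sup>2 + e\<^sup>2" and "D = (p + q)\<^sup>2 + e\<^sup>2"
  have nz: "A \<noteq> 0" "B \<noteq> 0" "D \<noteq> 0" unfolding A_def B_def D_def by (rule sq_nz[OF e])+
  have "p * q * ((hker e (p + q) - hker e p) / q + (hker e (p + q) - hker e q) / p)
      = (p + q) * hker e (p + q) - p * hker e p - q * hker e q"
  proof -
    have "p * q * ((a - b) / q + (a - c) / p) = p * (a - b) + q * (a - c)" for a b c :: real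
      using assms by (simp add: field_simps)
    note * = this
    show ?thesis unfolding * by (simp add: algebra_simps)
  qed
  also have "\<dots> = e\<^sup>2 / A + e\<^sup>2 / B - 1 - e\<^sup>2 / D" by (simp add: h A_def B_def D_def)
  also have "\<dots> = p * q * theta e p q - (1 - e\<^sup>2 / A) * (1 - e\<^sup>2 / B)"
  proof -
    have "e\<^sup>2 * (A * B) + p * q * (e\<^sup>2 * (2 * e\<^sup>2 - p * q)) = e\<^sup>2 * e\<^sup>2 * D"
      by (simp add: A_def B_def D_def power2_eq_square algebra_simps)
    hence "p * q * theta e p q = (e\<^sup>2 * e\<^sup>2 * D - e\<^sup>2 * (A * B)) / (A * B * D)"
      unfolding theta_def A_def[symmetric] B_def[symmetric] D_def[symmetric] by simp
    also have "\<dots> = e\<^sup>2 / A * (e\<^sup>2 / B) - e\<^sup>2 / D"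
      using nz by (simp add: diff_divide_distrib)
    finally show ?thesis by (simp add: algebra_simps)
  qed
  also have "(1 - e\<^sup>2 / A) * (1 - e\<^sup>2 / B) = p * q * (hker e p * hker e q)"
    unfolding A_def B_def h[symmetric] by (simp only: mult_ac)
  also have "p * q * theta e p q - p * q * (hker e p * hker e q) = p * q * (theta e p q - hker e p * hker e q)"
    by (simp add: algebra_simps)
  finally show ?thesis using assms by simp
qed

lemma theta_measurable [measurable]: "(\<lambda>(p, q). theta e p q) \<in> borel_measurable (borel \<Otimes>\<^sub>M borel)"
  unfolding theta_def by measurable

text \<open>Homogeneity of degree -2: in the plane all \<open>theta e\<close> are dilates of
  \<open>theta 1\<close> with the same mass.\<close>

lemma theta_scale:
  assumes "e > 0" shows "theta e (e * p) (e * q) = theta 1 p q / e\<^sup>2"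
proof -
  have "theta e (e * p) (e * q) = e\<^sup>2 * (e\<^sup>2 * (2 - p * q)) / ((e\<^sup>2 * (p\<^sup>2 + 1)) * (e\<^sup>2 * (q\<^sup>2 + 1)) * (e\<^sup>2 * ((p + q)\<^sup>2 + 1)))"
    unfolding theta_def by (simp add: power2_eq_square algebra_simps)
  also have "\<dots> = theta 1 p q / e\<^sup>2"
    using assms unfolding theta_def by (simp add: power2_eq_square)
  finally show ?thesis .
qed

section \<open>Total mass and concentration of the corner kernel\<close>

lemma integral_FTC_real_line:
  fixes F g :: "real \<Rightarrow> real"
  assumes int: "integrable lborel g" and c: "continuous_on UNIV g"
    and F: "\<And>x. (F has_real_derivative g x) (at x)"
    and A: "(F \<longlongrightarrow> A) at_bot" and B: "(F \<longlongrightarrow> B) at_top"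
  shows "(LINT x|lborel. g x) = B - A"
proof (rule LIMSEQ_unique)
  have [measurable]: "g \<in> borel_measurable borel" using int by simp
  show "(\<lambda>n. LINT x|lborel. indicator {- real n..real n} x *\<^sub>R g x) \<longlonglongrightarrow> (LINT x|lborel. g x)"
  proof (rule integral_dominated_convergence[where w="\<lambda>x. \<bar>g x\<bar>"])
    show "AE x in lborel. (\<lambda>n. indicator {- real n..real n} x *\<^sub>R g x) \<longlonglongrightarrow> g x"
    proof (intro AE_I2 tendsto_eventually)
      fix x :: real
      show "\<forall>\<^sub>F n in sequentially. indicator {- real n..real n} x *\<^sub>R g x = g x"
        using eventually_ge_at_top[of "nat \<lceil>\<bar>x\<bar>\<rceil>"]
        by eventually_elim (auto simp: indicator_def nat_le_iff ceiling_le_iff abs_le_iff)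
    qed
  qed (use int in \<open>auto simp: indicator_def\<close>)
  have eq: "(LINT x|lborel. indicator {- real n..real n} x *\<^sub>R g x) = F (real n) - F (- real n)" for n
  proof (rule integral_FTC_atLeastAtMost)
    show "(F has_vector_derivative g x) (at x within {- real n..real n})" for x
      using has_field_derivative_at_within[OF F[of x]] by (simp add: has_real_derivative_iff_has_vector_derivative)
  qed (use continuous_on_subset[OF c] in auto)
  have "(\<lambda>n. F (real n)) \<longlonglongrightarrow> B" using B filterlim_real_sequentially by (rule filterlim_compose)
  moreover have "(\<lambda>n. F (- real n)) \<longlonglongrightarrow> A"
    by (rule filterlim_compose[OF A]) (simp add: filterlim_real_sequentially filterlim_uminus_at_top[symmetric])
  ultimately show "(\<lambda>n. LINT x|lborel. indicator {- real n..real n} x *\<^sub>R g x) \<longlonglongrightarrow> B - A"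
    unfolding eq by (intro tendsto_diff)
qed

lemma arctan_shift_deriv: "((\<lambda>x. arctan (x + c)) has_real_derivative 1 / (1 + (x + c)\<^sup>2)) (at x)"
  using DERIV_chain2[OF DERIV_arctan, of "\<lambda>x. x + c" 1] by (auto intro!: derivative_eq_intros simp: inverse_eq_divide)

lemma one_plus_sq_nz [simp]: "1 + (x::real)\<^sup>2 \<noteq> 0" "1 + (x::real)\<^sup>2 > 0"
  using sum_power2_gt_zero_iff[of 1 x] by auto

lemma arctan_shift_lims:
  "((\<lambda>x. arctan (x + c)) \<longlongrightarrow> pi / 2) at_top" "((\<lambda>x. arctan (x + c)) \<longlongrightarrow> - (pi / 2)) at_bot"
proof -
  have "filterlim (\<lambda>x. c + x) at_top at_top" by (rule filterlim_tendsto_add_at_top) (auto simp: filterlim_ident)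
  thus "((\<lambda>x. arctan (x + c)) \<longlongrightarrow> pi / 2) at_top"
    using filterlim_compose[OF tendsto_arctan_at_top] by (simp add: add.commute)
  have "filterlim (\<lambda>x. c + x) at_bot at_bot" unfolding filterlim_at_bot
  proof
    fix Z
    show "\<forall>\<^sub>F x in at_bot. c + x \<le> Z" using eventually_le_at_bot[of "Z - c"] by eventually_elim auto
  qed
  thus "((\<lambda>x. arctan (x + c)) \<longlongrightarrow> - (pi / 2)) at_bot"
    using filterlim_compose[OF tendsto_arctan_at_bot] by (simp add: add.commute)
qed

lemma lorentz_integrable: "integrable lborel (\<lambda>x. 1 / (1 + (x + c)\<^sup>2))" for c :: real
proof -
  have "set_integrable lborel (einterval (-\<infinity>) \<infinity>) (\<lambda>x::real. 1 / (1 + (x + c)\<^sup>2))"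
    by (rule interval_integral_FTC_nonneg[where F="\<lambda>x. arctan (x + c)" and A="- (pi/2)" and B="pi/2"])
       (use arctan_shift_lims in \<open>auto simp: arctan_shift_deriv ereal_tendsto_simps intro!: continuous_intros less_imp_le\<close>)
  thus ?thesis by (simp add: set_integrable_def)
qed

lemma lorentz_integral: "(LINT x|lborel. 1 / (1 + (x + c)\<^sup>2)) = pi"
  using integral_FTC_real_line[OF lorentz_integrable _ arctan_shift_deriv arctan_shift_lims(2,1)]
  by (simp add: continuous_intros)

text \<open>Completing squares shows that the numerator is at most twice the sum of
  \<open>1 + y\<^sup>2\<close> and \<open>1 + (x + y)\<^sup>2\<close>. Each of these cancels a
  factor of the denominator and leaves a product of two Lorentzians, integrable over the
  plane.\<close>

lemma abs_theta_le: "\<bar>theta 1 x y\<bar> \<le> 2 / (1 + x\<^sup>2) * (1 / (1 + (y + 0)\<^sup>2) + 1 / (1 + (y + x)\<^sup>2))"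
proof -
  define A B D where "A = 1 + x\<^sup>2" and "B = 1 + y\<^sup>2" and "D = 1 + (x + y)\<^sup>2"
  have pos: "A > 0" "B > 0" "D > 0" by (auto simp: A_def B_def D_def)
  have "x * y \<le> 2 * B + 2 * D - 2" "2 - x * y \<le> 2 * (B + D)"
  proof -
    have "2 * (B + D) - 2 - x * y = 2 + (3/2 * y + x)\<^sup>2 + 7/4 * y\<^sup>2 + x\<^sup>2"
      by (simp add: B_def D_def power2_eq_square algebra_simps)
    also have "\<dots> \<ge> 0" by (intro add_nonneg_nonneg) auto
    finally show "x * y \<le> 2 * B + 2 * D - 2" by simp
    have "2 * (B + D) - (2 - x * y) = 2 + 2 * (x + 5/4 * y)\<^sup>2 + 7/8 * y\<^sup>2"
      by (simp add: B_def D_def power2_eq_square algebra_simps)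
    also have "\<dots> \<ge> 0" by (intro add_nonneg_nonneg) auto
    finally show "2 - x * y \<le> 2 * (B + D)" by simp
  qed
  hence "\<bar>2 - x * y\<bar> \<le> 2 * (B + D)" by (auto simp: abs_le_iff)
  hence "\<bar>2 - x * y\<bar> / (A * B * D) \<le> 2 * (B + D) / (A * B * D)"
    using pos by (intro divide_right_mono) auto
  also have "\<dots> = 2 / A * (1 / B + 1 / D)" using pos by (simp add: field_simps)
  finally show ?thesis using pos unfolding theta_def A_def B_def D_def
    by (simp add: abs_mult add.commute)
qed

lemma theta_section_integrable: "integrable lborel (theta 1 x)"
proof (rule Bochner_Integration.integrable_bound)
  show "integrable lborel (\<lambda>y. 2 / (1 + x\<^sup>2) * (1 / (1 + (y + 0)\<^sup>2) + 1 / (1 + (y + x)\<^sup>2)))"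
    by (intro integrable_mult_right Bochner_Integration.integrable_add lorentz_integrable)
  show "theta 1 x \<in> borel_measurable lborel" unfolding theta_def by measurable
qed (use abs_theta_le in auto)

lemma theta_integrable: "integrable (lborel \<Otimes>\<^sub>M lborel) (\<lambda>(x, y). theta 1 x y)"
proof (rule lborel_pair.Fubini_integrable)
  show "(\<lambda>(x, y). theta 1 x y) \<in> borel_measurable (lborel \<Otimes>\<^sub>M lborel)"
    unfolding theta_def by measurable
  show "AE x in lborel. integrable lborel (\<lambda>y. case (x, y) of (x, y) \<Rightarrow> theta 1 x y)"
    using theta_section_integrable by simp
  show "integrable lborel (\<lambda>x. LINT y|lborel. norm (case (x, y) of (x, y) \<Rightarrow> theta 1 x y))"
  proof (rule Bochner_Integration.integrable_bound)
    show "integrable lborel (\<lambda>x. 4 * pi * (1 / (1 + (x + 0)\<^sup>2)))"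
      by (intro integrable_mult_right lorentz_integrable)
    show "(\<lambda>x. LINT y|lborel. norm (case (x, y) of (x, y) \<Rightarrow> theta 1 x y)) \<in> borel_measurable lborel"
      unfolding theta_def by measurable
    show "AE x in lborel. norm (LINT y|lborel. norm (case (x, y) of (x, y) \<Rightarrow> theta 1 x y))
        \<le> norm (4 * pi * (1 / (1 + (x + 0)\<^sup>2)))"
    proof (rule AE_I2)
      fix x :: real
      have i: "integrable lborel (\<lambda>y. 2 / (1 + x\<^sup>2) * (1 / (1 + (y + 0)\<^sup>2) + 1 / (1 + (y + x)\<^sup>2)))"
        by (intro integrable_mult_right Bochner_Integration.integrable_add lorentz_integrable)
      have "norm (LINT y|lborel. norm (theta 1 x y)) = (LINT y|lborel. \<bar>theta 1 x y\<bar>)" by simp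
      also have "\<dots> \<le> (LINT y|lborel. 2 / (1 + x\<^sup>2) * (1 / (1 + (y + 0)\<^sup>2) + 1 / (1 + (y + x)\<^sup>2)))"
        by (rule integral_mono) (use i theta_section_integrable abs_theta_le in auto)
      also have "\<dots> = 2 / (1 + x\<^sup>2) * (pi + pi)"
        unfolding integral_mult_right_zero
        by (subst Bochner_Integration.integral_add) (rule lorentz_integrable | simp only: lorentz_integral)+
      also have "\<dots> = norm (4 * pi * (1 / (1 + (x + 0)\<^sup>2)))" by (simp add: abs_mult)
      finally show "norm (LINT y|lborel. norm (case (x, y) of (x, y) \<Rightarrow> theta 1 x y))
        \<le> norm (4 * pi * (1 / (1 + (x + 0)\<^sup>2)))" by simp
    qed
  qed
qed

text \<open>Division by \<open>(f y)\<^sup>2\<close> turns the difference into a continuous function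
  of \<open>inverse (f y)\<close>; the general filter covers both ends of the line.\<close>

lemma ln_quot_tendsto:
  assumes "filterlim f at_infinity F"
  shows "((\<lambda>y::'a. ln (1 + (f y + x)\<^sup>2) - ln (1 + (f y)\<^sup>2)) \<longlongrightarrow> (0::real)) F"
proof -
  have inv: "((\<lambda>y. inverse (f y)) \<longlongrightarrow> 0) F" by (rule tendsto_inverse_0[THEN filterlim_compose, OF assms])
  have "((\<lambda>y. ln (((inverse (f y))\<^sup>2 + (1 + x * inverse (f y))\<^sup>2) / ((inverse (f y))\<^sup>2 + 1))) \<longlongrightarrow>
      ln ((0\<^sup>2 + (1 + x * 0)\<^sup>2) / (0\<^sup>2 + 1))) F"
    by (intro tendsto_intros inv) auto
  moreover have "\<forall>\<^sub>F y in F. f y \<noteq> 0"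
    using assms filterlim_at_infinity_imp_eventually_ne by blast
  hence "\<forall>\<^sub>F y in F. ln (((inverse (f y))\<^sup>2 + (1 + x * inverse (f y))\<^sup>2) / ((inverse (f y))\<^sup>2 + 1))
      = ln (1 + (f y + x)\<^sup>2) - ln (1 + (f y)\<^sup>2)"
  proof eventually_elim
    case (elim y)
    have "(inverse (f y))\<^sup>2 + (1 + x * inverse (f y))\<^sup>2 = (1 + (f y + x)\<^sup>2) / (f y)\<^sup>2"
      "(inverse (f y))\<^sup>2 + 1 = (1 + (f y)\<^sup>2) / (f y)\<^sup>2"
      using elim by (simp_all add: field_simps power2_eq_square)
    hence "((inverse (f y))\<^sup>2 + (1 + x * inverse (f y))\<^sup>2) / ((inverse (f y))\<^sup>2 + 1) = (1 + (f y + x)\<^sup>2) / (1 + (f y)\<^sup>2)"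
      using elim by simp
    thus ?case by (simp add: ln_div)
  qed
  ultimately show ?thesis by (simp add: tendsto_cong)
qed

text \<open>Partial fractions in \<open>y\<close> give the antiderivative \<open>F\<close>. Its
  logarithmic part tends to 0 at both ends, and the arctangent rises by \<open>pi\<close>.
  \<open>F\<close> divides by \<open>x\<close>; the section \<open>x = 0\<close> is a null set for
  the double integral.\<close>

lemma theta_section_integral: "(LINT y|lborel. theta 1 x y) = pi / (1 + x\<^sup>2)" if x: "x \<noteq> 0"
proof -
  define F where "F y = (ln (1 + (y + x)\<^sup>2) - ln (1 + y\<^sup>2)) / (2 * x * (1 + x\<^sup>2)) + arctan (y + x) / (1 + x\<^sup>2)" for y
  have "(LINT y|lborel. theta 1 x y) = (0 / (2 * x * (1 + x\<^sup>2)) + (pi / 2) / (1 + x\<^sup>2)) - (0 / (2 * x * (1 + x\<^sup>2)) + (- (pi / 2)) / (1 + x\<^sup>2))"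
  proof (rule integral_FTC_real_line[OF theta_section_integrable])
    show "continuous_on UNIV (theta 1 x)"
      unfolding theta_def by (intro continuous_intros) (auto simp: add.commute[of _ 1])
    show "(F \<longlongrightarrow> 0 / (2 * x * (1 + x\<^sup>2)) + - (pi / 2) / (1 + x\<^sup>2)) at_bot"
      "(F \<longlongrightarrow> 0 / (2 * x * (1 + x\<^sup>2)) + (pi / 2) / (1 + x\<^sup>2)) at_top"
      unfolding F_def
      by (intro tendsto_add tendsto_divide tendsto_const arctan_shift_lims
            ln_quot_tendsto[of "\<lambda>y. y"] filterlim_at_bot_imp_at_infinity filterlim_at_top_imp_at_infinity
            filterlim_ident; use x in simp)+
    fix y
    have d: "((\<lambda>y. ln (1 + (y + c)\<^sup>2)) has_real_derivative 2 * (y + c) / (1 + (y + c)\<^sup>2)) (at y)" for c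
      by (auto intro!: derivative_eq_intros simp: divide_simps)
    define A B D where "A = 1 + x\<^sup>2" and "B = 1 + y\<^sup>2" and "D = 1 + (y + x)\<^sup>2"
    have nz: "A \<noteq> 0" "B \<noteq> 0" "D \<noteq> 0" by (auto simp: A_def B_def D_def)
    have "(F has_real_derivative (2 * (y + x) / D - 2 * (y + 0) / B) / (2 * x * A) + (1 / D) / A) (at y)"
      unfolding F_def A_def B_def D_def using d[of 0] d[of x] arctan_shift_deriv[of x y]
      by (intro DERIV_add DERIV_diff DERIV_cdivide) auto
    also have "(2 * (y + x) / D - 2 * (y + 0) / B) / (2 * x * A) + (1 / D) / A = ((y + x) * B - y * D + x * B) / (x * A * B * D)"
      using nz x by (simp add: field_simps)
    also have "(y + x) * B - y * D + x * B = x * (2 - x * y)"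
      by (simp add: B_def D_def power2_eq_square algebra_simps)
    also have "x * (2 - x * y) / (x * A * B * D) = theta 1 x y"
      using x by (simp add: theta_def A_def B_def D_def add.commute)
    finally show "(F has_real_derivative theta 1 x y) (at y)" .
  qed
  also have "\<dots> = (pi / 2 + pi / 2) / (1 + x\<^sup>2)" by (simp only: add_divide_distrib minus_divide_left[symmetric], simp?)
  also have "\<dots> = pi / (1 + x\<^sup>2)" by simp
  finally show ?thesis .
qed

lemma theta_integral: "(LINT z|(lborel \<Otimes>\<^sub>M lborel). theta 1 (fst z) (snd z)) = pi\<^sup>2"
proof -
  have "(LINT z|(lborel \<Otimes>\<^sub>M lborel). theta 1 (fst z) (snd z)) = (LINT x|lborel. LINT y|lborel. theta 1 x y)"
    using lborel_pair.integral_fst[OF theta_integrable] by (simp add: case_prod_beta')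
  also have "\<dots> = (LINT x|lborel. pi * (1 / (1 + (x + 0)\<^sup>2)))"
  proof (rule integral_cong_AE)
    have "AE x in lborel. x \<noteq> (0::real)" by (rule AE_lborel_singleton)
    thus "AE x in lborel. (LINT y|lborel. theta 1 x y) = pi * (1 / (1 + (x + 0)\<^sup>2))"
      by eventually_elim (simp add: theta_section_integral)
  qed (unfold theta_def, measurable)
  also have "\<dots> = pi\<^sup>2" unfolding integral_mult_right_zero lorentz_integral by (simp add: power2_eq_square)
  finally show ?thesis .
qed

text \<open>An affine change of variables moves the scaling from \<open>theta\<close> into the
  argument of \<open>g\<close>, where continuity at one point suffices. As \<open>theta\<close>
  changes sign, the domination uses its absolute value.\<close>

lemma theta_approx_identity:
  fixes g :: "real \<times> real \<Rightarrow> real"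
  assumes [measurable]: "g \<in> borel_measurable borel" and b: "\<And>z. \<bar>g z\<bar> \<le> C"
    and c: "isCont g (s0, t0)" and e: "\<And>n. e n > 0" and e0: "e \<longlonglongrightarrow> 0"
  shows "(\<lambda>n. LINT z|lborel. g z * theta (e n) (fst z - s0) (snd z - t0)) \<longlonglongrightarrow> pi\<^sup>2 * g (s0, t0)"
proof -
  have [measurable]: "(\<lambda>z::real \<times> real. theta e' (fst z - s) (snd z - t)) \<in> borel_measurable borel" for e' s t
    unfolding theta_def borel_prod[symmetric] by measurable
  have int: "integrable lborel (\<lambda>z::real\<times>real. theta 1 (fst z) (snd z))"
    using theta_integrable by (simp add: lborel_prod case_prod_beta')
  have eq: "(LINT z|lborel. g z * theta (e n) (fst z - s0) (snd z - t0))
     = (LINT z|lborel. g ((s0, t0) + e n *\<^sub>R z) * theta 1 (fst z) (snd z))" for n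
  proof -
    have "(LINT z|lborel. g z * theta (e n) (fst z - s0) (snd z - t0)) =
       (LINT z|density (distr lborel borel (\<lambda>x. (s0, t0) + e n *\<^sub>R x)) (\<lambda>_. ennreal (\<bar>e n\<bar> ^ DIM(real \<times> real))).
          g z * theta (e n) (fst z - s0) (snd z - t0))"
      using lborel_affine[of "e n" "(s0, t0)"] e[of n] by simp
    also have "\<dots> = (LINT z|lborel. (e n)\<^sup>2 * (g ((s0, t0) + e n *\<^sub>R z) * theta (e n) (e n * fst z) (e n * snd z)))"
      using e[of n] by (subst integral_density) (auto simp: integral_distr power2_eq_square)
    also have "\<dots> = (LINT z|lborel. g ((s0, t0) + e n *\<^sub>R z) * theta 1 (fst z) (snd z))"
      using e[of n] by (intro Bochner_Integration.integral_cong refl) (simp add: theta_scale)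
    finally show ?thesis .
  qed
  have "(\<lambda>n. LINT z|lborel. g ((s0, t0) + e n *\<^sub>R z) * theta 1 (fst z) (snd z)) \<longlonglongrightarrow>
     (LINT z|lborel. g (s0, t0) * theta 1 (fst z) (snd z))"
  proof (rule integral_dominated_convergence[where w="\<lambda>z. C * \<bar>theta 1 (fst z) (snd z)\<bar>"])
    show "integrable lborel (\<lambda>z::real\<times>real. C * \<bar>theta 1 (fst z) (snd z)\<bar>)" using int by simp
    show "AE z in lborel. (\<lambda>n. g ((s0, t0) + e n *\<^sub>R z) * theta 1 (fst z) (snd z)) \<longlonglongrightarrow> g (s0, t0) * theta 1 (fst z) (snd z)"
    proof (intro AE_I2 tendsto_mult tendsto_const)
      fix z :: "real \<times> real"
      have "(\<lambda>n. (s0, t0) + e n *\<^sub>R z) \<longlonglongrightarrow> (s0, t0) + 0 *\<^sub>R z" by (intro tendsto_intros e0)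
      hence "(\<lambda>n. (s0, t0) + e n *\<^sub>R z) \<longlonglongrightarrow> (s0, t0)" by simp
      from isCont_tendsto_compose[OF c this] show "(\<lambda>n. g ((s0, t0) + e n *\<^sub>R z)) \<longlonglongrightarrow> g (s0, t0)" .
    qed
    show "AE z in lborel. norm (g ((s0, t0) + e n *\<^sub>R z) * theta 1 (fst z) (snd z)) \<le> C * \<bar>theta 1 (fst z) (snd z)\<bar>" for n
      using b by (auto simp: abs_mult intro!: mult_right_mono)
    show "(\<lambda>z::real \<times> real. g ((s0, t0) + e n *\<^sub>R z) * theta 1 (fst z) (snd z)) \<in> borel_measurable lborel" for n
      using int by auto
    show "(\<lambda>z::real \<times> real. g (s0, t0) * theta 1 (fst z) (snd z)) \<in> borel_measurable lborel"
      using int by auto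
  qed
  also have "(LINT z|lborel. g (s0, t0) * theta 1 (fst z) (snd z)) = pi\<^sup>2 * g (s0, t0)"
    using theta_integral by (simp add: lborel_prod)
  finally show ?thesis unfolding eq .
qed

section \<open>Circular means\<close>

definition unit_vec :: "real \<Rightarrow> real^2" where
  "unit_vec \<theta> = vector [cos \<theta>, sin \<theta>]"

lemma unit_vec_nth: "unit_vec \<theta> $ i = (if i = 1 then cos \<theta> else sin \<theta>)"
  using exhaust_2[of i] by (auto simp: unit_vec_def)

lemma unit_vec_alt: "unit_vec \<theta> = (\<chi> i. if i = 1 then cos \<theta> else sin \<theta>)"
  by (simp add: vec_eq_iff unit_vec_nth)

lemma norm_unit_vec [simp]: "norm (unit_vec \<theta>) = 1"
  by (simp add: norm_vec_def L2_set_def sum_2 unit_vec_nth)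

lemma continuous_on_unit_vec [continuous_intros]:
  fixes g :: "'b::t2_space \<Rightarrow> real"
  shows "continuous_on S g \<Longrightarrow> continuous_on S (\<lambda>x. unit_vec (g x))"
proof -
  assume g: "continuous_on S g"
  have "continuous_on S (\<lambda>x. (if i = 1 then cos (g x) else sin (g x)))" for i :: 2
    by (cases "i = 1") (simp_all add: continuous_on_cos[OF g] continuous_on_sin[OF g])
  thus ?thesis unfolding unit_vec_alt by (intro continuous_on_vec_lambda)
qed

lemma circ_mean_alt: "circ_mean f y r = 1 / (2 * pi) * (LINT \<theta>:{0..2*pi}|lborel. f (y + r *\<^sub>R unit_vec \<theta>))"
  by (simp add: circ_mean_def unit_vec_def)

text \<open>The bound is the diameter of the square. It is strict because the square is open, so
  circles of radius \<open>2 * sqrt 2 * a\<close> about a boundary point already miss the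
  square.\<close>

lemma norm_le_in_square:
  assumes "z \<in> square a" "\<And>i. \<bar>y $ i\<bar> \<le> a" "a > 0"
  shows "norm (z - y) < 2 * sqrt 2 * a"
proof -
  have "\<bar>z $ i - y $ i\<bar> < 2 * a" for i
    using assms(1) assms(2)[of i] by (auto simp: square_def abs_less_iff abs_le_iff) (smt (verit))+
  hence sq: "(z $ i - y $ i)\<^sup>2 < (2 * a)\<^sup>2" for i
    by (metis abs_ge_zero power2_abs power_strict_mono zero_less_numeral)
  have "norm (z - y) = sqrt ((z $ 1 - y $ 1)\<^sup>2 + (z $ 2 - y $ 2)\<^sup>2)"
    by (simp add: norm_vec_def L2_set_def sum_2)
  also have "\<dots> < sqrt ((2 * a)\<^sup>2 + (2 * a)\<^sup>2)" using sq[of 1] sq[of 2] by simp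
  also have "\<dots> = sqrt (2 * (2 * a)\<^sup>2)" by simp
  also have "\<dots> = 2 * sqrt 2 * a" unfolding real_sqrt_mult real_sqrt_abs using assms(3) by simp
  finally show ?thesis .
qed

lemma open_square: "open (square a)"
proof -
  have "square a = (\<Inter>i\<in>UNIV. {x. - a < x $ i} \<inter> {x. x $ i < a})" by (auto simp: square_def)
  also have "open \<dots>"
    by (intro open_INT open_Int) (auto intro!: open_Collect_less continuous_intros)
  finally show ?thesis .
qed

text \<open>On the open complement of the support the derivative is zero, so \<open>f'\<close> can
  be continued by zero to a map \<open>G\<close> that is differentiable on the whole plane. Its
  derivative is bounded because \<open>f''\<close> is continuous on the compact support, and the
  mean value inequality on the convex plane gives the Lipschitz constant.\<close>

lemma C2_0_extension:
  assumes "C2_0 U f" "open U"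
  obtains G :: "real^2 \<Rightarrow> (real^2) \<Rightarrow>\<^sub>L real" and L :: real where
    "0 \<le> L" "\<And>z. (f has_derivative blinfun_apply (G z)) (at z)"
    "\<And>z w. norm (G z - G w) \<le> L * norm (z - w)"
    "\<And>z. z \<notin> U \<Longrightarrow> f z = 0" "\<And>z. z \<notin> U \<Longrightarrow> G z = 0"
proof -
  define K where "K = closure {x. f x \<noteq> 0}"
  have K: "compact K" "K \<subseteq> U" "closed K" using assms by (auto simp: C2_0_def K_def)
  have f0: "f z = 0" if "z \<notin> K" for z using that closure_subset[of "{x. f x \<noteq> 0}"] by (auto simp: K_def)
  obtain f' and f'' :: "real ^ 2 \<Rightarrow> (real ^ 2) \<Rightarrow>\<^sub>L ((real ^ 2) \<Rightarrow>\<^sub>L real)"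
    where f': "\<And>x. x \<in> U \<Longrightarrow> (f has_derivative blinfun_apply (f' x)) (at x)"
      and f'': "\<And>x. x \<in> U \<Longrightarrow> (f' has_derivative blinfun_apply (f'' x)) (at x)"
      and cont: "continuous_on U f''"
    using assms(1) unfolding C2_0_def C2_on_def by blast
  define G where "G z = (if z \<in> U then f' z else 0)" for z
  define H where "H z = (if z \<in> K then f'' z else 0)" for z
  have der0: "(f has_derivative (\<lambda>h. 0)) (at z)" if "z \<notin> K" for z
    by (rule has_derivative_transform_within_open[of "\<lambda>_. 0" _ _ _ "- K"])
       (use that K f0 in \<open>auto simp: open_Compl\<close>)
  have G0: "G z = 0" if "z \<notin> K" for z
  proof (cases "z \<in> U")
    case True
    have "blinfun_apply (f' z) = (\<lambda>h. 0)" using has_derivative_unique[OF f'[OF True] der0[OF that]] .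
    hence "f' z = 0" by (intro blinfun_eqI) simp
    thus ?thesis by (simp add: G_def)
  qed (simp add: G_def)
  have dG: "(f has_derivative blinfun_apply (G z)) (at z)" for z
  proof (cases "z \<in> K")
    case True thus ?thesis using f'[of z] K by (auto simp: G_def)
  next
    case False
    have "blinfun_apply (0 :: (real^2) \<Rightarrow>\<^sub>L real) = (\<lambda>h. 0)" by (simp add: fun_eq_iff)
    thus ?thesis using der0[OF False] G0[OF False] by simp
  qed
  have dH: "(G has_derivative blinfun_apply (H z)) (at z)" for z
  proof (cases "z \<in> K")
    case True
    hence "z \<in> U" using K by auto
    have "(G has_derivative blinfun_apply (f'' z)) (at z)"
      by (rule has_derivative_transform_within_open[OF f''[OF \<open>z \<in> U\<close>] assms(2) \<open>z \<in> U\<close>]) (simp add: G_def)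
    thus ?thesis using True by (simp add: H_def)
  next
    case False
    have "(G has_derivative (\<lambda>h. 0)) (at z)"
      by (rule has_derivative_transform_within_open[of "\<lambda>_. 0" _ _ _ "- K"])
         (use False K G0 in \<open>auto simp: open_Compl\<close>)
    thus ?thesis using False by (simp add: H_def zero_blinfun.rep_eq)
  qed
  have "bounded (f'' ` K)"
    using compact_continuous_image[OF continuous_on_subset[OF cont K(2)] K(1)] compact_imp_bounded by blast
  then obtain B where "B > 0" and B: "\<And>z. z \<in> K \<Longrightarrow> norm (f'' z) \<le> B"
    unfolding bounded_pos by auto
  hence HB: "norm (H z) \<le> B" for z by (simp add: H_def)
  have "norm (G z - G w) \<le> B * norm (z - w)" for z w
    by (rule differentiable_bound[of UNIV G "\<lambda>z. blinfun_apply (H z)"])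
       (use dH HB in \<open>auto simp: norm_blinfun.rep_eq[symmetric]\<close>)
  moreover have "z \<notin> K" if "z \<notin> U" for z using K(2) that by auto
  ultimately show ?thesis by (intro that[of B G]) (use \<open>B > 0\<close> dG G0 f0 in auto)
qed

text \<open>The gradient \<open>G\<close> is global because the circles are centred on the boundary
  and leave the square; all estimates on means then hold without regard to the boundary.\<close>

locale c11_square =
  fixes a L :: real and f :: "real^2 \<Rightarrow> real" and G :: "real^2 \<Rightarrow> (real^2) \<Rightarrow>\<^sub>L real"
  assumes a: "a > 0" and L: "0 \<le> L"
    and deriv_f: "\<And>z. (f has_derivative blinfun_apply (G z)) (at z)"
    and lip_G: "\<And>z w. norm (G z - G w) \<le> L * norm (z - w)"
    and f_out: "\<And>z. z \<notin> square a \<Longrightarrow> f z = 0" and G_out: "\<And>z. z \<notin> square a \<Longrightarrow> G z = 0"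
begin

lemma cont_f: "continuous_on UNIV f"
  by (intro continuous_at_imp_continuous_on ballI has_derivative_continuous[OF deriv_f])

lemma cont_G: "continuous_on UNIV G"
proof -
  have "L-lipschitz_on UNIV G" using lip_G L by (auto simp: lipschitz_on_def dist_norm)
  thus ?thesis by (rule lipschitz_on_continuous_on)
qed

lemmas cont_f' [continuous_intros] = continuous_on_compose2[OF cont_f _ subset_UNIV]
lemmas cont_G' [continuous_intros] = continuous_on_compose2[OF cont_G _ subset_UNIV]

text \<open>The derivative of \<open>circ_mean f y\<close> in the radius.\<close>

definition dmean :: "real^2 \<Rightarrow> real \<Rightarrow> real" where
  "dmean y r = 1 / (2 * pi) * (LINT \<theta>:{0..2*pi}|lborel. G (y + r *\<^sub>R unit_vec \<theta>) (unit_vec \<theta>))"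

lemma circ_mean_HK: "circ_mean f y r = 1 / (2 * pi) * integral {0..2*pi} (\<lambda>\<theta>. f (y + r *\<^sub>R unit_vec \<theta>))"
  unfolding circ_mean_alt
  by (subst set_borel_integral_eq_integral) (auto intro!: borel_integrable_atLeastAtMost' continuous_intros)

lemma dmean_HK: "dmean y r = 1 / (2 * pi) * integral {0..2*pi} (\<lambda>\<theta>. G (y + r *\<^sub>R unit_vec \<theta>) (unit_vec \<theta>))"
  unfolding dmean_def
  by (subst set_borel_integral_eq_integral) (auto intro!: borel_integrable_atLeastAtMost' continuous_intros)

lemma circ_mean_deriv: "(circ_mean f y has_real_derivative dmean y r) (at r)"
proof -
  have "((\<lambda>r. integral (cbox 0 (2*pi)) (\<lambda>\<theta>. f (y + r *\<^sub>R unit_vec \<theta>))) has_field_derivative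
     integral (cbox 0 (2*pi)) (\<lambda>\<theta>. G (y + r *\<^sub>R unit_vec \<theta>) (unit_vec \<theta>))) (at r within UNIV)"
  proof (rule leibniz_rule_field_derivative)
    fix r \<theta> :: real
    have "((\<lambda>r. y + r *\<^sub>R unit_vec \<theta>) has_derivative (\<lambda>h. h *\<^sub>R unit_vec \<theta>)) (at r)"
      by (auto intro!: derivative_eq_intros)
    from has_derivative_compose[OF this deriv_f]
    show "((\<lambda>r. f (y + r *\<^sub>R unit_vec \<theta>)) has_field_derivative G (y + r *\<^sub>R unit_vec \<theta>) (unit_vec \<theta>)) (at r within UNIV)"
      unfolding has_field_derivative_def blinfun.scaleR_right
      by (simp add: mult_commute_abs)
    show "(\<lambda>\<theta>. f (y + r *\<^sub>R unit_vec \<theta>)) integrable_on cbox 0 (2*pi)"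
      by (auto intro!: integrable_continuous_interval continuous_intros)
    show "continuous_on (UNIV \<times> cbox 0 (2*pi)) (\<lambda>(r, \<theta>). G (y + r *\<^sub>R unit_vec \<theta>) (unit_vec \<theta>))"
      unfolding split_beta by (intro continuous_intros)
  qed auto
  from DERIV_cmult[OF this, of "1 / (2 * pi)"] show ?thesis
    unfolding circ_mean_HK[abs_def] dmean_HK by simp
qed

lemma dmean_lip: "\<bar>dmean y r - dmean y s\<bar> \<le> L * \<bar>r - s\<bar>"
proof -
  let ?g = "\<lambda>r \<theta>. G (y + r *\<^sub>R unit_vec \<theta>) (unit_vec \<theta>)"
  have "dmean y r - dmean y s = 1 / (2 * pi) * integral {0..2*pi} (\<lambda>\<theta>. ?g r \<theta> - ?g s \<theta>)"
    unfolding dmean_HK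
    by (subst Henstock_Kurzweil_Integration.integral_diff)
       (auto intro!: integrable_continuous_interval continuous_intros simp: right_diff_distrib)
  moreover have "norm (integral {0..2*pi} (\<lambda>\<theta>. ?g r \<theta> - ?g s \<theta>)) \<le> (L * \<bar>r - s\<bar>) * (2 * pi - 0)"
  proof (rule integral_bound)
    show "continuous_on {0..2*pi} (\<lambda>\<theta>. ?g r \<theta> - ?g s \<theta>)" by (intro continuous_intros)
    show "norm (?g r \<theta> - ?g s \<theta>) \<le> L * \<bar>r - s\<bar>" for \<theta>
    proof -
      have "norm (?g r \<theta> - ?g s \<theta>) = norm ((G (y + r *\<^sub>R unit_vec \<theta>) - G (y + s *\<^sub>R unit_vec \<theta>)) (unit_vec \<theta>))"
        by (simp add: blinfun.diff_left)
      also have "\<dots> \<le> norm (G (y + r *\<^sub>R unit_vec \<theta>) - G (y + s *\<^sub>R unit_vec \<theta>)) * norm (unit_vec \<theta>)"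
        by (rule norm_blinfun)
      also have "\<dots> = norm (G (y + r *\<^sub>R unit_vec \<theta>) - G (y + s *\<^sub>R unit_vec \<theta>))" by simp
      also have "\<dots> \<le> L * norm ((y + r *\<^sub>R unit_vec \<theta>) - (y + s *\<^sub>R unit_vec \<theta>))" by (rule lip_G)
      also have "\<dots> = L * \<bar>r - s\<bar>" by (simp add: scaleR_left_diff_distrib[symmetric])
      finally show ?thesis .
    qed
  qed simp
  moreover have "\<bar>1 / (2 * pi) * x\<bar> \<le> L * \<bar>r - s\<bar>" if "\<bar>x\<bar> \<le> (L * \<bar>r - s\<bar>) * (2 * pi - 0)" for x
    using that by (simp add: abs_mult divide_le_eq)
  ultimately show ?thesis by simp
qed

definition on_boundary :: "real^2 \<Rightarrow> bool" where
  "on_boundary y \<longleftrightarrow> (\<forall>i. \<bar>y $ i\<bar> \<le> a) \<and> y \<notin> square a"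

lemma far_out:
  assumes "on_boundary y" "2 * sqrt 2 * a \<le> r"
  shows "y + r *\<^sub>R unit_vec \<theta> \<notin> square a"
proof
  assume "y + r *\<^sub>R unit_vec \<theta> \<in> square a"
  from norm_le_in_square[OF this, of y] assms a have "\<bar>r\<bar> < 2 * sqrt 2 * a"
    by (simp add: on_boundary_def)
  thus False using assms by simp
qed

lemma mean_profile:
  assumes y: "on_boundary y"
  shows "radial_profile L (2 * sqrt 2 * a) (circ_mean f y) (dmean y)"
proof
  have "y \<notin> square a" using y by (simp add: on_boundary_def)
  hence "f y = 0" by (rule f_out)
  thus "circ_mean f y 0 = 0" by (simp add: circ_mean_def set_lebesgue_integral_def)
  fix r :: real assume r: "2 * sqrt 2 * a \<le> r"
  show "circ_mean f y r = 0" "dmean y r = 0"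
    using far_out[OF y r] by (simp_all add: circ_mean_HK dmean_HK f_out G_out)
qed (use a L circ_mean_deriv dmean_lip in auto)

lemma means_measurable [measurable]:
  "(\<lambda>(y, r). circ_mean f y r) \<in> borel_measurable (borel \<Otimes>\<^sub>M borel)"
  "(\<lambda>(y, r). dmean y r) \<in> borel_measurable (borel \<Otimes>\<^sub>M borel)"
proof -
  have [measurable]: "(\<lambda>z. f (fst (fst z) + snd (fst z) *\<^sub>R unit_vec (snd z))) \<in> borel_measurable ((borel \<Otimes>\<^sub>M borel) \<Otimes>\<^sub>M borel)"
    "(\<lambda>z. G (fst (fst z) + snd (fst z) *\<^sub>R unit_vec (snd z)) (unit_vec (snd z))) \<in> borel_measurable ((borel \<Otimes>\<^sub>M borel) \<Otimes>\<^sub>M borel)"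
    unfolding borel_prod by (auto intro!: borel_measurable_continuous_onI continuous_intros)
  show "(\<lambda>(y, r). circ_mean f y r) \<in> borel_measurable (borel \<Otimes>\<^sub>M borel)"
    unfolding circ_mean_alt set_lebesgue_integral_def split_beta
    by (intro borel_measurable_times borel_measurable_const lborel.borel_measurable_lebesgue_integral)
       (simp add: split_beta)
  show "(\<lambda>(y, r). dmean y r) \<in> borel_measurable (borel \<Otimes>\<^sub>M borel)"
    unfolding dmean_def set_lebesgue_integral_def split_beta
    by (intro borel_measurable_times borel_measurable_const lborel.borel_measurable_lebesgue_integral)
       (simp add: split_beta)
qed

end

section \<open>Coordinates adapted to a side, and polar coordinates about a boundary point\<close>

lemma line_point_nth [simp]: "line_point i p q $ i = p" "line_point i p q $ other i = q"
  using exhaust_2[of i] by (auto simp: line_point_def other_def)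

lemma other_neq [simp]: "other i \<noteq> i" "i \<noteq> other i"
  using exhaust_2[of i] by (auto simp: other_def)

lemma UNIV_2_other: "UNIV = {i, other i}"
  using exhaust_2[of i] by (auto simp: other_def UNIV_2)

lemma line_point_alt: "line_point i p q = p *\<^sub>R axis i 1 + q *\<^sub>R axis (other i) 1"
  using exhaust_2 by (auto simp: vec_eq_iff line_point_def axis_def other_def) 

lemma continuous_on_line_point [continuous_intros]:
  "continuous_on S g \<Longrightarrow> continuous_on S h \<Longrightarrow> continuous_on S (\<lambda>x. line_point i (g x) (h x))"
  unfolding line_point_alt by (intro continuous_intros)

lemma line_point_measurable [measurable]:
  "(\<lambda>z. line_point i (fst z) (snd z)) \<in> borel_measurable borel"
  by (intro borel_measurable_continuous_onI continuous_intros)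

lemma norm_line_point: "(norm (line_point i p q))\<^sup>2 = p\<^sup>2 + q\<^sup>2"
  by (simp add: norm_vec_def L2_set_def UNIV_2_other[of i] sum_nonneg)

text \<open>Reading vectors as pairs, in either order of the coordinates, preserves the volume of
  boxes, which determines Lebesgue measure. The coordinate normal to a side can thus always be put
  first.\<close>

lemma lborel_line_point: "(lborel :: (real^2) measure) = distr lborel borel (\<lambda>z. line_point i (fst z) (snd z))"
proof (rule lborel_eqI)
  fix l u :: "real^2" assume le: "\<And>b. b \<in> Basis \<Longrightarrow> l \<bullet> b \<le> u \<bullet> b"
  have le': "l $ j \<le> u $ j" for j using le[of "axis j 1"] by (simp add: inner_axis)
  have B: "(Basis :: (real^2) set) = {axis i 1, axis (other i) 1}"
    using UNIV_2_other[of i] by (auto simp: Basis_vec_def)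
  have ne: "axis i (1::real) \<noteq> axis (other i) 1" by (simp add: axis_eq_axis)
  have box: "(\<lambda>z. line_point i (fst z) (snd z)) -` box l u = {l $ i<..<u $ i} \<times> {l $ other i<..<u $ other i}"
    by (auto simp: box_def B inner_axis)
  have "emeasure (distr lborel borel (\<lambda>z. line_point i (fst z) (snd z))) (box l u)
     = emeasure (lborel \<Otimes>\<^sub>M lborel) ({l $ i<..<u $ i} \<times> {l $ other i<..<u $ other i})"
    by (subst emeasure_distr) (auto simp: box lborel_prod)
  also have "\<dots> = ennreal ((u - l) $ i) * ennreal ((u - l) $ other i)"
    using le' by (subst lborel.emeasure_pair_measure_Times) auto
  also have "\<dots> = (\<Prod>b\<in>Basis. (u - l) \<bullet> b)"
    using le' ne by (simp add: B inner_axis ennreal_mult)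
  finally show "emeasure (distr lborel borel (\<lambda>z. line_point i (fst z) (snd z))) (box l u) = (\<Prod>b\<in>Basis. (u - l) \<bullet> b)" .
qed simp

context c11_square
begin

lemma f_integrable:
  assumes "continuous_on UNIV w"
  shows "integrable lborel (\<lambda>z. f z * w z)"
proof -
  define K :: "(real^2) set" where "K = cbox (\<chi> i. - a) (\<chi> i. a)"
  have "square a \<subseteq> K" by (auto simp: square_def K_def mem_box_cart less_imp_le)
  hence "(\<lambda>z. f z * w z) = (\<lambda>z. indicator K z *\<^sub>R (f z * w z))"
    using f_out by (auto simp: indicator_def fun_eq_iff)
  moreover have "integrable lborel (\<lambda>z. indicator K z *\<^sub>R (f z * w z))"
    by (rule borel_integrable_compact) (use continuous_on_subset[OF assms] in \<open>auto simp: K_def intro!: continuous_intros\<close>)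
  ultimately show ?thesis by simp
qed

text \<open>\<open>r * (2 * pi * circ_mean f y r)\<close> is the density of \<open>f\<close> with
  respect to the distance from \<open>y\<close>. Radii below the diameter reach the whole support of
  \<open>f\<close>.\<close>

lemma polar_coordinates:
  assumes y: "on_boundary y" and psi: "continuous_on UNIV \<psi>"
  shows "(LINT r:{0<..<2 * sqrt 2 * a}|lborel. r * \<psi> r * (2 * pi * circ_mean f y r)) =
    (LINT z|lborel. f z * \<psi> (norm (z - y)))"
proof -
  define R where "R = 2 * sqrt 2 * a"
  define h where "h z = f z * \<psi> (norm (z - y))" for z
  have cpsi: "continuous_on S (\<lambda>x. \<psi> (k x))" if "continuous_on S k" for S :: "'b::topological_space set" and k
    by (rule continuous_on_compose2[OF psi that]) auto
  have ch: "continuous_on S (\<lambda>x. h (k x))" if "continuous_on S k" for S :: "'b::topological_space set" and k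
    unfolding h_def using that by (intro continuous_intros cpsi)
  have int_h: "integrable lborel h" unfolding h_def by (rule f_integrable) (intro continuous_intros cpsi)
  define S where "S = box (vector [0, 0]) (vector [R, 2 * pi] :: real^2)"
  have S: "v \<in> S \<longleftrightarrow> 0 < v $ 1 \<and> v $ 1 < R \<and> 0 < v $ 2 \<and> v $ 2 < 2 * pi" for v
    by (auto simp: S_def mem_box_cart forall_2)
  define g where "g v = y + v $ 1 *\<^sub>R unit_vec (v $ 2)" for v :: "real^2"
  define g' where "g' v k = (\<chi> i. k $ 1 * (if i = 1 then cos (v $ 2) else sin (v $ 2)) +
      v $ 1 * (if i = 1 then - sin (v $ 2) * k $ 2 else cos (v $ 2) * k $ 2) :: real^2)" for v k :: "real^2"
  have cg: "continuous_on T g" for T unfolding g_def by (intro continuous_intros)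
  have dnth: "((\<lambda>v::real^2. v $ i) has_derivative (\<lambda>k. k $ i)) F" for i F
    by (rule bounded_linear_imp_has_derivative) (rule bounded_linear_vec_nth)
  have dg: "(g has_derivative g' v) (at v within S)" for v
  proof -
    have "g = (\<lambda>v. \<chi> i. y $ i + v $ 1 * (if i = 1 then cos (v $ 2) else sin (v $ 2)))"
      by (simp add: g_def fun_eq_iff vec_eq_iff unit_vec_nth)
    moreover have "((\<lambda>v. y $ i + v $ 1 * (if i = 1 then cos (v $ 2) else sin (v $ 2))) has_derivative
      (\<lambda>k. k $ 1 * (if i = 1 then cos (v $ 2) else sin (v $ 2)) +
      v $ 1 * (if i = 1 then - sin (v $ 2) * k $ 2 else cos (v $ 2) * k $ 2))) (at v within S)" for i :: 2
      by (cases "i = 1") (auto intro!: derivative_eq_intros dnth)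
    ultimately show ?thesis unfolding g'_def
      by (subst has_derivative_componentwise_within) (auto simp: Basis_vec_def inner_axis)
  qed
  have det: "\<bar>det (matrix (g' v))\<bar> = \<bar>v $ 1\<bar>" for v
  proof -
    have "det (matrix (g' v)) = v $ 1 * (cos (v $ 2) * cos (v $ 2)) + v $ 1 * (sin (v $ 2) * sin (v $ 2))"
      unfolding det_2 by (simp add: matrix_def g'_def axis_def algebra_simps)
    also have "\<dots> = v $ 1 * ((cos (v $ 2))\<^sup>2 + (sin (v $ 2))\<^sup>2)"
      by (simp only: power2_eq_square distrib_left)
    finally show ?thesis by simp
  qed
  have inj: "inj_on g S"
  proof (rule inj_onI)
    fix v w assume vw: "v \<in> S" "w \<in> S" "g v = g w"
    hence eq: "v $ 1 *\<^sub>R unit_vec (v $ 2) = w $ 1 *\<^sub>R unit_vec (w $ 2)" by (simp add: g_def)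
    from arg_cong[OF this, of norm] have 1: "v $ 1 = w $ 1" using vw by (simp add: S)
    with eq have u: "unit_vec (v $ 2) = unit_vec (w $ 2)" using vw by (simp add: S)
    have "cos (v $ 2) = cos (w $ 2)" "sin (v $ 2) = sin (w $ 2)"
      using arg_cong[OF u, of "\<lambda>x. x $ 1"] arg_cong[OF u, of "\<lambda>x. x $ 2"] by (simp_all add: unit_vec_nth)
    then obtain n :: int where n: "v $ 2 = w $ 2 + 2 * pi * n" using sin_cos_eq_iff by metis
    hence n': "2 * pi * n = v $ 2 - w $ 2" by simp
    have "\<bar>2 * pi * n\<bar> < 2 * pi" unfolding n' using vw(1,2) by (simp add: S abs_less_iff)
    hence "\<bar>real_of_int n\<bar> < 1" by (simp add: abs_mult)
    hence "n = 0" by linarith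
    thus "v = w" using 1 n by (simp add: vec_eq_iff forall_2)
  qed
  \<comment> \<open>The open interval of angles misses the ray at angle 0. This ray lies in the line
    \<open>z $ 2 = y $ 2\<close>, a null set.\<close>
  have img: "z \<in> g ` S" if "h z \<noteq> 0" "z $ 2 \<noteq> y $ 2" for z
  proof -
    define r where "r = norm (z - y)"
    have "z \<in> square a" using that(1) f_out unfolding h_def by fastforce
    hence r: "r < R" unfolding r_def R_def
      using norm_le_in_square[of z a y] y a by (auto simp: on_boundary_def)
    have r0: "r > 0" using that(2) by (auto simp: r_def)
    have r2: "r\<^sup>2 = (z $ 1 - y $ 1)\<^sup>2 + (z $ 2 - y $ 2)\<^sup>2"
      by (simp add: r_def norm_vec_def L2_set_def sum_2)
    have "((z $ 1 - y $ 1) / r)\<^sup>2 + ((z $ 2 - y $ 2) / r)\<^sup>2 = 1"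
      unfolding power_divide add_divide_distrib[symmetric] r2[symmetric] using r0 by simp
    then obtain t where t: "0 \<le> t" "t < 2 * pi" "(z $ 1 - y $ 1) / r = cos t" "(z $ 2 - y $ 2) / r = sin t"
      by (rule sincos_total_2pi)
    have "t \<noteq> 0" using t(4) that(2) r0 by auto
    hence "vector [r, t] \<in> S" using t r r0 by (simp add: S)
    moreover have "z = g (vector [r, t])"
      using t(3,4) r0 by (simp add: g_def vec_eq_iff forall_2 unit_vec_nth field_simps)
    ultimately show ?thesis by blast
  qed
  \<comment> \<open>Values in \<open>real^1\<close> fit the vector-valued change of variables;
    \<open>vec\<close> and \<open>$ 1\<close> translate between the two forms.\<close>
  let ?F = "\<lambda>z. vec (h z) :: real^1"
  let ?D = "\<lambda>v. \<bar>v $ 1\<bar> * h (g v)"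
  have cD: "continuous_on T ?D" for T by (intro continuous_intros ch cg)
  have Dint: "integrable lborel (\<lambda>v. indicator S v *\<^sub>R ?D v)"
  proof -
    have "set_integrable lborel (cbox (vector [0, 0]) (vector [R, 2 * pi])) ?D"
      unfolding set_integrable_def by (rule borel_integrable_compact) (auto intro: cD)
    hence "set_integrable lborel S ?D"
      by (rule set_integrable_subset) (auto simp: S_def box_subset_cbox)
    thus ?thesis by (simp add: set_integrable_def)
  qed
  have absD: "?D absolutely_integrable_on S"
    using Dint borel_measurable_integrable[OF Dint] unfolding set_integrable_def
    by (subst integrable_completion) auto
  have "(\<lambda>v. \<bar>det (matrix (g' v))\<bar> *\<^sub>R ?F (g v)) = (\<lambda>v. vec (?D v))"
    by (simp add: det fun_eq_iff vec_eq_iff)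
  hence absF: "(\<lambda>v. \<bar>det (matrix (g' v))\<bar> *\<^sub>R ?F (g v)) absolutely_integrable_on S"
    using absD by (simp add: absolutely_integrable_on_1_iff)
  have "integral (g ` S) ?F = integral S (\<lambda>v. \<bar>det (matrix (g' v))\<bar> *\<^sub>R ?F (g v))"
    by (rule integral_change_of_variables) (use dg inj absF in \<open>auto simp: S_def\<close>)
  hence "integral (g ` S) ?F $ 1 = integral S (\<lambda>v. \<bar>det (matrix (g' v))\<bar> *\<^sub>R ?F (g v)) $ 1" by simp
  hence e1: "integral (g ` S) h = integral S ?D"
    by (simp add: integral_on_1_eq det)
  have "integral (g ` S) h = integral UNIV h"
  proof (rule integral_spike_set)
    have "{x \<in> UNIV - g ` S. h x \<noteq> 0} \<subseteq> {x. x $ 2 = y $ 2}" using img by auto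
    moreover have "negligible {x::real^2. x $ 2 = y $ 2}"
      using negligible_standard_hyperplane[of "axis 2 1 :: real^2" "y $ 2"] by (simp add: inner_axis)
    ultimately show "negligible {x \<in> UNIV - g ` S. h x \<noteq> 0}" by (rule negligible_subset[rotated])
    have "{x \<in> g ` S - UNIV. h x \<noteq> 0} = {}" by blast
    thus "negligible {x \<in> g ` S - UNIV. h x \<noteq> 0}" by (simp only: negligible_empty)
  qed
  hence e2: "integral S ?D = (LINT z|lborel. h z)"
    using e1 integral_lborel[OF int_h] by simp
  have "integral S ?D = (LINT v:S|lborel. ?D v)"
    using Dint by (subst set_borel_integral_eq_integral) (auto simp: set_integrable_def)
  also have "\<dots> = (LINT v|lborel. indicator S v *\<^sub>R ?D v)" by (simp add: set_lebesgue_integral_def)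
  also have "\<dots> = (LINT z|lborel. indicator S (line_point 1 (fst z) (snd z)) *\<^sub>R ?D (line_point 1 (fst z) (snd z)))"
    by (subst lborel_line_point[of 1], subst integral_distr) (use borel_measurable_integrable[OF Dint] in auto)
  also have "\<dots> = (LINT z|(lborel \<Otimes>\<^sub>M lborel). indicator {0<..<R} (fst z) * fst z *
        (indicator {0<..<2*pi} (snd z) * h (y + fst z *\<^sub>R unit_vec (snd z))))"
    unfolding lborel_prod
    by (intro Bochner_Integration.integral_cong refl)
       (auto simp: S g_def indicator_def line_point_def)
  also have "\<dots> = (LINT r|lborel. LINT t|lborel. indicator {0<..<R} r * r *
        (indicator {0<..<2*pi} t * h (y + r *\<^sub>R unit_vec t)))"
  proof (subst lborel_pair.integral_fst'[symmetric])
    have "integrable lborel (\<lambda>z. indicator S (line_point 1 (fst z) (snd z)) *\<^sub>R ?D (line_point 1 (fst z) (snd z)))"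
      using Dint borel_measurable_integrable[OF Dint]
      by (subst (asm) lborel_line_point[of 1], subst (asm) integrable_distr_eq) auto
    also have "(\<lambda>z. indicator S (line_point 1 (fst z) (snd z)) *\<^sub>R ?D (line_point 1 (fst z) (snd z))) =
      (\<lambda>z. indicator {0<..<R} (fst z) * fst z * (indicator {0<..<2*pi} (snd z) * h (y + fst z *\<^sub>R unit_vec (snd z))))"
      by (auto simp: S g_def indicator_def line_point_def fun_eq_iff)
    finally show "integrable (lborel \<Otimes>\<^sub>M lborel) (\<lambda>z. indicator {0<..<R} (fst z) * fst z *
        (indicator {0<..<2*pi} (snd z) * h (y + fst z *\<^sub>R unit_vec (snd z))))"
      by (simp add: lborel_prod)
  qed simp
  also have "\<dots> = (LINT r|lborel. indicator {0<..<R} r * (r * \<psi> r * (2 * pi * circ_mean f y r)))"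
  proof (intro Bochner_Integration.integral_cong refl)
    fix r :: real
    show "(LINT t|lborel. indicator {0<..<R} r * r * (indicator {0<..<2*pi} t * h (y + r *\<^sub>R unit_vec t)))
       = indicator {0<..<R} r * (r * \<psi> r * (2 * pi * circ_mean f y r))"
    proof (cases "r \<in> {0<..<R}")
      case True
      have h: "h (y + r *\<^sub>R unit_vec t) = \<psi> r * f (y + r *\<^sub>R unit_vec t)" for t
        using True by (simp add: h_def)
      have "(LINT t|lborel. indicator {0<..<2*pi} t * f (y + r *\<^sub>R unit_vec t)) =
         (LINT t|lborel. indicator {0..2*pi} t *\<^sub>R f (y + r *\<^sub>R unit_vec t))"
      proof (rule integral_cong_AE)
        have "(\<lambda>t. f (y + r *\<^sub>R unit_vec t)) \<in> borel_measurable borel"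
          by (intro borel_measurable_continuous_onI continuous_intros)
        thus "(\<lambda>t. indicator {0<..<2*pi} t * f (y + r *\<^sub>R unit_vec t)) \<in> borel_measurable lborel"
          "(\<lambda>t. indicator {0..2*pi} t *\<^sub>R f (y + r *\<^sub>R unit_vec t)) \<in> borel_measurable lborel" by auto
        show "AE t in lborel. indicator {0<..<2*pi} t * f (y + r *\<^sub>R unit_vec t) = indicator {0..2*pi} t *\<^sub>R f (y + r *\<^sub>R unit_vec t)"
          using AE_lborel_singleton[of 0] AE_lborel_singleton[of "2*pi"]
          by eventually_elim (auto simp: indicator_def)
      qed
      also have "\<dots> = 2 * pi * circ_mean f y r"
        by (simp add: circ_mean_alt set_lebesgue_integral_def)
      finally have "(LINT t|lborel. indicator {0<..<2*pi} t * f (y + r *\<^sub>R unit_vec t)) = 2 * pi * circ_mean f y r" .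
      moreover have "(LINT t|lborel. indicator {0<..<R} r * r * (indicator {0<..<2*pi} t * h (y + r *\<^sub>R unit_vec t)))
        = (LINT t|lborel. (r * \<psi> r) * (indicator {0<..<2*pi} t * f (y + r *\<^sub>R unit_vec t)))"
        using True by (intro Bochner_Integration.integral_cong refl) (simp add: h)
      ultimately show ?thesis using True by simp
    qed simp
  qed
  finally show ?thesis unfolding e2 h_def[symmetric] by (simp add: set_lebesgue_integral_def R_def)
qed

end

section \<open>Side integrals as planar integrals\<close>

lemma pv_measurable_param [measurable]:
  assumes [measurable]: "case_prod \<Phi> \<in> borel_measurable (M \<Otimes>\<^sub>M borel)" "s \<in> borel_measurable M"
  shows "(\<lambda>x. pv (\<Phi> x) (s x)) \<in> borel_measurable M"
    and "(\<lambda>x. pv_reg e (\<Phi> x) (s x)) \<in> borel_measurable M"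
proof -
  have [measurable]: "(\<lambda>x. \<Phi> x (s x)) \<in> borel_measurable M"
    using measurable_compose[OF _ assms(1), of "\<lambda>x. (x, s x)" M] by simp
  have [measurable]: "(\<lambda>z. \<Phi> (fst z) (snd z)) \<in> borel_measurable (M \<Otimes>\<^sub>M borel)"
    using assms(1) by (simp add: case_prod_beta')
  show "(\<lambda>x. pv (\<Phi> x) (s x)) \<in> borel_measurable M"
    unfolding pv_def pv_sub_def
    by (rule lborel.borel_measurable_lebesgue_integral) (simp add: case_prod_beta')
  show "(\<lambda>x. pv_reg e (\<Phi> x) (s x)) \<in> borel_measurable M"
    unfolding pv_reg_def set_lebesgue_integral_def
    by (rule lborel.borel_measurable_lebesgue_integral) (simp add: case_prod_beta')
qed

text \<open>The squared distance of \<open>z\<close> to the corner \<open>(c, d)\<close> minus that of the image \<open>(c + W, X)\<close> of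
  the reconstruction point to this corner.\<close>

definition corner_val :: "real \<Rightarrow> real \<Rightarrow> real \<Rightarrow> real \<Rightarrow> real \<times> real \<Rightarrow> real" where
  "corner_val c W d X z = (fst z - c)\<^sup>2 - W\<^sup>2 + ((snd z - d)\<^sup>2 - (X - d)\<^sup>2)"

lemma AE_coord_neq:
  "AE z in (lborel :: (real \<times> real) measure). fst z \<noteq> X"
  "AE z in (lborel :: (real \<times> real) measure). snd z \<noteq> X"
proof -
  have *: "AE z in lborel. z \<bullet> b \<noteq> X" if "b \<in> Basis" for b :: "real \<times> real"
  proof -
    have "negligible {z. z \<bullet> b = X}" by (rule negligible_standard_hyperplane) fact
    hence "{z. z \<bullet> b = X} \<in> null_sets lebesgue" by (simp add: negligible_iff_null_sets)
    hence "AE z in lebesgue. z \<bullet> b \<noteq> X" by (rule AE_I') auto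
    thus ?thesis by (simp add: AE_completion_iff)
  qed
  show "AE z in (lborel :: (real \<times> real) measure). fst z \<noteq> X"
    using *[of "(1, 0)"] by (simp add: Basis_prod_def inner_prod_def)
  show "AE z in (lborel :: (real \<times> real) measure). snd z \<noteq> X"
    using *[of "(0, 1)"] by (simp add: Basis_prod_def inner_prod_def)
qed

context c11_square
begin

text \<open>The first argument is the coordinate normal to the sides with index \<open>i\<close> and
  the second runs along them, so one set of lemmas serves both pairs of sides.\<close>

definition planar :: "2 \<Rightarrow> real \<times> real \<Rightarrow> real" where
  "planar i z = f (line_point i (fst z) (snd z))"

lemma cont_planar [continuous_intros]:
  "continuous_on S g \<Longrightarrow> continuous_on S (\<lambda>x. planar i (g x))"
  unfolding planar_def by (intro continuous_intros)

lemma planar_measurable [measurable]: "planar i \<in> borel_measurable borel"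
  by (intro borel_measurable_continuous_onI continuous_intros)

lemma planar_out: "planar i z = 0" if "a \<le> \<bar>fst z\<bar> \<or> a \<le> \<bar>snd z\<bar>"
proof -
  have "line_point i (fst z) (snd z) \<notin> square a"
  proof
    assume "line_point i (fst z) (snd z) \<in> square a"
    hence "- a < line_point i (fst z) (snd z) $ j \<and> line_point i (fst z) (snd z) $ j < a" for j
      by (simp add: square_def)
    from this[of i] this[of "other i"] that show False by auto
  qed
  thus ?thesis by (simp add: planar_def f_out)
qed

definition bd :: "2 \<Rightarrow> real \<Rightarrow> real \<Rightarrow> real^2" where
  "bd i \<sigma> u = line_point i (\<sigma> * a) u"

lemma bd_boundary:
  assumes "\<sigma> \<in> {1, -1}" "\<bar>u\<bar> \<le> a"
  shows "on_boundary (bd i \<sigma> u)"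
  unfolding on_boundary_def
proof
  show "\<forall>j. \<bar>bd i \<sigma> u $ j\<bar> \<le> a"
    using assms a by (auto simp: bd_def line_point_def)
  have "bd i \<sigma> u $ i = \<sigma> * a" by (simp add: bd_def)
  thus "bd i \<sigma> u \<notin> square a"
    using assms(1) a by (auto simp: square_def intro!: exI[of _ i])
qed

lemma bd_measurable [measurable]: "bd i \<sigma> \<in> borel_measurable borel"
  unfolding bd_def by (intro borel_measurable_continuous_onI continuous_intros)

lemma profile_bd:
  assumes "\<sigma> \<in> {1, -1}" "\<bar>u\<bar> \<le> a"
  shows "radial_profile L (2 * sqrt 2 * a) (circ_mean f (bd i \<sigma> u)) (dmean (bd i \<sigma> u))"
  using mean_profile[OF bd_boundary[OF assms]] .

text \<open>\<open>pv_reg_parts\<close> produces \<open>r * circ_mean\<close>, which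
  \<open>polar_coordinates\<close> turns into a planar integral. The centre now enters only through
  a squared distance.\<close>

lemma pv_reg_planar:
  assumes y: "on_boundary y" and e: "e > 0"
  shows "pv_reg e (dmean y) s = - (1 / pi) * (LINT z|lborel. f z * hker' e ((norm (z - y))\<^sup>2 - s\<^sup>2))"
proof -
  interpret radial_profile L "2 * sqrt 2 * a" "circ_mean f y" "dmean y" by (rule mean_profile[OF y])
  let ?R = "2 * sqrt 2 * a"
  let ?k = "\<lambda>r. r * circ_mean f y r * hker' e (r\<^sup>2 - s\<^sup>2)"
  have c: "continuous_on UNIV ?k" using e cont_M by (intro continuous_intros)
  have "(LINT r:{0<..<?R}|lborel. r * hker' e (r\<^sup>2 - s\<^sup>2) * (2 * pi * circ_mean f y r)) = (LINT r|lborel. 2 * pi * (indicator {0..?R} r *\<^sub>R ?k r))"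
    unfolding set_lebesgue_integral_def
  proof (rule integral_cong_AE)
    show "AE r in lborel. indicator {0<..<?R} r *\<^sub>R (r * hker' e (r\<^sup>2 - s\<^sup>2) * (2 * pi * circ_mean f y r)) = 2 * pi * (indicator {0..?R} r *\<^sub>R ?k r)"
      using AE_lborel_singleton[of 0] AE_lborel_singleton[of ?R]
      by eventually_elim (auto simp: indicator_def)
  qed auto
  also have "\<dots> = 2 * pi * integral {0..?R} ?k"
    unfolding integral_mult_right_zero using continuous_on_subset[OF c]
    by (subst set_borel_integral_eq_integral(2)[symmetric])
       (auto intro!: borel_integrable_atLeastAtMost' simp: set_lebesgue_integral_def)
  finally have k: "(LINT r:{0<..<?R}|lborel. r * hker' e (r\<^sup>2 - s\<^sup>2) * (2 * pi * circ_mean f y r)) = 2 * pi * integral {0..?R} ?k" .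
  have "continuous_on UNIV (\<lambda>r. hker' e (r\<^sup>2 - s\<^sup>2))" using e by (intro continuous_intros)
  from polar_coordinates[OF y this]
  have "2 * pi * integral {0..?R} ?k = (LINT z|lborel. f z * hker' e ((norm (z - y))\<^sup>2 - s\<^sup>2))"
    unfolding k .
  hence "integral {0..?R} ?k = (LINT z|lborel. f z * hker' e ((norm (z - y))\<^sup>2 - s\<^sup>2)) / (2 * pi)"
    by (simp add: field_simps)
  thus ?thesis using pv_reg_parts[OF e, of s] by simp
qed

lemma integral_planar:
  assumes "continuous_on UNIV w"
  shows "(LINT z|lborel. f z * w z) = (LINT z|lborel. planar i z * w (line_point i (fst z) (snd z)))"
proof -
  have "(\<lambda>z. f z * w z) \<in> borel_measurable borel"
    by (intro borel_measurable_continuous_onI continuous_intros assms)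
  thus ?thesis unfolding planar_def by (subst lborel_line_point[of i], subst integral_distr) auto
qed

text \<open>Fubini for the centre \<open>u\<close> and the planar point \<open>z\<close>. The
  quotient has an apparent pole at \<open>snd z = X\<close>; its integrability is inherited from
  \<open>H\<close>, which is continuous on a compact box and zero outside it. \<open>W\<close> and
  \<open>X\<close> are free so that the lemma can be used for every image of the reconstruction
  point.\<close>

lemma side_reg:
  assumes \<sigma>: "\<sigma> \<in> {1, -1}" and e: "e > 0"
  shows "(LINT u:{-a..a}|lborel. pv_reg e (dmean (bd i \<sigma> u)) (sqrt (W\<^sup>2 + (X - u)\<^sup>2))) =
    1 / (2 * pi) * (LINT z|lborel. planar i z *
      ((hker e (corner_val (\<sigma> * a) W a X z) - hker e (corner_val (\<sigma> * a) W (-a) X z)) / (snd z - X)))"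
    and "integrable lborel (\<lambda>z. planar i z *
      ((hker e (corner_val (\<sigma> * a) W a X z) - hker e (corner_val (\<sigma> * a) W (-a) X z)) / (snd z - X)))"
proof -
  define q where "q u z = corner_val (\<sigma> * a) W u X z" for u z
  have q_cont: "continuous_on S (\<lambda>x. q (g x) (h x))" if "continuous_on S g" "continuous_on S h"
    for S :: "'b::t2_space set" and g h
    unfolding q_def corner_val_def using that by (intro continuous_intros)
  define H where "H = (\<lambda>(u, z). indicator {-a..a} u * (planar i z * hker' e (q u z)))"
  have H: "integrable (lborel \<Otimes>\<^sub>M lborel) H"
  proof -
    define K where "K = cbox (-a, (-a, -a)) (a, (a, a))"
    have "continuous_on K (\<lambda>p. planar i (snd p) * hker' e (q (fst p) (snd p)))"
      by (intro continuous_intros q_cont e)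
    hence "integrable lborel (\<lambda>p. indicator K p *\<^sub>R (planar i (snd p) * hker' e (q (fst p) (snd p))))"
      by (rule borel_integrable_compact[rotated]) (simp add: K_def)
    also have "(\<lambda>p. indicator K p *\<^sub>R (planar i (snd p) * hker' e (q (fst p) (snd p)))) = H"
    proof -
      have "- a \<le> fst z \<and> fst z \<le> a \<and> - a \<le> snd z \<and> snd z \<le> a" if "planar i z \<noteq> 0" for z
        using planar_out[of z i] that by linarith
      thus ?thesis by (fastforce simp: H_def K_def fun_eq_iff indicator_def cbox_Pair_eq)
    qed
    finally show ?thesis by (simp add: lborel_prod)
  qed
    have [measurable]: "H \<in> borel_measurable (borel \<Otimes>\<^sub>M borel)"
      using borel_measurable_integrable[OF H] by simp
    have [measurable]: "(\<lambda>(z, u). H (u, z)) \<in> borel_measurable (lborel \<Otimes>\<^sub>M lborel)" by measurable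
    have [measurable]: "q d \<in> borel_measurable borel" for d
      by (intro borel_measurable_continuous_onI q_cont continuous_intros)
    have [measurable]: "snd \<in> borel_measurable (borel :: (real \<times> real) measure)"
      by (intro borel_measurable_continuous_onI continuous_intros)
    have m1: "(\<lambda>z. LINT u|lborel. H (u, z)) \<in> borel_measurable lborel" by measurable
    have m2: "(\<lambda>z. - (1 / 2) * (planar i z * ((hker e (q a z) - hker e (q (-a) z)) / (snd z - X)))) \<in> borel_measurable lborel"
      by measurable
    have "AE z in (lborel :: (real \<times> real) measure). snd z \<noteq> X" by (rule AE_coord_neq)
    hence ae: "AE z in lborel. (LINT u|lborel. H (u, z)) = - (1 / 2) * (planar i z * ((hker e (q a z) - hker e (q (-a) z)) / (snd z - X)))"
    proof eventually_elim
      case (elim z)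
      define B where "B = snd z - X"
      have B: "B \<noteq> 0" using elim by (simp add: B_def)
      have "(LINT u|lborel. indicator {-a..a} u *\<^sub>R hker' e (q u z)) = hker e (q a z) / (-2 * B) - hker e (q (-a) z) / (-2 * B)"
      proof (rule integral_FTC_atLeastAtMost)
        fix u :: real
        have "((\<lambda>u. q u z) has_real_derivative - 2 * B) (at u within {-a..a})"
          unfolding q_def corner_val_def B_def by (auto intro!: derivative_eq_intros)
        from DERIV_cdivide[OF hker_deriv[OF e this], of "- 2 * B"]
        show "((\<lambda>u. hker e (q u z) / (-2 * B)) has_vector_derivative hker' e (q u z)) (at u within {-a..a})"
          using B by (simp add: has_real_derivative_iff_has_vector_derivative)
      qed (use a e in \<open>auto intro!: continuous_intros q_cont\<close>)
      also have "\<dots> = - (1 / 2) * ((hker e (q a z) - hker e (q (-a) z)) / B)" using B by (simp add: field_simps)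
      finally have "(LINT u|lborel. planar i z * (indicator {-a..a} u *\<^sub>R hker' e (q u z))) = planar i z * (- (1 / 2) * ((hker e (q a z) - hker e (q (-a) z)) / B))"
        by simp
      thus ?case by (simp add: H_def B_def mult_ac)
    qed
  have half: "integrable lborel (\<lambda>z. - (1 / 2) * (planar i z * ((hker e (q a z) - hker e (q (-a) z)) / (snd z - X))))"
    using lborel_pair.integrable_snd[of "\<lambda>u z. H (u, z)"] H integrable_cong_AE[OF m1 m2 ae] by simp
  have "integrable lborel (\<lambda>z. planar i z * ((hker e (q a z) - hker e (q (-a) z)) / (snd z - X)))"
  proof -
    have "integrable lborel g" if "integrable lborel (\<lambda>z. - (1 / 2) * g z)" for g :: "real \<times> real \<Rightarrow> real"
      using integrable_mult_right[of "- 2" lborel, OF that] by simp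
    from this[OF half] show ?thesis .
  qed
  thus "integrable lborel (\<lambda>z. planar i z *
      ((hker e (corner_val (\<sigma> * a) W a X z) - hker e (corner_val (\<sigma> * a) W (-a) X z)) / (snd z - X)))"
    by (simp only: q_def)
  have "(LINT u:{-a..a}|lborel. pv_reg e (dmean (bd i \<sigma> u)) (sqrt (W\<^sup>2 + (X - u)\<^sup>2)))
     = (LINT u|lborel. - (1 / pi) * (LINT z|lborel. H (u, z)))"
    unfolding set_lebesgue_integral_def
  proof (intro Bochner_Integration.integral_cong refl)
    fix u :: real
    show "indicator {-a..a} u *\<^sub>R pv_reg e (dmean (bd i \<sigma> u)) (sqrt (W\<^sup>2 + (X - u)\<^sup>2)) = - (1 / pi) * (LINT z|lborel. H (u, z))"
    proof (cases "u \<in> {-a..a}")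
      case True
      hence y: "on_boundary (bd i \<sigma> u)" using \<sigma> by (intro bd_boundary) auto
      have q: "(norm (line_point i (fst z) (snd z) - bd i \<sigma> u))\<^sup>2 - (sqrt (W\<^sup>2 + (X - u)\<^sup>2))\<^sup>2 = q u z" for z
      proof -
        have "line_point i (fst z) (snd z) - bd i \<sigma> u = line_point i (fst z - \<sigma> * a) (snd z - u)"
          by (simp add: bd_def line_point_def vec_eq_iff)
        thus ?thesis by (simp add: norm_line_point q_def corner_val_def add_nonneg_nonneg)
      qed
      show ?thesis using True
        unfolding pv_reg_planar[OF y e]
        by (subst integral_planar[of _ i]) (auto simp: q[simplified] H_def intro!: continuous_intros e)
    qed (simp add: H_def)
  qed
  also have "\<dots> = - (1 / pi) * (LINT u|lborel. LINT z|lborel. H (u, z))"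
    by (rule integral_mult_right_zero)
  also have "(LINT u|lborel. LINT z|lborel. H (u, z)) = (LINT z|lborel. LINT u|lborel. H (u, z))"
    using lborel_pair.Fubini_integral[of "\<lambda>u z. H (u, z)"] H by simp
  also have "\<dots> = (LINT z|lborel. - (1 / 2) * (planar i z * ((hker e (q a z) - hker e (q (-a) z)) / (snd z - X))))"
    by (rule integral_cong_AE[OF m1 m2 ae])
  also have "\<dots> = - (1 / 2) * (LINT z|lborel. planar i z * ((hker e (q a z) - hker e (q (-a) z)) / (snd z - X)))"
    by (rule integral_mult_right_zero)
  finally show "(LINT u:{-a..a}|lborel. pv_reg e (dmean (bd i \<sigma> u)) (sqrt (W\<^sup>2 + (X - u)\<^sup>2))) =
    1 / (2 * pi) * (LINT z|lborel. planar i z *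
      ((hker e (corner_val (\<sigma> * a) W a X z) - hker e (corner_val (\<sigma> * a) W (-a) X z)) / (snd z - X)))"
    by (simp add: q_def)
qed

lemma pv_dmean_bound:
  assumes \<sigma>: "\<sigma> \<in> {1, -1}" and u: "\<bar>u\<bar> \<le> a" and W: "W \<noteq> 0" and s: "\<bar>W\<bar> \<le> s"
  defines "R \<equiv> 2 * sqrt 2 * a"
  shows "\<bar>pv (dmean (bd i \<sigma> u)) s\<bar> \<le> L * (1 / \<bar>W\<bar> + R / W\<^sup>2) * (2 * R)"
    and "0 < e \<Longrightarrow> \<bar>pv_reg e (dmean (bd i \<sigma> u)) s - pv (dmean (bd i \<sigma> u)) s\<bar> \<le> L * (1 / \<bar>W\<bar> + R / W\<^sup>2) * (pi * e / \<bar>W\<bar>)"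
proof -
  interpret radial_profile L R "circ_mean f (bd i \<sigma> u)" "dmean (bd i \<sigma> u)"
    unfolding R_def by (rule profile_bd[OF \<sigma> u])
  have s0: "s > 0" using W s by auto
  have "L * (s + R) / s\<^sup>2 = L * (1 / s + R / s\<^sup>2)" using s0 by (simp add: field_simps power2_eq_square)
  also have "\<dots> \<le> L * (1 / \<bar>W\<bar> + R / \<bar>W\<bar>\<^sup>2)"
    using s W L R by (intro mult_left_mono add_mono divide_left_mono power_mono mult_pos_pos) auto
  finally have le: "L * (s + R) / s\<^sup>2 \<le> L * (1 / \<bar>W\<bar> + R / W\<^sup>2)" by simp
  show "\<bar>pv (dmean (bd i \<sigma> u)) s\<bar> \<le> L * (1 / \<bar>W\<bar> + R / W\<^sup>2) * (2 * R)"
    using R by (intro order_trans[OF pv_bound[OF lip_supp_M' s0]] mult_right_mono le) auto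
  assume e: "0 < e"
  show "\<bar>pv_reg e (dmean (bd i \<sigma> u)) s - pv (dmean (bd i \<sigma> u)) s\<bar> \<le> L * (1 / \<bar>W\<bar> + R / W\<^sup>2) * (pi * e / \<bar>W\<bar>)"
    using R L s0 W s e
    by (intro order_trans[OF pv_reg_rate[OF lip_supp_M' s0 e]] mult_mono le divide_left_mono) auto
qed

text \<open>Every point of the side is at distance at least the modulus of \<open>W\<close> from the
  image, so \<open>pv_dmean_bound\<close> is uniform in \<open>u\<close> and dominated convergence
  applies.\<close>

lemma side_limit:
  assumes \<sigma>: "\<sigma> \<in> {1, -1}" and W: "W \<noteq> 0" and e: "\<And>n. 0 < e n" "\<And>n. e n \<le> 1" and e0: "e \<longlonglongrightarrow> 0"
  shows "(\<lambda>n. 1 / (2 * pi) * (LINT z|lborel. planar i z *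
      ((hker (e n) (corner_val (\<sigma> * a) W a X z) - hker (e n) (corner_val (\<sigma> * a) W (-a) X z)) / (snd z - X))))
    \<longlonglongrightarrow> (LINT u:{-a..a}|lborel. pv (dmean (bd i \<sigma> u)) (sqrt (W\<^sup>2 + (X - u)\<^sup>2)))"
  unfolding side_reg(1)[OF \<sigma> e(1), symmetric] set_lebesgue_integral_def
proof (rule integral_dominated_convergence)
  define R where "R = 2 * sqrt 2 * a"
  define C where "C = L * (1 / \<bar>W\<bar> + R / W\<^sup>2)"
  have C: "C \<ge> 0" unfolding C_def R_def using L a by (intro mult_nonneg_nonneg add_nonneg_nonneg) auto
  have [measurable]: "(\<lambda>(u, r). dmean (bd i \<sigma> u) r) \<in> borel_measurable (borel \<Otimes>\<^sub>M borel)"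
    using measurable_compose[of "\<lambda>z. (bd i \<sigma> (fst z), snd z)" "borel \<Otimes>\<^sub>M borel" "borel \<Otimes>\<^sub>M borel", OF _ means_measurable(2)]
    by (simp add: case_prod_beta')
  show "(\<lambda>u. indicator {-a..a} u *\<^sub>R pv (dmean (bd i \<sigma> u)) (sqrt (W\<^sup>2 + (X - u)\<^sup>2))) \<in> borel_measurable lborel"
    "(\<lambda>u. indicator {-a..a} u *\<^sub>R pv_reg (e n) (dmean (bd i \<sigma> u)) (sqrt (W\<^sup>2 + (X - u)\<^sup>2))) \<in> borel_measurable lborel" for n
    by measurable
  have s: "\<bar>W\<bar> \<le> sqrt (W\<^sup>2 + (X - u)\<^sup>2)" for u by (rule real_le_rsqrt) simp
  show "integrable lborel (\<lambda>u. indicator {-a..a} u *\<^sub>R (C * (2 * R) + C * (pi * 1 / \<bar>W\<bar>)))"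
    by (rule borel_integrable_compact) auto
  show "AE u in lborel. norm (indicator {-a..a} u *\<^sub>R pv_reg (e n) (dmean (bd i \<sigma> u)) (sqrt (W\<^sup>2 + (X - u)\<^sup>2)))
      \<le> indicator {-a..a} u *\<^sub>R (C * (2 * R) + C * (pi * 1 / \<bar>W\<bar>))" for n
  proof (rule AE_I2)
    fix u
    show "norm (indicator {-a..a} u *\<^sub>R pv_reg (e n) (dmean (bd i \<sigma> u)) (sqrt (W\<^sup>2 + (X - u)\<^sup>2)))
      \<le> indicator {-a..a} u *\<^sub>R (C * (2 * R) + C * (pi * 1 / \<bar>W\<bar>))"
    proof (cases "u \<in> {-a..a}")
      case True
      hence u: "\<bar>u\<bar> \<le> a" by auto
      have "C * (pi * e n / \<bar>W\<bar>) \<le> C * (pi * 1 / \<bar>W\<bar>)"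
        using e(2)[of n] C by (intro mult_left_mono divide_right_mono) auto
      thus ?thesis using True pv_dmean_bound[OF \<sigma> u W s[of u], where i=i] e(1)[of n]
        unfolding C_def[symmetric] R_def[symmetric] by (fastforce simp: abs_le_iff)
    qed simp
  qed
  show "AE u in lborel. (\<lambda>n. indicator {-a..a} u *\<^sub>R pv_reg (e n) (dmean (bd i \<sigma> u)) (sqrt (W\<^sup>2 + (X - u)\<^sup>2)))
      \<longlonglongrightarrow> indicator {-a..a} u *\<^sub>R pv (dmean (bd i \<sigma> u)) (sqrt (W\<^sup>2 + (X - u)\<^sup>2))"
  proof (rule AE_I2)
    fix u
    show "(\<lambda>n. indicator {-a..a} u *\<^sub>R pv_reg (e n) (dmean (bd i \<sigma> u)) (sqrt (W\<^sup>2 + (X - u)\<^sup>2)))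
      \<longlonglongrightarrow> indicator {-a..a} u *\<^sub>R pv (dmean (bd i \<sigma> u)) (sqrt (W\<^sup>2 + (X - u)\<^sup>2))"
    proof (cases "u \<in> {-a..a}")
      case True
      hence u: "\<bar>u\<bar> \<le> a" by auto
      have "sqrt (W\<^sup>2 + (X - u)\<^sup>2) > 0" using s[of u] W by linarith
      thus ?thesis
        using radial_profile.lip_supp_M'[OF profile_bd[OF \<sigma> u]] e(1) e0
        by (intro tendsto_scaleR tendsto_const pv_reg_tendsto) auto
    qed simp
  qed
qed

end

section \<open>Lattices of images\<close>

abbreviation sgns :: "real set" where "sgns \<equiv> {1, -1}"

lemma sum_symmetric_Suc:
  fixes g :: "int \<Rightarrow> real"
  shows "sum g {- int (Suc N)..int (Suc N)} = g (- int (Suc N)) + sum g {- int N..int N} + g (int (Suc N))"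
proof -
  have "{- int (Suc N)..int (Suc N)} = insert (- int (Suc N)) (insert (int (Suc N)) {- int N..int N})" by auto
  thus ?thesis by simp
qed

lemma minus_one_powi: "(-1::real) powi n = (if even n then 1 else - 1)"
proof (cases "even n")
  case True
  then obtain m where "n = 2 * m" by blast
  thus ?thesis by (simp add: power_int_mult)
next
  case False
  then obtain m where "n = 2 * m + 1" by (elim oddE)
  thus ?thesis by (simp add: power_int_mult power_int_add)
qed

text \<open>Every even tile is grouped with its neighbour on the side of \<open>\<tau>\<close>. The
  range contains an odd number of odd tiles on each side of 0, so exactly one extreme tile, opposite
  to \<open>\<tau>\<close>, stays single.\<close>

lemma tile_pairing:
  fixes g :: "int \<Rightarrow> real"
  assumes "\<tau> = 1 \<or> \<tau> = - 1"
  shows "sum g {- int (2 * K + 1)..int (2 * K + 1)} =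
    g (- \<tau> * int (2 * K + 1)) + (\<Sum>m\<in>{- int K..int K}. g (2 * m) + g (2 * m + \<tau>))"
proof (induction K)
  case 0
  have "{-1..1::int} = {-1, 0, 1}" by auto
  thus ?case using assms by auto
next
  case (Suc K)
  have "sum g {- int (2 * Suc K + 1)..int (2 * Suc K + 1)} =
      g (- int (2 * K + 3)) + (g (- int (2 * K + 2)) + sum g {- int (2 * K + 1)..int (2 * K + 1)} + g (int (2 * K + 2))) + g (int (2 * K + 3))"
    using sum_symmetric_Suc[of g "2 * K + 2"] sum_symmetric_Suc[of g "2 * K + 1"]
    by (simp add: numeral_eq_Suc)
  also have "\<dots> = g (- \<tau> * int (2 * Suc K + 1)) + (\<Sum>m\<in>{- int (Suc K)..int (Suc K)}. g (2 * m) + g (2 * m + \<tau>))"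
    unfolding Suc.IH sum_symmetric_Suc using assms
    by (auto simp: algebra_simps)
  finally show ?case .
qed

lemma telescope_shift:
  fixes g :: "int \<Rightarrow> real"
  shows "(\<Sum>k\<in>{- int K..int K}. g (k + 1) - g k) = g (int K + 1) - g (- int K)"
proof (induction K)
  case (Suc K)
  have "- int (Suc K) + 1 = - int K" "int (Suc K) = int K + 1" by simp_all
  thus ?case unfolding sum_symmetric_Suc Suc.IH by (simp add: add.commute)
qed simp

definition lip_sq :: "real \<Rightarrow> real \<Rightarrow> (real \<Rightarrow> real) \<Rightarrow> bool" where
  "lip_sq a L \<phi> \<longleftrightarrow> 0 \<le> L \<and> (\<forall>z w. \<bar>\<phi> z - \<phi> w\<bar> \<le> L * \<bar>z - w\<bar>) \<and> (\<forall>z. a \<le> \<bar>z\<bar> \<longrightarrow> \<phi> z = 0)"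

lemma lip_sq_measurable: "lip_sq a L \<phi> \<Longrightarrow> \<phi> \<in> borel_measurable borel"
proof -
  assume "lip_sq a L \<phi>"
  hence "L-lipschitz_on UNIV \<phi>" by (auto simp: lip_sq_def lipschitz_on_def dist_real_def)
  thus ?thesis by (intro borel_measurable_continuous_onI lipschitz_on_continuous_on)
qed

locale lattice_images =
  fixes a x :: real and K :: nat
  assumes a: "a > 0" and x: "\<bar>x\<bar> < a"
begin

text \<open>\<open>Wk \<sigma> k\<close> is the signed distance of \<open>x\<close> to the line with index \<open>k\<close>, \<open>Xn n\<close> is \<open>x\<close> folded from the
  tile with index \<open>n\<close> into the square. The terms with \<open>Qe\<close> and \<open>Bt\<close> come from the two ends of the
  truncated lattice.\<close>

definition Wk :: "real \<Rightarrow> int \<Rightarrow> real" where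
  "Wk \<sigma> k = x - \<sigma> * a - 4 * of_int k * a"

definition Xn :: "int \<Rightarrow> real" where
  "Xn n = (-1) powi n * (x - 2 * of_int n * a)"

definition Bt :: "real \<Rightarrow> real \<Rightarrow> real" where
  "Bt \<tau> z = z + x + \<tau> * (4 * real K + 2) * a"

definition Pk :: "real \<Rightarrow> int \<Rightarrow> real \<Rightarrow> real" where
  "Pk \<sigma> k z = (z - \<sigma> * a)\<^sup>2 - (Wk \<sigma> k)\<^sup>2"

definition Qe :: "real \<Rightarrow> real \<Rightarrow> real" where
  "Qe \<tau> z = (z - \<tau> * a)\<^sup>2 - (x + \<tau> * (4 * real K + 3) * a)\<^sup>2"

definition bK :: "real \<Rightarrow> real" where
  "bK z = (\<Sum>\<tau>\<in>sgns. \<tau> / Bt \<tau> z)"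

text \<open>The factor that one coordinate contributes to the product terms. With
  \<open>1 / v\<close> in place of \<open>hker e v\<close> it becomes \<open>bK z / 2\<close>, by
  \<open>xi_sum\<close>.\<close>

definition Xi :: "real \<Rightarrow> real \<Rightarrow> real" where
  "Xi e z = (\<Sum>\<sigma>\<in>sgns. \<sigma> * (\<Sum>k\<in>{- int K..int K}. Wk \<sigma> k * hker e (Pk \<sigma> k z)))"

text \<open>Tiles \<open>2 * m\<close> and \<open>2 * m + \<tau>\<close> meet at the coordinate
  \<open>\<tau> * a + 4 * m * a\<close>. Their folded points are \<open>\<tau> * a + W\<close> and
  \<open>\<tau> * a - W\<close>, so \<open>H\<close> has the same argument in both and the
  denominators combine to \<open>2 * W / (q\<^sup>2 - W\<^sup>2)\<close>. The constant
  \<open>h0\<close> cancels between the two corners; it is available for producing the differences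
  of \<open>hker_corner_identity\<close>.\<close>

lemma tile_sum:
  assumes nz: "\<And>\<tau> m. \<tau> \<in> sgns \<Longrightarrow> Pk \<tau> m z \<noteq> 0"
  shows "(\<Sum>n\<in>{- int (2*K+1)..int (2*K+1)}. (-1) powi n *
      ((H ((z - a)\<^sup>2 - (Xn n - a)\<^sup>2) - H ((z - (-a))\<^sup>2 - (Xn n - (-a))\<^sup>2)) / (z - Xn n)))
   = (\<Sum>\<tau>\<in>sgns. \<tau> * (\<Sum>m\<in>{- int K..int K}. 2 * Wk \<tau> m * ((H (Pk \<tau> m z) - h0) / Pk \<tau> m z)))
     - (\<Sum>\<tau>\<in>sgns. \<tau> * ((H (Qe \<tau> z) - h0) / Bt \<tau> z))" (is "?L = ?R1 - ?R2")
proof -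
  define g where "g \<tau> n = (-1) powi n * ((H ((z - \<tau> * a)\<^sup>2 - (Xn n - \<tau> * a)\<^sup>2) - h0) / (z - Xn n))" for \<tau> n
  have pair: "sum (g (of_int \<tau>)) {- int (2*K+1)..int (2*K+1)} =
     - ((H (Qe (of_int \<tau>) z) - h0) / Bt (of_int \<tau>) z) +
     (\<Sum>m\<in>{- int K..int K}. 2 * Wk (of_int \<tau>) m * ((H (Pk (of_int \<tau>) m z) - h0) / Pk (of_int \<tau>) m z))"
    if \<tau>: "\<tau> = 1 \<or> \<tau> = - 1" for \<tau> :: int
  proof -
    let ?t = "of_int \<tau> :: real"
    have t2: "?t * ?t = 1" using \<tau> by auto
    have odd: "odd (2 * m + \<tau>)" "odd (- \<tau> * int (2 * K + 1))" for m using \<tau> by auto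
    have m1: "(-1::real) powi (2 * m + \<tau>) = -1" "(-1::real) powi (- \<tau> * int (2 * K + 1)) = -1" "(-1::real) powi (2 * m) = 1" for m
      using odd by (auto simp: minus_one_powi)
    have "g ?t (2 * m) + g ?t (2 * m + \<tau>) = 2 * Wk ?t m * ((H (Pk ?t m z) - h0) / Pk ?t m z)" for m
    proof -
      define q where "q = z - ?t * a"
      define W where "W = Wk ?t m"
      have X: "Xn (2 * m) = W + ?t * a" "Xn (2 * m + \<tau>) = - W + ?t * a"
        unfolding Xn_def m1 by (simp_all add: W_def Wk_def algebra_simps)
      have P: "Pk ?t m z = q\<^sup>2 - W\<^sup>2" by (simp add: Pk_def q_def W_def)
      have "Pk ?t m z \<noteq> 0" using nz \<tau> by auto
      hence n: "q - W \<noteq> 0" "q + W \<noteq> 0" "q\<^sup>2 - W\<^sup>2 \<noteq> 0" unfolding P by (auto simp: power2_eq_square square_eq_iff eq_neg_iff_add_eq_0)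
      have z: "z - (W + ?t * a) = q - W" "z - (- W + ?t * a) = q + W" by (simp_all add: q_def)
      have "g ?t (2 * m) + g ?t (2 * m + \<tau>) = (H (q\<^sup>2 - W\<^sup>2) - h0) * (1 / (q - W) - 1 / (q + W))"
        unfolding g_def m1 X z by (simp add: q_def[symmetric] right_diff_distrib minus_divide_left)
      also have "1 / (q - W) - 1 / (q + W) = 2 * W / (q\<^sup>2 - W\<^sup>2)"
      proof -
        have "1 / (q - W) - 1 / (q + W) = 2 * W / ((q - W) * (q + W))" using n by (simp add: field_simps)
        thus ?thesis by (simp add: power2_eq_square algebra_simps)
      qed
      finally show ?thesis unfolding P W_def by simp
    qed
    moreover have "g ?t (- \<tau> * int (2 * K + 1)) = - ((H (Qe ?t z) - h0) / Bt ?t z)"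
    proof -
      have X: "Xn (- \<tau> * int (2 * K + 1)) = - (x + ?t * (4 * real K + 2) * a)"
        unfolding Xn_def m1 by (simp add: algebra_simps)
      have z: "z - Xn (- \<tau> * int (2 * K + 1)) = Bt ?t z" unfolding X by (simp add: Bt_def)
      have "Xn (- \<tau> * int (2 * K + 1)) - ?t * a = - (x + ?t * (4 * real K + 3) * a)" unfolding X by (simp add: algebra_simps)
      hence "(Xn (- \<tau> * int (2 * K + 1)) - ?t * a)\<^sup>2 = (x + ?t * (4 * real K + 3) * a)\<^sup>2" by (simp only: power2_minus)
      thus ?thesis unfolding g_def z m1 Qe_def by (simp add: minus_divide_left)
    qed
    ultimately show ?thesis unfolding tile_pairing[OF \<tau>, of "g ?t" K] by (simp only:)
  qed
  have "?L = (\<Sum>n\<in>{- int (2*K+1)..int (2*K+1)}. g 1 n - g (-1) n)"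
    by (intro sum.cong refl) (simp add: g_def diff_divide_distrib[symmetric] right_diff_distrib[symmetric])
  also have "\<dots> = sum (g 1) {- int (2*K+1)..int (2*K+1)} - sum (g (-1)) {- int (2*K+1)..int (2*K+1)}"
    by (rule sum_subtractf)
  also have "\<dots> = ?R1 - ?R2" using pair[of 1] pair[of "-1"] by (simp add: minus_divide_left)
  finally show ?thesis .
qed

lemma abs_sgn_times: "\<sigma> \<in> sgns \<Longrightarrow> \<bar>\<sigma> * y\<bar> = \<bar>y\<bar>"
  by (auto simp: abs_mult)

lemma odd_abs_ge: "\<sigma> \<in> sgns \<Longrightarrow> 1 \<le> \<bar>\<sigma> + 2 * real_of_int k\<bar>"
proof -
  assume \<sigma>: "\<sigma> \<in> sgns"
  have "1 \<le> \<bar>1 + 2 * k\<bar>" "1 \<le> \<bar>- 1 + 2 * k\<bar>" by presburger+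
  hence "real_of_int 1 \<le> real_of_int \<bar>1 + 2 * k\<bar>" "real_of_int 1 \<le> real_of_int \<bar>- 1 + 2 * k\<bar>"
    by (simp_all only: of_int_le_iff)
  thus ?thesis using \<sigma> by auto
qed

lemma Wk_nz: "\<sigma> \<in> sgns \<Longrightarrow> Wk \<sigma> k \<noteq> 0"
proof
  assume \<sigma>: "\<sigma> \<in> sgns" and "Wk \<sigma> k = 0"
  hence "x = (\<sigma> + 4 * of_int k) * a" by (simp add: Wk_def algebra_simps)
  hence "\<bar>\<sigma> + 4 * of_int k\<bar> * a < 1 * a" using x a by (simp add: abs_mult)
  hence "\<bar>\<sigma> + 4 * of_int k\<bar> < 1" using a by simp
  thus False using odd_abs_ge[OF \<sigma>, of "2 * k"] by simp
qed

text \<open>Lines with a nonzero index stay \<open>2 * a\<close> away from \<open>x\<close>, which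
  in the flipped coordinate is at or beyond the end of the support.\<close>

lemma Wk_big: "\<sigma> \<in> sgns \<Longrightarrow> k \<noteq> 0 \<Longrightarrow> 2 * a \<le> \<bar>Wk \<sigma> k\<bar>"
proof -
  assume \<sigma>: "\<sigma> \<in> sgns" and k: "k \<noteq> 0"
  have "1 \<le> \<bar>k\<bar>" using k by simp
  hence "1 \<le> \<bar>real_of_int k\<bar>" by linarith
  hence "4 * a * 1 \<le> 4 * a * \<bar>real_of_int k\<bar>" using a by (intro mult_left_mono) auto
  hence "4 * a \<le> \<bar>4 * of_int k * a\<bar>" using a by (simp add: abs_mult mult_ac)
  moreover have "\<bar>x - \<sigma> * a\<bar> \<le> 2 * a" using x \<sigma> by auto
  ultimately show ?thesis unfolding Wk_def by linarith
qed

lemma sum_odd_nz: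
  assumes "\<sigma> \<in> sgns" "\<bar>z\<bar> < a"
  shows "z + x - 2 * \<sigma> * a - 4 * of_int k * a \<noteq> 0"
proof
  assume "z + x - 2 * \<sigma> * a - 4 * of_int k * a = 0"
  hence "z + x = (\<sigma> + 2 * of_int k) * (2 * a)" by (simp add: algebra_simps)
  hence "\<bar>\<sigma> + 2 * of_int k\<bar> * (2 * a) = \<bar>z + x\<bar>" using a by (simp add: abs_mult)
  also have "\<dots> < 1 * (2 * a)" using x assms(2) by linarith
  finally have "\<bar>\<sigma> + 2 * of_int k\<bar> < 1" using a by simp
  thus False using odd_abs_ge[OF assms(1), of k] by simp
qed

lemma diff_even_nz:
  assumes "\<bar>z\<bar> < a" "z \<noteq> x"
  shows "z - x + 4 * of_int k * a \<noteq> 0"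
proof (cases "k = 0")
  case False
  hence "1 \<le> \<bar>real_of_int k\<bar>" by linarith
  hence "4 * a * 1 \<le> 4 * a * \<bar>real_of_int k\<bar>" using a by (intro mult_left_mono) auto
  hence "4 * a \<le> \<bar>4 * of_int k * a\<bar>" using a by (simp add: abs_mult mult_ac)
  thus ?thesis using assms(1) x a by linarith
qed (use assms in simp)

text \<open>Displays the poles: the translates \<open>x - 4 * k * a\<close> and the mirror images
  \<open>2 * \<sigma> * a + 4 * k * a - x\<close>. Inside the square only \<open>z = x\<close>
  occurs, for \<open>k = 0\<close>.\<close>

lemma Pk_factor: "Pk \<sigma> k z = (z - x + 4 * of_int k * a) * (z + x - 2 * \<sigma> * a - 4 * of_int k * a)"
  unfolding Pk_def Wk_def power2_eq_square by (simp add: algebra_simps)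

lemma Pk_nz: "\<sigma> \<in> sgns \<Longrightarrow> \<bar>z\<bar> < a \<Longrightarrow> z \<noteq> x \<Longrightarrow> Pk \<sigma> k z \<noteq> 0"
  unfolding Pk_factor using sum_odd_nz diff_even_nz by simp

lemma Wk_quot:
  assumes "\<sigma> \<in> sgns" "\<bar>z\<bar> < a" "z \<noteq> x"
  shows "Wk \<sigma> k / Pk \<sigma> k z = (1 / (z - x + 4 * of_int k * a) - 1 / (z + x - 2 * \<sigma> * a - 4 * of_int k * a)) / 2"
proof -
  define A B where "A = z - x + 4 * of_int k * a" and "B = z + x - 2 * \<sigma> * a - 4 * of_int k * a"
  have nz: "A \<noteq> 0" "B \<noteq> 0" using sum_odd_nz[OF assms(1,2)] diff_even_nz[OF assms(2,3)] by (simp_all add: A_def B_def)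
  have W: "Wk \<sigma> k = (B - A) / 2" by (simp add: Wk_def A_def B_def)
  show ?thesis unfolding Pk_factor A_def[symmetric] B_def[symmetric] W using nz by (simp add: field_simps)
qed

text \<open>In the partial fractions of \<open>Wk_quot\<close> the translates of \<open>x\<close>
  are the same for both signs and cancel. The mirror terms of sign \<open>-1\<close> at
  \<open>k\<close> and of sign \<open>1\<close> at \<open>k\<close> are consecutive values of
  \<open>g\<close>, so they telescope to the two ends.\<close>

lemma xi_sum:
  assumes z: "\<bar>z\<bar> < a" "z \<noteq> x"
  shows "(\<Sum>\<sigma>\<in>sgns. \<sigma> * (\<Sum>k\<in>{- int K..int K}. Wk \<sigma> k / Pk \<sigma> k z)) = bK z / 2"
proof -
  let ?I = "{- int K..int K}"
  define g where "g k = 1 / (z + x + 2 * a - 4 * of_int k * a)" for k :: int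
  have "(\<Sum>\<sigma>\<in>sgns. \<sigma> * (\<Sum>k\<in>?I. Wk \<sigma> k / Pk \<sigma> k z)) =
    (\<Sum>k\<in>?I. Wk 1 k / Pk 1 k z) - (\<Sum>k\<in>?I. Wk (-1) k / Pk (-1) k z)" by simp
  also have "\<dots> = (\<Sum>k\<in>?I. - (g (k + 1) - g k) / 2)"
    unfolding sum_subtractf[symmetric]
    by (intro sum.cong refl) (simp add: Wk_quot z g_def diff_divide_distrib[symmetric] algebra_simps)
  also have "\<dots> = - (\<Sum>k\<in>?I. g (k + 1) - g k) / 2"
    by (simp add: sum_divide_distrib[symmetric] sum_negf[symmetric])
  also have "\<dots> = bK z / 2"
    unfolding telescope_shift by (simp add: g_def bK_def Bt_def algebra_simps)
  finally show ?thesis .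
qed

section \<open>Weak limit of the image sum in one coordinate\<close>

lemma flip_integral:
  fixes g :: "real \<Rightarrow> real"
  assumes "\<sigma> \<in> sgns"
  shows "(LINT z|lborel. g z) = (LINT r|lborel. g (\<sigma> * (a - r)))"
    and "integrable lborel (\<lambda>r. g (\<sigma> * (a - r))) \<longleftrightarrow> integrable lborel g"
proof -
  have e: "\<sigma> * (a - r) = \<sigma> * a + (- \<sigma>) * r" for r by (simp add: algebra_simps)
  have n: "- \<sigma> \<noteq> 0" "\<bar>- \<sigma>\<bar> = 1" using assms by auto
  show "(LINT z|lborel. g z) = (LINT r|lborel. g (\<sigma> * (a - r)))"
    using lborel_integral_real_affine[OF n(1), of g "\<sigma> * a"] n(2) by (simp add: e)
  show "integrable lborel (\<lambda>r. g (\<sigma> * (a - r))) \<longleftrightarrow> integrable lborel g"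
    using lborel_integrable_real_affine_iff[OF n(1), of g "\<sigma> * a"] by (simp add: e)
qed

text \<open>The substitution \<open>z = \<sigma> * (a - r)\<close> places the corner at
  \<open>r = 0\<close> and the support in \<open>[0, 2 * a]\<close>, where the results on principal
  values apply.\<close>

lemma flip_lip:
  assumes "lip_sq a L \<phi>" "\<sigma> \<in> sgns"
  shows "lip_supp L (2 * a) (\<lambda>r. \<phi> (\<sigma> * (a - r)))"
proof -
  have [measurable]: "\<phi> \<in> borel_measurable borel" using assms(1) by (rule lip_sq_measurable)
  have "\<bar>\<phi> (\<sigma> * (a - r)) - \<phi> (\<sigma> * (a - s))\<bar> \<le> L * \<bar>r - s\<bar>" for r s
  proof -
    have "\<bar>\<sigma> * (a - r) - \<sigma> * (a - s)\<bar> = \<bar>r - s\<bar>" using assms(2) by auto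
    thus ?thesis using assms(1) unfolding lip_sq_def by metis
  qed
  moreover have "\<phi> (\<sigma> * (a - r)) = 0" if "2 * a \<le> r" for r
    using assms that a by (auto simp: lip_sq_def abs_sgn_times)
  ultimately show ?thesis using assms(1) a by (auto simp: lip_supp_def lip_sq_def)
qed

lemma flip_neg: "lip_sq a L \<phi> \<Longrightarrow> \<sigma> \<in> sgns \<Longrightarrow> r < 0 \<Longrightarrow> \<phi> (\<sigma> * (a - r)) = 0"
  using a by (auto simp: lip_sq_def)

lemma Pk_flip: "\<sigma> \<in> sgns \<Longrightarrow> Pk \<sigma> k (\<sigma> * (a - r)) = r\<^sup>2 - \<bar>Wk \<sigma> k\<bar>\<^sup>2"
  by (auto simp: Pk_def power2_eq_square algebra_simps)

lemma int_hker:
  assumes "lip_sq a L \<phi>" "\<sigma> \<in> sgns" "e > 0"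
  shows "(LINT z|lborel. \<phi> z * hker e (Pk \<sigma> k z)) = pv_reg e (\<lambda>r. \<phi> (\<sigma> * (a - r))) \<bar>Wk \<sigma> k\<bar>"
    and "integrable lborel (\<lambda>z. \<phi> z * hker e (Pk \<sigma> k z))"
proof -
  have eq: "(\<lambda>r. \<phi> (\<sigma> * (a - r)) * hker e (Pk \<sigma> k (\<sigma> * (a - r)))) =
    (\<lambda>r. indicator {0..} r *\<^sub>R (\<phi> (\<sigma> * (a - r)) * hker e (r\<^sup>2 - \<bar>Wk \<sigma> k\<bar>\<^sup>2)))"
    using flip_neg[OF assms(1,2)] unfolding Pk_flip[OF assms(2)] by (auto simp: indicator_def fun_eq_iff)
  show "(LINT z|lborel. \<phi> z * hker e (Pk \<sigma> k z)) = pv_reg e (\<lambda>r. \<phi> (\<sigma> * (a - r))) \<bar>Wk \<sigma> k\<bar>"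
    unfolding pv_reg_def set_lebesgue_integral_def
    by (subst flip_integral(1)[OF assms(2)], subst eq) simp
  have "integrable lborel (\<lambda>r. \<phi> (\<sigma> * (a - r)) * hker e (Pk \<sigma> k (\<sigma> * (a - r))))"
    unfolding eq using lip_supp_hker_integrable[OF flip_lip[OF assms(1,2)] assms(3)]
    by (simp add: set_integrable_def)
  thus "integrable lborel (\<lambda>z. \<phi> z * hker e (Pk \<sigma> k z))"
    by (subst (asm) flip_integral(2)[OF assms(2)])
qed

text \<open>One cut around \<open>z = x\<close> serves every index. For \<open>k = 0\<close> it is
  the symmetric cut around the pole \<open>r = \<bar>Wk \<sigma> k\<bar>\<close>; for other
  \<open>k\<close> the function vanishes at and beyond the pole, and the integral converges
  absolutely. The integrands can therefore be added before the limit.\<close>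

lemma cut_limit:
  assumes lip: "lip_sq a L \<phi>" and \<sigma>: "\<sigma> \<in> sgns" and d: "\<And>n. d n > 0" "d \<longlonglongrightarrow> 0"
  shows "(\<lambda>n. LINT z|lborel. indicator {z. d n \<le> \<bar>z - x\<bar>} z * (\<phi> z / Pk \<sigma> k z))
      \<longlonglongrightarrow> pv (\<lambda>r. \<phi> (\<sigma> * (a - r))) \<bar>Wk \<sigma> k\<bar>" (is ?lim)
    and "integrable lborel (\<lambda>z. indicator {z. d n \<le> \<bar>z - x\<bar>} z * (\<phi> z / Pk \<sigma> k z))" (is ?int)
proof -
  define \<psi> where "\<psi> r = \<phi> (\<sigma> * (a - r))" for r
  define s where "s = \<bar>Wk \<sigma> k\<bar>"
  have s: "s > 0" using Wk_nz[OF \<sigma>] by (simp add: s_def)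
  have lip': "lip_supp L (2 * a) \<psi>" unfolding \<psi>_def by (rule flip_lip[OF lip \<sigma>])
  have neg: "\<psi> r = 0" if "r < 0" for r unfolding \<psi>_def using flip_neg[OF lip \<sigma> that] .
  have big: "\<psi> r = 0" if "2 * a \<le> r" for r using lip' that by (auto simp: lip_supp_def)
  have ind: "\<bar>\<sigma> * (a - r) - x\<bar> = \<bar>r - (a - \<sigma> * x)\<bar>" for r
    using \<sigma> by auto
  have [measurable]: "\<psi> \<in> borel_measurable borel" using lip' by (simp add: lip_supp_def)
  have "?lim \<and> (\<forall>n. integrable lborel (\<lambda>z. indicator {z. d n \<le> \<bar>z - x\<bar>} z * (\<phi> z / Pk \<sigma> k z)))"
  proof (cases "k = 0")
    case True
    have s': "s = a - \<sigma> * x" using True \<sigma> x a by (auto simp: s_def Wk_def abs_if)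
    have eq: "(\<lambda>r. indicator {z. d n \<le> \<bar>z - x\<bar>} (\<sigma> * (a - r)) * (\<phi> (\<sigma> * (a - r)) / Pk \<sigma> k (\<sigma> * (a - r)))) =
      (\<lambda>r. indicator ({0..2 * a} - {s - d n<..<s + d n}) r *\<^sub>R (\<psi> r / (r\<^sup>2 - s\<^sup>2)))" for n
    proof
      fix r
      consider "r < 0" | "r > 2 * a" | "0 \<le> r" "r \<le> 2 * a" by linarith
      thus "indicator {z. d n \<le> \<bar>z - x\<bar>} (\<sigma> * (a - r)) * (\<phi> (\<sigma> * (a - r)) / Pk \<sigma> k (\<sigma> * (a - r))) =
        indicator ({0..2 * a} - {s - d n<..<s + d n}) r *\<^sub>R (\<psi> r / (r\<^sup>2 - s\<^sup>2))"
      proof cases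
        case 3
        have "d n \<le> \<bar>\<sigma> * (a - r) - x\<bar> \<longleftrightarrow> r \<notin> {s - d n<..<s + d n}"
          unfolding ind s'[symmetric] by (auto simp: abs_if)
        thus ?thesis unfolding Pk_flip[OF \<sigma>] s_def[symmetric] using 3
          by (simp add: indicator_def \<psi>_def)
      qed (use neg big in \<open>auto simp: \<psi>_def[symmetric]\<close>)
    qed
    have "filterlim d (at_right 0) sequentially"
      using d by (auto simp: filterlim_at intro!: always_eventually less_imp_neq[symmetric])
    from filterlim_compose[OF pv_cut_tendsto[OF lip' s order.refl] this]
    have ?lim unfolding flip_integral(1)[OF \<sigma>, of "\<lambda>z. indicator {z. d _ \<le> \<bar>z - x\<bar>} z * (\<phi> z / Pk \<sigma> k z)"] eq
      by (simp add: set_lebesgue_integral_def \<psi>_def[symmetric] s_def[symmetric])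
    moreover have "integrable lborel (\<lambda>z. indicator {z. d n \<le> \<bar>z - x\<bar>} z * (\<phi> z / Pk \<sigma> k z))" for n
      using pv_cut_integrable[OF lip' s d(1)[of n], of "2 * a"] eq[of n]
      unfolding set_integrable_def by (subst flip_integral(2)[OF \<sigma>, symmetric]) simp
    ultimately show ?thesis by blast
  next
    case False
    have "\<psi> s = 0" using Wk_big[OF \<sigma> False] by (intro big) (simp add: s_def)
    hence eq: "(\<lambda>r. pv_sub \<psi> s r / (r\<^sup>2 - s\<^sup>2)) = (\<lambda>r. \<phi> (\<sigma> * (a - r)) / Pk \<sigma> k (\<sigma> * (a - r)))"
      using neg unfolding Pk_flip[OF \<sigma>] s_def[symmetric] \<psi>_def[symmetric] by (auto simp: pv_sub_def fun_eq_iff)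
    have int: "integrable lborel (\<lambda>z. \<phi> z / Pk \<sigma> k z)"
      using pv_integrable[OF lip' s] unfolding eq by (subst flip_integral(2)[OF \<sigma>, symmetric])
    have [measurable]: "(\<lambda>z. \<phi> z / Pk \<sigma> k z) \<in> borel_measurable borel" using int by simp
    have i: "integrable lborel (\<lambda>z. indicator {z. d n \<le> \<bar>z - x\<bar>} z * (\<phi> z / Pk \<sigma> k z))" for n
    proof (rule Bochner_Integration.integrable_bound[OF int])
      show "(\<lambda>z. indicator {z. d n \<le> \<bar>z - x\<bar>} z * (\<phi> z / Pk \<sigma> k z)) \<in> borel_measurable lborel" by measurable
    qed (auto simp: indicator_def)
    have "(\<lambda>n. LINT z|lborel. indicator {z. d n \<le> \<bar>z - x\<bar>} z * (\<phi> z / Pk \<sigma> k z)) \<longlonglongrightarrow> (LINT z|lborel. \<phi> z / Pk \<sigma> k z)"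
    proof (rule integral_dominated_convergence[where w="\<lambda>z. \<bar>\<phi> z / Pk \<sigma> k z\<bar>"])
      show "AE z in lborel. (\<lambda>n. indicator {z. d n \<le> \<bar>z - x\<bar>} z * (\<phi> z / Pk \<sigma> k z)) \<longlonglongrightarrow> \<phi> z / Pk \<sigma> k z"
        using AE_lborel_singleton[of x]
      proof eventually_elim
        case (elim z)
        have "\<forall>\<^sub>F n in sequentially. d n < \<bar>z - x\<bar>" using elim d(2) by (intro order_tendstoD) auto
        hence "\<forall>\<^sub>F n in sequentially. indicator {z. d n \<le> \<bar>z - x\<bar>} z * (\<phi> z / Pk \<sigma> k z) = \<phi> z / Pk \<sigma> k z"
          by eventually_elim auto
        thus ?case by (rule tendsto_eventually)
      qed
      show "integrable lborel (\<lambda>z. \<bar>\<phi> z / Pk \<sigma> k z\<bar>)" using int by (rule integrable_abs)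
      show "(\<lambda>z. indicator {z. d n \<le> \<bar>z - x\<bar>} z * (\<phi> z / Pk \<sigma> k z)) \<in> borel_measurable lborel" for n by measurable
    qed (auto simp: indicator_def)
    also have "(LINT z|lborel. \<phi> z / Pk \<sigma> k z) = pv \<psi> s"
      unfolding pv_def eq by (rule flip_integral(1)[OF \<sigma>])
    finally show ?thesis using i by (simp add: \<psi>_def[abs_def] s_def)
  qed
  thus ?lim ?int by blast+
qed

lemma Bt_big:
  assumes "\<tau> \<in> sgns" "\<bar>z\<bar> \<le> a" "1 \<le> K"
  shows "4 * real K * a \<le> \<bar>Bt \<tau> z\<bar>"
proof -
  have "\<bar>\<tau> * (4 * real K + 2) * a\<bar> = (4 * real K + 2) * a" using assms(1) a by (auto simp: abs_mult)
  hence "(4 * real K + 2) * a - 2 * a \<le> \<bar>Bt \<tau> z\<bar>" unfolding Bt_def using x assms(2) by linarith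
  thus ?thesis by (simp add: algebra_simps)
qed

lemma bK_bound:
  assumes "\<bar>z\<bar> \<le> a" "1 \<le> K"
  shows "\<bar>bK z\<bar> \<le> 1 / (2 * real K * a)"
proof -
  have p: "0 < 4 * real K * a" using a assms by simp
  have q: "1 / \<bar>Bt \<tau> z\<bar> \<le> 1 / (4 * real K * a)" if "\<tau> \<in> sgns" for \<tau>
    using Bt_big[OF that assms] p by (intro frac_le) linarith+
  have "\<bar>bK z\<bar> \<le> 1 / \<bar>Bt 1 z\<bar> + 1 / \<bar>Bt (-1) z\<bar>"
    unfolding bK_def using abs_triangle_ineq4[of "1 / Bt 1 z" "1 / Bt (-1) z"] by simp
  also have "\<dots> \<le> 1 / (4 * real K * a) + 1 / (4 * real K * a)" by (intro add_mono q) auto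
  also have "\<dots> = 1 / (2 * real K * a)" using p by (simp add: field_simps)
  finally show ?thesis .
qed

lemma bK_measurable [measurable]: "bK \<in> borel_measurable borel"
  unfolding bK_def Bt_def by measurable

lemma Xi_measurable [measurable]: "Xi e \<in> borel_measurable borel"
  unfolding Xi_def Pk_def by measurable

lemma lip_sq_bK_integrable:
  assumes lip: "lip_sq a L \<phi>" and K: "1 \<le> K"
  shows "integrable lborel (\<lambda>z. \<phi> z * (bK z / 2))"
proof (rule integrable_bounded_Icc[where l="-a" and u=a and C="(L * (2 * a)) * (1 / (2 * real K * a) / 2)"])
  have [measurable]: "\<phi> \<in> borel_measurable borel" using lip by (rule lip_sq_measurable)
  show "(\<lambda>z. \<phi> z * (bK z / 2)) \<in> borel_measurable borel" by measurable
  fix z assume z: "- a \<le> z" "z \<le> a"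
  have "\<bar>\<phi> z - \<phi> a\<bar> \<le> L * \<bar>z - a\<bar>" "\<phi> a = 0"
    using lip a abs_of_pos[OF a] unfolding lip_sq_def by (blast, simp)
  moreover have "L * \<bar>z - a\<bar> \<le> L * (2 * a)" using lip z by (intro mult_left_mono) (auto simp: lip_sq_def)
  ultimately have 1: "\<bar>\<phi> z\<bar> \<le> L * (2 * a)" by simp
  have "\<bar>bK z\<bar> \<le> 1 / (2 * real K * a)" by (rule bK_bound) (use K z in auto)
  hence 2: "\<bar>bK z / 2\<bar> \<le> 1 / (2 * real K * a) / 2" unfolding abs_divide abs_numeral
    by (rule divide_right_mono) simp
  show "\<bar>\<phi> z * (bK z / 2)\<bar> \<le> (L * (2 * a)) * (1 / (2 * real K * a) / 2)"
    unfolding abs_mult by (rule mult_mono[OF 1 2]) (use lip a in \<open>auto simp: lip_sq_def\<close>)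
qed (use lip in \<open>auto simp: lip_sq_def\<close>)

text \<open>Outside the cut the integrands add up pointwise by \<open>xi_sum\<close>, where the pole
  at \<open>x\<close> has cancelled. The cut can then be removed from an absolutely convergent
  integral.\<close>

lemma pv_sum:
  assumes lip: "lip_sq a L \<phi>" and K: "1 \<le> K"
  shows "(\<Sum>\<sigma>\<in>sgns. \<sigma> * (\<Sum>k\<in>{- int K..int K}. Wk \<sigma> k * pv (\<lambda>r. \<phi> (\<sigma> * (a - r))) \<bar>Wk \<sigma> k\<bar>))
    = (LINT z|lborel. \<phi> z * (bK z / 2))"
proof (rule LIMSEQ_unique)
  define d where "d n = 1 / real (Suc n)" for n
  have d: "\<And>n. d n > 0" "d \<longlonglongrightarrow> 0"
    unfolding d_def using LIMSEQ_inverse_real_of_nat by (simp_all add: inverse_eq_divide)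
  let ?A = "\<lambda>n \<sigma> k z. indicator {z. d n \<le> \<bar>z - x\<bar>} z * (\<phi> z / Pk \<sigma> k z)"
  let ?S = "\<lambda>n. \<Sum>\<sigma>\<in>sgns. \<sigma> * (\<Sum>k\<in>{- int K..int K}. Wk \<sigma> k * (LINT z|lborel. ?A n \<sigma> k z))"
  show "?S \<longlonglongrightarrow> (\<Sum>\<sigma>\<in>sgns. \<sigma> * (\<Sum>k\<in>{- int K..int K}. Wk \<sigma> k * pv (\<lambda>r. \<phi> (\<sigma> * (a - r))) \<bar>Wk \<sigma> k\<bar>))"
    by (intro tendsto_sum tendsto_mult tendsto_const cut_limit(1)[OF lip _ d])
  have [measurable]: "\<phi> \<in> borel_measurable borel" using lip by (rule lip_sq_measurable)
  have eq: "?S n = (LINT z|lborel. indicator {z. d n \<le> \<bar>z - x\<bar>} z * (\<phi> z * (bK z / 2)))" for n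
  proof -
    have "?S n = (LINT z|lborel. (\<Sum>\<sigma>\<in>sgns. \<sigma> * (\<Sum>k\<in>{- int K..int K}. Wk \<sigma> k * ?A n \<sigma> k z)))"
    proof -
      have inner: "(LINT z|lborel. (\<Sum>k\<in>{- int K..int K}. Wk \<sigma> k * ?A n \<sigma> k z)) =
          (\<Sum>k\<in>{- int K..int K}. Wk \<sigma> k * (LINT z|lborel. ?A n \<sigma> k z))" if \<sigma>: "\<sigma> \<in> sgns" for \<sigma>
        unfolding integral_mult_right_zero[symmetric]
        by (intro Bochner_Integration.integral_sum integrable_mult_right cut_limit(2)[OF lip \<sigma> d])
      have "(LINT z|lborel. (\<Sum>\<sigma>\<in>sgns. \<sigma> * (\<Sum>k\<in>{- int K..int K}. Wk \<sigma> k * ?A n \<sigma> k z))) =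
        (\<Sum>\<sigma>\<in>sgns. LINT z|lborel. \<sigma> * (\<Sum>k\<in>{- int K..int K}. Wk \<sigma> k * ?A n \<sigma> k z))"
        by (intro Bochner_Integration.integral_sum Bochner_Integration.integrable_sum
             integrable_mult_right cut_limit(2)[OF lip _ d])
      also have "\<dots> = ?S n"
        unfolding integral_mult_right_zero[of _ "_::real" "\<lambda>z. sum _ _"] using inner by (intro sum.cong refl) simp
      finally show ?thesis ..
    qed
    also have "\<dots> = (LINT z|lborel. indicator {z. d n \<le> \<bar>z - x\<bar>} z * (\<phi> z * (bK z / 2)))"
    proof (intro Bochner_Integration.integral_cong refl)
      fix z
      show "(\<Sum>\<sigma>\<in>sgns. \<sigma> * (\<Sum>k\<in>{- int K..int K}. Wk \<sigma> k * ?A n \<sigma> k z)) = indicator {z. d n \<le> \<bar>z - x\<bar>} z * (\<phi> z * (bK z / 2))"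
      proof (cases "d n \<le> \<bar>z - x\<bar> \<and> \<bar>z\<bar> < a")
        case True
        hence "z \<noteq> x" using d(1)[of n] by auto
        have "(\<Sum>\<sigma>\<in>sgns. \<sigma> * (\<Sum>k\<in>{- int K..int K}. Wk \<sigma> k * ?A n \<sigma> k z)) =
          \<phi> z * (\<Sum>\<sigma>\<in>sgns. \<sigma> * (\<Sum>k\<in>{- int K..int K}. Wk \<sigma> k / Pk \<sigma> k z))"
          unfolding sum_distrib_left using True by (intro sum.cong refl) simp
        thus ?thesis using xi_sum[of z] True \<open>z \<noteq> x\<close> by simp
      next
        case False
        hence "indicator {z. d n \<le> \<bar>z - x\<bar>} z = (0::real) \<or> \<phi> z = 0" using lip by (auto simp: lip_sq_def)
        thus ?thesis by auto
      qed
    qed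
    finally show ?thesis .
  qed
  have int: "integrable lborel (\<lambda>z. \<phi> z * (bK z / 2))" by (rule lip_sq_bK_integrable[OF lip K])
  show "?S \<longlonglongrightarrow> (LINT z|lborel. \<phi> z * (bK z / 2))"
    unfolding eq
  proof (rule integral_dominated_convergence[where w="\<lambda>z. \<bar>\<phi> z * (bK z / 2)\<bar>"])
    show "AE z in lborel. (\<lambda>n. indicator {z. d n \<le> \<bar>z - x\<bar>} z * (\<phi> z * (bK z / 2))) \<longlonglongrightarrow> \<phi> z * (bK z / 2)"
      using AE_lborel_singleton[of x]
    proof eventually_elim
      case (elim z)
      have "\<forall>\<^sub>F n in sequentially. d n < \<bar>z - x\<bar>" using elim d(2) by (intro order_tendstoD) auto
      hence "\<forall>\<^sub>F n in sequentially. indicator {z. d n \<le> \<bar>z - x\<bar>} z * (\<phi> z * (bK z / 2)) = \<phi> z * (bK z / 2)"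
        by eventually_elim auto
      thus ?case by (rule tendsto_eventually)
    qed
    show "integrable lborel (\<lambda>z. \<bar>\<phi> z * (bK z / 2)\<bar>)" using int by (rule integrable_abs)
    show "(\<lambda>z. indicator {z. d n \<le> \<bar>z - x\<bar>} z * (\<phi> z * (bK z / 2))) \<in> borel_measurable lborel" for n by measurable
  qed (auto simp: indicator_def)
qed

text \<open>The sum over all indices of the rates in \<open>pv_reg_rate\<close>, each weighted with
  the distance. It is independent of the tested function and of \<open>e\<close>, which allows a
  later use on a function whose Lipschitz constant itself contains \<open>e\<close>.\<close>

definition omega_const :: real where
  "omega_const = (\<Sum>\<sigma>\<in>sgns. \<Sum>k\<in>{- int K..int K}. (\<bar>Wk \<sigma> k\<bar> + 2 * a) / (Wk \<sigma> k)\<^sup>2 * pi)"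

text \<open>Tested against \<open>\<phi>\<close>, \<open>Xi e\<close> gives a combination of
  regularised principal values and \<open>bK / 2\<close> the same combination of true ones. The
  difference is a sum of regularisation errors.\<close>

lemma omega_bound:
  assumes lip: "lip_sq a L \<phi>" and K: "1 \<le> K" and e: "e > 0"
  shows "\<bar>LINT z|lborel. \<phi> z * (Xi e z - bK z / 2)\<bar> \<le> omega_const * L * e"
    and "integrable lborel (\<lambda>z. \<phi> z * (Xi e z - bK z / 2))"
proof -
  let ?I = "{- int K..int K}"
  let ?\<psi> = "\<lambda>\<sigma> r. \<phi> (\<sigma> * (a - r))"
  have X: "(\<lambda>z. \<phi> z * Xi e z) = (\<lambda>z. \<Sum>\<sigma>\<in>sgns. \<sigma> * (\<Sum>k\<in>?I. Wk \<sigma> k * (\<phi> z * hker e (Pk \<sigma> k z))))"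
    unfolding Xi_def sum_distrib_left by (intro ext sum.cong refl) (simp only: mult_ac)
  have i1: "integrable lborel (\<lambda>z. \<phi> z * Xi e z)"
    unfolding X by (intro Bochner_Integration.integrable_sum integrable_mult_right int_hker(2)[OF lip _ e])
  have "(LINT z|lborel. \<phi> z * Xi e z) = (\<Sum>\<sigma>\<in>sgns. LINT z|lborel. \<sigma> * (\<Sum>k\<in>?I. Wk \<sigma> k * (\<phi> z * hker e (Pk \<sigma> k z))))"
    unfolding X by (intro Bochner_Integration.integral_sum Bochner_Integration.integrable_sum integrable_mult_right int_hker(2)[OF lip _ e])
  also have "\<dots> = (\<Sum>\<sigma>\<in>sgns. \<sigma> * (\<Sum>k\<in>?I. Wk \<sigma> k * pv_reg e (?\<psi> \<sigma>) \<bar>Wk \<sigma> k\<bar>))"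
  proof (rule sum.cong[OF refl])
    fix \<sigma> :: real assume \<sigma>: "\<sigma> \<in> sgns"
    have "(LINT z|lborel. (\<Sum>k\<in>?I. Wk \<sigma> k * (\<phi> z * hker e (Pk \<sigma> k z)))) =
        (\<Sum>k\<in>?I. LINT z|lborel. Wk \<sigma> k * (\<phi> z * hker e (Pk \<sigma> k z)))"
      by (intro Bochner_Integration.integral_sum integrable_mult_right int_hker(2)[OF lip \<sigma> e])
    also have "\<dots> = (\<Sum>k\<in>?I. Wk \<sigma> k * pv_reg e (?\<psi> \<sigma>) \<bar>Wk \<sigma> k\<bar>)"
      unfolding integral_mult_right_zero int_hker(1)[OF lip \<sigma> e] ..
    finally show "(LINT z|lborel. \<sigma> * (\<Sum>k\<in>?I. Wk \<sigma> k * (\<phi> z * hker e (Pk \<sigma> k z)))) =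
        \<sigma> * (\<Sum>k\<in>?I. Wk \<sigma> k * pv_reg e (?\<psi> \<sigma>) \<bar>Wk \<sigma> k\<bar>)"
      unfolding integral_mult_right_zero by simp
  qed
  finally have eq1: "(LINT z|lborel. \<phi> z * Xi e z) = (\<Sum>\<sigma>\<in>sgns. \<sigma> * (\<Sum>k\<in>?I. Wk \<sigma> k * pv_reg e (?\<psi> \<sigma>) \<bar>Wk \<sigma> k\<bar>))" .
  have i2: "integrable lborel (\<lambda>z. \<phi> z * (bK z / 2))" by (rule lip_sq_bK_integrable[OF lip K])
  show "integrable lborel (\<lambda>z. \<phi> z * (Xi e z - bK z / 2))"
    unfolding right_diff_distrib using i1 i2 by (rule Bochner_Integration.integrable_diff)
  have eq2: "(LINT z|lborel. \<phi> z * (Xi e z - bK z / 2)) =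
     (\<Sum>\<sigma>\<in>sgns. \<Sum>k\<in>?I. \<sigma> * (Wk \<sigma> k * (pv_reg e (?\<psi> \<sigma>) \<bar>Wk \<sigma> k\<bar> - pv (?\<psi> \<sigma>) \<bar>Wk \<sigma> k\<bar>)))"
    unfolding right_diff_distrib Bochner_Integration.integral_diff[OF i1 i2] eq1 pv_sum[OF lip K, symmetric]
    by (simp add: sum_subtractf sum_distrib_left)
  have "\<bar>LINT z|lborel. \<phi> z * (Xi e z - bK z / 2)\<bar> \<le> (\<Sum>\<sigma>\<in>sgns. \<Sum>k\<in>?I. (\<bar>Wk \<sigma> k\<bar> + 2 * a) / (Wk \<sigma> k)\<^sup>2 * pi * (L * e))"
    unfolding eq2
  proof (intro order_trans[OF sum_abs] sum_mono)
    fix \<sigma> :: real and k assume \<sigma>: "\<sigma> \<in> sgns"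
    define s where "s = \<bar>Wk \<sigma> k\<bar>"
    have s: "s > 0" using Wk_nz[OF \<sigma>] by (simp add: s_def)
    have "\<bar>\<sigma> * (Wk \<sigma> k * (pv_reg e (?\<psi> \<sigma>) s - pv (?\<psi> \<sigma>) s))\<bar> = s * \<bar>pv_reg e (?\<psi> \<sigma>) s - pv (?\<psi> \<sigma>) s\<bar>"
      unfolding s_def by (simp only: abs_sgn_times[OF \<sigma>] abs_mult[of "Wk \<sigma> k"])
    also have "\<dots> \<le> s * (L * (s + 2 * a) / s\<^sup>2 * (pi * e / s))"
      using s pv_reg_rate[OF flip_lip[OF lip \<sigma>] s e] by (intro mult_left_mono) auto
    also have "\<dots> = (s + 2 * a) / s\<^sup>2 * pi * (L * e)" using s by simp
    finally show "\<bar>\<sigma> * (Wk \<sigma> k * (pv_reg e (?\<psi> \<sigma>) \<bar>Wk \<sigma> k\<bar> - pv (?\<psi> \<sigma>) \<bar>Wk \<sigma> k\<bar>))\<bar>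
      \<le> (\<bar>Wk \<sigma> k\<bar> + 2 * a) / (Wk \<sigma> k)\<^sup>2 * pi * (L * e)" by (simp add: s_def)
  qed
  also have "\<dots> = omega_const * L * e"
    by (simp only: omega_const_def mult.assoc sum_distrib_right)
  finally show "\<bar>LINT z|lborel. \<phi> z * (Xi e z - bK z / 2)\<bar> \<le> omega_const * L * e" .
qed

end

section \<open>Concentration of the kernel at the images belonging to a corner\<close>

lemma fst_snd_borel [measurable]:
  "fst \<in> borel_measurable (borel :: (real \<times> real) measure)"
  "snd \<in> borel_measurable (borel :: (real \<times> real) measure)"
  by (auto intro!: borel_measurable_continuous_onI continuous_intros)

lemma integrable_bounded_box:
  fixes g :: "real \<times> real \<Rightarrow> real"
  assumes [measurable]: "g \<in> borel_measurable borel"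
    and "\<And>z. \<lbrakk>\<bar>fst z\<bar> \<le> T; \<bar>snd z\<bar> \<le> T\<rbrakk> \<Longrightarrow> \<bar>g z\<bar> \<le> C" "\<And>z. T < \<bar>fst z\<bar> \<or> T < \<bar>snd z\<bar> \<Longrightarrow> g z = 0"
  shows "integrable lborel g"
proof (rule integrableI_bounded_set[where A="cbox (-T, -T) (T, T)" and B=C])
  show "AE z in lborel. z \<notin> cbox (-T, -T) (T, T) \<longrightarrow> g z = 0"
  proof (intro AE_I2 impI assms(3))
    fix z assume "z \<notin> cbox (-T, -T) (T, T)"
    thus "T < \<bar>fst z\<bar> \<or> T < \<bar>snd z\<bar>" by (cases z) (auto simp: cbox_Pair_eq)
  qed
  show "AE z in lborel. z \<in> cbox (-T, -T) (T, T) \<longrightarrow> norm (g z) \<le> C"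
    using assms(2) by (auto simp: cbox_Pair_eq intro!: AE_I2)
  show "emeasure lborel (cbox (-T, -T) (T, T)) < \<infinity>" using emeasure_lborel_cbox_finite by blast
qed auto

lemma theta_bound: "e > 0 \<Longrightarrow> \<bar>theta e p q\<bar> \<le> 4 / e\<^sup>2"
proof -
  assume e: "e > 0"
  have b: "\<bar>theta 1 x y\<bar> \<le> 4" for x y
  proof -
    have "\<bar>theta 1 x y\<bar> \<le> 2 / (1 + x\<^sup>2) * (1 / (1 + (y + 0)\<^sup>2) + 1 / (1 + (y + x)\<^sup>2))" by (rule abs_theta_le)
    also have "\<dots> \<le> 2 / 1 * (1 / 1 + 1 / 1)"
      by (intro mult_mono divide_left_mono add_mono) (auto simp: add_pos_nonneg)
    finally show ?thesis by simp
  qed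
  have "theta e p q = theta 1 (p / e) (q / e) / e\<^sup>2" using theta_scale[OF e, of "p / e" "q / e"] e by simp
  thus ?thesis using b[of "p / e" "q / e"] e by (simp add: divide_right_mono)
qed

text \<open>The squared distance to \<open>\<sigma> * a\<close> becomes the variable. Its density
  \<open>1 / (2 * sqrt s)\<close> is compensated by the vanishing of \<open>\<phi>\<close> at
  \<open>\<sigma> * a\<close>: the Lipschitz condition bounds the new function by
  \<open>C / 2\<close>.\<close>

lemma sqrt_substitution:
  assumes a: "a > 0" and lip: "lip_sq a C \<phi>" and \<sigma>: "\<sigma> \<in> sgns"
    and [measurable]: "k \<in> borel_measurable borel" and k: "\<And>s. \<bar>k s\<bar> \<le> B"
  shows "(LINT z|lborel. \<phi> z * k ((z - \<sigma> * a)\<^sup>2)) =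
    (LINT s|lborel. (if 0 < s then \<phi> (\<sigma> * (a - sqrt s)) / (2 * sqrt s) else 0) * k s)"
proof -
  interpret lattice_images a 0 0 by unfold_locales (use a in auto)
  define \<psi> where "\<psi> r = \<phi> (\<sigma> * (a - r))" for r
  have [measurable]: "\<phi> \<in> borel_measurable borel" using lip by (rule lip_sq_measurable)
  have C: "0 \<le> C" using lip by (simp add: lip_sq_def)
  have neg: "\<psi> r = 0" if "r \<le> 0" for r using \<sigma> a lip that by (auto simp: \<psi>_def lip_sq_def)
  have big: "\<psi> r = 0" if "2 * a \<le> r" for r using \<sigma> a lip that by (auto simp: \<psi>_def lip_sq_def)
  have \<psi>le: "\<bar>\<psi> r\<bar> \<le> C * r" if "0 \<le> r" for r
  proof -
    have "\<bar>\<psi> r - \<psi> 0\<bar> \<le> C * \<bar>\<sigma> * (a - r) - \<sigma> * (a - 0)\<bar>" using lip unfolding lip_sq_def \<psi>_def by blast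
    also have "\<bar>\<sigma> * (a - r) - \<sigma> * (a - 0)\<bar> = r" using \<sigma> that by auto
    finally show ?thesis using neg[of 0] by simp
  qed
  let ?f = "\<lambda>s. (if 0 < s then \<psi> (sqrt s) / (2 * sqrt s) else 0) * k s"
  have [measurable]: "\<psi> \<in> borel_measurable borel" unfolding \<psi>_def by measurable
  have fm: "?f \<in> borel_measurable borel" by measurable
  have fb: "\<bar>?f s\<bar> \<le> C / 2 * B" for s
  proof -
    have "\<bar>if 0 < s then \<psi> (sqrt s) / (2 * sqrt s) else 0\<bar> \<le> C / 2"
      using \<psi>le[of "sqrt s"] C by (auto simp: divide_le_eq mult_ac)
    thus ?thesis unfolding abs_mult using k C by (intro mult_mono) auto
  qed
  have f0: "?f s = 0" if "s \<notin> {0..(2 * a)\<^sup>2}" for s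
  proof (cases "s \<le> 0")
    case False
    hence "(2 * a)\<^sup>2 < s" using that by auto
    hence "2 * a \<le> sqrt s" using real_le_rsqrt[of "2 * a" s] by simp
    thus ?thesis using big by simp
  qed auto
  have "(LINT z|lborel. \<phi> z * k ((z - \<sigma> * a)\<^sup>2)) = (LINT r|lborel. \<psi> r * k ((\<sigma> * (a - r) - \<sigma> * a)\<^sup>2))"
    unfolding \<psi>_def by (rule flip_integral(1)[OF \<sigma>])
  also have "\<dots> = (LINT r|lborel. ?f (r\<^sup>2) * (2 * r) * indicator {0..2 * a} r)"
  proof (intro Bochner_Integration.integral_cong refl)
    fix r
    have e: "(\<sigma> * (a - r) - \<sigma> * a)\<^sup>2 = r\<^sup>2" using \<sigma> by auto
    consider "r \<le> 0" | "2 * a < r" | "0 < r" "r \<le> 2 * a" by linarith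
    thus "\<psi> r * k ((\<sigma> * (a - r) - \<sigma> * a)\<^sup>2) = ?f (r\<^sup>2) * (2 * r) * indicator {0..2 * a} r"
      unfolding e by cases (use neg big in \<open>auto simp: indicator_def\<close>)
  qed
  also have "\<dots> = (LINT s|lborel. ?f s * indicator {0\<^sup>2..(2 * a)\<^sup>2} s)"
  proof (rule integral_substitution(2)[symmetric])
    show "set_integrable lborel {0\<^sup>2..(2 * a)\<^sup>2} ?f" unfolding set_integrable_def
      by (rule integrable_bounded_Icc[where l=0 and u="(2*a)\<^sup>2" and C="C / 2 * B"])
         (use fm fb in \<open>auto simp: indicator_def\<close>)
  qed (use a in \<open>auto intro!: derivative_eq_intros continuous_intros\<close>)
  also have "\<dots> = (LINT s|lborel. ?f s)"
  proof (intro Bochner_Integration.integral_cong refl)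
    fix s show "?f s * indicator {0\<^sup>2..(2 * a)\<^sup>2} s = ?f s"
    proof (cases "s \<in> {0..(2 * a)\<^sup>2}")
      case False thus ?thesis unfolding f0[OF False] by simp
    qed simp
  qed
  finally show ?thesis by (simp only: \<psi>_def)
qed

context c11_square
begin

text \<open>A shift by \<open>2 * a\<close> along an axis leaves the square, where the Lipschitz map
  \<open>G\<close> is zero.\<close>

lemma G_bound: "norm (G z) \<le> 2 * a * L"
proof (cases "z \<in> square a")
  case True
  let ?w = "z + (2 * a) *\<^sub>R axis 1 1"
  have "- a < z $ 1" using True by (simp add: square_def)
  hence "?w $ 1 > a" by simp
  hence "?w \<notin> square a" by (auto simp: square_def intro!: exI[of _ 1])
  hence "norm (G z - 0) \<le> L * norm (z - ?w)" using lip_G[of z ?w] G_out by simp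
  also have "norm (z - ?w) = 2 * a" using a by simp
  finally show ?thesis by (simp add: mult_ac)
qed (use G_out L a in simp)

lemma planar_deriv:
  "((\<lambda>p. planar i (p, q)) has_real_derivative G (line_point i p q) (axis i 1)) (at p)"
  "((\<lambda>q. planar i (p, q)) has_real_derivative G (line_point i p q) (axis (other i) 1)) (at q)"
proof -
  have "((\<lambda>p. line_point i p q) has_derivative (\<lambda>h. h *\<^sub>R axis i 1)) (at p)"
    "((\<lambda>q. line_point i p q) has_derivative (\<lambda>h. h *\<^sub>R axis (other i) 1)) (at q)"
    unfolding line_point_alt by (auto intro!: derivative_eq_intros)
  from this[THEN has_derivative_compose, OF deriv_f]
  show "((\<lambda>p. planar i (p, q)) has_real_derivative G (line_point i p q) (axis i 1)) (at p)"
    "((\<lambda>q. planar i (p, q)) has_real_derivative G (line_point i p q) (axis (other i) 1)) (at q)"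
    by (simp_all add: planar_def has_field_derivative_def blinfun.scaleR_right mult_commute_abs)
qed

lemma abs_G_axis: "\<bar>blinfun_apply H (axis i 1)\<bar> \<le> norm (H :: (real^2) \<Rightarrow>\<^sub>L real)"
  using norm_blinfun[of H "axis i 1"] by simp

lemma planar_lip:
  "\<bar>planar i (p, q) - planar i (p', q)\<bar> \<le> 2 * a * L * \<bar>p - p'\<bar>"
  "\<bar>planar i (p, q) - planar i (p, q')\<bar> \<le> 2 * a * L * \<bar>q - q'\<bar>"
proof -
  have b: "norm (blinfun_apply (G z) (axis j 1)) \<le> 2 * a * L" for z j
    using order_trans[OF abs_G_axis G_bound] by simp
  show "\<bar>planar i (p, q) - planar i (p', q)\<bar> \<le> 2 * a * L * \<bar>p - p'\<bar>"
    using field_differentiable_bound[of UNIV "\<lambda>p. planar i (p, q)", OF _ planar_deriv(1) b] by simp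
  show "\<bar>planar i (p, q) - planar i (p, q')\<bar> \<le> 2 * a * L * \<bar>q - q'\<bar>"
    using field_differentiable_bound[of UNIV "\<lambda>q. planar i (p, q)", OF _ planar_deriv(2) b] by simp
qed

text \<open>Mean value inequality in \<open>p\<close> for the difference in \<open>q\<close>, whose
  derivative is controlled by the Lipschitz gradient. Differences in one coordinate are thereby
  Lipschitz in the other, with a constant proportional to the increment.\<close>

lemma planar_mixed:
  "\<bar>(planar i (p, q) - planar i (p', q)) - (planar i (p, q') - planar i (p', q'))\<bar> \<le> L * \<bar>p - p'\<bar> * \<bar>q - q'\<bar>"
proof -
  let ?D = "\<lambda>p. G (line_point i p q) (axis i 1) - G (line_point i p q') (axis i 1)"
  have "norm (?D p) \<le> L * \<bar>q - q'\<bar>" for p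
  proof -
    have d: "line_point i p q - line_point i p q' = (q - q') *\<^sub>R axis (other i) 1"
      by (simp add: line_point_alt scaleR_diff_left)
    have "\<bar>?D p\<bar> \<le> norm (G (line_point i p q) - G (line_point i p q'))"
      using abs_G_axis[of "G (line_point i p q) - G (line_point i p q')" i] by (simp add: blinfun.diff_left)
    also have "\<dots> \<le> L * \<bar>q - q'\<bar>" using lip_G[of "line_point i p q" "line_point i p q'"] by (simp add: d)
    finally show ?thesis by simp
  qed
  from field_differentiable_bound[of UNIV "\<lambda>p. planar i (p, q) - planar i (p, q')", OF _ DERIV_diff[OF planar_deriv(1) planar_deriv(1)] this, of p p']
  show ?thesis by (simp add: algebra_simps)
qed

lemma planar_lip_sq:
  "lip_sq a (2 * a * L) (\<lambda>p. planar i (p, q))" "lip_sq a (2 * a * L) (\<lambda>q. planar i (p, q))"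
  "lip_sq a (L * \<bar>p - p'\<bar>) (\<lambda>q. planar i (p, q) - planar i (p', q))"
  using planar_lip planar_mixed planar_out L a by (auto simp: lip_sq_def)

lemma planar_bound: "\<bar>planar i z\<bar> \<le> 2 * a * L * (2 * a)"
proof (cases "\<bar>fst z\<bar> < a")
  case True
  have "planar i (a, snd z) = 0" using a by (intro planar_out) auto
  hence "\<bar>planar i z\<bar> \<le> 2 * a * L * \<bar>fst z - a\<bar>" using planar_lip(1)[of i "fst z" "snd z" a] by simp
  also have "\<dots> \<le> 2 * a * L * (2 * a)" using True L a by (intro mult_left_mono) auto
  finally show ?thesis .
qed (use planar_out L a in auto)

lemma planar_times_integrable:
  assumes [measurable]: "w \<in> borel_measurable borel"
    and w: "\<And>z. \<lbrakk>\<bar>fst z\<bar> \<le> a; \<bar>snd z\<bar> \<le> a\<rbrakk> \<Longrightarrow> \<bar>w z\<bar> \<le> C"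
  shows "integrable lborel (\<lambda>z. planar i z * w z)"
proof (rule integrable_bounded_box[where T=a and C="2 * a * L * (2 * a) * C"])
  fix z :: "real \<times> real" assume "\<bar>fst z\<bar> \<le> a" "\<bar>snd z\<bar> \<le> a"
  thus "\<bar>planar i z * w z\<bar> \<le> 2 * a * L * (2 * a) * C"
    unfolding abs_mult using planar_bound w L a by (intro mult_mono) auto
qed (use planar_out in auto)

text \<open>In the squared distances to the two sides through the corner, \<open>theta\<close> is
  centred at \<open>(W\<^sup>2, W'\<^sup>2)\<close>. The Jacobian is singular on both sides, but
  \<open>planar\<close> vanishes on both, and the mixed difference bound makes the density
  \<open>g\<close> at most \<open>L / 4\<close>. The centre pulls back to the point in the
  limit.\<close>

lemma theta_corner_limit:
  assumes \<sigma>: "\<sigma> \<in> sgns" and \<tau>: "\<tau> \<in> sgns" and W: "W \<noteq> 0" "W' \<noteq> 0"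
    and e: "\<And>n. 0 < e n" and e0: "e \<longlonglongrightarrow> 0"
  shows "(\<lambda>n. LINT z|lborel. planar i z * theta (e n) ((fst z - \<sigma> * a)\<^sup>2 - W\<^sup>2) ((snd z - \<tau> * a)\<^sup>2 - W'\<^sup>2))
    \<longlonglongrightarrow> pi\<^sup>2 * (planar i (\<sigma> * (a - \<bar>W\<bar>), \<tau> * (a - \<bar>W'\<bar>)) / (4 * \<bar>W\<bar> * \<bar>W'\<bar>))"
proof -
  define G1 where "G1 s q = (if 0 < s then planar i (\<sigma> * (a - sqrt s), q) / (2 * sqrt s) else 0)" for s q
  define g where "g z = (if 0 < snd z then G1 (fst z) (\<tau> * (a - sqrt (snd z))) / (2 * sqrt (snd z)) else 0)" for z
  have [measurable]: "(\<lambda>z. planar i (\<sigma> * (a - sqrt (fst z)), snd z)) \<in> borel_measurable borel"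
    "(\<lambda>z. planar i (\<sigma> * (a - sqrt (fst z)), \<tau> * (a - sqrt (snd z)))) \<in> borel_measurable borel"
    by (auto intro!: borel_measurable_continuous_onI continuous_intros)
  have G1m [measurable]: "(\<lambda>z. G1 (fst z) (snd z)) \<in> borel_measurable borel" unfolding G1_def by measurable
  have gm [measurable]: "g \<in> borel_measurable borel" unfolding g_def G1_def by measurable
  have G1lip: "lip_sq a (L / 2) (G1 s)" for s
  proof (cases "0 < s")
    case True
    have "lip_sq a (L * \<bar>\<sigma> * (a - sqrt s) - \<sigma> * a\<bar>) (\<lambda>q. planar i (\<sigma> * (a - sqrt s), q) - planar i (\<sigma> * a, q))"
      by (rule planar_lip_sq(3))
    moreover have "planar i (\<sigma> * a, q) = 0" for q using \<sigma> a by (intro planar_out) auto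
    moreover have "\<bar>\<sigma> * (a - sqrt s) - \<sigma> * a\<bar> = sqrt s" using \<sigma> True by auto
    ultimately have "lip_sq a (L * sqrt s) (\<lambda>q. planar i (\<sigma> * (a - sqrt s), q))" by simp
    thus ?thesis using True L
      by (auto simp: lip_sq_def G1_def diff_divide_distrib[symmetric] abs_divide divide_le_eq mult_ac)
  qed (use L in \<open>simp add: G1_def lip_sq_def\<close>)
  have lip_bd: "\<bar>\<phi> q\<bar> \<le> C * (2 * a)" if "lip_sq a C \<phi>" for C \<phi> q
  proof (cases "\<bar>q\<bar> < a")
    case True
    have "\<bar>\<phi> q - \<phi> a\<bar> \<le> C * \<bar>q - a\<bar>" "\<phi> a = 0"
      using that abs_of_pos[OF a] unfolding lip_sq_def by (blast, simp)
    moreover have "C * \<bar>q - a\<bar> \<le> C * (2 * a)" using that True by (intro mult_left_mono) (auto simp: lip_sq_def)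
    ultimately show ?thesis by simp
  qed (use that a in \<open>auto simp: lip_sq_def\<close>)
  have far: "planar i (\<sigma> * (a - sqrt s), q) = 0" if "4 * a\<^sup>2 \<le> s" for s q
  proof (rule planar_out)
    have "2 * a \<le> sqrt s" using that by (intro real_le_rsqrt) (simp add: power_mult_distrib)
    thus "a \<le> \<bar>fst (\<sigma> * (a - sqrt s), q)\<bar> \<or> a \<le> \<bar>snd (\<sigma> * (a - sqrt s), q)\<bar>" using \<sigma> by auto
  qed
  have G1z: "G1 s q = 0" if "s \<le> 0 \<or> 4 * a\<^sup>2 \<le> s \<or> a \<le> \<bar>q\<bar>" for s q
    using that far planar_out[of _ i] by (auto simp: G1_def)
  have gz: "g z = 0" if "fst z \<le> 0 \<or> 4 * a\<^sup>2 \<le> fst z \<or> snd z \<le> 0 \<or> 4 * a\<^sup>2 \<le> snd z" for z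
  proof (cases "0 < snd z \<and> 4 * a\<^sup>2 \<le> snd z")
    case True
    hence "2 * a \<le> sqrt (snd z)" by (intro real_le_rsqrt) (simp add: power_mult_distrib)
    hence "a \<le> \<bar>\<tau> * (a - sqrt (snd z))\<bar>" using \<tau> by auto
    thus ?thesis using G1z by (simp add: g_def)
  next
    case False thus ?thesis using that G1z by (auto simp: g_def)
  qed
  have gb: "\<bar>g z\<bar> \<le> L / 4" for z
  proof (cases "0 < snd z")
    case True
    have "G1 (fst z) (\<tau> * a) = 0" using \<tau> a by (intro G1z) auto
    moreover have "\<bar>G1 (fst z) (\<tau> * (a - sqrt (snd z))) - G1 (fst z) (\<tau> * a)\<bar> \<le> L / 2 * \<bar>\<tau> * (a - sqrt (snd z)) - \<tau> * a\<bar>"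
      using G1lip unfolding lip_sq_def by blast
    moreover have "\<bar>\<tau> * (a - sqrt (snd z)) - \<tau> * a\<bar> = sqrt (snd z)" using \<tau> True by auto
    ultimately show ?thesis using True by (simp add: g_def divide_le_eq mult_ac)
  qed (use L in \<open>simp add: g_def\<close>)
  \<comment> \<open>One box for all integrands: \<open>a\<close> bounds the original coordinates and
    \<open>4 * a\<^sup>2\<close> the squared distances.\<close>
  have a4: "a \<le> a + 4 * a\<^sup>2" "4 * a\<^sup>2 \<le> a + 4 * a\<^sup>2" using a by auto
  have eq: "(LINT z|lborel. planar i z * theta e ((fst z - \<sigma> * a)\<^sup>2 - W\<^sup>2) ((snd z - \<tau> * a)\<^sup>2 - W'\<^sup>2)) =
     (LINT z|lborel. g z * theta e (fst z - W\<^sup>2) (snd z - W'\<^sup>2))" if e: "e > 0" for e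
  proof -
    let ?B = "4 / e\<^sup>2"
    have tm [measurable]: "(\<lambda>z. theta e (p z) (q z)) \<in> borel_measurable M"
      if [measurable]: "p \<in> borel_measurable M" "q \<in> borel_measurable M" for p q and M :: "'b measure"
      unfolding theta_def by measurable
    note tb = theta_bound[OF e]
    define P Q where "P p = (p - \<sigma> * a)\<^sup>2 - W\<^sup>2" and "Q q = (q - \<tau> * a)\<^sup>2 - W'\<^sup>2" for p q
    have i1: "integrable lborel (\<lambda>z. planar i z * theta e (P (fst z)) (Q (snd z)))"
      by (rule planar_times_integrable[where C="?B"]) (use tb in \<open>auto simp: P_def Q_def\<close>)
    have i2: "integrable lborel (\<lambda>z. G1 (fst z) (snd z) * theta e (fst z - W\<^sup>2) (Q (snd z)))"
    proof (rule integrable_bounded_box[where T="a + 4 * a\<^sup>2" and C="(L / 2 * (2 * a)) * ?B"])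
      show "(\<lambda>z. G1 (fst z) (snd z) * theta e (fst z - W\<^sup>2) (Q (snd z))) \<in> borel_measurable borel"
        unfolding Q_def by measurable
      show "\<bar>G1 (fst z) (snd z) * theta e (fst z - W\<^sup>2) (Q (snd z))\<bar> \<le> (L / 2 * (2 * a)) * ?B" for z
        unfolding abs_mult using lip_bd[OF G1lip] tb L a by (intro mult_mono) auto
      show "G1 (fst z) (snd z) * theta e (fst z - W\<^sup>2) (Q (snd z)) = 0"
        if "a + 4 * a\<^sup>2 < \<bar>fst z\<bar> \<or> a + 4 * a\<^sup>2 < \<bar>snd z\<bar>" for z
      proof -
        have "fst z \<le> 0 \<or> 4 * a\<^sup>2 \<le> fst z \<or> a \<le> \<bar>snd z\<bar>" using that a4 by linarith
        thus ?thesis using G1z by simp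
      qed
    qed
    have i3: "integrable lborel (\<lambda>z. g z * theta e (fst z - W\<^sup>2) (snd z - W'\<^sup>2))"
    proof (rule integrable_bounded_box[where T="a + 4 * a\<^sup>2" and C="L / 4 * ?B"])
      show "\<bar>g z * theta e (fst z - W\<^sup>2) (snd z - W'\<^sup>2)\<bar> \<le> L / 4 * ?B" for z
        unfolding abs_mult using gb tb L by (intro mult_mono) auto
      show "g z * theta e (fst z - W\<^sup>2) (snd z - W'\<^sup>2) = 0"
        if "a + 4 * a\<^sup>2 < \<bar>fst z\<bar> \<or> a + 4 * a\<^sup>2 < \<bar>snd z\<bar>" for z
      proof -
        have "fst z \<le> 0 \<or> 4 * a\<^sup>2 \<le> fst z \<or> snd z \<le> 0 \<or> 4 * a\<^sup>2 \<le> snd z" using that a4 by linarith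
        thus ?thesis using gz by simp
      qed
    qed measurable
    have "(LINT z|lborel. planar i z * theta e (P (fst z)) (Q (snd z))) =
       (LINT q|lborel. LINT p|lborel. planar i (p, q) * theta e (P p) (Q q))"
      using lborel_pair.integral_snd[of "\<lambda>p q. planar i (p, q) * theta e (P p) (Q q)"] i1
      by (simp add: lborel_prod case_prod_beta')
    also have "\<dots> = (LINT q|lborel. LINT s|lborel. G1 s q * theta e (s - W\<^sup>2) (Q q))"
      unfolding P_def G1_def
      by (intro Bochner_Integration.integral_cong refl
           sqrt_substitution[OF a planar_lip_sq(1) \<sigma>, where k="\<lambda>s. theta e (s - W\<^sup>2) (Q _)" and B="?B"] tb)
         measurable
    also have "\<dots> = (LINT s|lborel. LINT q|lborel. G1 s q * theta e (s - W\<^sup>2) (Q q))"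
      using lborel_pair.Fubini_integral[of "\<lambda>s q. G1 s q * theta e (s - W\<^sup>2) (Q q)"] i2
      by (simp add: lborel_prod case_prod_beta')
    also have "\<dots> = (LINT s|lborel. LINT t|lborel. g (s, t) * theta e (s - W\<^sup>2) (t - W'\<^sup>2))"
      unfolding Q_def g_def fst_conv snd_conv
      by (intro Bochner_Integration.integral_cong refl
           sqrt_substitution[OF a G1lip \<tau>, where k="\<lambda>t. theta e (_ - W\<^sup>2) (t - W'\<^sup>2)" and B="?B"] tb)
         measurable
    also have "\<dots> = (LINT z|lborel. g z * theta e (fst z - W\<^sup>2) (snd z - W'\<^sup>2))"
      using lborel_pair.integral_fst[of "\<lambda>s t. g (s, t) * theta e (s - W\<^sup>2) (t - W'\<^sup>2)"] i3
      by (simp add: lborel_prod case_prod_beta')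
    finally show ?thesis by (simp add: P_def Q_def)
  qed
  have "isCont g (W\<^sup>2, W'\<^sup>2)"
  proof -
    define U where "U = {z :: real \<times> real. 0 < fst z} \<inter> {z. 0 < snd z}"
    have U: "open U" unfolding U_def by (intro open_Int open_Collect_less continuous_intros)
    have "continuous_on U (\<lambda>z. planar i (\<sigma> * (a - sqrt (fst z)), \<tau> * (a - sqrt (snd z))) / (2 * sqrt (fst z)) / (2 * sqrt (snd z)))"
      by (intro continuous_intros) (auto simp: U_def)
    hence "continuous_on U g"
      by (rule continuous_on_eq) (auto simp: U_def g_def G1_def)
    moreover have "(W\<^sup>2, W'\<^sup>2) \<in> U" using W by (simp add: U_def)
    ultimately show ?thesis using continuous_on_eq_continuous_at[OF U] by blast
  qed
  from theta_approx_identity[OF gm gb this e e0]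
  have "(\<lambda>n. LINT z|lborel. g z * theta (e n) (fst z - W\<^sup>2) (snd z - W'\<^sup>2)) \<longlonglongrightarrow> pi\<^sup>2 * g (W\<^sup>2, W'\<^sup>2)" .
  moreover have "g (W\<^sup>2, W'\<^sup>2) = planar i (\<sigma> * (a - \<bar>W\<bar>), \<tau> * (a - \<bar>W'\<bar>)) / (4 * \<bar>W\<bar> * \<bar>W'\<bar>)"
    using W by (simp add: g_def G1_def)
  ultimately show ?thesis using eq[OF e] by simp
qed

end

section \<open>Summation over the images\<close>

text \<open>\<open>K\<close> truncates the lines to indices up to \<open>K\<close> and each line to
  tiles up to \<open>2 * K + 1\<close>. The pairing of tiles then produces indices up to
  \<open>K\<close> in the other coordinate, so the perpendicular pairs of sides run over the same
  double index set.\<close>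

locale two_images = c11_square +
  fixes x1 x2 :: real and K :: nat
  assumes x1: "\<bar>x1\<bar> < a" and x2: "\<bar>x2\<bar> < a" and K: "1 \<le> K"
begin

sublocale X: lattice_images a x1 K by unfold_locales (use a x1 in auto)
sublocale Y: lattice_images a x2 K by unfold_locales (use a x2 in auto)

end

context lattice_images
begin

definition idx :: "(real \<times> int) set" where "idx = sgns \<times> {- int K..int K}"

definition wt :: "real \<times> int \<Rightarrow> real" where "wt p = fst p * Wk (fst p) (snd p)"

definition Pp :: "real \<times> int \<Rightarrow> real \<Rightarrow> real" where "Pp p z = Pk (fst p) (snd p) z"

lemma sum_idx: "(\<Sum>\<sigma>\<in>sgns. \<sigma> * (\<Sum>k\<in>{- int K..int K}. Wk \<sigma> k * y \<sigma> k)) = (\<Sum>p\<in>idx. wt p * y (fst p) (snd p))"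
  unfolding idx_def wt_def
  by (simp add: sum.cartesian_product' sum_distrib_left mult.assoc del: sum.insert)

lemma Xi_idx: "Xi e z = (\<Sum>p\<in>idx. wt p * hker e (Pp p z))"
  unfolding Xi_def Pp_def by (rule sum_idx)

lemma tile_sum_idx:
  assumes nz: "\<And>\<tau> m. \<tau> \<in> sgns \<Longrightarrow> Pk \<tau> m z \<noteq> 0"
  shows "(\<Sum>n\<in>{- int (2*K+1)..int (2*K+1)}. (-1) powi n *
      ((H ((z - a)\<^sup>2 - (Xn n - a)\<^sup>2) - H ((z - (-a))\<^sup>2 - (Xn n - (-a))\<^sup>2)) / (z - Xn n)))
   = (\<Sum>q\<in>idx. wt q * (2 * ((H (Pp q z) - h0) / Pp q z)))
     - ((\<Sum>\<tau>\<in>sgns. \<tau> * (H (Qe \<tau> z) / Bt \<tau> z)) - h0 * bK z)"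
proof -
  have "(\<Sum>\<tau>\<in>sgns. \<tau> * (\<Sum>m\<in>{- int K..int K}. 2 * Wk \<tau> m * ((H (Pk \<tau> m z) - h0) / Pk \<tau> m z)))
     = (\<Sum>\<tau>\<in>sgns. \<tau> * (\<Sum>m\<in>{- int K..int K}. Wk \<tau> m * (2 * ((H (Pk \<tau> m z) - h0) / Pk \<tau> m z))))"
    by (simp only: mult.assoc mult.left_commute[of 2])
  also have "\<dots> = (\<Sum>q\<in>idx. wt q * (2 * ((H (Pp q z) - h0) / Pp q z)))"
    unfolding Pp_def by (rule sum_idx)
  finally have A: "(\<Sum>\<tau>\<in>sgns. \<tau> * (\<Sum>m\<in>{- int K..int K}. 2 * Wk \<tau> m * ((H (Pk \<tau> m z) - h0) / Pk \<tau> m z)))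
     = (\<Sum>q\<in>idx. wt q * (2 * ((H (Pp q z) - h0) / Pp q z)))" .
  have B: "(\<Sum>\<tau>\<in>sgns. \<tau> * ((H (Qe \<tau> z) - h0) / Bt \<tau> z)) = (\<Sum>\<tau>\<in>sgns. \<tau> * (H (Qe \<tau> z) / Bt \<tau> z)) - h0 * bK z"
    by (simp add: bK_def diff_divide_distrib algebra_simps)
  show ?thesis unfolding A[symmetric] B[symmetric] by (rule tile_sum) (rule nz)
qed

lemma Qe_le:
  assumes K: "1 \<le> K" and \<tau>: "\<tau> \<in> sgns" and z: "\<bar>z\<bar> \<le> a"
  shows "Qe \<tau> z \<le> 4 * a\<^sup>2 - (4 * real K + 2)\<^sup>2 * a\<^sup>2"
proof -
  have "(z - \<tau> * a)\<^sup>2 \<le> (2 * a)\<^sup>2" unfolding abs_le_square_iff[symmetric] using z \<tau> a by auto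
  moreover have "((4 * real K + 2) * a)\<^sup>2 \<le> (x + \<tau> * (4 * real K + 3) * a)\<^sup>2"
  proof -
    have "\<bar>\<tau> * (4 * real K + 3) * a\<bar> = (4 * real K + 3) * a" using \<tau> a by (auto simp: abs_mult)
    hence "(4 * real K + 3) * a - a \<le> \<bar>x + \<tau> * (4 * real K + 3) * a\<bar>" using x by linarith
    hence "\<bar>(4 * real K + 2) * a\<bar> \<le> \<bar>x + \<tau> * (4 * real K + 3) * a\<bar>" using a by (simp add: algebra_simps)
    thus ?thesis by (simp only: abs_le_square_iff)
  qed
  ultimately show ?thesis unfolding Qe_def by (simp add: power_mult_distrib)
qed

end

context two_images
begin

text \<open>The terms with \<open>hker\<close> that the unpaired tiles at the ends of the truncated
  lines leave behind.\<close>

definition E1 :: "real \<Rightarrow> real \<times> real \<Rightarrow> real" where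
  "E1 e z = (\<Sum>p\<in>X.idx. X.wt p * (\<Sum>\<tau>\<in>sgns. \<tau> * (hker e (X.Pp p (fst z) + Y.Qe \<tau> (snd z)) / Y.Bt \<tau> (snd z))))"

definition kern :: "real \<Rightarrow> real \<times> real \<Rightarrow> real" where
  "kern e z = (\<Sum>\<sigma>\<in>sgns. \<sigma> * (\<Sum>k\<in>{- int K..int K}. X.Wk \<sigma> k *
     (\<Sum>n\<in>{- int (2*K+1)..int (2*K+1)}. (-1) powi n *
       ((hker e (corner_val (\<sigma> * a) (X.Wk \<sigma> k) a (Y.Xn n) z) - hker e (corner_val (\<sigma> * a) (X.Wk \<sigma> k) (-a) (Y.Xn n) z)) / (snd z - Y.Xn n)))))"

text \<open>\<open>tile_sum_idx\<close> on each line, with \<open>h0\<close> equal to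
  \<open>hker e\<close> of the part from the normal coordinate. This makes the numerators those of
  the corner identity, at the price of the term \<open>Xi * bK\<close>.\<close>

lemma kern_eq:
  assumes nz: "\<And>\<tau> m. \<tau> \<in> sgns \<Longrightarrow> Y.Pk \<tau> m (snd z) \<noteq> 0"
  shows "kern e z = (\<Sum>p\<in>X.idx. X.wt p * (\<Sum>q\<in>Y.idx. Y.wt q *
       (2 * ((hker e (X.Pp p (fst z) + Y.Pp q (snd z)) - hker e (X.Pp p (fst z))) / Y.Pp q (snd z)))))
     - E1 e z + X.Xi e (fst z) * Y.bK (snd z)"
proof -
  have cv: "corner_val (\<sigma> * a) (X.Wk \<sigma> k) d X' z = X.Pk \<sigma> k (fst z) + ((snd z - d)\<^sup>2 - (X' - d)\<^sup>2)" for \<sigma> k d X'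
    by (simp add: corner_val_def X.Pk_def)
  have "kern e z = (\<Sum>\<sigma>\<in>sgns. \<sigma> * (\<Sum>k\<in>{- int K..int K}. X.Wk \<sigma> k *
      ((\<Sum>q\<in>Y.idx. Y.wt q * (2 * ((hker e (X.Pk \<sigma> k (fst z) + Y.Pp q (snd z)) - hker e (X.Pk \<sigma> k (fst z))) / Y.Pp q (snd z))))
     - ((\<Sum>\<tau>\<in>sgns. \<tau> * (hker e (X.Pk \<sigma> k (fst z) + Y.Qe \<tau> (snd z)) / Y.Bt \<tau> (snd z))) - hker e (X.Pk \<sigma> k (fst z)) * Y.bK (snd z)))))"
    unfolding kern_def cv
    by (intro sum.cong refl arg_cong2[where f=times]
        Y.tile_sum_idx[OF nz, where H="\<lambda>t. hker e (X.Pk _ _ (fst z) + t)" and ?h0.0="hker e (X.Pk _ _ (fst z))"])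
  also have "\<dots> = (\<Sum>p\<in>X.idx. X.wt p *
      ((\<Sum>q\<in>Y.idx. Y.wt q * (2 * ((hker e (X.Pp p (fst z) + Y.Pp q (snd z)) - hker e (X.Pp p (fst z))) / Y.Pp q (snd z))))
     - ((\<Sum>\<tau>\<in>sgns. \<tau> * (hker e (X.Pp p (fst z) + Y.Qe \<tau> (snd z)) / Y.Bt \<tau> (snd z))) - hker e (X.Pp p (fst z)) * Y.bK (snd z))))"
    unfolding X.Pp_def by (rule X.sum_idx)
  finally show ?thesis
    unfolding E1_def X.Xi_idx right_diff_distrib sum_subtractf sum_distrib_right
    by (simp only: mult.assoc)
qed

lemma abs_wt: "p \<in> X.idx \<Longrightarrow> \<bar>X.wt p\<bar> = \<bar>X.Wk (fst p) (snd p)\<bar>"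
  unfolding X.wt_def X.idx_def by (auto simp: abs_mult)

text \<open>At an end tile the argument of \<open>hker\<close> is at most
  \<open>- (W\<^sup>2 + 16 * K\<^sup>2 * a\<^sup>2)\<close>. The inequality of arithmetic and
  geometric means lets it absorb the weight \<open>W\<close> and leave
  \<open>1 / (8 * K * a)\<close>; the denominator \<open>Bt\<close> contributes another
  \<open>1 / K\<close>. Summed over \<open>4 * (2 * K + 1)\<close> terms this is
  \<open>O(1 / K)\<close>, uniformly in \<open>e\<close>.\<close>

lemma E1_bound:
  assumes e: "e > 0" and z: "\<bar>fst z\<bar> \<le> a" "\<bar>snd z\<bar> \<le> a"
  shows "\<bar>E1 e z\<bar> \<le> 3 / (8 * a\<^sup>2 * real K)"
proof -
  let ?K = "real K"
  have k: "?K \<ge> 1" using K by simp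
  have bnd: "\<bar>X.wt p * (\<tau> * (hker e (X.Pp p (fst z) + Y.Qe \<tau> (snd z)) / Y.Bt \<tau> (snd z)))\<bar> \<le> 1 / (32 * a\<^sup>2 * ?K\<^sup>2)"
    if p: "p \<in> X.idx" and \<tau>: "\<tau> \<in> sgns" for p \<tau>
  proof -
    define W where "W = \<bar>X.wt p\<bar>"
    have \<sigma>: "fst p \<in> sgns" using p by (auto simp: X.idx_def)
    have W: "W = \<bar>X.Wk (fst p) (snd p)\<bar>" using abs_wt[OF p] by (simp add: W_def)
    have W0: "W > 0" unfolding W using X.Wk_nz[OF \<sigma>] by simp
    define D where "D = X.Pp p (fst z) + Y.Qe \<tau> (snd z)"
    have "(fst z - fst p * a)\<^sup>2 \<le> (2 * a)\<^sup>2" unfolding abs_le_square_iff[symmetric] using z \<sigma> a by auto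
    hence "X.Pp p (fst z) \<le> 4 * a\<^sup>2 - W\<^sup>2" by (simp add: X.Pp_def X.Pk_def W power_mult_distrib)
    moreover have "Y.Qe \<tau> (snd z) \<le> 4 * a\<^sup>2 - (4 * ?K + 2)\<^sup>2 * a\<^sup>2" by (rule Y.Qe_le[OF K \<tau> z(2)])
    moreover have "(16 * ?K\<^sup>2 + 8) * a\<^sup>2 \<le> (4 * ?K + 2)\<^sup>2 * a\<^sup>2"
      using k by (intro mult_right_mono) (simp_all add: power2_eq_square algebra_simps)
    ultimately have D: "D \<le> - (W\<^sup>2 + 16 * ?K\<^sup>2 * a\<^sup>2)" unfolding D_def by (simp add: algebra_simps)
    have "0 \<le> (W - 4 * ?K * a)\<^sup>2" by simp
    hence amgm: "8 * ?K * a * W \<le> W\<^sup>2 + 16 * ?K\<^sup>2 * a\<^sup>2" by (simp add: power2_eq_square algebra_simps)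
    have pos: "0 < 8 * ?K * a * W" using k a W0 by simp
    hence D8: "8 * ?K * a * W \<le> \<bar>D\<bar>" "D \<noteq> 0" using D amgm by (simp_all add: abs_if, linarith+)
    have "\<bar>hker e D\<bar> \<le> 1 / \<bar>D\<bar>" by (rule abs_hker_le[OF e D8(2)])
    also have "\<dots> \<le> 1 / (8 * ?K * a * W)" using D8 pos by (intro frac_le) auto
    finally have "W * \<bar>hker e D\<bar> \<le> W * (1 / (8 * ?K * a * W))" using W0 by (intro mult_left_mono) auto
    also have "\<dots> = 1 / (8 * ?K * a)" using W0 by simp
    finally have h: "W * \<bar>hker e D\<bar> \<le> 1 / (8 * ?K * a)" .
    have B: "4 * ?K * a \<le> \<bar>Y.Bt \<tau> (snd z)\<bar>" by (rule Y.Bt_big[OF \<tau> z(2) K])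
    have "\<bar>X.wt p * (\<tau> * (hker e D / Y.Bt \<tau> (snd z)))\<bar> = W * \<bar>hker e D\<bar> / \<bar>Y.Bt \<tau> (snd z)\<bar>"
      using \<tau> by (auto simp: W_def abs_mult)
    also have "\<dots> \<le> (1 / (8 * ?K * a)) / (4 * ?K * a)"
      using h B k a W0 by (intro frac_le) auto
    also have "\<dots> = 1 / (32 * a\<^sup>2 * ?K\<^sup>2)" by (simp add: power2_eq_square)
    finally show ?thesis by (simp add: D_def)
  qed
  have "\<bar>E1 e z\<bar> \<le> (\<Sum>p\<in>X.idx. \<Sum>\<tau>\<in>sgns. 1 / (32 * a\<^sup>2 * ?K\<^sup>2))"
    unfolding E1_def sum_distrib_left by (intro order_trans[OF sum_abs] sum_mono bnd)
  also have "\<dots> = (2 * (2 * ?K + 1)) * 2 / (32 * a\<^sup>2 * ?K\<^sup>2)"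
  proof -
    have "(\<Sum>p\<in>X.idx. \<Sum>\<tau>\<in>sgns. c) = (2 * (2 * ?K + 1)) * 2 * c" for c :: real
      by (simp add: X.idx_def card_cartesian_product)
    from this[of "1 / (32 * a\<^sup>2 * ?K\<^sup>2)"] show ?thesis by simp
  qed
  also have "\<dots> \<le> (2 * (3 * ?K)) * 2 / (32 * a\<^sup>2 * ?K\<^sup>2)"
    using k by (intro divide_right_mono mult_right_mono mult_left_mono) auto
  also have "\<dots> = 3 / (8 * a\<^sup>2 * ?K)" using k by (simp add: field_simps power2_eq_square)
  finally show ?thesis .
qed

text \<open>A finite combination of instances of \<open>side_limit\<close>; it ties the planar
  kernel to the principal values over the sides.\<close>

lemma kern_limit:
  assumes e: "\<And>n. 0 < e n" "\<And>n. e n \<le> 1" and e0: "e \<longlonglongrightarrow> 0"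
  shows "(\<lambda>n. 1 / (2 * pi) * (LINT z|lborel. planar i z * kern (e n) z)) \<longlonglongrightarrow>
    (\<Sum>\<sigma>\<in>sgns. \<sigma> * (\<Sum>k\<in>{- int K..int K}. X.Wk \<sigma> k * (\<Sum>n\<in>{- int (2*K+1)..int (2*K+1)}. (-1) powi n *
      (LINT u:{-a..a}|lborel. pv (dmean (bd i \<sigma> u)) (sqrt ((X.Wk \<sigma> k)\<^sup>2 + (Y.Xn n - u)\<^sup>2))))))"
    and "0 < e' \<Longrightarrow> integrable lborel (\<lambda>z. planar i z * kern e' z)"
proof -
  let ?T = "\<lambda>e \<sigma> k n z. planar i z * ((hker e (corner_val (\<sigma> * a) (X.Wk \<sigma> k) a (Y.Xn n) z) - hker e (corner_val (\<sigma> * a) (X.Wk \<sigma> k) (-a) (Y.Xn n) z)) / (snd z - Y.Xn n))"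
  let ?N = "{- int (2*K+1)..int (2*K+1)}"
  let ?k = "{- int K..int K}"
  have eq: "(\<lambda>z. planar i z * kern e z) = (\<lambda>z. \<Sum>\<sigma>\<in>sgns. \<sigma> * (\<Sum>k\<in>?k. X.Wk \<sigma> k * (\<Sum>n\<in>?N. (-1) powi n * ?T e \<sigma> k n z)))" for e
    unfolding kern_def sum_distrib_left by (intro ext sum.cong refl) (simp only: mult.left_commute)
  have int: "integrable lborel (?T e \<sigma> k n)" if "e > 0" "\<sigma> \<in> sgns" for e \<sigma> k n
    by (rule side_reg(2)[OF that(2,1)])
  show "integrable lborel (\<lambda>z. planar i z * kern e' z)" if "0 < e'"
    unfolding eq by (intro Bochner_Integration.integrable_sum integrable_mult_right int that)
  have L: "(LINT z|lborel. planar i z * kern e z) = (\<Sum>\<sigma>\<in>sgns. \<sigma> * (\<Sum>k\<in>?k. X.Wk \<sigma> k * (\<Sum>n\<in>?N. (-1) powi n * (LINT z|lborel. ?T e \<sigma> k n z))))" if "e > 0" for e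
  proof -
    have 1: "(LINT z|lborel. (\<Sum>n\<in>?N. (-1) powi n * ?T e \<sigma> k n z)) = (\<Sum>n\<in>?N. (-1) powi n * (LINT z|lborel. ?T e \<sigma> k n z))"
      if \<sigma>: "\<sigma> \<in> sgns" for \<sigma> k
      unfolding integral_mult_right_zero[symmetric]
      by (intro Bochner_Integration.integral_sum integrable_mult_right int \<sigma> \<open>e > 0\<close>)
    have 2: "(LINT z|lborel. (\<Sum>k\<in>?k. X.Wk \<sigma> k * (\<Sum>n\<in>?N. (-1) powi n * ?T e \<sigma> k n z))) = (\<Sum>k\<in>?k. X.Wk \<sigma> k * (LINT z|lborel. (\<Sum>n\<in>?N. (-1) powi n * ?T e \<sigma> k n z)))"
      if \<sigma>: "\<sigma> \<in> sgns" for \<sigma>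
      unfolding integral_mult_right_zero[symmetric]
      by (intro Bochner_Integration.integral_sum Bochner_Integration.integrable_sum integrable_mult_right int \<sigma> \<open>e > 0\<close>)
    have 3: "(LINT z|lborel. (\<Sum>\<sigma>\<in>sgns. \<sigma> * (\<Sum>k\<in>?k. X.Wk \<sigma> k * (\<Sum>n\<in>?N. (-1) powi n * ?T e \<sigma> k n z)))) =
       (\<Sum>\<sigma>\<in>sgns. \<sigma> * (LINT z|lborel. (\<Sum>k\<in>?k. X.Wk \<sigma> k * (\<Sum>n\<in>?N. (-1) powi n * ?T e \<sigma> k n z))))"
      unfolding integral_mult_right_zero[symmetric]
      by (intro Bochner_Integration.integral_sum Bochner_Integration.integrable_sum integrable_mult_right int \<open>e > 0\<close>)
    show ?thesis unfolding eq 3 using 1 2 by (intro sum.cong refl) simp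
  qed
  have "1 / (2 * pi) * (LINT z|lborel. planar i z * kern (e n) z) =
     (\<Sum>\<sigma>\<in>sgns. \<sigma> * (\<Sum>k\<in>?k. X.Wk \<sigma> k * (\<Sum>m\<in>?N. (-1) powi m * (1 / (2 * pi) * (LINT z|lborel. ?T (e n) \<sigma> k m z)))))" for n
    unfolding L[OF e(1)] sum_distrib_left by (intro sum.cong refl) (simp only: mult.left_commute)
  thus "(\<lambda>n. 1 / (2 * pi) * (LINT z|lborel. planar i z * kern (e n) z)) \<longlonglongrightarrow>
    (\<Sum>\<sigma>\<in>sgns. \<sigma> * (\<Sum>k\<in>?k. X.Wk \<sigma> k * (\<Sum>n\<in>?N. (-1) powi n *
      (LINT u:{-a..a}|lborel. pv (dmean (bd i \<sigma> u)) (sqrt ((X.Wk \<sigma> k)\<^sup>2 + (Y.Xn n - u)\<^sup>2))))))"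
    by (simp only:) (intro tendsto_sum tendsto_mult tendsto_const side_limit X.Wk_nz e e0)
qed

end

context lattice_images
begin

lemma sum_idx_zero: "(\<Sum>p\<in>idx. if snd p = 0 then c else (0::real)) = 2 * c"
proof -
  have "(\<Sum>p\<in>idx. if snd p = 0 then c else (0::real)) = (\<Sum>\<sigma>\<in>sgns. \<Sum>k\<in>{- int K..int K}. if k = 0 then c else 0)"
    unfolding idx_def by (simp add: sum.cartesian_product' del: sum.insert)
  thus ?thesis by simp
qed

text \<open>At index 0 the distance is that to the side itself, so flipping back returns
  \<open>x\<close>. The weight is negative for either sign, hence products of two such weights are
  positive.\<close>

lemma image_zero:
  assumes "p \<in> idx" "snd p = 0"
  shows "fst p * (a - \<bar>Wk (fst p) (snd p)\<bar>) = x" "wt p = - \<bar>Wk (fst p) (snd p)\<bar>"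
  using assms x a by (auto simp: idx_def wt_def Wk_def abs_if)

lemma image_nonzero:
  assumes "p \<in> idx" "snd p \<noteq> 0"
  shows "a \<le> \<bar>fst p * (a - \<bar>Wk (fst p) (snd p)\<bar>)\<bar>"
proof -
  have \<sigma>: "fst p \<in> sgns" using assms by (auto simp: idx_def)
  show ?thesis unfolding abs_sgn_times[OF \<sigma>] using Wk_big[OF \<sigma> assms(2)] a by linarith
qed

definition om :: "real \<Rightarrow> real \<Rightarrow> real" where "om e z = Xi e z - bK z / 2"

lemma om_measurable [measurable]: "om e \<in> borel_measurable borel"
  unfolding om_def by measurable

text \<open>A crude bound growing like \<open>1 / e\<close>, sufficient for integrability at fixed
  \<open>e\<close>.\<close>

lemma om_bounded:
  assumes e: "e > 0" and K: "1 \<le> K"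
  obtains C where "0 \<le> C" "\<And>z. \<bar>z\<bar> \<le> a \<Longrightarrow> \<bar>om e z\<bar> \<le> C"
proof
  define C where "C = (\<Sum>p\<in>idx. \<bar>wt p\<bar> * (1 / e)) + 1 / (2 * real K * a) / 2"
  show "0 \<le> C" unfolding C_def using e a by (intro add_nonneg_nonneg sum_nonneg) auto
  fix z assume z: "\<bar>z\<bar> \<le> a"
  have "\<bar>Xi e z\<bar> \<le> (\<Sum>p\<in>idx. \<bar>wt p\<bar> * (1 / e))"
    unfolding Xi_idx by (rule order_trans[OF sum_abs]) (auto simp only: abs_mult intro!: sum_mono mult_left_mono abs_hker_le' e)
  moreover have "\<bar>bK z / 2\<bar> \<le> 1 / (2 * real K * a) / 2"
    unfolding abs_divide abs_numeral by (intro divide_right_mono bK_bound z K) simp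
  ultimately show "\<bar>om e z\<bar> \<le> C" unfolding om_def C_def by linarith
qed

end

section \<open>Combination of the two perpendicular pairs of sides\<close>

context two_images
begin

definition side_sum :: "2 \<Rightarrow> real" where
  "side_sum i = (\<Sum>\<sigma>\<in>sgns. \<sigma> * (\<Sum>k\<in>{- int K..int K}. X.Wk \<sigma> k * (\<Sum>n\<in>{- int (2*K+1)..int (2*K+1)}. (-1) powi n *
      (LINT u:{-a..a}|lborel. pv (dmean (bd i \<sigma> u)) (sqrt ((X.Wk \<sigma> k)\<^sup>2 + (Y.Xn n - u)\<^sup>2))))))"

text \<open>The same setting with the coordinates exchanged; \<open>S.kern\<close> and
  \<open>S.E1\<close> are therefore evaluated at swapped pairs.\<close>

sublocale S: two_images a L f G x2 x1 K
  by unfold_locales (use x1 x2 K in auto)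

lemma planar_swap: "planar 2 (q, p) = planar 1 (p, q)"
proof -
  have "line_point 2 q p = line_point 1 p q" by (simp add: line_point_def vec_eq_iff forall_2)
  thus ?thesis by (simp add: planar_def)
qed

lemma swap_integral:
  fixes g :: "real \<times> real \<Rightarrow> real"
  assumes "integrable lborel g"
  shows "(LINT z|lborel. g z) = (LINT z|lborel. g (snd z, fst z))" "integrable lborel (\<lambda>z. g (snd z, fst z))"
  using lborel_pair.integral_product_swap[of g] lborel_pair.integrable_product_swap[of g]
    assms borel_measurable_integrable[OF assms]
  by (simp_all add: lborel_prod case_prod_beta' borel_prod)

text \<open>\<open>Y.omega_bound\<close> applied to differences of sections shows that the inner
  integral \<open>\<phi>\<close> is Lipschitz with a constant of order \<open>e\<close>; here the
  mixed differences of \<open>planar\<close> are needed. \<open>X.omega_bound\<close> applied to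
  \<open>\<phi>\<close> adds the second factor \<open>e\<close>.\<close>

lemma omega_pair_bound:
  assumes e: "e > 0"
  shows "integrable lborel (\<lambda>z. planar i z * (X.om e (fst z) * Y.om e (snd z)))"
    and "\<bar>LINT z|lborel. planar i z * (X.om e (fst z) * Y.om e (snd z))\<bar> \<le> X.omega_const * (Y.omega_const * L * e) * e"
proof -
  obtain C1 where C1: "0 \<le> C1" "\<And>z. \<bar>z\<bar> \<le> a \<Longrightarrow> \<bar>X.om e z\<bar> \<le> C1" using X.om_bounded[OF e K] by blast
  obtain C2 where C2: "0 \<le> C2" "\<And>z. \<bar>z\<bar> \<le> a \<Longrightarrow> \<bar>Y.om e z\<bar> \<le> C2" using Y.om_bounded[OF e K] by blast
  show int: "integrable lborel (\<lambda>z. planar i z * (X.om e (fst z) * Y.om e (snd z)))"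
    by (rule planar_times_integrable[where C="C1 * C2"]) (use C1 C2 in \<open>auto simp: abs_mult intro!: mult_mono\<close>)
  define \<phi> where "\<phi> p = (LINT q|lborel. planar i (p, q) * Y.om e q)" for p
  have "lip_sq a (Y.omega_const * L * e) \<phi>"
  proof -
    have "\<bar>\<phi> p - \<phi> p'\<bar> \<le> (Y.omega_const * L * e) * \<bar>p - p'\<bar>" for p p'
    proof -
      have "\<phi> p - \<phi> p' = (LINT q|lborel. (planar i (p, q) - planar i (p', q)) * (Y.Xi e q - Y.bK q / 2))"
        unfolding \<phi>_def Y.om_def left_diff_distrib
        by (rule Bochner_Integration.integral_diff[symmetric])
           (use Y.omega_bound(2)[OF planar_lip_sq(2)[of i] K e] in \<open>auto simp: left_diff_distrib\<close>)
      also have "\<bar>\<dots>\<bar> \<le> Y.omega_const * (L * \<bar>p - p'\<bar>) * e"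
        by (rule Y.omega_bound(1)[OF planar_lip_sq(3) K e])
      finally show ?thesis by (simp add: mult_ac)
    qed
    moreover have "\<phi> p = 0" if "a \<le> \<bar>p\<bar>" for p using that planar_out[of "(p, _)" i] by (simp add: \<phi>_def)
    moreover have "0 \<le> Y.omega_const"
      unfolding Y.omega_const_def using a by (intro sum_nonneg mult_nonneg_nonneg divide_nonneg_nonneg add_nonneg_nonneg) auto
    ultimately show ?thesis using L e by (auto simp: lip_sq_def)
  qed
  from X.omega_bound(1)[OF this K e]
  have "\<bar>LINT p|lborel. \<phi> p * X.om e p\<bar> \<le> X.omega_const * (Y.omega_const * L * e) * e" by (simp add: X.om_def)
  moreover have "(LINT p|lborel. \<phi> p * X.om e p) = (LINT p|lborel. LINT q|lborel. planar i (p, q) * (X.om e p * Y.om e q))"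
  proof (intro Bochner_Integration.integral_cong refl)
    fix p
    have "(LINT q|lborel. planar i (p, q) * (X.om e p * Y.om e q)) = (LINT q|lborel. X.om e p * (planar i (p, q) * Y.om e q))"
      by (simp only: mult.left_commute)
    also have "\<dots> = X.om e p * \<phi> p" unfolding \<phi>_def by (rule integral_mult_right_zero)
    finally show "\<phi> p * X.om e p = (LINT q|lborel. planar i (p, q) * (X.om e p * Y.om e q))" by simp
  qed
  moreover have "\<dots> = (LINT z|lborel. planar i z * (X.om e (fst z) * Y.om e (snd z)))"
    using lborel_pair.integral_fst[of "\<lambda>p q. planar i (p, q) * (X.om e p * Y.om e q)"] int
    by (simp add: lborel_prod case_prod_beta')
  ultimately show "\<bar>LINT z|lborel. planar i z * (X.om e (fst z) * Y.om e (snd z))\<bar> \<le> X.omega_const * (Y.omega_const * L * e) * e"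
    by simp
qed

definition theta_sum :: "real \<Rightarrow> real \<times> real \<Rightarrow> real" where
  "theta_sum e z = (\<Sum>p\<in>X.idx. \<Sum>q\<in>Y.idx. 2 * (X.wt p * Y.wt q) * theta e (X.Pp p (fst z)) (Y.Pp q (snd z)))"

text \<open>The truncation errors, small for large \<open>K\<close> uniformly in
  \<open>e\<close>.\<close>

definition rest :: "real \<Rightarrow> real \<times> real \<Rightarrow> real" where
  "rest e z = X.bK (fst z) * Y.bK (snd z) / 2 - E1 e z - S.E1 e (snd z, fst z)"

text \<open>Completing the product: \<open>- 2 * Xi * Xi'\<close> together with the mixed terms
  \<open>Xi * bK'\<close> and \<open>Xi' * bK\<close> equals \<open>- 2 * om * om'\<close> plus
  \<open>bK * bK' / 2\<close>, where the prime marks the other coordinate. This explains the half in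
  \<open>om\<close>.\<close>

lemma kernel_total:
  assumes e: "e > 0" and z: "fst z \<noteq> x1" "snd z \<noteq> x2"
  shows "planar 1 z * (kern e z + S.kern e (snd z, fst z)) =
    planar 1 z * theta_sum e z - 2 * (planar 1 z * (X.om e (fst z) * Y.om e (snd z))) + planar 1 z * rest e z"
proof (cases "\<bar>fst z\<bar> < a \<and> \<bar>snd z\<bar> < a")
  case True
  have nzX: "X.Pk \<tau> m (fst z) \<noteq> 0" if "\<tau> \<in> sgns" for \<tau> m using X.Pk_nz[OF that] True z by blast
  have nzY: "Y.Pk \<tau> m (snd z) \<noteq> 0" if "\<tau> \<in> sgns" for \<tau> m using Y.Pk_nz[OF that] True z by blast
  define P where "P p = X.Pp p (fst z)" for p
  define Q where "Q q = Y.Pp q (snd z)" for q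
  have nz: "P p \<noteq> 0" "Q q \<noteq> 0" if "p \<in> X.idx" "q \<in> Y.idx" for p q
    using that nzX nzY by (auto simp: P_def Q_def X.Pp_def Y.Pp_def X.idx_def Y.idx_def)
  define D1 D2 where "D1 = (\<Sum>p\<in>X.idx. X.wt p * (\<Sum>q\<in>Y.idx. Y.wt q * (2 * ((hker e (P p + Q q) - hker e (P p)) / Q q))))"
    and "D2 = (\<Sum>q\<in>Y.idx. Y.wt q * (\<Sum>p\<in>X.idx. X.wt p * (2 * ((hker e (Q q + P p) - hker e (Q q)) / P p))))"
  have k1: "kern e z = D1 - E1 e z + X.Xi e (fst z) * Y.bK (snd z)"
    unfolding D1_def P_def Q_def by (rule kern_eq) (rule nzY)
  have k2: "S.kern e (snd z, fst z) = D2 - S.E1 e (snd z, fst z) + Y.Xi e (snd z) * X.bK (fst z)"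
    unfolding D2_def P_def Q_def using S.kern_eq[of "(snd z, fst z)" e] nzX by simp
  have "D1 + D2 = (\<Sum>p\<in>X.idx. \<Sum>q\<in>Y.idx. X.wt p * (Y.wt q * (2 * ((hker e (P p + Q q) - hker e (P p)) / Q q))) +
      Y.wt q * (X.wt p * (2 * ((hker e (Q q + P p) - hker e (Q q)) / P p))))"
    unfolding D1_def D2_def sum_distrib_left
    by (subst (2) sum.swap) (simp only: sum.distrib)
  also have "\<dots> = (\<Sum>p\<in>X.idx. \<Sum>q\<in>Y.idx. 2 * (X.wt p * Y.wt q) * theta e (P p) (Q q) - 2 * ((X.wt p * hker e (P p)) * (Y.wt q * hker e (Q q))))"
  proof (intro sum.cong refl)
    fix p q assume "p \<in> X.idx" "q \<in> Y.idx"
    from hker_corner_identity[OF e nz[OF this]]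
    have "(hker e (P p + Q q) - hker e (P p)) / Q q + (hker e (Q q + P p) - hker e (Q q)) / P p
      = theta e (P p) (Q q) - hker e (P p) * hker e (Q q)" (is "?A + ?B = ?C - ?D") by (simp add: add.commute)
    hence B: "?B = ?C - ?D - ?A" by simp
    show "X.wt p * (Y.wt q * (2 * ((hker e (P p + Q q) - hker e (P p)) / Q q))) +
      Y.wt q * (X.wt p * (2 * ((hker e (Q q + P p) - hker e (Q q)) / P p))) =
      2 * (X.wt p * Y.wt q) * theta e (P p) (Q q) - 2 * ((X.wt p * hker e (P p)) * (Y.wt q * hker e (Q q)))"
      unfolding B by (simp only: algebra_simps)
  qed
  also have "\<dots> = theta_sum e z - 2 * (X.Xi e (fst z) * Y.Xi e (snd z))"
  proof -
    have "(\<Sum>p\<in>X.idx. \<Sum>q\<in>Y.idx. 2 * (A p * B q)) = 2 * (sum A X.idx * sum B Y.idx)" for A B :: "real \<times> int \<Rightarrow> real"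
      unfolding sum_product by (simp only: sum_distrib_left)
    thus ?thesis unfolding theta_sum_def X.Xi_idx Y.Xi_idx sum_subtractf P_def Q_def by simp
  qed
  finally have D: "D1 + D2 = theta_sum e z - 2 * (X.Xi e (fst z) * Y.Xi e (snd z))" .
  have tot: "kern e z + S.kern e (snd z, fst z) = theta_sum e z - 2 * (X.om e (fst z) * Y.om e (snd z)) + rest e z"
    unfolding k1 k2 rest_def X.om_def Y.om_def using D by (simp add: algebra_simps)
  show ?thesis unfolding tot by (simp add: algebra_simps)
next
  case False
  hence "planar 1 z = 0" by (intro planar_out) auto
  thus ?thesis by simp
qed

text \<open>If an index is nonzero, the image lies outside the open square and contributes nothing.
  For each of the four pairs with both indices 0 the weights cancel the Jacobian up to a half,
  leaving \<open>pi\<^sup>2 / 2\<close> times the value of \<open>f\<close>.\<close>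

lemma theta_sum_limit:
  assumes e: "\<And>n. 0 < e n" and e0: "e \<longlonglongrightarrow> 0"
  shows "(\<lambda>n. LINT z|lborel. planar 1 z * theta_sum (e n) z) \<longlonglongrightarrow> 2 * pi\<^sup>2 * planar 1 (x1, x2)"
    and "0 < e' \<Longrightarrow> integrable lborel (\<lambda>z. planar 1 z * theta_sum e' z)"
proof -
  let ?t = "\<lambda>e p q z. planar 1 z * theta e (X.Pp p (fst z)) (Y.Pp q (snd z))"
  have int: "integrable lborel (?t e p q)" if "0 < e" for e p q
    by (rule planar_times_integrable[where C="4 / e\<^sup>2"])
       (use theta_bound[OF that] in \<open>auto simp: theta_def X.Pp_def Y.Pp_def X.Pk_def Y.Pk_def\<close>)
  have eq: "(\<lambda>z. planar 1 z * theta_sum e z) = (\<lambda>z. \<Sum>p\<in>X.idx. \<Sum>q\<in>Y.idx. 2 * (X.wt p * Y.wt q) * ?t e p q z)" for e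
    unfolding theta_sum_def sum_distrib_left by (intro ext sum.cong refl) (simp only: mult.left_commute)
  show "integrable lborel (\<lambda>z. planar 1 z * theta_sum e' z)" if "0 < e'"
    unfolding eq by (intro Bochner_Integration.integrable_sum integrable_mult_right int that)
  have L: "(LINT z|lborel. planar 1 z * theta_sum e z) = (\<Sum>p\<in>X.idx. \<Sum>q\<in>Y.idx. 2 * (X.wt p * Y.wt q) * (LINT z|lborel. ?t e p q z))" if "0 < e" for e
  proof -
    have "(LINT z|lborel. planar 1 z * theta_sum e z) = (\<Sum>p\<in>X.idx. LINT z|lborel. (\<Sum>q\<in>Y.idx. 2 * (X.wt p * Y.wt q) * ?t e p q z))"
      unfolding eq by (intro Bochner_Integration.integral_sum Bochner_Integration.integrable_sum integrable_mult_right int that)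
    also have "\<dots> = (\<Sum>p\<in>X.idx. \<Sum>q\<in>Y.idx. LINT z|lborel. 2 * (X.wt p * Y.wt q) * ?t e p q z)"
      by (intro sum.cong refl Bochner_Integration.integral_sum Bochner_Integration.integrable_sum integrable_mult_right int that)
    finally show ?thesis unfolding integral_mult_right_zero .
  qed
  let ?lim = "\<lambda>p q. pi\<^sup>2 * (planar 1 (fst p * (a - \<bar>X.Wk (fst p) (snd p)\<bar>), fst q * (a - \<bar>Y.Wk (fst q) (snd q)\<bar>)) /
       (4 * \<bar>X.Wk (fst p) (snd p)\<bar> * \<bar>Y.Wk (fst q) (snd q)\<bar>))"
  have "(\<lambda>n. LINT z|lborel. planar 1 z * theta_sum (e n) z) \<longlonglongrightarrow> (\<Sum>p\<in>X.idx. \<Sum>q\<in>Y.idx. 2 * (X.wt p * Y.wt q) * ?lim p q)"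
    unfolding L[OF e]
  proof (intro tendsto_sum tendsto_mult tendsto_const)
    fix p q assume pq: "p \<in> X.idx" "q \<in> Y.idx"
    hence "fst p \<in> sgns" "fst q \<in> sgns" by (auto simp: X.idx_def Y.idx_def)
    thus "(\<lambda>n. LINT z|lborel. ?t (e n) p q z) \<longlonglongrightarrow> ?lim p q"
      unfolding X.Pp_def Y.Pp_def X.Pk_def Y.Pk_def
      by (intro theta_corner_limit X.Wk_nz Y.Wk_nz e e0)
  qed
  also have "(\<Sum>p\<in>X.idx. \<Sum>q\<in>Y.idx. 2 * (X.wt p * Y.wt q) * ?lim p q) =
     (\<Sum>p\<in>X.idx. \<Sum>q\<in>Y.idx. if snd q = 0 then (if snd p = 0 then pi\<^sup>2 * planar 1 (x1, x2) / 2 else 0) else 0)"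
  proof (intro sum.cong refl)
    fix p q assume pq: "p \<in> X.idx" "q \<in> Y.idx"
    hence \<sigma>: "fst p \<in> sgns" "fst q \<in> sgns" by (auto simp: X.idx_def Y.idx_def)
    show "2 * (X.wt p * Y.wt q) * ?lim p q = (if snd q = 0 then (if snd p = 0 then pi\<^sup>2 * planar 1 (x1, x2) / 2 else 0) else 0)"
    proof (cases "snd p = 0 \<and> snd q = 0")
      case True
      show ?thesis
        unfolding X.image_zero[OF pq(1) conjunct1[OF True]] Y.image_zero[OF pq(2) conjunct2[OF True]]
        using True X.Wk_nz[OF \<sigma>(1), of "snd p"] Y.Wk_nz[OF \<sigma>(2), of "snd q"] by simp
    next
      case False
      hence "planar 1 (fst p * (a - \<bar>X.Wk (fst p) (snd p)\<bar>), fst q * (a - \<bar>Y.Wk (fst q) (snd q)\<bar>)) = 0"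
        using X.image_nonzero[OF pq(1)] Y.image_nonzero[OF pq(2)] by (intro planar_out) auto
      thus ?thesis using False by auto
    qed
  qed
  also have "\<dots> = 2 * pi\<^sup>2 * planar 1 (x1, x2)"
    unfolding Y.sum_idx_zero
  proof -
    have "(\<Sum>p\<in>X.idx. 2 * (if snd p = 0 then pi\<^sup>2 * planar 1 (x1, x2) / 2 else 0)) =
      (\<Sum>p\<in>X.idx. if snd p = 0 then pi\<^sup>2 * planar 1 (x1, x2) else 0)" by (intro sum.cong refl) auto
    thus "(\<Sum>p\<in>X.idx. 2 * (if snd p = 0 then pi\<^sup>2 * planar 1 (x1, x2) / 2 else 0)) = 2 * pi\<^sup>2 * planar 1 (x1, x2)"
      unfolding X.sum_idx_zero by simp
  qed
  finally show "(\<lambda>n. LINT z|lborel. planar 1 z * theta_sum (e n) z) \<longlonglongrightarrow> 2 * pi\<^sup>2 * planar 1 (x1, x2)" .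
qed

lemma E1_measurable [measurable]: "E1 e \<in> borel_measurable borel"
  unfolding E1_def X.Pp_def X.Pk_def Y.Qe_def Y.Bt_def by measurable

lemma rest_measurable [measurable]: "rest e \<in> borel_measurable borel"
proof -
  have [measurable]: "(\<lambda>z. S.E1 e (snd z, fst z)) \<in> borel_measurable borel"
    unfolding S.E1_def X.Pp_def X.Pk_def Y.Pp_def Y.Pk_def X.Qe_def X.Bt_def Y.Qe_def Y.Bt_def fst_conv snd_conv by measurable
  show ?thesis unfolding rest_def by measurable
qed

lemma rest_bound:
  assumes e: "e > 0" and z: "\<bar>fst z\<bar> \<le> a" "\<bar>snd z\<bar> \<le> a"
  shows "\<bar>rest e z\<bar> \<le> 1 / (a\<^sup>2 * real K)"
proof -
  have k: "real K \<ge> 1" using K by simp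
  have "\<bar>X.bK (fst z) * Y.bK (snd z)\<bar> \<le> 1 / (2 * real K * a) * (1 / (2 * real K * a))"
    unfolding abs_mult using X.bK_bound[OF z(1) K] Y.bK_bound[OF z(2) K] k a by (intro mult_mono) auto
  also have "\<dots> = 1 / (4 * a\<^sup>2 * real K * real K)" by (simp add: power2_eq_square)
  also have "\<dots> \<le> 1 / (4 * a\<^sup>2 * real K * 1)" using k a by (intro divide_left_mono mult_left_mono) auto
  also have "\<dots> = 1 / 4 * (1 / (a\<^sup>2 * real K))" by simp
  finally have b: "\<bar>X.bK (fst z) * Y.bK (snd z) / 2\<bar> \<le> 1 / 8 * (1 / (a\<^sup>2 * real K))"
    unfolding abs_divide abs_numeral by linarith
  have "\<bar>E1 e z\<bar> \<le> 3 / 8 * (1 / (a\<^sup>2 * real K))" using E1_bound[OF e z] by simp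
  moreover have "\<bar>S.E1 e (snd z, fst z)\<bar> \<le> 3 / 8 * (1 / (a\<^sup>2 * real K))" using S.E1_bound[OF e, of "(snd z, fst z)"] z by simp
  moreover have "0 \<le> 1 / (a\<^sup>2 * real K)" by simp
  ultimately show ?thesis unfolding rest_def using b by linarith
qed

text \<open>As \<open>e\<close> tends to 0 the \<open>theta\<close> part converges and the
  \<open>om\<close> part vanishes. No limit of the \<open>rest\<close> part is taken: its bound,
  uniform in \<open>e\<close>, becomes the error.\<close>

lemma truncated_reconstruction:
  "\<bar>side_sum 1 + S.side_sum 2 - pi * planar 1 (x1, x2)\<bar> \<le> (LINT z|lborel. \<bar>planar 1 z\<bar>) / (2 * pi * a\<^sup>2 * real K)"
proof -
  define e where "e n = 1 / real (Suc n)" for n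
  have e: "0 < e n" "e n \<le> 1" for n by (simp_all add: e_def)
  have e0: "e \<longlonglongrightarrow> 0" unfolding e_def using LIMSEQ_inverse_real_of_nat by (simp add: inverse_eq_divide)
  let ?\<Theta> = "\<lambda>n. LINT z|lborel. planar 1 z * theta_sum (e n) z"
  let ?\<Omega> = "\<lambda>n. LINT z|lborel. planar 1 z * (X.om (e n) (fst z) * Y.om (e n) (snd z))"
  let ?R = "\<lambda>n. LINT z|lborel. planar 1 z * rest (e n) z"
  define A where "A n = 1 / (2 * pi) * (LINT z|lborel. planar 1 z * kern (e n) z) + 1 / (2 * pi) * (LINT z|lborel. planar 2 z * S.kern (e n) z)" for n
  have A: "A \<longlonglongrightarrow> side_sum 1 + S.side_sum 2"
    unfolding A_def side_sum_def S.side_sum_def by (intro tendsto_add kern_limit S.kern_limit e e0)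
  have intR: "integrable lborel (\<lambda>z. planar 1 z * rest (e n) z)" for n
    by (rule planar_times_integrable[where C="1 / (a\<^sup>2 * real K)"]) (use rest_bound[OF e(1)] in auto)
  have An: "A n = 1 / (2 * pi) * (?\<Theta> n - 2 * ?\<Omega> n + ?R n)" for n
  proof -
    have i1: "integrable lborel (\<lambda>z. planar 1 z * kern (e n) z)" by (rule kern_limit(2)[OF e e0 e(1)])
    have i2: "integrable lborel (\<lambda>z. planar 2 z * S.kern (e n) z)" by (rule S.kern_limit(2)[OF e e0 e(1)])
    have s: "(LINT z|lborel. planar 2 z * S.kern (e n) z) = (LINT z|lborel. planar 1 z * S.kern (e n) (snd z, fst z))"
      "integrable lborel (\<lambda>z. planar 1 z * S.kern (e n) (snd z, fst z))"
      using swap_integral[OF i2] by (simp_all add: planar_swap)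
    have "A n = 1 / (2 * pi) * ((LINT z|lborel. planar 1 z * kern (e n) z) + (LINT z|lborel. planar 1 z * S.kern (e n) (snd z, fst z)))"
      unfolding A_def s(1) by (simp only: distrib_left)
    also have "(LINT z|lborel. planar 1 z * kern (e n) z) + (LINT z|lborel. planar 1 z * S.kern (e n) (snd z, fst z)) =
       (LINT z|lborel. planar 1 z * (kern (e n) z + S.kern (e n) (snd z, fst z)))"
      unfolding distrib_left by (rule Bochner_Integration.integral_add[OF i1 s(2), symmetric])
    also have "\<dots> = (LINT z|lborel. planar 1 z * theta_sum (e n) z - 2 * (planar 1 z * (X.om (e n) (fst z) * Y.om (e n) (snd z))) + planar 1 z * rest (e n) z)"
    proof (rule integral_cong_AE)
      show "(\<lambda>z. planar 1 z * (kern (e n) z + S.kern (e n) (snd z, fst z))) \<in> borel_measurable lborel"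
        unfolding distrib_left using i1 s(2) by (intro borel_measurable_add) auto
      show "(\<lambda>z. planar 1 z * theta_sum (e n) z - 2 * (planar 1 z * (X.om (e n) (fst z) * Y.om (e n) (snd z))) + planar 1 z * rest (e n) z) \<in> borel_measurable lborel"
        using theta_sum_limit(2)[OF e(1) e0 e(1)] by measurable
      show "AE z in lborel. planar 1 z * (kern (e n) z + S.kern (e n) (snd z, fst z)) =
        planar 1 z * theta_sum (e n) z - 2 * (planar 1 z * (X.om (e n) (fst z) * Y.om (e n) (snd z))) + planar 1 z * rest (e n) z"
        using AE_coord_neq(1)[of x1] AE_coord_neq(2)[of x2]
        by eventually_elim (rule kernel_total[OF e(1)])
    qed
    also have "\<dots> = ?\<Theta> n - 2 * ?\<Omega> n + ?R n"
    proof -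
      have "(LINT z|lborel. f1 z - 2 * f2 z + f3 z) = (LINT z|lborel. f1 z) - 2 * (LINT z|lborel. f2 z) + (LINT z|lborel. f3 z)"
        if "integrable lborel f1" "integrable lborel f2" "integrable lborel f3" for f1 f2 f3 :: "real \<times> real \<Rightarrow> real"
        using that by simp
      from this[OF theta_sum_limit(2)[OF e(1) e0 e(1)] omega_pair_bound(1)[OF e(1)] intR] show ?thesis .
    qed
    finally show ?thesis .
  qed
  have R: "\<bar>?R n\<bar> \<le> (LINT z|lborel. \<bar>planar 1 z\<bar>) * (1 / (a\<^sup>2 * real K))" for n
  proof -
    have ip: "integrable lborel (\<lambda>z. \<bar>planar 1 z\<bar>)"
      using planar_times_integrable[of "\<lambda>_. 1" 1 1] by (simp add: integrable_abs)
    have "\<bar>?R n\<bar> \<le> (LINT z|lborel. \<bar>planar 1 z * rest (e n) z\<bar>)"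
      using integral_norm_bound[of lborel "\<lambda>z. planar 1 z * rest (e n) z"] by simp
    also have "\<dots> \<le> (LINT z|lborel. \<bar>planar 1 z\<bar> * (1 / (a\<^sup>2 * real K)))"
    proof (rule integral_mono)
      fix z
      show "\<bar>planar 1 z * rest (e n) z\<bar> \<le> \<bar>planar 1 z\<bar> * (1 / (a\<^sup>2 * real K))"
      proof (cases "\<bar>fst z\<bar> \<le> a \<and> \<bar>snd z\<bar> \<le> a")
        case True thus ?thesis unfolding abs_mult using rest_bound[OF e(1)] by (intro mult_left_mono) auto
      next
        case False hence "planar 1 z = 0" by (intro planar_out) auto
        thus ?thesis by simp
      qed
    qed (use intR ip in auto)
    also have "\<dots> = (LINT z|lborel. \<bar>planar 1 z\<bar>) * (1 / (a\<^sup>2 * real K))" by (rule integral_mult_left_zero)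
    finally show ?thesis .
  qed
  have \<Omega>: "?\<Omega> \<longlonglongrightarrow> 0"
  proof (rule Lim_null_comparison)
    show "\<forall>\<^sub>F n in sequentially. norm (?\<Omega> n) \<le> X.omega_const * (Y.omega_const * L * e n) * e n"
      using omega_pair_bound(2)[OF e(1)] by (intro always_eventually) simp
    have "(\<lambda>n. X.omega_const * (Y.omega_const * L * e n) * e n) \<longlonglongrightarrow> X.omega_const * (Y.omega_const * L * 0) * 0"
      by (intro tendsto_intros e0)
    thus "(\<lambda>n. X.omega_const * (Y.omega_const * L * e n) * e n) \<longlonglongrightarrow> 0" by simp
  qed
  have "(\<lambda>n. A n - 1 / (2 * pi) * (?\<Theta> n - 2 * ?\<Omega> n)) \<longlonglongrightarrow>
     side_sum 1 + S.side_sum 2 - 1 / (2 * pi) * (2 * pi\<^sup>2 * planar 1 (x1, x2) - 2 * 0)"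
    by (intro tendsto_intros A \<Omega> theta_sum_limit(1) e e0)
  also have "1 / (2 * pi) * (2 * pi\<^sup>2 * planar 1 (x1, x2) - 2 * 0) = pi * planar 1 (x1, x2)"
    by (simp add: power2_eq_square)
  finally have lim: "(\<lambda>n. \<bar>A n - 1 / (2 * pi) * (?\<Theta> n - 2 * ?\<Omega> n)\<bar>) \<longlonglongrightarrow> \<bar>side_sum 1 + S.side_sum 2 - pi * planar 1 (x1, x2)\<bar>"
    by (rule tendsto_rabs)
  show ?thesis
  proof (rule tendsto_upperbound[OF lim])
    show "\<forall>\<^sub>F n in sequentially. \<bar>A n - 1 / (2 * pi) * (?\<Theta> n - 2 * ?\<Omega> n)\<bar> \<le> (LINT z|lborel. \<bar>planar 1 z\<bar>) / (2 * pi * a\<^sup>2 * real K)"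
    proof (intro always_eventually allI)
      fix n
      have "A n - 1 / (2 * pi) * (?\<Theta> n - 2 * ?\<Omega> n) = 1 / (2 * pi) * ?R n" unfolding An by (simp only: right_diff_distrib distrib_left)
      hence "\<bar>A n - 1 / (2 * pi) * (?\<Theta> n - 2 * ?\<Omega> n)\<bar> = 1 / (2 * pi) * \<bar>?R n\<bar>" by (simp add: abs_mult)
      also have "\<dots> \<le> 1 / (2 * pi) * ((LINT z|lborel. \<bar>planar 1 z\<bar>) * (1 / (a\<^sup>2 * real K)))" using R by (intro mult_left_mono) auto
      finally show "\<bar>A n - 1 / (2 * pi) * (?\<Theta> n - 2 * ?\<Omega> n)\<bar> \<le> (LINT z|lborel. \<bar>planar 1 z\<bar>) / (2 * pi * a\<^sup>2 * real K)"
        by (simp add: mult_ac)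
    qed
  qed simp
qed

end

section \<open>Replicated potentials\<close>

context c11_square
begin

definition odd_pt :: "real \<Rightarrow> bool" where
  "odd_pt t \<longleftrightarrow> (\<exists>m::int. t = (2 * of_int m + 1) * a)"

definition tile_no :: "real \<Rightarrow> int" where
  "tile_no t = \<lfloor>(t + a) / (2 * a)\<rfloor>"

text \<open>\<open>sg\<close> and \<open>fd\<close> are the sign and the folded coordinate of the
  replication. Both are 0 at the odd multiples of \<open>a\<close>, so the replicated function
  vanishes there while \<open>fd\<close> still names a point of the side.\<close>

definition sg :: "real \<Rightarrow> real" where
  "sg t = (if odd_pt t then 0 else (-1) powi tile_no t)"

definition fd :: "real \<Rightarrow> real" where
  "fd t = (if odd_pt t then 0 else (-1) powi tile_no t * (t - 2 * of_int (tile_no t) * a))"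

lemma tile_no_unique: "\<bar>t - 2 * of_int n * a\<bar> < a \<Longrightarrow> tile_no t = n"
proof -
  assume "\<bar>t - 2 * of_int n * a\<bar> < a"
  hence "of_int n \<le> (t + a) / (2 * a)" "(t + a) / (2 * a) < of_int n + 1"
    using a by (auto simp: field_simps abs_less_iff)
  thus ?thesis unfolding tile_no_def by (rule floor_unique)
qed

lemma tile_no_bound: "\<not> odd_pt t \<Longrightarrow> \<bar>t - 2 * of_int (tile_no t) * a\<bar> < a"
proof -
  assume n: "\<not> odd_pt t"
  have "of_int (tile_no t) \<le> (t + a) / (2 * a)" "(t + a) / (2 * a) < of_int (tile_no t) + 1"
    unfolding tile_no_def by linarith+
  hence "2 * of_int (tile_no t) * a - a \<le> t" "t < 2 * of_int (tile_no t) * a + a"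
    using a by (auto simp: field_simps)
  moreover have "t \<noteq> 2 * of_int (tile_no t) * a - a"
  proof
    assume "t = 2 * of_int (tile_no t) * a - a"
    hence "t = (2 * of_int (tile_no t - 1) + 1) * a" by (simp add: algebra_simps)
    thus False using n unfolding odd_pt_def by blast
  qed
  ultimately show ?thesis by (simp add: abs_less_iff)
qed

lemma not_odd_pt: "\<bar>t - 2 * of_int n * a\<bar> < a \<Longrightarrow> \<not> odd_pt t"
proof
  assume b: "\<bar>t - 2 * of_int n * a\<bar> < a" and "odd_pt t"
  then obtain m :: int where "t = (2 * of_int m + 1) * a" by (auto simp: odd_pt_def)
  hence "t - 2 * of_int n * a = (1 + 2 * of_int (m - n)) * a" by (simp add: algebra_simps)
  hence "\<bar>1 + 2 * real_of_int (m - n)\<bar> * a < 1 * a" using b a by (simp add: abs_mult)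
  hence "\<bar>1 + 2 * real_of_int (m - n)\<bar> < 1" using a by (simp only: mult_less_cancel_right)
  thus False using lattice_images.odd_abs_ge[of a 0 1 "m - n"] a by (simp add: lattice_images_def)
qed

lemma abs_powi: "\<bar>(-1::real) powi n\<bar> = 1" "((-1::real) powi n) * ((-1) powi n) = 1"
  by (simp_all add: minus_one_powi)

lemma fd_le: "\<bar>fd t\<bar> \<le> a"
  using tile_no_bound[of t] a by (auto simp: fd_def abs_mult abs_powi)

lemma abs_sg_le: "\<bar>sg t\<bar> \<le> 1"
  by (simp add: sg_def abs_powi)

lemma replicate_alt: "replicate_1D a h t = sg t * h (fd t)"
proof (cases "odd_pt t")
  case True
  thus ?thesis by (simp add: replicate_1D_def sg_def odd_pt_def[symmetric])
next
  case False
  have "(THE n::int. \<bar>t - 2 * of_int n * a\<bar> < a) = tile_no t"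
  proof (rule the_equality)
    show "\<bar>t - 2 * of_int (tile_no t) * a\<bar> < a" by (rule tile_no_bound[OF False])
    show "n = tile_no t" if "\<bar>t - 2 * of_int n * a\<bar> < a" for n using tile_no_unique[OF that] by simp
  qed
  thus ?thesis using False by (simp add: replicate_1D_def sg_def fd_def odd_pt_def[symmetric] Let_def)
qed

lemma tile_measurable [measurable]:
  "tile_no \<in> borel \<rightarrow>\<^sub>M count_space UNIV" "Measurable.pred borel odd_pt"
  "sg \<in> borel_measurable borel" "fd \<in> borel_measurable borel"
proof -
  show t: "tile_no \<in> borel \<rightarrow>\<^sub>M count_space UNIV" unfolding tile_no_def by measurable
  show o: "Measurable.pred borel odd_pt" unfolding odd_pt_def by measurable
  note [measurable] = t o
  have [measurable]: "(\<lambda>t. (-1::real) powi tile_no t) \<in> borel_measurable borel"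
    "(\<lambda>t. real_of_int (tile_no t)) \<in> borel_measurable borel"
    by (auto intro: measurable_compose[OF t])
  show "sg \<in> borel_measurable borel" "fd \<in> borel_measurable borel"
    unfolding sg_def fd_def by measurable
qed

definition bf :: "2 \<Rightarrow> real \<Rightarrow> real \<Rightarrow> real^2" where
  "bf i \<sigma> t = bd i \<sigma> (fd t)"

definition pot :: "2 \<Rightarrow> real \<Rightarrow> real \<Rightarrow> real \<Rightarrow> real" where
  "pot i \<sigma> t s = sg t * pv (\<lambda>r. r * circ_mean f (bf i \<sigma> t) r) s"

text \<open>By \<open>pot_deriv\<close> this is the derivative of \<open>pot\<close> in
  \<open>s\<close> divided by \<open>s\<close>; the missing factor is the one that cancels the norm
  in the chain rule.\<close>

definition dpot :: "2 \<Rightarrow> real \<Rightarrow> real \<Rightarrow> real \<Rightarrow> real" where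
  "dpot i \<sigma> t s = sg t * pv (dmean (bf i \<sigma> t)) s"

abbreviation R :: real where "R \<equiv> 2 * sqrt 2 * a"

lemma profile_bf: "\<sigma> \<in> sgns \<Longrightarrow> radial_profile L R (circ_mean f (bf i \<sigma> t)) (dmean (bf i \<sigma> t))"
  unfolding bf_def by (rule profile_bd[OF _ fd_le])

lemma integrand_alt:
  "pv_integrand a f (i, \<sigma>) y s r = sg (y $ other i) * (r * circ_mean f (bf i \<sigma> (y $ other i)) r / (r\<^sup>2 - s\<^sup>2))"
  by (simp add: pv_integrand_def repl_mean_def replicate_alt bf_def bd_def)

lemma pv_link:
  assumes \<sigma>: "\<sigma> \<in> sgns" and s: "s > 0"
  shows "pv_exists 0 R s (pv_integrand a f (i, \<sigma>) y s)"
    and "pv_potential a f (i, \<sigma>) y s = pot i \<sigma> (y $ other i) s"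
proof -
  define t where "t = y $ other i"
  interpret radial_profile L R "circ_mean f (bf i \<sigma> t)" "dmean (bf i \<sigma> t)" by (rule profile_bf[OF \<sigma>])
  have eq: "pv_integrand a f (i, \<sigma>) y s = (\<lambda>r. sg t * (r * circ_mean f (bf i \<sigma> t) r / (r\<^sup>2 - s\<^sup>2)))"
    unfolding integrand_alt[abs_def] t_def ..
  have lim: "((\<lambda>\<epsilon>. LINT r:({0..R} - {s - \<epsilon><..<s + \<epsilon>})|lborel. pv_integrand a f (i, \<sigma>) y s r) \<longlongrightarrow> pot i \<sigma> t s) (at_right 0)"
    unfolding eq pot_def set_integral_mult_right
    by (intro tendsto_mult tendsto_const pv_cut_tendsto[OF lip_supp_rM s]) simp
  have "set_integrable lborel ({0..R} - {s - \<epsilon><..<s + \<epsilon>}) (pv_integrand a f (i, \<sigma>) y s)" if "\<epsilon> > 0" for \<epsilon>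
    unfolding eq by (intro set_integrable_mult_right pv_cut_integrable[OF lip_supp_rM s that])
  thus "pv_exists 0 R s (pv_integrand a f (i, \<sigma>) y s)" unfolding pv_exists_def using lim by blast
  show "pv_potential a f (i, \<sigma>) y s = pot i \<sigma> (y $ other i) s"
    unfolding pv_potential_def pv_integral_def t_def[symmetric]
    by (rule tendsto_Lim[OF _ lim]) simp
qed

lemma pot_deriv:
  assumes \<sigma>: "\<sigma> \<in> sgns" and s: "s > 0"
  shows "(pot i \<sigma> t has_real_derivative (s * dpot i \<sigma> t s)) (at s)"
proof -
  interpret radial_profile L R "circ_mean f (bf i \<sigma> t)" "dmean (bf i \<sigma> t)" by (rule profile_bf[OF \<sigma>])
  from DERIV_cmult[OF pv_rM_deriv[OF s], of "sg t"] show ?thesis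
    unfolding pot_def[abs_def] dpot_def by (simp add: mult_ac)
qed

lemma pv_potential_deriv:
  assumes \<sigma>: "\<sigma> \<in> sgns" and s: "s > 0"
  shows "(pv_potential a f (i, \<sigma>) y has_real_derivative (s * dpot i \<sigma> (y $ other i) s)) (at s)"
  by (rule has_field_derivative_transform_within_open[OF pot_deriv[OF \<sigma> s], of "{0<..}"])
     (use s pv_link(2)[OF \<sigma>] in auto)

text \<open>Polar coordinates with weight 1: the integral does not depend on the centre. Far away
  the potentials of all points of a line thus have the same leading term up to the sign
  \<open>sg\<close>.\<close>

lemma pot_mass:
  assumes \<sigma>: "\<sigma> \<in> sgns"
  shows "(LINT r:{0..}|lborel. r * circ_mean f (bf i \<sigma> t) r) = 1 / (2 * pi) * (LINT z|lborel. f z)"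
proof -
  interpret radial_profile L R "circ_mean f (bf i \<sigma> t)" "dmean (bf i \<sigma> t)" by (rule profile_bf[OF \<sigma>])
  let ?M = "circ_mean f (bf i \<sigma> t)"
  have "(LINT r:{0<..<R}|lborel. r * 1 * (2 * pi * ?M r)) = (LINT z|lborel. f z * 1)"
    by (rule polar_coordinates) (auto simp: bf_def intro!: bd_boundary[OF \<sigma> fd_le])
  moreover have "(LINT r:{0<..<R}|lborel. r * 1 * (2 * pi * ?M r)) = (LINT r|lborel. 2 * pi * (indicator {0..} r *\<^sub>R (r * ?M r)))"
    unfolding set_lebesgue_integral_def
  proof (intro Bochner_Integration.integral_cong refl)
    fix r
    show "indicator {0<..<R} r *\<^sub>R (r * 1 * (2 * pi * ?M r)) = 2 * pi * (indicator {0..} r *\<^sub>R (r * ?M r))"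
      by (cases "R \<le> r") (use M_R in \<open>auto simp: indicator_def\<close>)
  qed
  ultimately have "2 * pi * (LINT r:{0..}|lborel. r * ?M r) = (LINT z|lborel. f z)"
    unfolding integral_mult_right_zero set_lebesgue_integral_def by simp
  thus ?thesis by (simp add: field_simps)
qed

text \<open>The integral of a derivative between two zeros of the mean. It removes the leading term
  in \<open>pv_decay\<close> and gives \<open>dpot\<close> its fourth-power decay.\<close>

lemma dmean_mass:
  assumes \<sigma>: "\<sigma> \<in> sgns"
  shows "(LINT r:{0..}|lborel. dmean (bf i \<sigma> t) r) = 0"
proof -
  interpret radial_profile L R "circ_mean f (bf i \<sigma> t)" "dmean (bf i \<sigma> t)" by (rule profile_bf[OF \<sigma>])
  have "(LINT r:{0..}|lborel. dmean (bf i \<sigma> t) r) = (LINT r|lborel. indicator {0..R} r *\<^sub>R dmean (bf i \<sigma> t) r)"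
    unfolding set_lebesgue_integral_def
  proof (intro Bochner_Integration.integral_cong refl)
    fix r
    show "indicator {0..} r *\<^sub>R dmean (bf i \<sigma> t) r = indicator {0..R} r *\<^sub>R dmean (bf i \<sigma> t) r"
      by (cases "R \<le> r") (use M'_R in \<open>auto simp: indicator_def\<close>)
  qed
  also have "\<dots> = circ_mean f (bf i \<sigma> t) R - circ_mean f (bf i \<sigma> t) 0"
  proof (rule integral_FTC_atLeastAtMost)
    show "(circ_mean f (bf i \<sigma> t) has_vector_derivative dmean (bf i \<sigma> t) r) (at r within {0..R})" for r
      using has_field_derivative_at_within[OF deriv[of r]] by (simp add: has_real_derivative_iff_has_vector_derivative)
  qed (use R continuous_on_subset[OF cont_M'] in auto)
  finally show ?thesis using M_0 M_R by simp
qed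

section \<open>Decay and cancellation along one line\<close>

definition mass :: real where "mass = 1 / (2 * pi) * (LINT z|lborel. f z)"
text \<open>The constants of \<open>pv_decay\<close>: \<open>C1\<close> for the derivative of the
  mean, \<open>C2\<close> for \<open>r\<close> times the mean, whose Lipschitz constant is
  \<open>2 * L * R\<^sup>2\<close>.\<close>

definition C1 :: real where "C1 = 28 * L * R ^ 4"
definition C2 :: real where "C2 = 28 * (2 * L * R\<^sup>2) * R ^ 4"

lemma C_nonneg: "0 \<le> C1" "0 \<le> C2"
  using L a by (auto simp: C1_def C2_def)

lemma dpot_bound:
  assumes "\<sigma> \<in> sgns" "s > 0" shows "\<bar>dpot i \<sigma> t s\<bar> \<le> C1 / s ^ 4"
proof -
  interpret radial_profile L R "circ_mean f (bf i \<sigma> t)" "dmean (bf i \<sigma> t)" by (rule profile_bf[OF assms(1)])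
  have "\<bar>pv (dmean (bf i \<sigma> t)) s\<bar> \<le> C1 / s ^ 4"
    using pv_decay[OF lip_supp_M' assms(2)] by (simp add: dmean_mass[OF assms(1)] C1_def)
  moreover have "\<bar>dpot i \<sigma> t s\<bar> \<le> 1 * \<bar>pv (dmean (bf i \<sigma> t)) s\<bar>"
    unfolding dpot_def abs_mult using abs_sg_le by (intro mult_right_mono) auto
  ultimately show ?thesis by simp
qed

lemma pot_asymp:
  assumes "\<sigma> \<in> sgns" "s > 0" shows "\<bar>pot i \<sigma> t s + mass * (sg t / s\<^sup>2)\<bar> \<le> C2 / s ^ 4"
proof -
  interpret radial_profile L R "circ_mean f (bf i \<sigma> t)" "dmean (bf i \<sigma> t)" by (rule profile_bf[OF assms(1)])
  have "\<bar>pv (\<lambda>r. r * circ_mean f (bf i \<sigma> t) r) s + mass / s\<^sup>2\<bar> \<le> C2 / s ^ 4"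
    using pv_decay[OF lip_supp_rM assms(2)] by (simp add: pot_mass[OF assms(1)] C2_def mass_def)
  moreover have "pot i \<sigma> t s + mass * (sg t / s\<^sup>2) = sg t * (pv (\<lambda>r. r * circ_mean f (bf i \<sigma> t) r) s + mass / s\<^sup>2)"
    by (simp add: pot_def algebra_simps)
  ultimately have *: "\<bar>pv (\<lambda>r. r * circ_mean f (bf i \<sigma> t) r) s + mass / s\<^sup>2\<bar> \<le> C2 / s ^ 4"
    "pot i \<sigma> t s + mass * (sg t / s\<^sup>2) = sg t * (pv (\<lambda>r. r * circ_mean f (bf i \<sigma> t) r) s + mass / s\<^sup>2)" by auto
  have "\<bar>sg t * x\<bar> \<le> 1 * \<bar>x\<bar>" for x
    unfolding abs_mult using abs_sg_le by (intro mult_right_mono) auto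
  from this[of "pv (\<lambda>r. r * circ_mean f (bf i \<sigma> t) r) s + mass / s\<^sup>2"] *(1) show ?thesis unfolding *(2) by simp
qed

lemma pot_measurable [measurable]:
  assumes [measurable]: "s \<in> borel_measurable borel"
  shows "(\<lambda>t. pot i \<sigma> t (s t)) \<in> borel_measurable borel" "(\<lambda>t. dpot i \<sigma> t (s t)) \<in> borel_measurable borel"
proof -
  have [measurable]: "bf i \<sigma> \<in> borel_measurable borel" unfolding bf_def by measurable
  have 1: "(\<lambda>z. (bf i \<sigma> (fst z), snd z)) \<in> borel \<Otimes>\<^sub>M borel \<rightarrow>\<^sub>M borel \<Otimes>\<^sub>M borel" by measurable
  have [measurable]: "(\<lambda>(t, r). dmean (bf i \<sigma> t) r) \<in> borel_measurable (borel \<Otimes>\<^sub>M borel)"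
    "(\<lambda>z. circ_mean f (bf i \<sigma> (fst z)) (snd z)) \<in> borel_measurable (borel \<Otimes>\<^sub>M borel)"
    using measurable_compose[OF 1 means_measurable(2)] measurable_compose[OF 1 means_measurable(1)]
    by (simp_all add: case_prod_beta')
  have [measurable]: "(\<lambda>(t, r). r * circ_mean f (bf i \<sigma> t) r) \<in> borel_measurable (borel \<Otimes>\<^sub>M borel)"
    unfolding case_prod_beta' by measurable
  show "(\<lambda>t. pot i \<sigma> t (s t)) \<in> borel_measurable borel" unfolding pot_def by measurable
  show "(\<lambda>t. dpot i \<sigma> t (s t)) \<in> borel_measurable borel" unfolding dpot_def by measurable
qed

definition dist_line :: "real \<Rightarrow> real \<Rightarrow> real \<Rightarrow> real" where
  "dist_line W c t = sqrt (W\<^sup>2 + (c - t)\<^sup>2)"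

lemma dist_line_measurable [measurable]: "dist_line W c \<in> borel_measurable borel"
  unfolding dist_line_def by measurable

lemma dist_line_props:
  assumes "W \<noteq> 0"
  shows "\<bar>W\<bar> \<le> dist_line W c t" "0 < dist_line W c t" "(dist_line W c t)\<^sup>2 = W\<^sup>2 + (c - t)\<^sup>2"
proof -
  show 1: "\<bar>W\<bar> \<le> dist_line W c t" unfolding dist_line_def by (rule real_le_rsqrt) simp
  thus "0 < dist_line W c t" using assms by linarith
  show "(dist_line W c t)\<^sup>2 = W\<^sup>2 + (c - t)\<^sup>2" by (simp add: dist_line_def add_nonneg_nonneg)
qed

lemma inverse_sq_line:
  assumes W: "W \<noteq> 0"
  shows "integrable lborel (\<lambda>t. 1 / (W\<^sup>2 + (c - t)\<^sup>2))" "(LINT t|lborel. 1 / (W\<^sup>2 + (c - t)\<^sup>2)) = pi / \<bar>W\<bar>"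
proof -
  let ?g = "\<lambda>t. 1 / (W\<^sup>2 + (c - t)\<^sup>2)"
  have eq: "?g (c + \<bar>W\<bar> * u) = (1 / W\<^sup>2) * (1 / (1 + (u + 0)\<^sup>2))" for u
  proof -
    have "W\<^sup>2 + (c - (c + \<bar>W\<bar> * u))\<^sup>2 = W\<^sup>2 * (1 + (u + 0)\<^sup>2)" by (simp add: power_mult_distrib algebra_simps)
    thus ?thesis by (simp only: divide_divide_eq_left mult_1 times_divide_times_eq mult_1_right)
  qed
  have nz: "\<bar>W\<bar> \<noteq> 0" using W by simp
  have "integrable lborel (\<lambda>u. ?g (c + \<bar>W\<bar> * u))"
    unfolding eq by (intro integrable_mult_right lorentz_integrable)
  thus "integrable lborel ?g" using lborel_integrable_real_affine_iff[OF nz, of ?g c] by simp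
  have "(LINT t|lborel. ?g t) = \<bar>W\<bar> * (LINT u|lborel. ?g (c + \<bar>W\<bar> * u))"
    using lborel_integral_real_affine[OF nz, of ?g c] by simp
  also have "\<dots> = \<bar>W\<bar> * (1 / W\<^sup>2 * pi)" unfolding eq integral_mult_right_zero lorentz_integral ..
  also have "\<dots> = pi / \<bar>W\<bar>" using W by (simp add: power2_eq_square abs_if)
  finally show "(LINT t|lborel. ?g t) = pi / \<bar>W\<bar>" .
qed

lemma inverse_fourth_le:
  assumes W: "W \<noteq> 0"
  shows "1 / dist_line W c t ^ 4 \<le> 1 / W\<^sup>2 * (1 / (W\<^sup>2 + (c - t)\<^sup>2))"
proof -
  have p: "0 < W\<^sup>2" "0 < W\<^sup>2 + (c - t)\<^sup>2" using W by (auto simp: add_pos_nonneg)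
  have "dist_line W c t ^ 4 = (dist_line W c t)\<^sup>2 * (dist_line W c t)\<^sup>2" by (simp add: power4_eq_xxxx power2_eq_square)
  also have "\<dots> = (W\<^sup>2 + (c - t)\<^sup>2) * (W\<^sup>2 + (c - t)\<^sup>2)" unfolding dist_line_props(3)[OF W] ..
  also have "\<dots> \<ge> W\<^sup>2 * (W\<^sup>2 + (c - t)\<^sup>2)" using p by (intro mult_right_mono) auto
  finally have "1 / dist_line W c t ^ 4 \<le> 1 / (W\<^sup>2 * (W\<^sup>2 + (c - t)\<^sup>2))" using p dist_line_props(2)[OF W, of c t] by (intro divide_left_mono mult_pos_pos) auto
  thus ?thesis by simp
qed

lemma dpot_line:
  assumes \<sigma>: "\<sigma> \<in> sgns" and W: "W \<noteq> 0"
  shows "\<bar>W * dpot i \<sigma> t (dist_line W c t)\<bar> \<le> C1 / \<bar>W\<bar> * (1 / (W\<^sup>2 + (c - t)\<^sup>2))"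
    and "integrable lborel (\<lambda>t. W * dpot i \<sigma> t (dist_line W c t))"
    and "\<bar>LINT t|lborel. W * dpot i \<sigma> t (dist_line W c t)\<bar> \<le> C1 * pi / W\<^sup>2"
proof -
  show b: "\<bar>W * dpot i \<sigma> t (dist_line W c t)\<bar> \<le> C1 / \<bar>W\<bar> * (1 / (W\<^sup>2 + (c - t)\<^sup>2))" for t
  proof -
    have "\<bar>dpot i \<sigma> t (dist_line W c t)\<bar> \<le> C1 * (1 / dist_line W c t ^ 4)"
      using dpot_bound[OF \<sigma> dist_line_props(2)[OF W]] by simp
    also have "\<dots> \<le> C1 * (1 / W\<^sup>2 * (1 / (W\<^sup>2 + (c - t)\<^sup>2)))"
      by (intro mult_left_mono inverse_fourth_le W C_nonneg)
    finally have "\<bar>W\<bar> * \<bar>dpot i \<sigma> t (dist_line W c t)\<bar> \<le> \<bar>W\<bar> * (C1 * (1 / W\<^sup>2 * (1 / (W\<^sup>2 + (c - t)\<^sup>2))))"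
      by (intro mult_left_mono) auto
    also have "\<dots> = C1 / \<bar>W\<bar> * (1 / (W\<^sup>2 + (c - t)\<^sup>2))" using W by (simp add: power2_eq_square abs_if)
    finally show ?thesis by (simp add: abs_mult)
  qed
  have i: "integrable lborel (\<lambda>t. C1 / \<bar>W\<bar> * (1 / (W\<^sup>2 + (c - t)\<^sup>2)))" by (intro integrable_mult_right inverse_sq_line W)
  show int: "integrable lborel (\<lambda>t. W * dpot i \<sigma> t (dist_line W c t))"
    by (rule Bochner_Integration.integrable_bound[OF i]) (use b order_trans[OF b abs_ge_self] in auto)
  have "\<bar>LINT t|lborel. W * dpot i \<sigma> t (dist_line W c t)\<bar> \<le> (LINT t|lborel. \<bar>W * dpot i \<sigma> t (dist_line W c t)\<bar>)"
    using integral_norm_bound[of lborel "\<lambda>t. W * dpot i \<sigma> t (dist_line W c t)"] by simp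
  also have "\<dots> \<le> (LINT t|lborel. C1 / \<bar>W\<bar> * (1 / (W\<^sup>2 + (c - t)\<^sup>2)))"
    by (rule integral_mono) (use int i b in auto)
  also have "\<dots> = C1 * pi / W\<^sup>2"
    unfolding integral_mult_right_zero inverse_sq_line(2)[OF W] by (simp add: power2_eq_square)
  finally show "\<bar>LINT t|lborel. W * dpot i \<sigma> t (dist_line W c t)\<bar> \<le> C1 * pi / W\<^sup>2" .
qed

lemma sg_shift: "sg (t + 2 * a) = - sg t"
proof -
  have "odd_pt (t + 2 * a) \<longleftrightarrow> odd_pt t"
  proof
    assume "odd_pt (t + 2 * a)"
    then obtain m :: int where "t + 2 * a = (2 * of_int m + 1) * a" by (auto simp: odd_pt_def)
    hence "t = (2 * of_int (m - 1) + 1) * a" by (simp add: algebra_simps)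
    thus "odd_pt t" unfolding odd_pt_def by blast
  next
    assume "odd_pt t"
    then obtain m :: int where "t = (2 * of_int m + 1) * a" by (auto simp: odd_pt_def)
    hence "t + 2 * a = (2 * of_int (m + 1) + 1) * a" by (simp add: algebra_simps)
    thus "odd_pt (t + 2 * a)" unfolding odd_pt_def by blast
  qed
  moreover have "tile_no (t + 2 * a) = tile_no t + 1"
  proof -
    have "(t + 2 * a + a) / (2 * a) = (t + a) / (2 * a) + 1" using a by (simp add: field_simps)
    thus ?thesis unfolding tile_no_def by simp
  qed
  ultimately show ?thesis by (simp add: sg_def minus_one_powi)
qed

text \<open>Under a shift by \<open>2 * a\<close> the sign \<open>sg\<close> flips, so the integral
  is half that of \<open>sg\<close> against the Lorentzian minus its translate. This difference
  gains a factor of order \<open>a / \<bar>W\<bar>\<close>, which improves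
  \<open>pi / \<bar>W\<bar>\<close> to a bound summable over the lines.\<close>

lemma sg_line:
  assumes W: "W \<noteq> 0"
  shows "integrable lborel (\<lambda>t. sg t * (1 / (W\<^sup>2 + (c - t)\<^sup>2)))"
    and "\<bar>LINT t|lborel. sg t * (1 / (W\<^sup>2 + (c - t)\<^sup>2))\<bar> \<le> pi * a / W\<^sup>2"
proof -
  let ?g = "\<lambda>c t. 1 / (W\<^sup>2 + (c - t)\<^sup>2)"
  have i: "integrable lborel (\<lambda>t. sg t * ?g c t)" for c
    by (rule Bochner_Integration.integrable_bound[OF inverse_sq_line(1)[OF W, of c]])
       (use abs_sg_le in \<open>auto simp: abs_mult intro!: mult_left_le_one_le divide_right_mono\<close>)
  show "integrable lborel (\<lambda>t. sg t * ?g c t)" by (rule i)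
  define c' where "c' = c - 2 * a"
  have "(LINT t|lborel. sg t * ?g c t) = (LINT t|lborel. sg (2 * a + 1 * t) * ?g c (2 * a + 1 * t))"
    using lborel_integral_real_affine[of 1 "\<lambda>t. sg t * ?g c t" "2 * a"] by simp
  also have "\<dots> = (LINT t|lborel. - (sg t * ?g c' t))"
  proof (intro Bochner_Integration.integral_cong refl)
    fix t
    have "c - (2 * a + 1 * t) = c' - t" "sg (2 * a + 1 * t) = - sg t"
      using sg_shift[of t] by (simp_all add: c'_def add.commute)
    thus "sg (2 * a + 1 * t) * ?g c (2 * a + 1 * t) = - (sg t * ?g c' t)"
      by (simp only: mult_minus_left)
  qed
  finally have e1: "(LINT t|lborel. sg t * ?g c t) = - (LINT t|lborel. sg t * ?g c' t)" by simp
  have "2 * (LINT t|lborel. sg t * ?g c t) = (LINT t|lborel. sg t * ?g c t) - (LINT t|lborel. sg t * ?g c' t)"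
    using e1 by simp
  also have "\<dots> = (LINT t|lborel. sg t * ?g c t - sg t * ?g c' t)"
    by (rule Bochner_Integration.integral_diff[symmetric]) (rule i)+
  finally have e2: "2 * (LINT t|lborel. sg t * ?g c t) = (LINT t|lborel. sg t * ?g c t - sg t * ?g c' t)" .
  have b: "\<bar>sg t * ?g c t - sg t * ?g c' t\<bar> \<le> a / \<bar>W\<bar> * (?g c t + ?g c' t)" for t
  proof -
    define u v A B where "u = c - t" and "v = c' - t" and "A = W\<^sup>2 + u\<^sup>2" and "B = W\<^sup>2 + v\<^sup>2"
    have p: "A > 0" "B > 0" using W by (auto simp: A_def B_def add_pos_nonneg)
    have am: "\<bar>y\<bar> / (W\<^sup>2 + y\<^sup>2) \<le> 1 / (2 * \<bar>W\<bar>)" for y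
    proof -
      have "0 \<le> (\<bar>W\<bar> - \<bar>y\<bar>)\<^sup>2" by simp
      hence "2 * \<bar>W\<bar> * \<bar>y\<bar> \<le> W\<^sup>2 + y\<^sup>2" by (simp add: power2_eq_square algebra_simps)
      thus ?thesis using W by (simp add: divide_le_eq field_simps add_pos_nonneg)
    qed
    have uv: "v = u - 2 * a" by (simp add: u_def v_def c'_def)
    have "1 / A - 1 / B = (B - A) / (A * B)" using p by (simp add: field_simps)
    also have "B - A = - (2 * a) * (u + v)" by (simp add: A_def B_def uv power2_eq_square algebra_simps)
    finally have "\<bar>1 / A - 1 / B\<bar> = 2 * a * \<bar>u + v\<bar> / (A * B)" using p a by (simp add: abs_mult)
    also have "\<dots> \<le> 2 * a * (\<bar>u\<bar> + \<bar>v\<bar>) / (A * B)" using p a by (intro divide_right_mono mult_left_mono) auto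
    also have "\<dots> = 2 * a * ((\<bar>u\<bar> / A) * (1 / B) + (\<bar>v\<bar> / B) * (1 / A))" using p by (simp add: field_simps)
    also have "\<dots> \<le> 2 * a * ((1 / (2 * \<bar>W\<bar>)) * (1 / B) + (1 / (2 * \<bar>W\<bar>)) * (1 / A))"
      using am p a unfolding A_def B_def by (intro mult_left_mono add_mono mult_right_mono) auto
    also have "\<dots> = a / \<bar>W\<bar> * (1 / A + 1 / B)" using W by (simp add: field_simps)
    finally have "\<bar>?g c t - ?g c' t\<bar> \<le> a / \<bar>W\<bar> * (?g c t + ?g c' t)" by (simp add: A_def B_def u_def v_def)
    moreover have "\<bar>sg t * ?g c t - sg t * ?g c' t\<bar> \<le> 1 * \<bar>?g c t - ?g c' t\<bar>"
      unfolding right_diff_distrib[symmetric] abs_mult using abs_sg_le by (intro mult_right_mono) auto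
    ultimately show ?thesis unfolding mult_1 by (rule order_trans[rotated])
  qed
  have i2: "integrable lborel (\<lambda>t. a / \<bar>W\<bar> * (?g c t + ?g c' t))"
    by (intro integrable_mult_right Bochner_Integration.integrable_add inverse_sq_line W)
  have "\<bar>2 * (LINT t|lborel. sg t * ?g c t)\<bar> \<le> (LINT t|lborel. \<bar>sg t * ?g c t - sg t * ?g c' t\<bar>)"
    unfolding e2 using integral_norm_bound[of lborel "\<lambda>t. sg t * ?g c t - sg t * ?g c' t"] by simp
  also have "\<dots> \<le> (LINT t|lborel. a / \<bar>W\<bar> * (?g c t + ?g c' t))"
    by (rule integral_mono[OF _ i2 b]) (intro integrable_abs Bochner_Integration.integrable_diff i)
  also have "\<dots> = a / \<bar>W\<bar> * (pi / \<bar>W\<bar> + pi / \<bar>W\<bar>)"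
    unfolding integral_mult_right_zero Bochner_Integration.integral_add[OF inverse_sq_line(1)[OF W] inverse_sq_line(1)[OF W]] inverse_sq_line(2)[OF W] ..
  also have "\<dots> = 2 * (pi * a / W\<^sup>2)" using W by (simp add: field_simps power2_eq_square)
  finally show "\<bar>LINT t|lborel. sg t * ?g c t\<bar> \<le> pi * a / W\<^sup>2" by simp
qed

text \<open>The remainder after the mass term decays absolutely by \<open>pot_asymp\<close>; the
  mass term is controlled by the cancellation in \<open>sg_line\<close>.\<close>

lemma pot_line:
  assumes \<sigma>: "\<sigma> \<in> sgns" and W: "W \<noteq> 0"
  shows "integrable lborel (\<lambda>t. pot i \<sigma> t (dist_line W c t))"
    and "\<bar>LINT t|lborel. pot i \<sigma> t (dist_line W c t)\<bar> \<le> \<bar>mass\<bar> * (pi * a / W\<^sup>2) + C2 * pi / (W\<^sup>2 * \<bar>W\<bar>)"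
proof -
  let ?g = "\<lambda>t. 1 / (W\<^sup>2 + (c - t)\<^sup>2)"
  let ?r = "\<lambda>t. pot i \<sigma> t (dist_line W c t) + mass * (sg t * ?g t)"
  have b: "\<bar>?r t\<bar> \<le> C2 / W\<^sup>2 * ?g t" for t
  proof -
    have "\<bar>?r t\<bar> \<le> C2 * (1 / dist_line W c t ^ 4)"
      using pot_asymp[OF \<sigma> dist_line_props(2)[OF W], of i t c t] unfolding dist_line_props(3)[OF W] by simp
    also have "\<dots> \<le> C2 * (1 / W\<^sup>2 * ?g t)"
      by (intro mult_left_mono inverse_fourth_le W C_nonneg)
    finally show ?thesis by simp
  qed
  have i: "integrable lborel (\<lambda>t. C2 / W\<^sup>2 * ?g t)" by (intro integrable_mult_right inverse_sq_line W)
  have ir: "integrable lborel ?r"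
    by (rule Bochner_Integration.integrable_bound[OF i]) (use order_trans[OF b abs_ge_self] in auto)
  have ism: "integrable lborel (\<lambda>t. mass * (sg t * ?g t))" by (intro integrable_mult_right sg_line W)
  have eq: "(\<lambda>t. pot i \<sigma> t (dist_line W c t)) = (\<lambda>t. ?r t - mass * (sg t * ?g t))" by simp
  show "integrable lborel (\<lambda>t. pot i \<sigma> t (dist_line W c t))"
    unfolding eq by (rule Bochner_Integration.integrable_diff[OF ir ism])
  have "\<bar>LINT t|lborel. pot i \<sigma> t (dist_line W c t)\<bar> \<le> \<bar>LINT t|lborel. ?r t\<bar> + \<bar>mass * (LINT t|lborel. sg t * ?g t)\<bar>"
    unfolding eq Bochner_Integration.integral_diff[OF ir ism] integral_mult_right_zero by (rule abs_triangle_ineq4)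
  also have "\<bar>LINT t|lborel. ?r t\<bar> \<le> (LINT t|lborel. \<bar>?r t\<bar>)"
    using integral_norm_bound[of lborel ?r] by simp
  also have "\<dots> \<le> (LINT t|lborel. C2 / W\<^sup>2 * ?g t)"
    by (rule integral_mono[OF integrable_abs[OF ir] i b])
  also have "\<dots> = C2 * pi / (W\<^sup>2 * \<bar>W\<bar>)" unfolding integral_mult_right_zero inverse_sq_line(2)[OF W] by simp
  also have "\<bar>mass * (LINT t|lborel. sg t * ?g t)\<bar> \<le> \<bar>mass\<bar> * (pi * a / W\<^sup>2)"
    unfolding abs_mult by (intro mult_left_mono sg_line W) simp
  finally show "\<bar>LINT t|lborel. pot i \<sigma> t (dist_line W c t)\<bar> \<le> \<bar>mass\<bar> * (pi * a / W\<^sup>2) + C2 * pi / (W\<^sup>2 * \<bar>W\<bar>)"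
    by simp
qed

end

section \<open>Integrals over families of lines\<close>

text \<open>The mean value inequality bounds the difference quotients by \<open>w\<close>, so
  dominated convergence applies along every sequence tending to \<open>x0\<close>. It is used both
  along a line and over the index of the lines.\<close>

lemma has_derivative_integral_dominated:
  fixes g g' :: "'b \<Rightarrow> real \<Rightarrow> real"
  assumes \<delta>: "0 < \<delta>"
    and der: "\<And>\<omega> x. \<bar>x - x0\<bar> < \<delta> \<Longrightarrow> (g \<omega> has_real_derivative g' \<omega> x) (at x)"
    and int: "\<And>x. \<bar>x - x0\<bar> < \<delta> \<Longrightarrow> integrable M (\<lambda>\<omega>. g \<omega> x)"
    and meas: "(\<lambda>\<omega>. g' \<omega> x0) \<in> borel_measurable M"
    and bnd: "\<And>\<omega> x. \<bar>x - x0\<bar> < \<delta> \<Longrightarrow> \<bar>g' \<omega> x\<bar> \<le> w \<omega>" and w: "integrable M w"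
  shows "((\<lambda>x. LINT \<omega>|M. g \<omega> x) has_real_derivative (LINT \<omega>|M. g' \<omega> x0)) (at x0)"
  unfolding has_field_derivative_iff tendsto_at_iff_sequentially
proof (intro allI impI)
  fix X :: "nat \<Rightarrow> real" assume X: "\<forall>n. X n \<in> UNIV - {x0}" "X \<longlonglongrightarrow> x0"
  have "\<forall>\<^sub>F n in sequentially. \<bar>X n - x0\<bar> < \<delta>"
    using tendstoD[OF X(2) \<delta>] by (simp add: dist_real_def)
  then obtain N where N: "\<And>n. N \<le> n \<Longrightarrow> \<bar>X n - x0\<bar> < \<delta>" by (auto simp: eventually_sequentially)
  define Y where "Y n = X (n + N)" for n
  have Y: "Y n \<noteq> x0" "\<bar>Y n - x0\<bar> < \<delta>" for n using X(1) N by (auto simp: Y_def)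
  have Y0: "Y \<longlonglongrightarrow> x0" unfolding Y_def by (rule LIMSEQ_ignore_initial_segment[OF X(2)])
  have x0: "\<bar>x0 - x0\<bar> < \<delta>" using \<delta> by simp
  let ?q = "\<lambda>n \<omega>. (g \<omega> (Y n) - g \<omega> x0) / (Y n - x0)"
  have "(\<lambda>n. LINT \<omega>|M. ?q n \<omega>) \<longlonglongrightarrow> (LINT \<omega>|M. g' \<omega> x0)"
  proof (rule integral_dominated_convergence[OF meas _ w])
    show "?q n \<in> borel_measurable M" for n using int[OF Y(2)] int[OF x0] by measurable
    show "AE \<omega> in M. (\<lambda>n. ?q n \<omega>) \<longlonglongrightarrow> g' \<omega> x0"
    proof (rule AE_I2)
      fix \<omega>
      have "((\<lambda>y. (g \<omega> y - g \<omega> x0) / (y - x0)) \<longlongrightarrow> g' \<omega> x0) (at x0)"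
        using der[OF x0, of \<omega>] unfolding has_field_derivative_iff .
      from tendsto_compose_filtermap[THEN iffD1, OF _] this
      have "((\<lambda>y. (g \<omega> y - g \<omega> x0) / (y - x0)) \<circ> Y) \<longlonglongrightarrow> g' \<omega> x0"
        unfolding tendsto_at_iff_sequentially using Y(1) Y0 by blast
      thus "(\<lambda>n. ?q n \<omega>) \<longlonglongrightarrow> g' \<omega> x0" by (simp add: o_def)
    qed
    show "AE \<omega> in M. norm (?q n \<omega>) \<le> w \<omega>" for n
    proof (rule AE_I2)
      fix \<omega>
      have "norm (g \<omega> (Y n) - g \<omega> x0) \<le> w \<omega> * norm (Y n - x0)"
      proof (rule field_differentiable_bound[of "{x0 - \<delta><..<x0 + \<delta>}" "g \<omega>" "g' \<omega>"])
        fix z assume "z \<in> {x0 - \<delta><..<x0 + \<delta>}"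
        hence z: "\<bar>z - x0\<bar> < \<delta>" by (auto simp: abs_less_iff)
        show "(g \<omega> has_field_derivative g' \<omega> z) (at z within {x0 - \<delta><..<x0 + \<delta>})"
          by (rule has_field_derivative_at_within[OF der[OF z]])
        show "norm (g' \<omega> z) \<le> w \<omega>" using bnd[OF z] by simp
      qed (use Y(2)[of n] \<delta> in \<open>auto simp: abs_less_iff\<close>)
      thus "norm (?q n \<omega>) \<le> w \<omega>" using Y(1)[of n] by (simp add: divide_le_eq)
    qed
  qed
  also have "(\<lambda>n. LINT \<omega>|M. ?q n \<omega>) = (\<lambda>n. ((\<lambda>y. ((LINT \<omega>|M. g \<omega> y) - (LINT \<omega>|M. g \<omega> x0)) / (y - x0)) \<circ> X) (n + N))"
    using int[OF Y(2)] int[OF x0] by (simp add: Y_def[symmetric] fun_eq_iff)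
  finally show "((\<lambda>y. ((LINT \<omega>|M. g \<omega> y) - (LINT \<omega>|M. g \<omega> x0)) / (y - x0)) \<circ> X) \<longlonglongrightarrow> (LINT \<omega>|M. g' \<omega> x0)"
    by (rule LIMSEQ_offset)
qed

text \<open>Sums over the lines are written as integrals over the counting measure, so that dominated
  convergence and differentiation under the integral apply to them.\<close>

abbreviation cint :: "int measure" where "cint \<equiv> count_space UNIV"

lemma infsum_cint:
  fixes \<phi> :: "int \<Rightarrow> real"
  assumes "integrable cint \<phi>"
  shows "\<phi> summable_on UNIV" "infsum \<phi> UNIV = (LINT k|cint. \<phi> k)"
proof -
  have a: "Infinite_Set_Sum.abs_summable_on \<phi> UNIV" using assms by (simp add: Infinite_Set_Sum.abs_summable_on_def)
  show "\<phi> summable_on UNIV" by (rule abs_summable_summable[OF iffD2[OF abs_summable_equivalent a]])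
  show "infsum \<phi> UNIV = (LINT k|cint. \<phi> k)"
    using infsetsum_infsum[OF a] by (simp add: infsetsum_def)
qed

lemma cint_sq_integrable: "integrable cint (\<lambda>k. 1 / (1 + \<bar>real_of_int k\<bar>)\<^sup>2)"
proof -
  let ?f = "\<lambda>k::int. 1 / (1 + \<bar>real_of_int k\<bar>)\<^sup>2"
  have s: "summable (\<lambda>n. 1 / (1 + real n)\<^sup>2)"
    using inverse_power_summable[of 2, where ?'a=real] summable_Suc_iff[of "\<lambda>n. inverse ((real n)\<^sup>2)"]
    by (simp add: inverse_eq_divide add.commute)
  have "Infinite_Set_Sum.abs_summable_on (\<lambda>n. ?f (int n)) UNIV" "Infinite_Set_Sum.abs_summable_on (\<lambda>n. ?f (- int n)) UNIV"
    using s by (simp_all add: abs_summable_on_nat_iff')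
  hence "Infinite_Set_Sum.abs_summable_on ?f (range int)" "Infinite_Set_Sum.abs_summable_on ?f (range (\<lambda>n. - int n))"
    by (auto intro: abs_summable_on_reindex)
  hence "Infinite_Set_Sum.abs_summable_on ?f (range int \<union> range (\<lambda>n. - int n))"
    by (rule abs_summable_on_union)
  moreover have "range int \<union> range (\<lambda>n. - int n) = UNIV"
  proof -
    have "k \<in> range int \<union> range (\<lambda>n. - int n)" for k :: int
      by (cases "0 \<le> k") (auto simp: image_iff intro: exI[of _ "nat k"] exI[of _ "nat (- k)"])
    thus ?thesis by blast
  qed
  ultimately show ?thesis by (simp add: Infinite_Set_Sum.abs_summable_on_def)
qed

section \<open>Line integrals as functions of the reconstruction point\<close>

context c11_square
begin

definition Wl :: "real \<Rightarrow> real \<Rightarrow> int \<Rightarrow> real" where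
  "Wl x \<sigma> k = x - \<sigma> * a - 4 * of_int k * a"

text \<open>For \<open>k = 0\<close> this is the distance to the side; otherwise
  \<open>4 * \<bar>k\<bar> * a - 2 * a\<close> exceeds \<open>(1 + \<bar>k\<bar>) * a\<close>
  because \<open>\<bar>k\<bar> \<ge> 1\<close>. Inverse squares of the distances are thus summable,
  locally uniformly in \<open>x\<close>.\<close>

lemma Wl_lower:
  assumes \<sigma>: "\<sigma> \<in> sgns" and x: "\<bar>x\<bar> \<le> a - d"
  shows "d * (1 + \<bar>real_of_int k\<bar>) \<le> \<bar>Wl x \<sigma> k\<bar>"
proof (cases "k = 0")
  case True
  have "x \<le> a - d" "- x \<le> a - d" using x by linarith+
  hence "d \<le> \<bar>x - 1 * a\<bar>" "d \<le> \<bar>x - (-1) * a\<bar>" by linarith+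
  thus ?thesis using \<sigma> True by (auto simp: Wl_def)
next
  case False
  hence k: "1 \<le> \<bar>real_of_int k\<bar>" by linarith
  have d: "d \<le> a" using x by linarith
  show ?thesis
  proof (cases "0 \<le> d")
    case True
    have "\<bar>4 * of_int k * a\<bar> = 4 * \<bar>real_of_int k\<bar> * a" using a by (simp add: abs_mult)
    moreover have "\<bar>x - \<sigma> * a\<bar> \<le> 2 * a" using \<sigma> x True by auto
    ultimately have "4 * \<bar>real_of_int k\<bar> * a - 2 * a \<le> \<bar>Wl x \<sigma> k\<bar>" unfolding Wl_def by linarith
    moreover have "a * (1 + \<bar>real_of_int k\<bar>) \<le> 4 * \<bar>real_of_int k\<bar> * a - 2 * a"
      using mult_left_mono[OF k, of "3 * a"] a by (simp add: algebra_simps)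
    moreover have "d * (1 + \<bar>real_of_int k\<bar>) \<le> a * (1 + \<bar>real_of_int k\<bar>)" using d by (intro mult_right_mono) auto
    ultimately show ?thesis by linarith
  next
    case False
    hence "d * (1 + \<bar>real_of_int k\<bar>) \<le> 0" by (intro mult_nonpos_nonneg) auto
    thus ?thesis by linarith
  qed
qed

lemma Wl_nz: "\<sigma> \<in> sgns \<Longrightarrow> \<bar>x\<bar> < a \<Longrightarrow> Wl x \<sigma> k \<noteq> 0"
proof -
  assume "\<sigma> \<in> sgns" and x: "\<bar>x\<bar> < a"
  from Wl_lower[OF this(1), of x "a - \<bar>x\<bar>" k] have "(a - \<bar>x\<bar>) * (1 + \<bar>real_of_int k\<bar>) \<le> \<bar>Wl x \<sigma> k\<bar>" by simp
  moreover have "0 < (a - \<bar>x\<bar>) * (1 + \<bar>real_of_int k\<bar>)" using x by (intro mult_pos_pos) auto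
  ultimately show ?thesis by linarith
qed

lemma inverse_Wl_sq:
  assumes \<sigma>: "\<sigma> \<in> sgns" and x: "\<bar>x\<bar> \<le> a - d" and d: "0 < d"
  shows "1 / (Wl x \<sigma> k)\<^sup>2 \<le> 1 / d\<^sup>2 * (1 / (1 + \<bar>real_of_int k\<bar>)\<^sup>2)"
proof -
  have p: "0 < d * (1 + \<bar>real_of_int k\<bar>)" using d by (intro mult_pos_pos) auto
  have "(d * (1 + \<bar>real_of_int k\<bar>))\<^sup>2 \<le> \<bar>Wl x \<sigma> k\<bar>\<^sup>2"
    using p Wl_lower[OF \<sigma> x, of k] by (intro power_mono) auto
  hence "1 / (Wl x \<sigma> k)\<^sup>2 \<le> 1 / (d * (1 + \<bar>real_of_int k\<bar>))\<^sup>2" using p by (intro frac_le) auto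
  thus ?thesis by (simp add: power_mult_distrib)
qed

definition line_val :: "2 \<Rightarrow> real \<Rightarrow> real \<Rightarrow> real \<Rightarrow> int \<Rightarrow> real" where
  "line_val i \<sigma> c x k = (LINT t|lborel. pot i \<sigma> t (dist_line (Wl x \<sigma> k) c t))"

definition line_der :: "2 \<Rightarrow> real \<Rightarrow> real \<Rightarrow> real \<Rightarrow> int \<Rightarrow> real" where
  "line_der i \<sigma> c x k = (LINT t|lborel. Wl x \<sigma> k * dpot i \<sigma> t (dist_line (Wl x \<sigma> k) c t))"

lemma line_der_bound:
  assumes \<sigma>: "\<sigma> \<in> sgns" and x: "\<bar>x\<bar> \<le> a - d" and d: "0 < d"
  shows "\<bar>line_der i \<sigma> c x k\<bar> \<le> C1 * pi / d\<^sup>2 * (1 / (1 + \<bar>real_of_int k\<bar>)\<^sup>2)"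
proof -
  have "\<bar>x\<bar> < a" using x d by linarith
  hence "\<bar>line_der i \<sigma> c x k\<bar> \<le> C1 * pi / (Wl x \<sigma> k)\<^sup>2"
    unfolding line_der_def by (intro dpot_line(3) \<sigma> Wl_nz)
  also have "\<dots> = C1 * pi * (1 / (Wl x \<sigma> k)\<^sup>2)" by simp
  also have "\<dots> \<le> C1 * pi * (1 / d\<^sup>2 * (1 / (1 + \<bar>real_of_int k\<bar>)\<^sup>2))"
    using C_nonneg by (intro mult_left_mono inverse_Wl_sq assms) auto
  finally show ?thesis by simp
qed

lemma line_der_integrable:
  assumes \<sigma>: "\<sigma> \<in> sgns" and x: "\<bar>x\<bar> < a"
  shows "integrable cint (line_der i \<sigma> c x)"
proof (rule Bochner_Integration.integrable_bound)
  let ?d = "a - \<bar>x\<bar>"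
  show "integrable cint (\<lambda>k. C1 * pi / ?d\<^sup>2 * (1 / (1 + \<bar>real_of_int k\<bar>)\<^sup>2))"
    by (intro integrable_mult_right cint_sq_integrable)
  show "AE k in cint. norm (line_der i \<sigma> c x k) \<le> norm (C1 * pi / ?d\<^sup>2 * (1 / (1 + \<bar>real_of_int k\<bar>)\<^sup>2))"
    using order_trans[OF line_der_bound[OF \<sigma>, of x ?d] abs_ge_self] x by (intro AE_I2) simp
qed simp

lemma line_val_integrable:
  assumes \<sigma>: "\<sigma> \<in> sgns" and x: "\<bar>x\<bar> < a"
  shows "integrable cint (line_val i \<sigma> c x)"
proof (rule Bochner_Integration.integrable_bound)
  define d where "d = a - \<bar>x\<bar>"
  have d: "0 < d" "\<bar>x\<bar> \<le> a - d" using x by (auto simp: d_def)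
  define B where "B = \<bar>mass\<bar> * (pi * a) + C2 * pi / d"
  show "integrable cint (\<lambda>k. B / d\<^sup>2 * (1 / (1 + \<bar>real_of_int k\<bar>)\<^sup>2))"
    by (intro integrable_mult_right cint_sq_integrable)
  show "AE k in cint. norm (line_val i \<sigma> c x k) \<le> norm (B / d\<^sup>2 * (1 / (1 + \<bar>real_of_int k\<bar>)\<^sup>2))"
  proof (intro AE_I2)
    fix k
    have W: "Wl x \<sigma> k \<noteq> 0" by (rule Wl_nz[OF \<sigma> x])
    have "d * 1 \<le> d * (1 + \<bar>real_of_int k\<bar>)" using d by (intro mult_left_mono) auto
    hence dW: "d \<le> \<bar>Wl x \<sigma> k\<bar>" using Wl_lower[OF \<sigma> d(2), of k] by linarith
    have "\<bar>line_val i \<sigma> c x k\<bar> \<le> \<bar>mass\<bar> * (pi * a / (Wl x \<sigma> k)\<^sup>2) + C2 * pi / ((Wl x \<sigma> k)\<^sup>2 * \<bar>Wl x \<sigma> k\<bar>)"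
      unfolding line_val_def by (rule pot_line(2)[OF \<sigma> W])
    also have "\<dots> \<le> \<bar>mass\<bar> * (pi * a / (Wl x \<sigma> k)\<^sup>2) + C2 * pi / ((Wl x \<sigma> k)\<^sup>2 * d)"
      using dW d W C_nonneg by (intro add_left_mono divide_left_mono mult_left_mono mult_pos_pos) auto
    also have "\<dots> = B * (1 / (Wl x \<sigma> k)\<^sup>2)" by (simp add: B_def add_divide_distrib)
    also have "\<dots> \<le> B * (1 / d\<^sup>2 * (1 / (1 + \<bar>real_of_int k\<bar>)\<^sup>2))"
      unfolding B_def using C_nonneg a d
      by (intro mult_left_mono inverse_Wl_sq \<sigma>) auto
    finally have "\<bar>line_val i \<sigma> c x k\<bar> \<le> B / d\<^sup>2 * (1 / (1 + \<bar>real_of_int k\<bar>)\<^sup>2)" by simp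
    from order_trans[OF this abs_ge_self]
    show "norm (line_val i \<sigma> c x k) \<le> norm (B / d\<^sup>2 * (1 / (1 + \<bar>real_of_int k\<bar>)\<^sup>2))" by simp
  qed
qed simp

lemma dist_line_deriv:
  assumes W: "Wl x \<sigma> k \<noteq> 0"
  shows "((\<lambda>x. dist_line (Wl x \<sigma> k) c t) has_real_derivative Wl x \<sigma> k / dist_line (Wl x \<sigma> k) c t) (at x)"
proof -
  have p: "0 < (Wl x \<sigma> k)\<^sup>2 + (c - t)\<^sup>2" using W by (simp add: add_pos_nonneg)
  have W': "((\<lambda>x. (Wl x \<sigma> k)\<^sup>2 + (c - t)\<^sup>2) has_real_derivative 2 * Wl x \<sigma> k) (at x)"
    unfolding Wl_def by (auto intro!: derivative_eq_intros)
  from DERIV_chain2[OF DERIV_real_sqrt[OF p] W']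
  show ?thesis unfolding dist_line_def by (simp add: inverse_eq_divide)
qed

lemma pot_line_deriv:
  assumes \<sigma>: "\<sigma> \<in> sgns" and W: "Wl x \<sigma> k \<noteq> 0"
  shows "((\<lambda>x. pot i \<sigma> t (dist_line (Wl x \<sigma> k) c t)) has_real_derivative
     Wl x \<sigma> k * dpot i \<sigma> t (dist_line (Wl x \<sigma> k) c t)) (at x)"
proof -
  let ?s = "dist_line (Wl x \<sigma> k) c t"
  have "?s * dpot i \<sigma> t ?s * (Wl x \<sigma> k / ?s) = Wl x \<sigma> k * dpot i \<sigma> t ?s"
    using dist_line_props(2)[OF W, of c t] by simp
  with DERIV_chain2[OF pot_deriv[OF \<sigma> dist_line_props(2)[OF W]] dist_line_deriv[OF W, of c t], of i t]
  show ?thesis by simp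
qed

lemma line_val_deriv:
  assumes \<sigma>: "\<sigma> \<in> sgns" and x: "\<bar>x\<bar> < a"
  shows "((\<lambda>x. line_val i \<sigma> c x k) has_real_derivative line_der i \<sigma> c x k) (at x)"
  unfolding line_val_def line_der_def
proof (rule has_derivative_integral_dominated)
  define w where "w = \<bar>Wl x \<sigma> k\<bar>"
  \<comment> \<open>Nearby points stay in the range and keep at least half the distance
    \<open>w\<close> to the line, so a single Lorentzian dominates all the derivatives.\<close>
  define \<delta> where "\<delta> = min ((a - \<bar>x\<bar>) / 2) (w / 2)"
  have w: "0 < w" using Wl_nz[OF \<sigma> x] by (simp add: w_def)
  show "0 < \<delta>" using w x by (simp add: \<delta>_def)
  have near: "\<bar>y\<bar> < a" "w / 2 \<le> \<bar>Wl y \<sigma> k\<bar>" if "\<bar>y - x\<bar> < \<delta>" for y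
  proof -
    have "\<bar>y - x\<bar> < (a - \<bar>x\<bar>) / 2" "\<bar>y - x\<bar> < w / 2" using that by (auto simp: \<delta>_def)
    moreover have "Wl y \<sigma> k = Wl x \<sigma> k + (y - x)" by (simp add: Wl_def)
    ultimately have "\<bar>y\<bar> \<le> \<bar>x\<bar> + \<bar>y - x\<bar>" "w \<le> \<bar>Wl y \<sigma> k\<bar> + \<bar>y - x\<bar>"
      unfolding w_def by (linarith, simp)
    moreover have "\<bar>y - x\<bar> < (a - \<bar>x\<bar>) / 2" "\<bar>y - x\<bar> < w / 2" using that by (auto simp: \<delta>_def)
    ultimately show "\<bar>y\<bar> < a" "w / 2 \<le> \<bar>Wl y \<sigma> k\<bar>" using x by (auto simp: field_simps)
  qed
  show "integrable lborel (\<lambda>t. C1 / (w / 2) * (1 / ((w / 2)\<^sup>2 + (c - t)\<^sup>2)))"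
    using w by (intro integrable_mult_right inverse_sq_line) auto
  show "(\<lambda>t. Wl x \<sigma> k * dpot i \<sigma> t (dist_line (Wl x \<sigma> k) c t)) \<in> borel_measurable lborel"
    using dpot_line(2)[OF \<sigma> Wl_nz[OF \<sigma> x]] by auto
  fix y t assume y: "\<bar>y - x\<bar> < \<delta>"
  have Wy: "Wl y \<sigma> k \<noteq> 0" by (rule Wl_nz[OF \<sigma> near(1)[OF y]])
  show "((\<lambda>x. pot i \<sigma> t (dist_line (Wl x \<sigma> k) c t)) has_real_derivative
     Wl y \<sigma> k * dpot i \<sigma> t (dist_line (Wl y \<sigma> k) c t)) (at y)" by (rule pot_line_deriv[OF \<sigma> Wy])
  show "integrable lborel (\<lambda>t. pot i \<sigma> t (dist_line (Wl y \<sigma> k) c t))" by (rule pot_line(1)[OF \<sigma> Wy])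
  have "\<bar>Wl y \<sigma> k * dpot i \<sigma> t (dist_line (Wl y \<sigma> k) c t)\<bar> \<le> C1 / \<bar>Wl y \<sigma> k\<bar> * (1 / ((Wl y \<sigma> k)\<^sup>2 + (c - t)\<^sup>2))"
    by (rule dpot_line(1)[OF \<sigma> Wy])
  also have "\<dots> \<le> C1 / (w / 2) * (1 / ((w / 2)\<^sup>2 + (c - t)\<^sup>2))"
  proof (intro mult_mono divide_left_mono add_right_mono)
    have "(w / 2)\<^sup>2 \<le> \<bar>Wl y \<sigma> k\<bar>\<^sup>2" using near(2)[OF y] w by (intro power_mono) auto
    thus "(w / 2)\<^sup>2 \<le> (Wl y \<sigma> k)\<^sup>2" by simp
    show "0 < ((Wl y \<sigma> k)\<^sup>2 + (c - t)\<^sup>2) * ((w / 2)\<^sup>2 + (c - t)\<^sup>2)"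
      using Wy w by (intro mult_pos_pos add_pos_nonneg) auto
  qed (use near(2)[OF y] w C_nonneg Wy in \<open>auto simp: add_nonneg_nonneg\<close>)
  finally show "\<bar>Wl y \<sigma> k * dpot i \<sigma> t (dist_line (Wl y \<sigma> k) c t)\<bar> \<le> C1 / (w / 2) * (1 / ((w / 2)\<^sup>2 + (c - t)\<^sup>2))" .
qed

lemma sum_line_deriv:
  assumes \<sigma>: "\<sigma> \<in> sgns" and x: "\<bar>x\<bar> < a"
  shows "((\<lambda>x. LINT k|cint. line_val i \<sigma> c x k) has_real_derivative (LINT k|cint. line_der i \<sigma> c x k)) (at x)"
proof (rule has_derivative_integral_dominated)
  define \<delta> where "\<delta> = (a - \<bar>x\<bar>) / 2"
  show \<delta>: "0 < \<delta>" using x by (simp add: \<delta>_def)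
  show "integrable cint (\<lambda>k. C1 * pi / \<delta>\<^sup>2 * (1 / (1 + \<bar>real_of_int k\<bar>)\<^sup>2))"
    by (intro integrable_mult_right cint_sq_integrable)
  fix y k assume y: "\<bar>y - x\<bar> < \<delta>"
  have y1: "\<bar>y\<bar> \<le> a - \<delta>" using abs_triangle_ineq[of x "y - x"] y unfolding \<delta>_def by (simp add: field_simps)
  hence y2: "\<bar>y\<bar> < a" using \<delta> by linarith
  show "((\<lambda>x. line_val i \<sigma> c x k) has_real_derivative line_der i \<sigma> c y k) (at y)" by (rule line_val_deriv[OF \<sigma> y2])
  show "integrable cint (line_val i \<sigma> c y)" by (rule line_val_integrable[OF \<sigma> y2])
  show "\<bar>line_der i \<sigma> c y k\<bar> \<le> C1 * pi / \<delta>\<^sup>2 * (1 / (1 + \<bar>real_of_int k\<bar>)\<^sup>2)" by (rule line_der_bound[OF \<sigma> y1 \<delta>])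
qed simp

section \<open>From truncated lattices to full families of lines\<close>

definition tiles :: "nat \<Rightarrow> real set" where "tiles N = {t. tile_no t \<in> {- int N..int N}}"

lemma tiles_measurable [measurable]: "tiles N \<in> sets borel"
  using measurable_sets[OF tile_measurable(1), of "{- int N..int N}"] by (simp add: tiles_def vimage_def)

text \<open>On tile \<open>n\<close> the isometry \<open>t = 2 * n * a + (-1) ^ n * u\<close> undoes
  the folding: \<open>fd t\<close> becomes \<open>u\<close>, \<open>sg t\<close> becomes the sign,
  and the distance of \<open>x\<close> to the line point becomes that of a folded image to the side.
  Endpoints of tiles are a null set.\<close>

lemma tile_decomposition:
  assumes \<sigma>: "\<sigma> \<in> sgns" and W: "W \<noteq> 0"
  shows "(LINT t|lborel. indicator (tiles N) t * (W * dpot i \<sigma> t (dist_line W c t))) =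
    W * (\<Sum>n\<in>{- int N..int N}. (-1) powi n *
      (LINT u:{-a..a}|lborel. pv (dmean (bd i \<sigma> u)) (sqrt (W\<^sup>2 + ((-1) powi n * (c - 2 * of_int n * a) - u)\<^sup>2))))"
proof -
  let ?g = "\<lambda>t. W * dpot i \<sigma> t (dist_line W c t)"
  let ?T = "\<lambda>n::int. {t. \<bar>t - 2 * of_int n * a\<bar> < a}"
  have int: "integrable lborel ?g" by (rule dpot_line(2)[OF \<sigma> W])
  have [measurable]: "?T n \<in> sets borel" for n by measurable
  have eq: "indicator (tiles N) t * ?g t = (\<Sum>n\<in>{- int N..int N}. indicator (?T n) t * ?g t)" for t
  proof (cases "odd_pt t")
    case True thus ?thesis by (simp add: dpot_def sg_def)
  next
    case False
    have T: "t \<in> ?T n \<longleftrightarrow> n = tile_no t" for n using tile_no_bound[OF False] tile_no_unique[of t n] by auto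
    have "(\<Sum>n\<in>{- int N..int N}. indicator (?T n) t * ?g t) = (\<Sum>n\<in>{- int N..int N}. if n = tile_no t then ?g t else 0)"
      by (intro sum.cong refl) (use T in \<open>auto simp: indicator_def\<close>)
    thus ?thesis by (simp add: tiles_def indicator_def)
  qed
  have "(LINT t|lborel. indicator (tiles N) t * ?g t) = (\<Sum>n\<in>{- int N..int N}. LINT t|lborel. indicator (?T n) t * ?g t)"
    unfolding eq
  proof (rule Bochner_Integration.integral_sum)
    fix n
    show "integrable lborel (\<lambda>t. indicator (?T n) t * ?g t)"
      using integrable_mult_indicator[OF _ int, of "?T n"] by simp
  qed
  also have "\<dots> = (\<Sum>n\<in>{- int N..int N}. W * ((-1) powi n *
      (LINT u:{-a..a}|lborel. pv (dmean (bd i \<sigma> u)) (sqrt (W\<^sup>2 + ((-1) powi n * (c - 2 * of_int n * a) - u)\<^sup>2)))))"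
  proof (intro sum.cong refl)
    fix n :: int
    define s :: real where "s = (-1) powi n"
    have s: "s * s = 1" "\<bar>s\<bar> = 1" "s \<noteq> 0" using abs_powi[of n] by (auto simp: s_def)
    let ?p = "\<lambda>u. pv (dmean (bd i \<sigma> u)) (sqrt (W\<^sup>2 + (s * (c - 2 * of_int n * a) - u)\<^sup>2))"
    have "(LINT t|lborel. indicator (?T n) t * ?g t) = (LINT u|lborel. indicator (?T n) (2 * of_int n * a + s * u) * ?g (2 * of_int n * a + s * u))"
      using lborel_integral_real_affine[OF s(3), of "\<lambda>t. indicator (?T n) t * ?g t" "2 * of_int n * a"] s by simp
    also have "\<dots> = (LINT u|lborel. W * (s * (indicator {-a..a} u *\<^sub>R ?p u)))"
    proof (rule integral_cong_AE)
      have 1: "(\<lambda>(u, r). dmean (bd i \<sigma> u) r) \<in> borel_measurable (borel \<Otimes>\<^sub>M borel)"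
        using measurable_compose[of "\<lambda>z. (bd i \<sigma> (fst z), snd z)" "borel \<Otimes>\<^sub>M borel" "borel \<Otimes>\<^sub>M borel", OF _ means_measurable(2)]
        by (simp add: case_prod_beta')
      show "(\<lambda>u. W * (s * (indicator {-a..a} u *\<^sub>R ?p u))) \<in> borel_measurable lborel"
        using 1 by measurable
      show "(\<lambda>u. indicator (?T n) (2 * of_int n * a + s * u) * ?g (2 * of_int n * a + s * u)) \<in> borel_measurable lborel"
        using borel_measurable_integrable[OF int] by measurable
      show "AE u in lborel. indicator (?T n) (2 * of_int n * a + s * u) * ?g (2 * of_int n * a + s * u) = W * (s * (indicator {-a..a} u *\<^sub>R ?p u))"
        using AE_lborel_singleton[of a] AE_lborel_singleton[of "- a"]
      proof eventually_elim
        case (elim u)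
        let ?t = "2 * of_int n * a + s * u"
        show ?case
        proof (cases "\<bar>u\<bar> < a")
          case True
          have b: "\<bar>?t - 2 * of_int n * a\<bar> < a" using True s by (simp add: abs_mult)
          have t: "tile_no ?t = n" "\<not> odd_pt ?t" using tile_no_unique[OF b] not_odd_pt[OF b] by auto
          have f: "fd ?t = u" "sg ?t = s"
            using t s by (simp_all add: fd_def sg_def s_def[symmetric] mult.assoc[symmetric])
          have "s * (s * (c - 2 * of_int n * a) - u) = (s * s) * (c - 2 * of_int n * a) - s * u"
            by (simp only: right_diff_distrib mult.assoc)
          hence C: "c - ?t = s * (s * (c - 2 * of_int n * a) - u)" unfolding s(1) by simp
          have "(c - ?t)\<^sup>2 = (s * s) * (s * (c - 2 * of_int n * a) - u)\<^sup>2"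
            unfolding C by (simp only: power2_eq_square mult_ac)
          also have "\<dots> = (s * (c - 2 * of_int n * a) - u)\<^sup>2" unfolding s(1) by simp
          finally have "dist_line W c ?t = sqrt (W\<^sup>2 + (s * (c - 2 * of_int n * a) - u)\<^sup>2)" by (simp add: dist_line_def)
          thus ?thesis using True b by (auto simp: dpot_def f bf_def abs_less_iff)
        next
          case False
          hence "u \<notin> {-a..a}" using elim by auto
          moreover have "?t \<notin> ?T n" using False s by (simp add: abs_mult)
          ultimately show ?thesis by simp
        qed
      qed
    qed
    finally show "(LINT t|lborel. indicator (?T n) t * ?g t) = W * (s * (LINT u:{-a..a}|lborel. ?p u))"
      unfolding integral_mult_right_zero set_lebesgue_integral_def .
  qed
  finally show ?thesis by (simp only: sum_distrib_left)
qed

definition side_total :: "2 \<Rightarrow> real \<Rightarrow> real \<Rightarrow> real" where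
  "side_total i x c = (\<Sum>\<sigma>\<in>sgns. \<sigma> * (LINT k|cint. line_der i \<sigma> c x k))"

text \<open>The estimate for a line bounds the modulus of the integrand and so holds for every
  truncation of that line; it dominates in \<open>k\<close>. For fixed \<open>k\<close> the
  truncated integrals converge by absolute integrability, so both truncations can be governed by the
  same \<open>K\<close>.\<close>

lemma tiles_limit:
  assumes \<sigma>: "\<sigma> \<in> sgns" and x: "\<bar>x\<bar> < a"
  shows "(\<lambda>K. \<Sum>k\<in>{- int K..int K}. LINT t|lborel. indicator (tiles (2 * K + 1)) t * (Wl x \<sigma> k * dpot i \<sigma> t (dist_line (Wl x \<sigma> k) c t)))
    \<longlonglongrightarrow> (LINT k|cint. line_der i \<sigma> c x k)"
proof -
  define d where "d = a - \<bar>x\<bar>"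
  have d: "0 < d" "\<bar>x\<bar> \<le> a - d" using x by (auto simp: d_def)
  let ?g = "\<lambda>k t. Wl x \<sigma> k * dpot i \<sigma> t (dist_line (Wl x \<sigma> k) c t)"
  let ?B = "\<lambda>K k. LINT t|lborel. indicator (tiles (2 * K + 1)) t * ?g k t"
  have int: "integrable lborel (?g k)" for k by (rule dpot_line(2)[OF \<sigma> Wl_nz[OF \<sigma> x]])
  have [measurable]: "?g k \<in> borel_measurable borel" for k using borel_measurable_integrable[OF int[of k]] by simp
  have B: "\<bar>?B K k\<bar> \<le> C1 * pi / d\<^sup>2 * (1 / (1 + \<bar>real_of_int k\<bar>)\<^sup>2)" for K k
  proof -
    let ?W = "Wl x \<sigma> k"
    have W: "?W \<noteq> 0" by (rule Wl_nz[OF \<sigma> x])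
    have i: "integrable lborel (\<lambda>t. C1 / \<bar>?W\<bar> * (1 / (?W\<^sup>2 + (c - t)\<^sup>2)))" by (intro integrable_mult_right inverse_sq_line W)
    have i2: "integrable lborel (\<lambda>t. indicator (tiles (2 * K + 1)) t * ?g k t)"
      using integrable_mult_indicator[OF _ int, of "tiles (2 * K + 1)"] by simp
    have "\<bar>?B K k\<bar> \<le> (LINT t|lborel. \<bar>indicator (tiles (2 * K + 1)) t * ?g k t\<bar>)"
      using integral_norm_bound[of lborel "\<lambda>t. indicator (tiles (2 * K + 1)) t * ?g k t"] by simp
    also have "\<dots> \<le> (LINT t|lborel. C1 / \<bar>?W\<bar> * (1 / (?W\<^sup>2 + (c - t)\<^sup>2)))"
    proof (rule integral_mono[OF integrable_abs[OF i2] i])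
      fix t
      have "\<bar>indicator (tiles (2 * K + 1)) t * ?g k t\<bar> \<le> \<bar>?g k t\<bar>" by (simp add: indicator_def)
      also have "\<dots> \<le> C1 / \<bar>?W\<bar> * (1 / (?W\<^sup>2 + (c - t)\<^sup>2))" by (rule dpot_line(1)[OF \<sigma> W])
      finally show "\<bar>indicator (tiles (2 * K + 1)) t * ?g k t\<bar> \<le> C1 / \<bar>?W\<bar> * (1 / (?W\<^sup>2 + (c - t)\<^sup>2))" .
    qed
    also have "\<dots> = C1 * pi * (1 / ?W\<^sup>2)"
      unfolding integral_mult_right_zero inverse_sq_line(2)[OF W] by (simp add: power2_eq_square)
    also have "\<dots> \<le> C1 * pi * (1 / d\<^sup>2 * (1 / (1 + \<bar>real_of_int k\<bar>)\<^sup>2))"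
      using C_nonneg by (intro mult_left_mono inverse_Wl_sq \<sigma> d) auto
    finally show ?thesis by simp
  qed
  have lim: "(\<lambda>K. ?B K k) \<longlonglongrightarrow> line_der i \<sigma> c x k" for k
    unfolding line_der_def
  proof (rule integral_dominated_convergence[where w="\<lambda>t. \<bar>?g k t\<bar>"])
    show "integrable lborel (\<lambda>t. \<bar>?g k t\<bar>)" by (rule integrable_abs[OF int])
    show "AE t in lborel. (\<lambda>K. indicator (tiles (2 * K + 1)) t * ?g k t) \<longlonglongrightarrow> ?g k t"
    proof (intro AE_I2 tendsto_eventually)
      fix t
      have "\<forall>\<^sub>F K in sequentially. nat \<bar>tile_no t\<bar> \<le> K" by (rule eventually_ge_at_top)
      thus "\<forall>\<^sub>F K in sequentially. indicator (tiles (2 * K + 1)) t * ?g k t = ?g k t"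
      proof eventually_elim
        case (elim K)
        hence "t \<in> tiles (2 * K + 1)" by (auto simp: tiles_def)
        thus ?case by simp
      qed
    qed
    show "(\<lambda>t. indicator (tiles (2 * K + 1)) t * ?g k t) \<in> borel_measurable lborel" for K by measurable
  qed (auto simp: indicator_def)
  have "(\<lambda>K. LINT k|cint. indicator {- int K..int K} k * ?B K k) \<longlonglongrightarrow> (LINT k|cint. line_der i \<sigma> c x k)"
  proof (rule integral_dominated_convergence[where w="\<lambda>k. C1 * pi / d\<^sup>2 * (1 / (1 + \<bar>real_of_int k\<bar>)\<^sup>2)"])
    show "integrable cint (\<lambda>k. C1 * pi / d\<^sup>2 * (1 / (1 + \<bar>real_of_int k\<bar>)\<^sup>2))"
      by (intro integrable_mult_right cint_sq_integrable)
    show "AE k in cint. (\<lambda>K. indicator {- int K..int K} k * ?B K k) \<longlonglongrightarrow> line_der i \<sigma> c x k"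
    proof (intro AE_I2)
      fix k
      have "\<forall>\<^sub>F K in sequentially. nat \<bar>k\<bar> \<le> K" by (rule eventually_ge_at_top)
      hence "\<forall>\<^sub>F K in sequentially. ?B K k = indicator {- int K..int K} k * ?B K k"
      proof eventually_elim
        case (elim K)
        hence "k \<in> {- int K..int K}" by auto
        thus ?case by simp
      qed
      thus "(\<lambda>K. indicator {- int K..int K} k * ?B K k) \<longlonglongrightarrow> line_der i \<sigma> c x k"
        by (rule Lim_transform_eventually[OF lim])
    qed
    show "AE k in cint. norm (indicator {- int K..int K} k * ?B K k) \<le> C1 * pi / d\<^sup>2 * (1 / (1 + \<bar>real_of_int k\<bar>)\<^sup>2)" for K
    proof (intro AE_I2)
      fix k
      have "norm (indicator {- int K..int K} k * ?B K k) \<le> \<bar>?B K k\<bar>" by (simp add: indicator_def)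
      also note B
      finally show "norm (indicator {- int K..int K} k * ?B K k) \<le> C1 * pi / d\<^sup>2 * (1 / (1 + \<bar>real_of_int k\<bar>)\<^sup>2)" .
    qed
  qed auto
  also have "(\<lambda>K. LINT k|cint. indicator {- int K..int K} k * ?B K k) = (\<lambda>K. \<Sum>k\<in>{- int K..int K}. ?B K k)"
  proof
    fix K
    have fin: "finite {k \<in> UNIV. indicator {- int K..int K} k * ?B K k \<noteq> 0}"
      by (rule finite_subset[of _ "{- int K..int K}"]) (auto simp: indicator_def)
    show "(LINT k|cint. indicator {- int K..int K} k * ?B K k) = (\<Sum>k\<in>{- int K..int K}. ?B K k)"
      unfolding lebesgue_integral_count_space_finite_support[OF fin]
      by (rule sum.mono_neutral_cong_left) (auto simp: indicator_def)
  qed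
  finally show ?thesis .
qed

text \<open>The truncated sums are the \<open>side_sum\<close> of the lattice setting; their error
  \<open>O(1 / K)\<close> disappears while \<open>tiles_limit\<close> identifies their
  limits.\<close>

lemma line_reconstruction:
  assumes x: "\<bar>x1\<bar> < a" "\<bar>x2\<bar> < a"
  shows "side_total 1 x1 x2 + side_total 2 x2 x1 = pi * planar 1 (x1, x2)"
proof -
  define S where "S i x c K = (\<Sum>\<sigma>\<in>sgns. \<sigma> * (\<Sum>k\<in>{- int K..int K}. LINT t|lborel. indicator (tiles (2 * K + 1)) t * (Wl x \<sigma> k * dpot i \<sigma> t (dist_line (Wl x \<sigma> k) c t))))"
    for i x c K
  have lim: "(\<lambda>K. S i x c K) \<longlonglongrightarrow> side_total i x c" if "\<bar>x\<bar> < a" for i x c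
    unfolding S_def side_total_def by (intro tendsto_sum tendsto_mult tendsto_const tiles_limit that)
  have eq: "S i x c K = two_images.side_sum a G x c K i" if "\<bar>x\<bar> < a" "\<bar>c\<bar> < a" "1 \<le> K" for i x c K
  proof -
    interpret two_images a L f G x c K by unfold_locales (use that in auto)
    show ?thesis
      unfolding S_def side_sum_def
      unfolding X.Wk_def Y.Xn_def Wl_def[symmetric]
      by (intro sum.cong refl arg_cong2[where f=times] tile_decomposition Wl_nz that)
  qed
  define B where "B = (LINT z|lborel. \<bar>planar 1 z\<bar>) / (2 * pi * a\<^sup>2)"
  have bound: "\<bar>S 1 x1 x2 K + S 2 x2 x1 K - pi * planar 1 (x1, x2)\<bar> \<le> B * (1 / real K)" if K: "1 \<le> K" for K
  proof -
    interpret two_images a L f G x1 x2 K by unfold_locales (use x K in auto)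
    show ?thesis unfolding eq[OF x K] eq[OF x(2,1) K] using truncated_reconstruction by (simp add: B_def)
  qed
  have "(\<lambda>K. S 1 x1 x2 K + S 2 x2 x1 K - pi * planar 1 (x1, x2)) \<longlonglongrightarrow> 0"
  proof (rule Lim_null_comparison)
    show "\<forall>\<^sub>F K in sequentially. norm (S 1 x1 x2 K + S 2 x2 x1 K - pi * planar 1 (x1, x2)) \<le> B * (1 / real K)"
      using eventually_ge_at_top[of 1] by eventually_elim (use bound in simp)
    have "(\<lambda>K. B * (1 / real K)) \<longlonglongrightarrow> B * 0" by (intro tendsto_intros lim_1_over_n)
    thus "(\<lambda>K. B * (1 / real K)) \<longlonglongrightarrow> 0" by simp
  qed
  moreover have "(\<lambda>K. S 1 x1 x2 K + S 2 x2 x1 K - pi * planar 1 (x1, x2)) \<longlonglongrightarrow> side_total 1 x1 x2 + side_total 2 x2 x1 - pi * planar 1 (x1, x2)"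
    by (intro tendsto_intros lim x)
  ultimately have "side_total 1 x1 x2 + side_total 2 x2 x1 - pi * planar 1 (x1, x2) = 0" by (rule LIMSEQ_unique[rotated])
  thus ?thesis by simp
qed

end

section \<open>Return to vectors, normals and the three formulas\<close>

lemma sum_sides: "(\<Sum>j\<in>sides. F j) = (\<Sum>i\<in>UNIV. \<Sum>\<sigma>\<in>sgns. F (i, \<sigma>))"
  unfolding sides_def by (simp add: sum.cartesian_product' del: sum.insert)

lemma line_point_self: "line_point i (x $ i) (x $ other i) = x"
  by (simp add: line_point_def vec_eq_iff) (metis UNIV_2_other UNIV_I insertE singletonD)

lemma norm_shift_deriv:
  fixes v :: "real^2"
  assumes "v \<noteq> 0"
  shows "((\<lambda>\<tau>. norm (v + \<tau> *\<^sub>R axis l 1)) has_real_derivative v $ l / norm v) (at 0)"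
proof -
  have eq: "norm (v + \<tau> *\<^sub>R axis l 1) = sqrt ((norm v)\<^sup>2 + 2 * \<tau> * v $ l + \<tau>\<^sup>2)" for \<tau>
  proof -
    have "(norm (v + \<tau> *\<^sub>R axis l 1))\<^sup>2 = (norm v)\<^sup>2 + 2 * \<tau> * v $ l + \<tau>\<^sup>2"
      unfolding power2_norm_eq_inner
      by (simp add: inner_add_left inner_add_right inner_axis inner_axis' power2_eq_square algebra_simps)
    thus ?thesis by (metis norm_ge_zero real_sqrt_unique)
  qed
  have p: "(norm v)\<^sup>2 + 2 * 0 * v $ l + 0\<^sup>2 > 0" using assms by simp
  have "((\<lambda>\<tau>. (norm v)\<^sup>2 + 2 * \<tau> * v $ l + \<tau>\<^sup>2) has_real_derivative 2 * v $ l) (at 0)"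
    by (auto intro!: derivative_eq_intros)
  from DERIV_chain2[OF DERIV_real_sqrt[OF p] this] show ?thesis
    unfolding eq by (simp add: inverse_eq_divide)
qed

context c11_square
begin

abbreviation on_line :: "2 \<Rightarrow> real \<Rightarrow> int \<Rightarrow> real \<Rightarrow> real^2" where
  "on_line i \<sigma> k t \<equiv> line_point i (line_offset a (i, \<sigma>) k) t"

lemma diff_on_line: "x - on_line i \<sigma> k t = line_point i (Wl (x $ i) \<sigma> k) (x $ other i - t)"
proof -
  have "line_point i (x $ i) (x $ other i) - on_line i \<sigma> k t = line_point i (Wl (x $ i) \<sigma> k) (x $ other i - t)"
    by (simp add: line_point_def line_offset_def Wl_def vec_eq_iff)
  thus ?thesis by (simp add: line_point_self)
qed

lemma norm_diff_on_line: "norm (x - on_line i \<sigma> k t) = dist_line (Wl (x $ i) \<sigma> k) (x $ other i) t"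
  unfolding diff_on_line dist_line_def norm_line_point[symmetric, of _ _ i] by simp

lemma in_square: "x \<in> square a \<Longrightarrow> \<bar>x $ i\<bar> < a"
  by (auto simp: square_def abs_less_iff minus_less_iff)

lemma norm_pos_line:
  assumes "\<sigma> \<in> sgns" "x \<in> square a"
  shows "0 < norm (x - on_line i \<sigma> k t)"
  unfolding norm_diff_on_line by (intro dist_line_props(2) Wl_nz assms in_square)

lemma on_lineE:
  assumes "y \<in> line_family a (i, \<sigma>)"
  obtains k where "y = on_line i \<sigma> k (y $ other i)"
  using assms line_point_self[of i y] unfolding line_family_def by auto metis

text \<open>The chain rule, with the factor \<open>s\<close> of \<open>pv_potential_deriv\<close>
  cancelling the denominator of the derivative of the norm. All directions \<open>l\<close> are
  covered, since the existence of the full gradient is claimed.\<close>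

lemma pot_shift_deriv:
  assumes \<sigma>: "\<sigma> \<in> sgns" and p: "0 < norm (x - y)"
  shows "((\<lambda>\<tau>. pv_potential a f (i, \<sigma>) y (norm (x + \<tau> *\<^sub>R axis l 1 - y))) has_real_derivative
     (x - y) $ l * dpot i \<sigma> (y $ other i) (norm (x - y))) (at 0)"
proof -
  have nz: "x - y \<noteq> 0" using p by auto
  have e: "x + \<tau> *\<^sub>R axis l 1 - y = (x - y) + \<tau> *\<^sub>R axis l 1" for \<tau> by simp
  have "(pv_potential a f (i, \<sigma>) y has_real_derivative (norm (x - y) * dpot i \<sigma> (y $ other i) (norm (x - y)))) (at (norm ((x - y) + 0 *\<^sub>R axis l 1)))"
    using pv_potential_deriv[OF \<sigma> p] by simp
  from DERIV_chain2[OF this norm_shift_deriv[OF nz, of l]]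
  show ?thesis unfolding e using p by (simp add: mult.commute)
qed

lemma normal_inner: "normal (i, \<sigma>) \<bullet> v = \<sigma> * v $ i"
  by (simp add: normal_def inner_axis')

lemma normal_nth: "normal (i, \<sigma>) $ l = (if l = i then \<sigma> else 0)"
  by (simp add: normal_def axis_def)

text \<open>The right-hand side is the common form to which the radial and the gradient integrand
  both reduce; \<open>line_sum\<close> integrates it.\<close>

lemma radial_on_line:
  assumes \<sigma>: "\<sigma> \<in> sgns" and x: "x \<in> square a"
  shows "radial_integrand a f (i, \<sigma>) x (on_line i \<sigma> k t) =
    \<sigma> * (Wl (x $ i) \<sigma> k * dpot i \<sigma> t (dist_line (Wl (x $ i) \<sigma> k) (x $ other i) t))"
proof -
  let ?y = "on_line i \<sigma> k t"
  have p: "0 < norm (x - ?y)" by (rule norm_pos_line[OF \<sigma> x])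
  have "deriv (pv_potential a f (i, \<sigma>) ?y) (norm (x - ?y)) = norm (x - ?y) * dpot i \<sigma> t (norm (x - ?y))"
    using DERIV_imp_deriv[OF pv_potential_deriv[OF \<sigma> p]] by simp
  moreover have "(x - ?y) $ i = Wl (x $ i) \<sigma> k" unfolding diff_on_line by simp
  ultimately have "radial_integrand a f (i, \<sigma>) x ?y = \<sigma> * Wl (x $ i) \<sigma> k / norm (x - ?y) * (norm (x - ?y) * dpot i \<sigma> t (norm (x - ?y)))"
    unfolding radial_integrand_def normal_inner by simp
  also have "\<dots> = \<sigma> * (Wl (x $ i) \<sigma> k * dpot i \<sigma> t (norm (x - ?y)))" using p by simp
  finally show ?thesis unfolding norm_diff_on_line .
qed

lemma grad_on_line:
  assumes \<sigma>: "\<sigma> \<in> sgns" and x: "x \<in> square a"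
  shows "grad_integrand a f (i, \<sigma>) x (on_line i \<sigma> k t) =
    \<sigma> * (Wl (x $ i) \<sigma> k * dpot i \<sigma> t (dist_line (Wl (x $ i) \<sigma> k) (x $ other i) t))"
proof -
  let ?y = "on_line i \<sigma> k t"
  have p: "0 < norm (x - ?y)" by (rule norm_pos_line[OF \<sigma> x])
  have "(x - ?y) $ i = Wl (x $ i) \<sigma> k" unfolding diff_on_line by simp
  thus ?thesis
    using DERIV_imp_deriv[OF pot_shift_deriv[OF \<sigma> p, of i i]]
    unfolding grad_integrand_def normal_inner gradient_def partial_deriv_def
    by (simp add: norm_diff_on_line)
qed

lemma line_sum:
  assumes \<sigma>: "\<sigma> \<in> sgns" and x: "x \<in> square a"
    and g: "\<And>k t. g (on_line i \<sigma> k t) = \<sigma> * (Wl (x $ i) \<sigma> k * dpot i \<sigma> t (dist_line (Wl (x $ i) \<sigma> k) (x $ other i) t))"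
  shows "family_integrable a (i, \<sigma>) g"
    and "family_integral a (i, \<sigma>) g = \<sigma> * (LINT k|cint. line_der i \<sigma> (x $ other i) (x $ i) k)"
proof -
  have eq: "(LINT t|lborel. g (on_line i \<sigma> k t)) = \<sigma> * line_der i \<sigma> (x $ other i) (x $ i) k" for k
    unfolding g line_der_def by (rule integral_mult_right_zero)
  have int: "integrable cint (\<lambda>k. \<sigma> * line_der i \<sigma> (x $ other i) (x $ i) k)"
    by (intro integrable_mult_right line_der_integrable \<sigma> in_square x)
  have "integrable lborel (\<lambda>t. g (on_line i \<sigma> k t))" for k
    unfolding g by (intro integrable_mult_right dpot_line(2) \<sigma> Wl_nz in_square x)
  thus "family_integrable a (i, \<sigma>) g"
    unfolding family_integrable_def fst_conv eq using infsum_cint(1)[OF int] by blast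
  show "family_integral a (i, \<sigma>) g = \<sigma> * (LINT k|cint. line_der i \<sigma> (x $ other i) (x $ i) k)"
    unfolding family_integral_def fst_conv eq infsum_cint(2)[OF int] by (rule integral_mult_right_zero)
qed

lemma div_sum:
  assumes \<sigma>: "\<sigma> \<in> sgns" and x: "x \<in> square a"
  shows "family_integrable a (i, \<sigma>) (div_integrand a f (i, \<sigma>) x)"
    and "family_integral a (i, \<sigma>) (div_integrand a f (i, \<sigma>) x) =
      (LINT k|cint. line_val i \<sigma> (x $ other i) (x $ i) k) *\<^sub>R normal (i, \<sigma>)"
proof -
  have pt: "div_integrand a f (i, \<sigma>) x (on_line i \<sigma> k t) =
      pot i \<sigma> t (dist_line (Wl (x $ i) \<sigma> k) (x $ other i) t) *\<^sub>R normal (i, \<sigma>)" for k t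
    unfolding div_integrand_def pv_link(2)[OF \<sigma> norm_pos_line[OF \<sigma> x]] unfolding norm_diff_on_line by simp
  have i: "integrable lborel (\<lambda>t. pot i \<sigma> t (dist_line (Wl (x $ i) \<sigma> k) (x $ other i) t))" for k
    by (intro pot_line(1) \<sigma> Wl_nz in_square x)
  have eq: "(LINT t|lborel. div_integrand a f (i, \<sigma>) x (on_line i \<sigma> k t)) = line_val i \<sigma> (x $ other i) (x $ i) k *\<^sub>R normal (i, \<sigma>)" for k
    unfolding pt line_val_def using i by (intro integral_scaleR_left) simp
  have int: "integrable cint (line_val i \<sigma> (x $ other i) (x $ i))"
    by (intro line_val_integrable \<sigma> in_square x)
  have "integrable lborel (\<lambda>t. div_integrand a f (i, \<sigma>) x (on_line i \<sigma> k t))" for k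
    unfolding pt using i by simp
  thus "family_integrable a (i, \<sigma>) (div_integrand a f (i, \<sigma>) x)"
    unfolding family_integrable_def fst_conv eq using summable_on_scaleR_left[OF infsum_cint(1)[OF int]] by blast
  show "family_integral a (i, \<sigma>) (div_integrand a f (i, \<sigma>) x) =
      (LINT k|cint. line_val i \<sigma> (x $ other i) (x $ i) k) *\<^sub>R normal (i, \<sigma>)"
    unfolding family_integral_def fst_conv eq using infsum_scaleR_left[OF infsum_cint(1)[OF int]] infsum_cint(2)[OF int] by simp
qed

text \<open>Only the two opposite sides whose normals are parallel to axis \<open>l\<close>
  contribute to component \<open>l\<close>.\<close>

lemma div_field_nth:
  assumes x: "x \<in> square a"
  shows "div_field a f x $ l = (\<Sum>\<sigma>\<in>sgns. \<sigma> * (LINT k|cint. line_val l \<sigma> (x $ other l) (x $ l) k))"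
proof -
  have "div_field a f x = (\<Sum>i\<in>UNIV. \<Sum>\<sigma>\<in>sgns. (LINT k|cint. line_val i \<sigma> (x $ other i) (x $ i) k) *\<^sub>R normal (i, \<sigma>))"
    unfolding div_field_def sum_sides by (intro sum.cong refl div_sum(2) x)
  hence "div_field a f x $ l = (\<Sum>i\<in>UNIV. \<Sum>\<sigma>\<in>sgns. (LINT k|cint. line_val i \<sigma> (x $ other i) (x $ i) k) * (if l = i then \<sigma> else 0))"
    by (simp add: normal_nth)
  also have "\<dots> = (\<Sum>i\<in>UNIV. if l = i then (\<Sum>\<sigma>\<in>sgns. \<sigma> * (LINT k|cint. line_val i \<sigma> (x $ other i) (x $ i) k)) else 0)"
    by (intro sum.cong refl) (auto simp: mult.commute)
  also have "\<dots> = (\<Sum>\<sigma>\<in>sgns. \<sigma> * (LINT k|cint. line_val l \<sigma> (x $ other l) (x $ l) k))" by simp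
  finally show ?thesis .
qed

text \<open>The series for the field is available inside the square, and shifts shorter than
  \<open>a - \<bar>x $ l\<bar>\<close> stay there. The partial derivative therefore equals the
  derivative of the series, computed by \<open>sum_line_deriv\<close>.\<close>

lemma div_field_deriv:
  assumes x: "x \<in> square a"
  shows "((\<lambda>\<tau>. div_field a f (x + \<tau> *\<^sub>R axis l 1) $ l) has_real_derivative side_total l (x $ l) (x $ other l)) (at 0)"
proof (rule has_field_derivative_transform_within_open)
  define \<delta> where "\<delta> = a - \<bar>x $ l\<bar>"
  have \<delta>: "0 < \<delta>" using in_square[OF x] by (simp add: \<delta>_def)
  have d: "((\<lambda>\<tau>. LINT k|cint. line_val l \<sigma> (x $ other l) (x $ l + \<tau>) k) has_real_derivative (LINT k|cint. line_der l \<sigma> (x $ other l) (x $ l) k)) (at 0)"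
    if \<sigma>: "\<sigma> \<in> sgns" for \<sigma>
  proof -
    have "((\<lambda>\<tau>. x $ l + \<tau>) has_real_derivative 1) (at 0)" by (auto intro!: derivative_eq_intros)
    from DERIV_chain2[OF _ this, of "\<lambda>y. LINT k|cint. line_val l \<sigma> (x $ other l) y k"] sum_line_deriv[OF \<sigma> in_square[OF x]]
    show ?thesis by simp
  qed
  show "((\<lambda>\<tau>. \<Sum>\<sigma>\<in>sgns. \<sigma> * (LINT k|cint. line_val l \<sigma> (x $ other l) (x $ l + \<tau>) k)) has_real_derivative side_total l (x $ l) (x $ other l)) (at 0)"
    unfolding side_total_def by (intro DERIV_sum DERIV_cmult d)
  show "open {- \<delta><..<\<delta>}" "0 \<in> {- \<delta><..<\<delta>}" using \<delta> by auto
  fix \<tau> assume \<tau>: "\<tau> \<in> {- \<delta><..<\<delta>}"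
  have "x + \<tau> *\<^sub>R axis l 1 \<in> square a"
  proof -
    have "\<bar>x $ l + \<tau>\<bar> < a" using \<tau> by (auto simp: \<delta>_def)
    thus ?thesis using x by (auto simp: square_def axis_def abs_less_iff)
  qed
  from div_field_nth[OF this, of l]
  show "(\<Sum>\<sigma>\<in>sgns. \<sigma> * (LINT k|cint. line_val l \<sigma> (x $ other l) (x $ l + \<tau>) k)) = div_field a f (x + \<tau> *\<^sub>R axis l 1) $ l"
    by (simp add: axis_def)
qed

lemma total_reconstruction:
  assumes x: "x \<in> square a"
  shows "(\<Sum>i\<in>UNIV. side_total i (x $ i) (x $ other i)) = pi * f x"
proof -
  have o: "other 1 = 2" "other 2 = 1" by (auto simp: other_def)
  have "planar 1 (x $ 1, x $ 2) = f x" using line_point_self[of 1 x] by (simp add: planar_def o)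
  thus ?thesis using line_reconstruction[OF in_square[OF x, of 1] in_square[OF x, of 2]]
    by (simp add: sum_2 o)
qed

lemma reconstruction_from_lines:
  assumes x: "x \<in> square a"
    and g: "\<And>i \<sigma> k t. \<sigma> \<in> sgns \<Longrightarrow> g (i, \<sigma>) (on_line i \<sigma> k t) =
      \<sigma> * (Wl (x $ i) \<sigma> k * dpot i \<sigma> t (dist_line (Wl (x $ i) \<sigma> k) (x $ other i) t))"
  shows "f x = 1 / pi * (\<Sum>j\<in>sides. family_integral a j (g j))"
    and "\<forall>j\<in>sides. family_integrable a j (g j)"
proof -
  have "(\<Sum>j\<in>sides. family_integral a j (g j)) = (\<Sum>i\<in>UNIV. side_total i (x $ i) (x $ other i))"
    unfolding sum_sides side_total_def by (intro sum.cong refl line_sum(2) x g)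
  thus "f x = 1 / pi * (\<Sum>j\<in>sides. family_integral a j (g j))" using total_reconstruction[OF x] by simp
  show "\<forall>j\<in>sides. family_integrable a j (g j)"
    unfolding sides_def by (auto intro!: line_sum(1)[OF _ x] g)
qed

lemma well_defined_pv: "pv_well_defined a f"
  unfolding pv_well_defined_def sides_def by (auto intro: pv_link(1))

lemma well_defined_div:
  assumes x: "x \<in> square a"
  shows "div_formula_well_defined a f x"
  unfolding div_formula_well_defined_def
proof
  show "\<forall>j\<in>sides. family_integrable a j (div_integrand a f j x)"
    unfolding sides_def by (auto intro!: div_sum(1)[OF _ x])
  show "\<forall>i. has_partial_deriv i (\<lambda>z. div_field a f z $ i) x"
    unfolding has_partial_deriv_def field_differentiable_def using div_field_deriv[OF x] by blast
qed

lemma divergence_reconstruction: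
  assumes x: "x \<in> square a"
  shows "f x = 1 / pi * divergence (div_field a f) x"
  unfolding divergence_def partial_deriv_def DERIV_imp_deriv[OF div_field_deriv[OF x]]
    total_reconstruction[OF x] by simp

lemma well_defined_radial:
  assumes x: "x \<in> square a"
  shows "radial_formula_well_defined a f x"
  unfolding radial_formula_well_defined_def
proof (intro ballI conjI)
  fix j :: side and y
  assume j: "j \<in> sides"
  show "family_integrable a j (radial_integrand a f j x)"
    using reconstruction_from_lines(2)[OF x radial_on_line[OF _ x]] j by blast
  assume y: "y \<in> line_family a j"
  obtain i \<sigma> where ij: "j = (i, \<sigma>)" "\<sigma> \<in> sgns" using j by (auto simp: sides_def)
  obtain k where "y = on_line i \<sigma> k (y $ other i)" using on_lineE y ij by blast
  hence "0 < norm (x - y)" using norm_pos_line[OF ij(2) x] by metis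
  thus "pv_potential a f j y field_differentiable at (norm (x - y))"
    using pv_potential_deriv[OF ij(2)] unfolding ij field_differentiable_def by blast
qed

lemma well_defined_grad:
  assumes x: "x \<in> square a"
  shows "grad_formula_well_defined a f x"
  unfolding grad_formula_well_defined_def
proof (intro ballI conjI allI)
  fix j :: side and y and l :: 2
  assume j: "j \<in> sides"
  show "family_integrable a j (grad_integrand a f j x)"
    using reconstruction_from_lines(2)[OF x grad_on_line[OF _ x]] j by blast
  assume y: "y \<in> line_family a j"
  obtain i \<sigma> where ij: "j = (i, \<sigma>)" "\<sigma> \<in> sgns" using j by (auto simp: sides_def)
  obtain k where "y = on_line i \<sigma> k (y $ other i)" using on_lineE y ij by blast
  hence "0 < norm (x - y)" using norm_pos_line[OF ij(2) x] by metis
  thus "has_partial_deriv l (\<lambda>z. pv_potential a f j y (norm (z - y))) x"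
    using pot_shift_deriv[OF ij(2)] unfolding ij has_partial_deriv_def field_differentiable_def by blast
qed

end

theorem theorem4:
  fixes a :: real and f :: "real^2 \<Rightarrow> real"
  assumes "a > 0" and "C2_0 (square a) f"
  shows "pv_well_defined a f \<and>
    (\<forall>x\<in>square a.
       div_formula_well_defined a f x \<and>
       f x = 1 / pi * divergence
               (\<lambda>z. \<Sum>j\<in>sides. family_integral a j
                  (\<lambda>y. pv_potential a f j y (norm (z - y)) *\<^sub>R normal j)) x \<and>
       radial_formula_well_defined a f x \<and>
       f x = 1 / pi * (\<Sum>j\<in>sides. family_integral a j
               (\<lambda>y. (normal j \<bullet> (x - y)) / norm (x - y) *
                    deriv (pv_potential a f j y) (norm (x - y)))) \<and>
       grad_formula_well_defined a f x \<and>
       f x = 1 / pi * (\<Sum>j\<in>sides. family_integral a j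
               (\<lambda>y. normal j \<bullet>
                    gradient (\<lambda>z. pv_potential a f j y (norm (z - y))) x)))"
proof -
  obtain G L where G: "0 \<le> L" "\<And>z. (f has_derivative blinfun_apply (G z)) (at z)"
    "\<And>z w. norm (G z - G w) \<le> L * norm (z - w)"
    "\<And>z. z \<notin> square a \<Longrightarrow> f z = 0" "\<And>z. z \<notin> square a \<Longrightarrow> G z = 0"
    using C2_0_extension[OF assms(2) open_square] by metis
  interpret c11_square a L f G by unfold_locales (use assms(1) G in auto)
  show ?thesis
  proof (intro conjI ballI well_defined_pv well_defined_div well_defined_radial well_defined_grad)
    fix x assume x: "x \<in> square a"
    show "f x = 1 / pi * divergence (\<lambda>z. \<Sum>j\<in>sides. family_integral a j
        (\<lambda>y. pv_potential a f j y (norm (z - y)) *\<^sub>R normal j)) x"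
      using divergence_reconstruction[OF x] unfolding div_field_def[abs_def] div_integrand_def[abs_def] .
    show "f x = 1 / pi * (\<Sum>j\<in>sides. family_integral a j
        (\<lambda>y. (normal j \<bullet> (x - y)) / norm (x - y) * deriv (pv_potential a f j y) (norm (x - y))))"
      using reconstruction_from_lines(1)[OF x radial_on_line[OF _ x]] unfolding radial_integrand_def[abs_def] .
    show "f x = 1 / pi * (\<Sum>j\<in>sides. family_integral a j
        (\<lambda>y. normal j \<bullet> gradient (\<lambda>z. pv_potential a f j y (norm (z - y))) x))"
      using reconstruction_from_lines(1)[OF x grad_on_line[OF _ x]] unfolding grad_integrand_def[abs_def] .
  qed
qed

end
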